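(* Let $\Omega$ be a bounded, open, convex subset of $\mathbb R^d$, let $\mathsf m:[0,+\infty)\to[0,+\infty)$ be a mobility function (so $M=+\infty$), let $\mathfrak m>0$, and suppose that $$K_{\mathsf m,d}(r):=\frac1d\int_r^{+\infty}\big(z^{1+1/d}\,\mathsf m(z)\big)^{-1/2}\,dz$$ is finite (for $r>0$). Then any two measures $\mu_0,\mu_1\in\mathcal M^+(\overline\Omega,\mathfrak m)$ have finite distance $\mathcal W_{\mathsf m,\Omega}(\mu_0,\mu_1)<+\infty$, and the topology induced by $\mathcal W_{\mathsf m,\Omega}$ on $\mathcal M^+(\overline\Omega,\mathfrak m)$ coincides with the usual weak$^*$ topology. In particular, the metric space $(\mathcal M^+(\overline\Omega,\mathfrak m),\mathcal W_{\mathsf m,\Omega})$ is compact and separable.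
   Context: **Mobility.** $\mathsf m:[0,+\infty)\to[0,+\infty)$ is continuous, concave, strictly positive in $(0,+\infty)$; $\mathsf m'(\infty):=\lim_{r\to+\infty}\mathsf m(r)/r\ge0$. Conventions: $a/b=0$ if $a=b=0$, $a/b=+\infty$ if $a>0=b$. Action density: $\phi_{\mathsf m}(\rho,w)=|w|^2/\mathsf m(\rho)$ if $\rho\ge0$, $+\infty$ otherwise ($w\in\mathbb R^d$). ($K_{\mathsf m,d}$ is either everywhere finite on $(0,\infty)$ or identically $+\infty$.) **Measures and continuity equation.** $\mathcal M^+(\overline\Omega)$: finite positive Borel measures on $\mathbb R^d$ concentrated on $\overline\Omega$; $\mathcal M^+(\overline\Omega,\mathfrak m)$: those with total mass $\mathfrak m$; $\mathcal M(\overline\Omega;\mathbb R^d)$: $\mathbb R^d$-valued Borel measures of finite total variation concentrated on $\overline\Omega$. $\mathcal{CE}_\Omega(\mu_0\to\mu_1)$ is the set of pairs $(\mu_s)_{s\in[0,1]}\subset\mathcal M^+(\overline\Omega)$, $(\nu_s)_{s\in(0,1)}\subset\mathcal M(\overline\Omega;\mathbb R^d)$ such that $s\mapsto\mu_s$ is weakly$^*$ continuous with values $\mu_0,\mu_1$ at $s=0,1$; $(\nu_s)$ is a Borel family with $\int_0^1|\nu_s|(\overline\Omega)\,ds<+\infty$; and $\partial_s\mu_s+\nabla\cdot\nu_s=0$ in distributions in $(0,1)\times\mathbb R^d$. **Action and distance.** With Lebesgue decompositions $\mu=\rho\mathscr L^d+\mu^\perp$, $\nu=w\mathscr L^d+\nu^\perp$: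 $\Phi_{\mathsf m,\Omega}(\mu,\nu)=+\infty$ if $\mu$ or $\nu$ is not supported in $\overline\Omega$; otherwise, if $\mathsf m'(\infty)=0$, it equals $\int_\Omega\phi_{\mathsf m}(\rho,w)\,dx$ if $\nu^\perp=0$ and $+\infty$ otherwise; if $\mathsf m'(\infty)>0$, it equals $\int_\Omega\phi_{\mathsf m}(\rho,w)\,dx+\int_{\overline\Omega}|w^\perp|^2/\mathsf m'(\infty)\,d\mu^\perp$ if $\nu^\perp=w^\perp\mu^\perp\ll\mu^\perp$ and $+\infty$ otherwise. $\mathcal W_{\mathsf m,\Omega}^2(\mu_0,\mu_1):=\inf\{\int_0^1\Phi_{\mathsf m,\Omega}(\mu_s,\nu_s)\,ds:(\mu,\nu)\in\mathcal{CE}_\Omega(\mu_0\to\mu_1)\}$ ($+\infty$ if the set is empty). *)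

theory Defs
  imports "HOL-Analysis.Analysis"
begin

section \<open>Mobility functions and the action density\<close>

text \<open>Only the values of \<open>m\<close> on \<open>[0,\<infinity>)\<close> matter.\<close>

definition mobility :: "(real \<Rightarrow> real) \<Rightarrow> bool" where
  "mobility m \<longleftrightarrow>
     continuous_on {0..} m \<and> concave_on {0..} m \<and> (\<forall>r\<ge>0. 0 \<le> m r) \<and> (\<forall>r>0. 0 < m r)"

text \<open>The limit exists for every mobility, since \<open>(m r - m 0) / r\<close> is nonincreasing by concavity.\<close>

definition mob_slope :: "(real \<Rightarrow> real) \<Rightarrow> real" where
  "mob_slope m = Lim at_top (\<lambda>r. m r / r)"

definition K_mob :: "(real \<Rightarrow> real) \<Rightarrow> nat \<Rightarrow> real \<Rightarrow> ennreal" where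
  "K_mob m d r =
     ennreal (1 / real d) *
     (\<integral>\<^sup>+ z \<in> {r..}. ennreal ((z powr (1 + 1 / real d) * m z) powr (- 1 / 2)) \<partial>lborel)"

text \<open>Division on \<open>ennreal\<close> satisfies \<open>0 / 0 = 0\<close> and \<open>a / 0 = \<infinity>\<close> for \<open>a > 0\<close>, which are
  the conventions used for the action density.\<close>

definition act_density :: "(real \<Rightarrow> real) \<Rightarrow> real \<Rightarrow> 'a::euclidean_space \<Rightarrow> ennreal" where
  "act_density m r w = (if 0 \<le> r then ennreal ((norm w)\<^sup>2) / ennreal (m r) else \<infinity>)"

section \<open>Scalar and vector measures\<close>

definition Mplus :: "'a::euclidean_space set \<Rightarrow> 'a measure set" where
  "Mplus \<Omega> = {\<mu>. sets \<mu> = sets borel \<and> finite_measure \<mu> \<and> emeasure \<mu> (- closure \<Omega>) = 0}"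

definition Mplus_mass :: "'a::euclidean_space set \<Rightarrow> real \<Rightarrow> 'a measure set" where
  "Mplus_mass \<Omega> c = {\<mu> \<in> Mplus \<Omega>. emeasure \<mu> UNIV = ennreal c}"

text \<open>The weak* topology on a set \<open>X\<close> of finite measures, in duality with \<open>C\<^sub>c\<close>: the coarsest one
  for which \<open>\<mu> \<mapsto> \<integral> f d\<mu>\<close> is continuous for every continuous compactly supported \<open>f\<close>.
  For measures concentrated on one fixed compact set \<open>K\<close>, duality with \<open>C(K)\<close>, \<open>C\<^sub>0\<close>
  or \<open>C\<^sub>b\<close> gives the same topology.\<close>

definition weak_star :: "'a::euclidean_space measure set \<Rightarrow> 'a measure topology" where
  "weak_star X = topology_generated_by
     {{\<mu> \<in> X. (\<integral>x. f x \<partial>\<mu>) \<in> U} | (f :: 'a \<Rightarrow> real) U.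
        continuous_on UNIV f \<and> compact (closure {x. f x \<noteq> 0}) \<and> open U}"

text \<open>Vector measures are represented by set functions; only their values on Borel sets matter.\<close>

definition vec_measure :: "('a::euclidean_space set \<Rightarrow> 'b::euclidean_space) \<Rightarrow> bool" where
  "vec_measure \<nu> \<longleftrightarrow>
     (\<forall>A :: nat \<Rightarrow> 'a set. range A \<subseteq> sets borel \<longrightarrow> disjoint_family A \<longrightarrow>
        (\<lambda>i. \<nu> (A i)) sums \<nu> (\<Union>i. A i))"

definition total_var :: "('a::euclidean_space set \<Rightarrow> 'b::euclidean_space) \<Rightarrow> 'a set \<Rightarrow> ennreal" where
  "total_var \<nu> B =
     (SUP P \<in> {P. finite P \<and> disjoint P \<and> P \<subseteq> sets borel \<and> \<Union>P \<subseteq> B}.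
        \<Sum>A\<in>P. ennreal (norm (\<nu> A)))"

definition Mvec :: "'a::euclidean_space set \<Rightarrow> ('a set \<Rightarrow> 'a) set" where
  "Mvec \<Omega> = {\<nu>. vec_measure \<nu> \<and> total_var \<nu> UNIV < \<infinity> \<and> total_var \<nu> (- closure \<Omega>) = 0}"

text \<open>Integration against a signed measure through its Jordan decomposition. The positive part of
  \<open>\<sigma>\<close> is \<open>A \<mapsto> sup {\<sigma> B | B \<subseteq> A}\<close>; as \<open>ennreal\<close> sends negative reals to \<open>0\<close>, and \<open>B\<close> may
  be empty, the cut-off does not change the supremum.\<close>

definition pos_part_measure :: "('a::euclidean_space set \<Rightarrow> real) \<Rightarrow> 'a measure" where
  "pos_part_measure \<sigma> =
     measure_of UNIV (sets borel) (\<lambda>A. SUP B \<in> {B \<in> sets borel. B \<subseteq> A}. ennreal (\<sigma> B))"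

definition signed_integral :: "('a::euclidean_space set \<Rightarrow> real) \<Rightarrow> ('a \<Rightarrow> real) \<Rightarrow> real" where
  "signed_integral \<sigma> g =
     (\<integral>x. g x \<partial>pos_part_measure \<sigma>) - (\<integral>x. g x \<partial>pos_part_measure (\<lambda>B. - \<sigma> B))"

definition vec_integral ::
  "('a::euclidean_space set \<Rightarrow> 'a) \<Rightarrow> ('a \<Rightarrow> 'a) \<Rightarrow> real" where
  "vec_integral \<nu> \<xi> = (\<Sum>b\<in>Basis. signed_integral (\<lambda>B. \<nu> B \<bullet> b) (\<lambda>x. \<xi> x \<bullet> b))"

section \<open>The continuity equation\<close>

primrec Ck :: "nat \<Rightarrow> ('v::real_normed_vector \<Rightarrow> real) \<Rightarrow> bool" where
  "Ck 0 f \<longleftrightarrow> continuous_on UNIV f"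
| "Ck (Suc k) f \<longleftrightarrow>
     f differentiable_on UNIV \<and> (\<forall>v. Ck k (\<lambda>x. frechet_derivative f (at x) v))"

definition test_functions :: "(real \<times> 'a::euclidean_space \<Rightarrow> real) set" where
  "test_functions =
     {\<zeta>. (\<forall>k. Ck k \<zeta>) \<and> compact (closure {z. \<zeta> z \<noteq> 0}) \<and>
         closure {z. \<zeta> z \<noteq> 0} \<subseteq> {0<..<1} \<times> UNIV}"

definition time_deriv :: "(real \<times> 'a::euclidean_space \<Rightarrow> real) \<Rightarrow> real \<Rightarrow> 'a \<Rightarrow> real" where
  "time_deriv \<zeta> s x = frechet_derivative \<zeta> (at (s, x)) (1, 0)"

definition space_grad :: "(real \<times> 'a::euclidean_space \<Rightarrow> real) \<Rightarrow> real \<Rightarrow> 'a \<Rightarrow> 'a" where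
  "space_grad \<zeta> s x = (\<Sum>b\<in>Basis. frechet_derivative \<zeta> (at (s, x)) (0, b) *\<^sub>R b)"

text \<open>The values \<open>\<mu> s\<close> for \<open>s \<notin> [0,1]\<close> and \<open>\<nu> s\<close> for \<open>s \<notin> (0,1)\<close> are irrelevant.\<close>

definition CE ::
  "'a::euclidean_space set \<Rightarrow> 'a measure \<Rightarrow> 'a measure \<Rightarrow>
     ((real \<Rightarrow> 'a measure) \<times> (real \<Rightarrow> 'a set \<Rightarrow> 'a)) set" where
  "CE \<Omega> \<mu>0 \<mu>1 =
     {(\<mu>, \<nu>).
        (\<forall>s\<in>{0..1}. \<mu> s \<in> Mplus \<Omega>) \<and> (\<forall>s\<in>{0<..<1}. \<nu> s \<in> Mvec \<Omega>) \<and>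
        continuous_map (top_of_set {0..1}) (weak_star (Mplus \<Omega>)) \<mu> \<and>
        \<mu> 0 = \<mu>0 \<and> \<mu> 1 = \<mu>1 \<and>
        (\<forall>B\<in>sets borel. (\<lambda>s. \<nu> s B) \<in> borel_measurable (restrict_space borel {0<..<1})) \<and>
        (\<integral>\<^sup>+ s \<in> {0<..<1}. total_var (\<nu> s) (closure \<Omega>) \<partial>lborel) < \<infinity> \<and>
        (\<forall>\<zeta>\<in>test_functions.
           (LINT s:{0<..<1}|lborel.
              (\<integral>x. time_deriv \<zeta> s x \<partial>\<mu> s) + vec_integral (\<nu> s) (space_grad \<zeta> s)) = 0)}"

section \<open>The action functional and the distance\<close>

definition lebesgue_decomp ::
  "'a::euclidean_space measure \<Rightarrow> ('a \<Rightarrow> real) \<times> 'a measure \<Rightarrow> bool" where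
  "lebesgue_decomp \<mu> = (\<lambda>(\<rho>, \<mu>s).
     \<rho> \<in> borel_measurable borel \<and> (\<forall>x. 0 \<le> \<rho> x) \<and> sets \<mu>s = sets borel \<and>
     (\<exists>N\<in>null_sets lborel. emeasure \<mu>s (- N) = 0) \<and>
     (\<forall>B\<in>sets borel. emeasure \<mu> B = (\<integral>\<^sup>+ x \<in> B. ennreal (\<rho> x) \<partial>lborel) + emeasure \<mu>s B))"

definition vec_lebesgue_decomp ::
  "('a::euclidean_space set \<Rightarrow> 'a) \<Rightarrow> ('a \<Rightarrow> 'a) \<times> ('a set \<Rightarrow> 'a) \<Rightarrow> bool" where
  "vec_lebesgue_decomp \<nu> = (\<lambda>(w, \<nu>s).
     integrable lborel w \<and> vec_measure \<nu>s \<and>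
     (\<exists>N\<in>null_sets lborel. total_var \<nu>s (- N) = 0) \<and>
     (\<forall>B\<in>sets borel. \<nu> B = (LINT x:B|lborel. w x) + \<nu>s B))"

definition vec_density ::
  "'a::euclidean_space measure \<Rightarrow> ('a set \<Rightarrow> 'a) \<Rightarrow> ('a \<Rightarrow> 'a) \<Rightarrow> bool" where
  "vec_density \<theta> \<nu> w \<longleftrightarrow>
     integrable \<theta> w \<and> (\<forall>B\<in>sets borel. \<nu> B = (LINT x:B|\<theta>. w x))"

text \<open>The decompositions exist for finite measures and are unique, the densities up to null sets,
  so that the value does not depend on the choices made by \<open>SOME\<close>.\<close>

definition action ::
  "(real \<Rightarrow> real) \<Rightarrow> 'a::euclidean_space set \<Rightarrow> 'a measure \<Rightarrow> ('a set \<Rightarrow> 'a) \<Rightarrow> ennreal" where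
  "action m \<Omega> \<mu> \<nu> =
     (if emeasure \<mu> (- closure \<Omega>) \<noteq> 0 \<or> total_var \<nu> (- closure \<Omega>) \<noteq> 0 then \<infinity>
      else
        let (\<rho>, \<mu>s) = (SOME p. lebesgue_decomp \<mu> p);
            (w, \<nu>s) = (SOME p. vec_lebesgue_decomp \<nu> p);
            ac = (\<integral>\<^sup>+ x \<in> \<Omega>. act_density m (\<rho> x) (w x) \<partial>lborel)
        in if mob_slope m = 0 then
             (if \<forall>B\<in>sets borel. \<nu>s B = 0 then ac else \<infinity>)
           else
             (if \<exists>ws. vec_density \<mu>s \<nu>s ws then
                let ws = (SOME ws. vec_density \<mu>s \<nu>s ws)
                in ac + (\<integral>\<^sup>+ x \<in> closure \<Omega>. ennreal ((norm (ws x))\<^sup>2 / mob_slope m) \<partial>\<mu>s)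
              else \<infinity>))"

definition Wdist_sq ::
  "(real \<Rightarrow> real) \<Rightarrow> 'a::euclidean_space set \<Rightarrow> 'a measure \<Rightarrow> 'a measure \<Rightarrow> ennreal" where
  "Wdist_sq m \<Omega> \<mu>0 \<mu>1 =
     (INF (\<mu>, \<nu>) \<in> CE \<Omega> \<mu>0 \<mu>1. \<integral>\<^sup>+ s \<in> {0<..<1}. action m \<Omega> (\<mu> s) (\<nu> s) \<partial>lborel)"

definition Wdist ::
  "(real \<Rightarrow> real) \<Rightarrow> 'a::euclidean_space set \<Rightarrow> 'a measure \<Rightarrow> 'a measure \<Rightarrow> ennreal" where
  "Wdist m \<Omega> \<mu>0 \<mu>1 =
     (if Wdist_sq m \<Omega> \<mu>0 \<mu>1 = \<infinity> then \<infinity> else ennreal (sqrt (enn2real (Wdist_sq m \<Omega> \<mu>0 \<mu>1))))"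

text \<open>Real-valued version, required by \<^locale>\<open>Metric_space\<close>; it agrees with \<^const>\<open>Wdist\<close>
  wherever the latter is finite.\<close>

definition Wdist_real ::
  "(real \<Rightarrow> real) \<Rightarrow> 'a::euclidean_space set \<Rightarrow> 'a measure \<Rightarrow> 'a measure \<Rightarrow> real" where
  "Wdist_real m \<Omega> \<mu>0 \<mu>1 = enn2real (Wdist m \<Omega> \<mu>0 \<mu>1)"

end

theory Submission
  imports Defs "HOL-Probability.Probability"
begin

text \<open>For \<open>\<mu>\<close> of mass \<open>c\<close> let \<open>spread \<Omega> \<mu> e\<close> be the law of \<open>(1 - e) x + e y\<close>, with \<open>x\<close> distributed as \<open>\<mu>\<close> and \<open>y\<close>
  uniform in \<open>\<Omega>\<close>. Its density is at most \<open>R = c / (e\<^sup>d vol)\<close>, and finiteness of \<open>K\<close> forces \<open>R / m(R) = O(1 / e)\<close>;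
  moving along \<open>e = \<epsilon> s\<^sup>2\<close> therefore costs \<open>O(\<epsilon>)\<close> in action, uniformly in \<open>\<mu>\<close>. At \<open>e = 1\<close> all measures meet, so all distances
  are finite. For fixed \<open>\<epsilon>\<close>, two spread measures are joined by a path of densities and fluxes whose action is governed by the
  \<open>L\<^sup>2\<close> distance of the potentials \<open>\<integral> flux de\<close> over \<open>[\<epsilon>, 1]\<close>, and these are weakly continuous in \<open>\<mu>\<close>, since a ray crosses the frontier
  of a convex set at most once. Hence weak convergence implies convergence in the distance, and Helly's theorem makes
  the metric space compact. Conversely the action bounds the flux, so the distance controls integrals of smooth, hence of continuous,
  functions: the identity is continuous from a compact topology to the Hausdorff weak* topology, and the two agree.\<close>

section \<open>Smooth functions\<close>

text \<open>If the slope of the mobility at infinity is 0, a singular flux has infinite action: a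
  path can leave a concentrated measure only by an absolutely continuous flux, and its cost is
  decided by how large r / m(r) becomes at high density. The exponent 1 + 1 / d in K reflects that
  mass spread at scale e has density of order e^(-d): the bound r / m(r) = O(r^(1 / d)) drawn from K
  is one power of 1 / e.

  Comparing two spread measures meets the opposite obstacle: where the density vanishes m may vanish
  too, and interpolation may have infinite cost. A small weight of the uniform density keeps the
  mobility positive in between; it must vanish at both ends, but no faster than the square of the
  flux.

  The action along a path is handled as a function of time without known measurability, so its time
  integral is a lower integral. Symmetry and the triangle inequality rest on the inequalities that
  survive for lower integrals. Test functions vanish near the end times; weak* continuity recovers
  the boundary terms that make gluing possible.\<close>

lemma Ck_SucI:
  assumes "\<And>x. (f has_derivative D x) (at x)" and "\<And>v. Ck k (\<lambda>x. D x v)"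
  shows "Ck (Suc k) f"
proof -
  have "frechet_derivative f (at x) = D x" for x
    using frechet_derivative_at[OF assms(1)[of x]] by simp
  moreover have "f differentiable_on UNIV"
    using assms(1) by (auto simp: differentiable_on_def differentiable_def)
  ultimately show ?thesis using assms(2) by simp
qed

lemma Ck_Suc_has_derivative:
  assumes "Ck (Suc k) f"
  shows "(f has_derivative frechet_derivative f (at x)) (at x)"
  using assms by (simp add: differentiable_on_def frechet_derivative_works)

lemma Ck_Suc_imp_Ck: "Ck (Suc k) f \<Longrightarrow> Ck k f"
proof (induction k arbitrary: f)
  case 0
  then show ?case using differentiable_imp_continuous_on by auto
next
  case (Suc k)
  then show ?case by (metis Ck.simps(2))
qed

lemma Ck_const [simp]: "Ck k (\<lambda>x. c)"
proof (induction k arbitrary: c)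
  case (Suc k)
  show ?case by (rule Ck_SucI[where D = "\<lambda>x v. 0"]) (auto intro: Suc)
qed auto

lemma Ck_bounded_linear:
  assumes "bounded_linear f" shows "Ck k f"
proof (cases k)
  case 0 then show ?thesis using assms by (simp add: linear_continuous_on)
next
  case (Suc j)
  have "Ck (Suc j) f"
    by (rule Ck_SucI[where D = "\<lambda>x. f"]) (auto intro: bounded_linear_imp_has_derivative assms)
  then show ?thesis using Suc by simp
qed

lemma Ck_add: "Ck k f \<Longrightarrow> Ck k g \<Longrightarrow> Ck k (\<lambda>x. f x + g x)"
proof (induction k arbitrary: f g)
  case 0 then show ?case by (simp add: continuous_on_add)
next
  case (Suc k)
  show ?case
    by (rule Ck_SucI[OF has_derivative_add[OF Ck_Suc_has_derivative[OF Suc.prems(1)]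
          Ck_Suc_has_derivative[OF Suc.prems(2)]]]) (use Suc in auto)
qed

lemma Ck_mult: "Ck k f \<Longrightarrow> Ck k g \<Longrightarrow> Ck k (\<lambda>x. f x * g x)"
proof (induction k arbitrary: f g)
  case 0 then show ?case by (simp add: continuous_on_mult)
next
  case (Suc k)
  note mono = Ck_Suc_imp_Ck[OF Suc.prems(1)] Ck_Suc_imp_Ck[OF Suc.prems(2)]
  show ?case
  proof (rule Ck_SucI[OF has_derivative_mult[OF Ck_Suc_has_derivative[OF Suc.prems(1)]
          Ck_Suc_has_derivative[OF Suc.prems(2)]]])
    fix v
    show "Ck k (\<lambda>x. f x * frechet_derivative g (at x) v + frechet_derivative f (at x) v * g x)"
      by (intro Ck_add Suc.IH mono) (use Suc.prems in auto)
  qed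
qed

lemma Ck_comp_affine:
  assumes "bounded_linear L" shows "Ck k f \<Longrightarrow> Ck k (\<lambda>x. f (a + L x))"
proof (induction k arbitrary: f)
  case 0
  have "continuous_on UNIV (\<lambda>x. a + L x)"
    by (intro continuous_intros linear_continuous_on assms)
  then show ?case using 0 continuous_on_compose2[of UNIV f UNIV "\<lambda>x. a + L x"] by simp
next
  case (Suc k)
  have L: "((\<lambda>x. a + L x) has_derivative L) (at x)" for x
    using has_derivative_add[OF has_derivative_const bounded_linear_imp_has_derivative[OF assms]] by simp
  show ?case
  proof (rule Ck_SucI[OF has_derivative_compose[OF L Ck_Suc_has_derivative[OF Suc.prems]]])
    show "Ck k (\<lambda>x. frechet_derivative f (at (a + L x)) (L v))" for v
      using Suc.IH[of "\<lambda>y. frechet_derivative f (at y) (L v)"] Suc.prems by auto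
  qed
qed

lemma Ck_comp_linear: "bounded_linear L \<Longrightarrow> Ck k f \<Longrightarrow> Ck k (\<lambda>x. f (L x))"
  using Ck_comp_affine[of L k f 0] by simp

lemma Ck_real_SucI:
  fixes h :: "real \<Rightarrow> real"
  assumes "\<And>x. (h has_real_derivative h' x) (at x)" and "Ck k h'"
  shows "Ck (Suc k) h"
  by (rule Ck_SucI[where D = "\<lambda>x v. h' x * v"])
     (use assms in \<open>auto simp: has_field_derivative_def intro!: Ck_mult\<close>)

text \<open>The derivative of the composite contains the derivative of \<open>h\<close> at
  \<open>g x\<close>, so the induction on \<open>k\<close> runs over all \<open>h\<close>.
  Smoothness of every order passes from \<open>h\<close> to its derivative, whereas a fixed order
  would be lost.\<close>

lemma Ck_compose:
  fixes h :: "real \<Rightarrow> real"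
  shows "(\<And>j. Ck j h) \<Longrightarrow> Ck k g \<Longrightarrow> Ck k (\<lambda>x. h (g x))"
proof (induction k arbitrary: h g)
  case 0
  have "continuous_on UNIV h" using "0.prems"(1)[of 0] by simp
  then show ?case using "0.prems"(2) continuous_on_compose2[of UNIV h UNIV g] by simp
next
  case (Suc k)
  have h: "(h has_derivative frechet_derivative h (at x)) (at x)" for x
    using Ck_Suc_has_derivative[OF Suc.prems(1)] .
  show ?case
  proof (rule Ck_SucI[OF has_derivative_compose[OF Ck_Suc_has_derivative[OF Suc.prems(2)] h]])
    fix v
    \<comment> \<open>On the line a linear map is multiplication by its value at 1, which turns the
      chain rule into a product of two scalar functions.\<close>
    have *: "frechet_derivative h (at (g x)) (frechet_derivative g (at x) v)
       = frechet_derivative g (at x) v * frechet_derivative h (at (g x)) 1" for x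
      using linear_cmul[OF has_derivative_linear[OF h[of "g x"]], of "frechet_derivative g (at x) v" 1]
      by simp
    have h1: "Ck j (\<lambda>y. frechet_derivative h (at y) 1)" for j
      using Suc.prems(1)[of "Suc j"] by simp
    have "Ck k (\<lambda>x. frechet_derivative h (at (g x)) 1)"
      by (rule Suc.IH[OF h1 Ck_Suc_imp_Ck[OF Suc.prems(2)]])
    moreover have "Ck k (\<lambda>x. frechet_derivative g (at x) v)" using Suc.prems(2) by simp
    ultimately show "Ck k (\<lambda>x. frechet_derivative h (at (g x)) (frechet_derivative g (at x) v))"
      unfolding * by (intro Ck_mult)
  qed
qed

lemma Ck_real_polynomial_function:
  "real_polynomial_function p \<Longrightarrow> Ck k p"
  by (induction rule: real_polynomial_function.induct)
     (auto intro: Ck_add Ck_mult Ck_bounded_linear)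

section \<open>A smooth step from exp (-1 / x)\<close>

definition flat_exp :: "nat \<Rightarrow> real \<Rightarrow> real" where
  "flat_exp n x = (if x > 0 then inverse x ^ n * exp (- inverse x) else 0)"

text \<open>Inverting the variable turns this into the decay of x^n / exp x at infinity.\<close>

lemma flat_exp_tendsto_0: "(flat_exp n \<longlongrightarrow> 0) (at_right 0)"
proof -
  have "((\<lambda>x::real. x ^ n / exp x) \<longlongrightarrow> 0) at_top"
    by (rule tendsto_power_div_exp_0)
  then have "((\<lambda>x::real. inverse x ^ n / exp (inverse x)) \<longlongrightarrow> 0) (at_right 0)"
    using filterlim_compose filterlim_inverse_at_top_right by blast
  moreover have "\<forall>\<^sub>F x in at_right (0::real). inverse x ^ n / exp (inverse x) = flat_exp n x"
    by (simp add: flat_exp_def exp_minus divide_inverse eventually_at_right_less eventually_mono[OF eventually_at_right_less])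
  ultimately show ?thesis using Lim_transform_eventually by blast
qed

text \<open>The exponent \<open>n\<close> closes the family under differentiation, so that one
  induction on the order gives smoothness of all its members.\<close>

lemma flat_exp_has_derivative:
  "(flat_exp n has_real_derivative flat_exp (n + 2) x - of_nat n * flat_exp (n + 1) x) (at x)"
proof -
  consider "x > 0" | "x < 0" | "x = 0" by linarith
  then show ?thesis
  proof cases
    case 1
    have "((\<lambda>x. inverse x ^ n * exp (- inverse x)) has_real_derivative
        flat_exp (n + 2) x - of_nat n * flat_exp (n + 1) x) (at x)"
      using 1 by (auto intro!: derivative_eq_intros simp: flat_exp_def algebra_simps power2_eq_square)
         (cases n; simp add: field_simps)
    then show ?thesis
      by (rule has_field_derivative_transform_within_open[where S = "{0<..}"])
         (use 1 in \<open>auto simp: flat_exp_def\<close>)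
  next
    case 2
    have "((\<lambda>x. 0::real) has_real_derivative flat_exp (n + 2) x - of_nat n * flat_exp (n + 1) x) (at x)"
      using 2 by (simp add: flat_exp_def)
    then show ?thesis
      by (rule has_field_derivative_transform_within_open[where S = "{..<0}"])
         (use 2 in \<open>auto simp: flat_exp_def\<close>)
  next
    case 3
    \<comment> \<open>At 0 the difference quotient is 0 from the left, and from the right it is the
      next member of the family.\<close>
    have "((\<lambda>h. flat_exp n h / h) \<longlongrightarrow> 0) (at 0)"
    proof (rule filterlim_split_at)
      have "\<forall>\<^sub>F h in at_left (0::real). 0 = flat_exp n h / h"
        by (rule eventually_at_leftI[of "-1"]) (auto simp: flat_exp_def)
      then show "((\<lambda>h. flat_exp n h / h) \<longlongrightarrow> 0) (at_left 0)"
        by (rule Lim_transform_eventually[rotated]) simp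
      have "\<forall>\<^sub>F h in at_right (0::real). flat_exp (n+1) h = flat_exp n h / h"
        by (rule eventually_at_rightI[of _ 1]) (auto simp: flat_exp_def field_simps)
      then show "((\<lambda>h. flat_exp n h / h) \<longlongrightarrow> 0) (at_right 0)"
        by (rule Lim_transform_eventually[OF flat_exp_tendsto_0])
    qed
    then show ?thesis using 3 by (simp add: DERIV_def flat_exp_def)
  qed
qed

lemma Ck_flat_exp: "Ck k (flat_exp n)"
proof (induction k arbitrary: n)
  case 0
  show ?case
    using DERIV_continuous[OF flat_exp_has_derivative] by (simp add: continuous_at_imp_continuous_on)
next
  case (Suc k)
  have "Ck k (\<lambda>x. flat_exp (n + 2) x + (- of_nat n) * flat_exp (n + 1) x)"
    by (intro Ck_add Ck_mult Suc Ck_const)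
  then show ?case
    by (intro Ck_real_SucI[OF flat_exp_has_derivative]) simp
qed

definition bump :: "real \<Rightarrow> real" where
  "bump x = flat_exp 0 x * flat_exp 0 (1 - x)"

lemma Ck_affine: "Ck k h \<Longrightarrow> Ck k (\<lambda>x::real. h (a + b * x))"
  using Ck_comp_affine[OF bounded_linear_mult_right] .

lemma Ck_bump: "Ck k bump"
proof -
  have "Ck k (\<lambda>x. flat_exp 0 x * flat_exp 0 (1 + (-1) * x))"
    by (intro Ck_mult Ck_affine Ck_flat_exp)
  moreover have "bump = (\<lambda>x. flat_exp 0 x * flat_exp 0 (1 + (-1) * x))"
    by (auto simp: bump_def)
  ultimately show ?thesis by simp
qed

lemma bump_nonneg: "0 \<le> bump x" and bump_eq_0: "x \<le> 0 \<or> 1 \<le> x \<Longrightarrow> bump x = 0"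
  and bump_pos: "0 < x \<Longrightarrow> x < 1 \<Longrightarrow> 0 < bump x"
  by (auto simp: bump_def flat_exp_def)

text \<open>A normalised antiderivative of the bump. Its derivative is exported as well, since it
  serves later as an approximate identity.\<close>

lemma smooth_step_exists:
  "\<exists>S :: real \<Rightarrow> real. (\<forall>k. Ck k S) \<and> (\<forall>x\<le>0. S x = 0) \<and> (\<forall>x\<ge>1. S x = 1) \<and> mono S \<and>
     (\<exists>S'. continuous_on UNIV S' \<and> (\<forall>x. 0 \<le> S' x) \<and> (\<forall>x. x \<le> 0 \<or> 1 \<le> x \<longrightarrow> S' x = 0) \<and>
       (\<forall>x. (S has_real_derivative S' x) (at x)))"
proof -
  have cont: "continuous_on UNIV bump" using Ck_bump[of 0] by simp
  obtain T where T: "\<And>x. (T has_real_derivative bump x) (at x)"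
    using einterval_antiderivative[of "-\<infinity>" "\<infinity>" bump] cont
    by (auto simp: continuous_on_eq_continuous_at has_real_derivative_iff_has_vector_derivative)
  have T01: "T 0 < T 1"
  proof -
    obtain z where "0 < z" "z < 1" "T 1 - T 0 = (1 - 0) * bump z"
      using MVT2[of 0 1 T bump] T by auto
    then show ?thesis using bump_pos[of z] by simp
  qed
  have const: "T x = T y" if "x \<le> y" "y \<le> 0 \<or> 1 \<le> x" for x y
  proof (cases "x = y")
    case False
    then have "x < y" using that by simp
    from MVT2[OF this, of T bump] T obtain z where "x < z" "z < y" "T y - T x = (y - x) * bump z"
      by blast
    then show ?thesis using bump_eq_0[of z] that by auto
  qed auto
  have mono: "T x \<le> T y" if "x \<le> y" for x y
    using DERIV_nonneg_imp_nondecreasing[of x y T] that T bump_nonneg by blast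
  have T01': "T 1 - T 0 \<noteq> 0" using T01 by linarith
  define S where "S = (\<lambda>x. (T x - T 0) / (T 1 - T 0))"
  have dS: "(S has_real_derivative bump x / (T 1 - T 0)) (at x)" for x
    unfolding S_def by (use T01' in \<open>auto intro!: derivative_eq_intros T\<close>)
  have ck: "Ck k S" for k
  proof (cases k)
    case 0
    then show ?thesis using DERIV_continuous[OF dS] by (simp add: continuous_at_imp_continuous_on)
  next
    case (Suc j)
    have "Ck j (\<lambda>x. bump x * (1 / (T 1 - T 0)))" by (intro Ck_mult Ck_bump Ck_const)
    then show ?thesis unfolding Suc by (intro Ck_real_SucI[OF dS]) simp
  qed
  have S0: "S x = 0" if "x \<le> 0" for x using const[of x 0] that by (simp add: S_def)
  have S1: "S x = 1" if "x \<ge> 1" for x using const[of 1 x] that T01 by (simp add: S_def)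
  have mS: "mono S" using T01 by (intro monoI) (simp add: S_def divide_right_mono mono)
  have cS: "continuous_on UNIV (\<lambda>x. bump x / (T 1 - T 0))"
    using T01' by (intro continuous_intros cont) auto
  show ?thesis
    using ck S0 S1 mS cS dS T01 bump_nonneg bump_eq_0
    by (intro exI[of _ S] exI[of _ "\<lambda>x. bump x / (T 1 - T 0)"] conjI) auto
qed

section \<open>Set functions and their Jordan decomposition\<close>

text \<open>The constant sequence of empty sets is disjoint, and the terms of a convergent series
  tend to 0.\<close>

lemma vec_measure_empty:
  assumes "vec_measure \<nu>" shows "\<nu> {} = 0"
proof -
  have "(\<lambda>i::nat. \<nu> {}) sums \<nu> (\<Union>i::nat. {})"
    using assms[unfolded vec_measure_def, rule_format, of "\<lambda>i. {}"]
    by (auto simp: disjoint_family_on_def)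
  then show ?thesis using summable_LIMSEQ_zero sums_summable LIMSEQ_const_iff by blast
qed

lemma vec_measure_Un:
  assumes \<nu>: "vec_measure \<nu>" and AB: "A \<in> sets borel" "B \<in> sets borel" "A \<inter> B = {}"
  shows "\<nu> (A \<union> B) = \<nu> A + \<nu> B"
proof -
  have "(\<lambda>i. \<nu> (binaryset A B i)) sums \<nu> (\<Union>i. binaryset A B i)"
  proof -
    have "range (binaryset A B) \<subseteq> sets borel" "disjoint_family (binaryset A B)"
      using AB by (auto simp: range_binaryset_eq disjoint_family_on_def binaryset_def)
    then show ?thesis using \<nu> unfolding vec_measure_def by blast
  qed
  moreover have "(\<lambda>i. \<nu> (binaryset A B i)) sums (\<nu> A + \<nu> B)"
    using binaryset_sums[of \<nu> A B] vec_measure_empty[OF \<nu>] by blast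
  ultimately show ?thesis using sums_unique2 by (metis UN_binaryset_eq)
qed

lemma vec_measure_Diff:
  assumes "vec_measure \<nu>" "A \<in> sets borel" "B \<in> sets borel" "B \<subseteq> A"
  shows "\<nu> (A - B) = \<nu> A - \<nu> B"
proof -
  have "(A - B) \<inter> B = {}" "A - B \<union> B = A" using assms by auto
  then show ?thesis using vec_measure_Un[of \<nu> "A - B" B] assms by simp
qed

lemma vec_measure_bounded_linear:
  assumes "vec_measure \<nu>" "bounded_linear L"
  shows "vec_measure (\<lambda>B. L (\<nu> B))"
  using assms unfolding vec_measure_def by (auto intro: bounded_linear.sums)

lemma vec_measure_inner: "vec_measure \<nu> \<Longrightarrow> vec_measure (\<lambda>B. \<nu> B \<bullet> b)"
  by (rule vec_measure_bounded_linear[where L = "\<lambda>x. x \<bullet> b"]) (auto intro: bounded_linear_inner_left)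

lemma vec_measure_uminus: "vec_measure \<nu> \<Longrightarrow> vec_measure (\<lambda>B. - \<nu> B)"
  by (rule vec_measure_bounded_linear[where L = uminus]) (auto intro: bounded_linear_minus[OF bounded_linear_ident])

lemma vec_measure_scaleR: "vec_measure \<nu> \<Longrightarrow> vec_measure (\<lambda>B. r *\<^sub>R \<nu> B)"
  by (rule vec_measure_bounded_linear[where L = "scaleR r"]) (auto intro: bounded_linear_scaleR_right)

text \<open>\<open>ennreal\<close> cuts negative terms off at 0, so the right-hand side sums the
  positive parts and dominates every partial sum.\<close>

lemma ennreal_suminf_le:
  assumes "summable f" shows "ennreal (suminf f) \<le> (\<Sum>i. ennreal (f i))"
proof (rule LIMSEQ_le_const2)
  show "(\<lambda>n. ennreal (sum f {..<n})) \<longlonglongrightarrow> ennreal (suminf f)"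
    by (intro tendsto_ennrealI summable_LIMSEQ assms)
  have "ennreal (sum f {..<n}) \<le> (\<Sum>i<n. ennreal (f i))" for n
  proof (induction n)
    case (Suc n)
    have "ennreal (sum f {..<n} + f n) \<le> ennreal (sum f {..<n}) + ennreal (f n)"
      using ennreal_leI[of "sum f {..<n} + f n" "max 0 (sum f {..<n}) + max 0 (f n)"]
        ennreal_plus[of "max 0 (sum f {..<n})" "max 0 (f n)"]
      by simp
    then show ?case using Suc by (simp add: add_right_mono order_trans)
  qed auto
  also have "(\<Sum>i<n. ennreal (f i)) \<le> (\<Sum>i. ennreal (f i))" for n
    by (intro sum_le_suminf) auto
  finally show "\<exists>N. \<forall>n\<ge>N. ennreal (sum f {..<n}) \<le> (\<Sum>i. ennreal (f i))" by blast
qed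

text \<open>The positive variation, which is the set function handed to \<open>measure_of\<close> in
  \<open>pos_part_measure\<close>.\<close>

definition upper_var :: "('a::euclidean_space set \<Rightarrow> real) \<Rightarrow> 'a set \<Rightarrow> ennreal" where
  "upper_var \<sigma> A = (SUP B \<in> {B \<in> sets borel. B \<subseteq> A}. ennreal (\<sigma> B))"

lemma upper_var_mono: "A \<subseteq> A' \<Longrightarrow> upper_var \<sigma> A \<le> upper_var \<sigma> A'"
  unfolding upper_var_def by (intro SUP_subset_mono) auto

lemma upper_var_upper: "B \<in> sets borel \<Longrightarrow> B \<subseteq> A \<Longrightarrow> ennreal (\<sigma> B) \<le> upper_var \<sigma> A"
  unfolding upper_var_def by (intro SUP_upper) auto

text \<open>Competitors inside two disjoint sets unite to a competitor inside the union.\<close>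

lemma upper_var_add:
  assumes \<sigma>: "vec_measure \<sigma>" and "A \<in> sets borel" "A' \<in> sets borel" "A \<inter> A' = {}"
  shows "upper_var \<sigma> A + upper_var \<sigma> A' \<le> upper_var \<sigma> (A \<union> A')"
proof -
  have *: "ennreal (\<sigma> B) + ennreal (\<sigma> B') \<le> upper_var \<sigma> (A \<union> A')"
    if B: "B \<in> sets borel" "B \<subseteq> A" "B' \<in> sets borel" "B' \<subseteq> A'" for B B'
  proof (cases "0 \<le> \<sigma> B \<and> 0 \<le> \<sigma> B'")
    case True
    have "B \<inter> B' = {}" using B assms(4) by blast
    with True have "ennreal (\<sigma> B) + ennreal (\<sigma> B') = ennreal (\<sigma> (B \<union> B'))"
      using B by (simp add: vec_measure_Un[OF \<sigma>])
    then show ?thesis using B upper_var_upper[of "B \<union> B'" "A \<union> A'" \<sigma>] by auto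
  next
    case False
    \<comment> \<open>A negative value counts as 0, and the other set alone is then a
      competitor.\<close>
    then have "ennreal (\<sigma> B) = 0 \<or> ennreal (\<sigma> B') = 0" by (auto simp: ennreal_neg)
    then show ?thesis
      using B upper_var_upper[of B "A \<union> A'" \<sigma>] upper_var_upper[of B' "A \<union> A'" \<sigma>]
      by (auto simp: le_supI1 le_supI2)
  qed
  have ne: "{B \<in> sets borel. B \<subseteq> C} \<noteq> {}" for C :: "'a set" by auto
  have "upper_var \<sigma> A + upper_var \<sigma> A' =
    (SUP B \<in> {B \<in> sets borel. B \<subseteq> A}. SUP B' \<in> {B \<in> sets borel. B \<subseteq> A'}. ennreal (\<sigma> B) + ennreal (\<sigma> B'))"
    (is "_ = (SUP B \<in> ?P. SUP B' \<in> ?Q. _)")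
  proof -
    have "(SUP B \<in> ?P. SUP B' \<in> ?Q. ennreal (\<sigma> B) + ennreal (\<sigma> B')) = (SUP B \<in> ?P. ennreal (\<sigma> B) + upper_var \<sigma> A')"
      unfolding upper_var_def ennreal_SUP_add_right[OF ne] ..
    also have "\<dots> = upper_var \<sigma> A + upper_var \<sigma> A'"
      unfolding upper_var_def[of \<sigma> A] ennreal_SUP_add_left[OF ne] ..
    finally show ?thesis ..
  qed
  also have "\<dots> \<le> upper_var \<sigma> (A \<union> A')"
    using * by (intro SUP_least) auto
  finally show ?thesis .
qed

lemma upper_var_empty [simp]:
  assumes "vec_measure \<sigma>" shows "upper_var \<sigma> {} = 0"
proof -
  have "{B \<in> sets borel. B \<subseteq> {}} = {{}::'a set}" by auto
  then show ?thesis unfolding upper_var_def by (simp add: vec_measure_empty[OF assms])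
qed

text \<open>One inequality is the limit of finite superadditivity. For the other, a competitor in
  the union is cut along the \<open>A i\<close>, and countable additivity of \<sigma>
  applies.\<close>

lemma upper_var_suminf:
  fixes A :: "nat \<Rightarrow> 'a::euclidean_space set"
  assumes \<sigma>: "vec_measure \<sigma>" and A: "range A \<subseteq> sets borel" "disjoint_family A"
  shows "(\<Sum>i. upper_var \<sigma> (A i)) = upper_var \<sigma> (\<Union>i. A i)"
proof (rule antisym)
  have "(\<Sum>i<n. upper_var \<sigma> (A i)) \<le> upper_var \<sigma> (\<Union>i<n. A i)" for n
  proof (induction n)
    case (Suc n)
    have "(\<Sum>i<Suc n. upper_var \<sigma> (A i)) \<le> upper_var \<sigma> (\<Union>i<n. A i) + upper_var \<sigma> (A n)"
      using Suc by (auto intro: add_right_mono)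
    also have "\<dots> \<le> upper_var \<sigma> ((\<Union>i<n. A i) \<union> A n)"
    proof (rule upper_var_add[OF \<sigma>])
      show "(\<Union>i<n. A i) \<inter> A n = {}"
        using A(2) by (auto simp: disjoint_family_on_def) (metis UNIV_I disjoint_iff less_irrefl)
    qed (use A in auto)
    also have "(\<Union>i<n. A i) \<union> A n = (\<Union>i<Suc n. A i)" by (auto simp: less_Suc_eq)
    finally show ?case .
  qed (use \<sigma> in auto)
  then show "(\<Sum>i. upper_var \<sigma> (A i)) \<le> upper_var \<sigma> (\<Union>i. A i)"
    by (intro suminf_le_const) (auto intro!: order_trans[OF _ upper_var_mono[of _ "\<Union>i. A i"]])
  show "upper_var \<sigma> (\<Union>i. A i) \<le> (\<Sum>i. upper_var \<sigma> (A i))"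
    unfolding upper_var_def[of _ "\<Union>i. A i"]
  proof (rule SUP_least)
    fix B assume "B \<in> {B \<in> sets borel. B \<subseteq> (\<Union>i. A i)}"
    then have B: "B \<in> sets borel" "B = (\<Union>i. B \<inter> A i)" by auto
    have "range (\<lambda>i. B \<inter> A i) \<subseteq> sets borel" "disjoint_family (\<lambda>i. B \<inter> A i)"
      using A B(1) by (auto simp: disjoint_family_on_def)
    with \<sigma> have "(\<lambda>i. \<sigma> (B \<inter> A i)) sums \<sigma> (\<Union>i. B \<inter> A i)" unfolding vec_measure_def by blast
    then have s: "(\<lambda>i. \<sigma> (B \<inter> A i)) sums \<sigma> B" using B(2) by simp
    then have "ennreal (\<sigma> B) \<le> (\<Sum>i. ennreal (\<sigma> (B \<inter> A i)))"
      using ennreal_suminf_le[OF sums_summable[OF s]] sums_unique[OF s] by simp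
    also have "\<dots> \<le> (\<Sum>i. upper_var \<sigma> (A i))"
      using A B(1) by (intro suminf_le upper_var_upper) auto
    finally show "ennreal (\<sigma> B) \<le> (\<Sum>i. upper_var \<sigma> (A i))" .
  qed
qed

section \<open>Jordan parts and signed integrals\<close>

lemma sets_pos_part_measure [simp, measurable_cong]: "sets (pos_part_measure \<sigma>) = sets borel"
  and space_pos_part_measure [simp]: "space (pos_part_measure \<sigma>) = UNIV"
proof -
  have "sigma_algebra UNIV (sets (borel :: 'a measure))"
    using sets.sigma_algebra_axioms[of "borel :: 'a measure"] by simp
  then show "sets (pos_part_measure \<sigma>) = sets borel"
    unfolding pos_part_measure_def by (simp add: sigma_algebra.sigma_sets_eq)
  show "space (pos_part_measure \<sigma>) = UNIV"
    unfolding pos_part_measure_def by (simp add: space_measure_of_conv)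
qed

lemma emeasure_pos_part_measure:
  assumes \<sigma>: "vec_measure \<sigma>" and A: "A \<in> sets borel"
  shows "emeasure (pos_part_measure \<sigma>) A = upper_var \<sigma> A"
proof -
  have "countably_additive (sets (pos_part_measure \<sigma>)) (upper_var \<sigma>)"
    unfolding countably_additive_def using upper_var_suminf[OF \<sigma>] by auto
  moreover have "positive (sets (pos_part_measure \<sigma>)) (upper_var \<sigma>)"
    using \<sigma> by (simp add: positive_def)
  ultimately show ?thesis
    using A emeasure_measure_of[of "pos_part_measure \<sigma>" UNIV "sets borel" "upper_var \<sigma>" A]
    by (simp add: pos_part_measure_def upper_var_def[abs_def])
qed

text \<open>For \<open>B \<subseteq> A\<close>, additivity gives
  \<open>\<sigma> B = \<sigma> A - \<sigma> (A - B)\<close>, which is at most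
  \<open>\<sigma> A\<close> plus the negative variation of \<open>A\<close>. The supremum over
  \<open>B\<close> yields one inequality of the Jordan decomposition; the same argument for
  \<open>- \<sigma>\<close> yields the other.\<close>

lemma
  fixes \<sigma> :: "'a::euclidean_space set \<Rightarrow> real"
  assumes \<sigma>: "vec_measure \<sigma>" and K: "\<And>B. B \<in> sets borel \<Longrightarrow> \<bar>\<sigma> B\<bar> \<le> K"
  shows emeasure_pos_part_measure_le: "emeasure (pos_part_measure \<sigma>) A \<le> ennreal K"
    and finite_pos_part_measure: "finite_measure (pos_part_measure \<sigma>)"
    and pos_part_measure_diff: "A \<in> sets borel \<Longrightarrow>
      measure (pos_part_measure \<sigma>) A - measure (pos_part_measure (\<lambda>B. - \<sigma> B)) A = \<sigma> A"
proof -
  have K0: "0 \<le> K" using K[of "{}"] by auto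
  have le: "upper_var \<tau> A \<le> ennreal K" if "\<And>B. B \<in> sets borel \<Longrightarrow> \<bar>\<tau> B\<bar> \<le> K" for A and \<tau> :: "'a set \<Rightarrow> real"
    unfolding upper_var_def using that by (intro SUP_least ennreal_leI) (auto simp: abs_le_iff)
  have le': "emeasure (pos_part_measure \<tau>) A \<le> ennreal K" if "vec_measure \<tau>" "\<And>B. B \<in> sets borel \<Longrightarrow> \<bar>\<tau> B\<bar> \<le> K" for A and \<tau> :: "'a set \<Rightarrow> real"
  proof (cases "A \<in> sets borel")
    case True show ?thesis unfolding emeasure_pos_part_measure[OF that(1) True] by (rule le) (rule that(2))
  next
    case False then show ?thesis using emeasure_notin_sets[of A "pos_part_measure \<tau>"] by simp
  qed
  show 1: "emeasure (pos_part_measure \<sigma>) A \<le> ennreal K" by (rule le'[OF \<sigma> K])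
  have fin: "finite_measure (pos_part_measure \<tau>)" if "vec_measure \<tau>" "\<And>B. B \<in> sets borel \<Longrightarrow> \<bar>\<tau> B\<bar> \<le> K" for \<tau> :: "'a set \<Rightarrow> real"
    using le'[OF that, of UNIV] by (intro finite_measureI) (auto simp: top_unique)
  show "finite_measure (pos_part_measure \<sigma>)" by (rule fin[OF \<sigma> K])
  have key: "measure (pos_part_measure \<tau>) A \<le> \<tau> A + measure (pos_part_measure (\<lambda>B. - \<tau> B)) A"
    if \<tau>: "vec_measure \<tau>" "\<And>B. B \<in> sets borel \<Longrightarrow> \<bar>\<tau> B\<bar> \<le> K" and A: "A \<in> sets borel" for \<tau> :: "'a set \<Rightarrow> real"
  proof -
    define n where "n = measure (pos_part_measure (\<lambda>B. - \<tau> B)) A"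
    have \<tau>': "vec_measure (\<lambda>B. - \<tau> B)" "\<And>B. B \<in> sets borel \<Longrightarrow> \<bar>- \<tau> B\<bar> \<le> K"
      using vec_measure_uminus[OF \<tau>(1)] \<tau>(2) by auto
    interpret N: finite_measure "pos_part_measure (\<lambda>B. - \<tau> B)" by (rule fin[OF \<tau>'])
    interpret P: finite_measure "pos_part_measure \<tau>" by (rule fin[OF \<tau>])
    have n: "upper_var (\<lambda>B. - \<tau> B) A = ennreal n"
      using emeasure_pos_part_measure[OF \<tau>'(1) A] N.emeasure_eq_measure by (simp add: n_def)
    have B: "\<tau> B \<le> \<tau> A + n" if "B \<in> sets borel" "B \<subseteq> A" for B
    proof -
      have "ennreal (- \<tau> (A - B)) \<le> ennreal n"
        using upper_var_upper[of "A - B" A "\<lambda>B. - \<tau> B"] n that A by auto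
      then have "- \<tau> (A - B) \<le> n"
        using measure_nonneg[of "pos_part_measure (\<lambda>B. - \<tau> B)" A] by (auto simp: ennreal_le_iff2 n_def)
      then show ?thesis using vec_measure_Diff[OF \<tau>(1) A that] by simp
    qed
    have "upper_var \<tau> A \<le> ennreal (\<tau> A + n)"
      unfolding upper_var_def using B by (intro SUP_least ennreal_leI) auto
    moreover have "0 \<le> \<tau> A + n" using B[of "{}"] vec_measure_empty[OF \<tau>(1)] by simp
    ultimately show ?thesis
      using emeasure_pos_part_measure[OF \<tau>(1) A] n_def
      by (simp add: P.emeasure_eq_measure[symmetric] measure_def enn2real_leI)
  qed
  show "measure (pos_part_measure \<sigma>) A - measure (pos_part_measure (\<lambda>B. - \<sigma> B)) A = \<sigma> A" if "A \<in> sets borel"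
    using key[OF \<sigma> K that] key[OF vec_measure_uminus[OF \<sigma>] _ that] K by fastforce
qed

text \<open>Equality of sums of integrals stands in for equality of sums of measures.\<close>

lemma nn_integral_add_measure_eq:
  assumes [simp, measurable_cong]: "sets M1 = sets M" "sets M2 = sets M" "sets M3 = sets M" "sets M4 = sets M"
  assumes eq: "\<And>B. B \<in> sets M \<Longrightarrow> emeasure M1 B + emeasure M2 B = emeasure M3 B + emeasure M4 B"
  assumes g: "g \<in> borel_measurable M"
  shows "(\<integral>\<^sup>+x. g x \<partial>M1) + (\<integral>\<^sup>+x. g x \<partial>M2) = (\<integral>\<^sup>+x. g x \<partial>M3) + (\<integral>\<^sup>+x. g x \<partial>M4)"
  using g
proof (induction rule: borel_measurable_induct)
  case (cong f g)
  have "space M1 = space M" "space M2 = space M" "space M3 = space M" "space M4 = space M"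
    by (simp_all add: sets_eq_imp_space_eq[OF assms(1)] sets_eq_imp_space_eq[OF assms(2)] sets_eq_imp_space_eq[OF assms(3)] sets_eq_imp_space_eq[OF assms(4)])
  then have "(\<integral>\<^sup>+x. f x \<partial>M') = (\<integral>\<^sup>+x. g x \<partial>M')" if "M' \<in> {M1, M2, M3, M4}" for M'
    using cong(3) that by (intro nn_integral_cong) auto
  with cong(4) show ?case by simp
next
  case (set A)
  then show ?case using eq by simp
next
  case (mult u c)
  then show ?case by (simp add: nn_integral_cmult distrib_left[symmetric])
next
  case (add u v)
  have "(a + b) + (c + d) = (a + c) + (b + d)" for a b c d :: ennreal by (simp add: ac_simps)
  from this[of "integral\<^sup>N M1 v" "integral\<^sup>N M1 u" "integral\<^sup>N M2 v" "integral\<^sup>N M2 u"]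
    this[of "integral\<^sup>N M3 v" "integral\<^sup>N M3 u" "integral\<^sup>N M4 v" "integral\<^sup>N M4 u"]
  show ?case using add by (simp add: nn_integral_add)
next
  case (seq U)
  have *: "(\<integral>\<^sup>+x. (SUP i. U i) x \<partial>M') = (SUP i. (\<integral>\<^sup>+x. U i x \<partial>M'))" if "sets M' = sets M" for M'
  proof -
    have "U i \<in> borel_measurable M'" for i using seq(1)[of i] that by simp
    then show ?thesis using seq.hyps(3) by (simp add: nn_integral_monotone_convergence_SUP image_comp)
  qed
  have inc: "incseq (\<lambda>i. \<integral>\<^sup>+x. U i x \<partial>M')" for M'
    using seq.hyps(3) by (auto simp: incseq_def le_fun_def intro!: nn_integral_mono)
  have "(SUP i. (\<integral>\<^sup>+x. U i x \<partial>M1)) + (SUP i. (\<integral>\<^sup>+x. U i x \<partial>M2)) =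
     (SUP i. (\<integral>\<^sup>+x. U i x \<partial>M3)) + (SUP i. (\<integral>\<^sup>+x. U i x \<partial>M4))"
    unfolding ennreal_SUP_add[OF inc inc, symmetric] seq.IH ..
  then show ?case by (simp only: * assms(1-4))
qed

lemma integrable_bounded_finite_measure:
  fixes g :: "'a \<Rightarrow> real"
  assumes "finite_measure M" "g \<in> borel_measurable M" "\<And>x. \<bar>g x\<bar> \<le> K"
  shows "integrable M g"
  using finite_measure.integrable_const_bound[OF assms(1), of g K] assms by auto

text \<open>Adding \<open>K\<close> makes the integrand nonnegative, which reduces the claim to
  \<open>nn_integral\<close>; the contributions of \<open>K\<close> cancel because the total masses
  agree.\<close>

lemma integral_add_measure_eq:
  fixes g :: "'a \<Rightarrow> real"
  assumes [simp, measurable_cong]: "sets M1 = sets M" "sets M2 = sets M" "sets M3 = sets M" "sets M4 = sets M"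
  assumes fin: "finite_measure M1" "finite_measure M2" "finite_measure M3" "finite_measure M4"
  assumes eq: "\<And>B. B \<in> sets M \<Longrightarrow> measure M1 B + measure M2 B = measure M3 B + measure M4 B"
  assumes g[measurable]: "g \<in> borel_measurable M" and K: "\<And>x. \<bar>g x\<bar> \<le> K"
  shows "(LINT x|M1. g x) + (LINT x|M2. g x) = (LINT x|M3. g x) + (LINT x|M4. g x)"
proof -
  have sp: "space M1 = space M" "space M2 = space M" "space M3 = space M" "space M4 = space M"
    by (simp_all add: sets_eq_imp_space_eq[OF assms(1)] sets_eq_imp_space_eq[OF assms(2)] sets_eq_imp_space_eq[OF assms(3)] sets_eq_imp_space_eq[OF assms(4)])
  have gM: "g \<in> borel_measurable M'" if "M' \<in> {M1, M2, M3, M4}" for M' using that g by auto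
  have int: "integrable M' g" if "M' \<in> {M1, M2, M3, M4}" for M'
    using that fin gM[OF that] K by (intro integrable_bounded_finite_measure) auto
  have h: "(\<integral>\<^sup>+x. ennreal (g x + K) \<partial>M') = ennreal ((LINT x|M'. g x) + K * measure M' (space M'))"
    if M': "M' \<in> {M1, M2, M3, M4}" for M'
  proof -
    interpret finite_measure M' using fin M' by auto
    have "0 \<le> g x + K" for x using K[of x] by linarith
    then have "(\<integral>\<^sup>+x. ennreal (g x + K) \<partial>M') = ennreal (LINT x|M'. g x + K)"
      by (intro nn_integral_eq_integral) (auto intro: int[OF M'])
    then show ?thesis using int[OF M'] by (simp add: mult.commute)
  qed
  have nonneg: "0 \<le> (LINT x|M'. g x) + K * measure M' (space M')" if M': "M' \<in> {M1, M2, M3, M4}" for M'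
  proof -
    interpret finite_measure M' using fin M' by auto
    have "0 \<le> (LINT x|M'. g x + K)" using K by (intro Bochner_Integration.integral_nonneg) (smt (verit))
    then show ?thesis using int[OF M'] by (simp add: mult.commute)
  qed
  have "emeasure M1 B + emeasure M2 B = emeasure M3 B + emeasure M4 B" if "B \<in> sets M" for B
    using eq[OF that] fin by (simp add: finite_measure.emeasure_eq_measure flip: ennreal_plus)
  from nn_integral_add_measure_eq[OF assms(1-4) this, of "\<lambda>x. ennreal (g x + K)"]
  have "(LINT x|M1. g x) + K * measure M1 (space M1) + ((LINT x|M2. g x) + K * measure M2 (space M2))
      = (LINT x|M3. g x) + K * measure M3 (space M3) + ((LINT x|M4. g x) + K * measure M4 (space M4))"
    using nonneg[of M1] nonneg[of M2] nonneg[of M3] nonneg[of M4]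
    by (simp add: h flip: ennreal_plus)
  moreover have "K * measure M1 (space M1) + K * measure M2 (space M2) = K * measure M3 (space M3) + K * measure M4 (space M4)"
    using eq[OF sets.top] by (simp add: sp flip: distrib_left)
  ultimately show ?thesis by linarith
qed

text \<open>Any difference P - N of finite measures may replace the Jordan decomposition: the
  positive part plus N equals the negative part plus P, and equal sums have equal integrals.\<close>

lemma signed_integral_eq:
  fixes \<sigma> :: "'a::euclidean_space set \<Rightarrow> real"
  assumes [simp]: "sets P = sets borel" "sets N = sets borel" and fin: "finite_measure P" "finite_measure N"
  assumes \<sigma>: "\<And>B. B \<in> sets borel \<Longrightarrow> \<sigma> B = measure P B - measure N B"
  assumes g: "g \<in> borel_measurable borel" "\<And>x. \<bar>g x\<bar> \<le> K"
  shows "signed_integral \<sigma> g = (LINT x|P. g x) - (LINT x|N. g x)"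
proof -
  interpret P: finite_measure P by fact
  interpret N: finite_measure N by fact
  have vm: "vec_measure \<sigma>"
    unfolding vec_measure_def
  proof (intro allI impI)
    fix A :: "nat \<Rightarrow> 'a set" assume A: "range A \<subseteq> sets borel" "disjoint_family A"
    then have "(\<lambda>i. measure P (A i) - measure N (A i)) sums (measure P (\<Union>i. A i) - measure N (\<Union>i. A i))"
      by (intro sums_diff P.finite_measure_UNION N.finite_measure_UNION) auto
    moreover have "\<sigma> (A i) = measure P (A i) - measure N (A i)" for i using A by (intro \<sigma>) auto
    moreover have "\<sigma> (\<Union>i. A i) = measure P (\<Union>i. A i) - measure N (\<Union>i. A i)" using A by (intro \<sigma>) auto
    ultimately show "(\<lambda>i. \<sigma> (A i)) sums \<sigma> (\<Union>i. A i)" by simp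
  qed
  have K: "\<bar>\<sigma> B\<bar> \<le> measure P (space P) + measure N (space N)" if "B \<in> sets borel" for B
    using \<sigma>[OF that] P.bounded_measure[of B] N.bounded_measure[of B]
      measure_nonneg[of P B] measure_nonneg[of N B] by linarith
  have K': "\<bar>- \<sigma> B\<bar> \<le> measure P (space P) + measure N (space N)" if "B \<in> sets borel" for B
    using K[OF that] by simp
  note vm' = vec_measure_uminus[OF vm]
  have "(LINT x|pos_part_measure \<sigma>. g x) + (LINT x|N. g x) =
        (\<integral>x. g x \<partial>pos_part_measure (\<lambda>B. - \<sigma> B)) + (LINT x|P. g x)"
  proof (rule integral_add_measure_eq[where M = borel and K = "\<bar>K\<bar>"])
    show "measure (pos_part_measure \<sigma>) B + measure N B = measure (pos_part_measure (\<lambda>B. - \<sigma> B)) B + measure P B"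
      if "B \<in> sets borel" for B
      using pos_part_measure_diff[OF vm K that] \<sigma>[OF that] by simp
    show "\<bar>g x\<bar> \<le> \<bar>K\<bar>" for x using g(2)[of x] by linarith
  qed (use finite_pos_part_measure[OF vm K] finite_pos_part_measure[OF vm' K'] fin g in auto)
  then show ?thesis unfolding signed_integral_def by linarith
qed

text \<open>Both Jordan parts are concentrated on \<open>C\<close> and have mass at most
  \<open>K\<close>, because \<open>K\<close> bounds \<sigma> on every Borel set; hence the factor
  2.\<close>

lemma signed_integral_bound:
  assumes \<sigma>: "vec_measure \<sigma>" and K: "\<And>B. B \<in> sets borel \<Longrightarrow> \<bar>\<sigma> B\<bar> \<le> K"
    and C: "C \<in> sets borel" "\<And>B. B \<in> sets borel \<Longrightarrow> B \<inter> C = {} \<Longrightarrow> \<sigma> B = 0"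
    and g_meas[measurable]: "g \<in> borel_measurable borel"
    and g: "\<And>x. x \<in> C \<Longrightarrow> \<bar>g x\<bar> \<le> G" and G: "0 \<le> G"
  shows "\<bar>signed_integral \<sigma> g\<bar> \<le> 2 * K * G"
proof -
  have K0: "0 \<le> K" using K[of "{}"] by auto
  have *: "\<bar>\<integral>x. g x \<partial>pos_part_measure \<tau>\<bar> \<le> K * G"
    if \<tau>: "vec_measure \<tau>" and K: "\<And>B. B \<in> sets borel \<Longrightarrow> \<bar>\<tau> B\<bar> \<le> K"
      and C0: "\<And>B. B \<in> sets borel \<Longrightarrow> B \<inter> C = {} \<Longrightarrow> \<tau> B = 0" for \<tau>
  proof -
    interpret finite_measure "pos_part_measure \<tau>" by (rule finite_pos_part_measure[OF \<tau> K])
    have "upper_var \<tau> (- C) \<le> 0"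
      unfolding upper_var_def by (intro SUP_least) (auto simp: C0 disjoint_iff subset_eq)
    then have "emeasure (pos_part_measure \<tau>) (- C) = 0"
      using emeasure_pos_part_measure[OF \<tau>, of "- C"] C(1) by simp
    then have AE: "AE x in pos_part_measure \<tau>. x \<in> C"
      using C(1) by (intro AE_I[of _ _ "- C"]) auto
    have mK: "measure (pos_part_measure \<tau>) UNIV \<le> K"
      using emeasure_pos_part_measure_le[OF \<tau> K, of UNIV] K0 by (simp add: emeasure_eq_measure)
    have AEG: "AE x in pos_part_measure \<tau>. \<bar>g x\<bar> \<le> G" using AE by eventually_elim (rule g)
    have "integrable (pos_part_measure \<tau>) g"
      using AEG by (intro integrable_const_bound[of _ G]) auto
    then have "norm (LINT x|pos_part_measure \<tau>. g x) \<le> (LINT x|pos_part_measure \<tau>. G)"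
      using AEG by (intro order_trans[OF integral_norm_bound] integral_mono_AE) auto
    also have "\<dots> \<le> K * G" using mK G by (simp add: mult_right_mono)
    finally show ?thesis by simp
  qed
  have "\<bar>\<integral>x. g x \<partial>pos_part_measure \<sigma>\<bar> \<le> K * G" by (rule *[OF \<sigma> K C(2)])
  moreover have "\<bar>\<integral>x. g x \<partial>pos_part_measure (\<lambda>B. - \<sigma> B)\<bar> \<le> K * G"
    by (rule *[OF vec_measure_uminus[OF \<sigma>]]) (use K C(2) in auto)
  ultimately show ?thesis unfolding signed_integral_def by linarith
qed

lemma integral_sum_indicator_simple:
  fixes f :: "'a \<Rightarrow> real"
  assumes M: "finite_measure M" and f: "simple_function M f"
  shows "(LINT x|M. f x) = (\<Sum>y\<in>f ` space M. y * measure M (f -` {y} \<inter> space M))"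
proof -
  interpret finite_measure M by fact
  have "(LINT x|M. f x) = (LINT x|M. (\<Sum>y\<in>f ` space M. y * indicator (f -` {y} \<inter> space M) x))"
  proof (intro Bochner_Integration.integral_cong refl)
    fix x assume x: "x \<in> space M"
    have "(\<Sum>y\<in>f ` space M. y * indicator (f -` {y} \<inter> space M) x) = (\<Sum>y\<in>f ` space M. if y = f x then y else 0)"
      using x by (intro sum.cong) (auto simp: indicator_def)
    then show "f x = (\<Sum>y\<in>f ` space M. y * indicator (f -` {y} \<inter> space M) x)"
      using x simple_functionD(1)[OF f] by simp
  qed
  also have "\<dots> = (\<Sum>y\<in>f ` space M. LINT x|M. y * indicator (f -` {y} \<inter> space M) x)"
    using simple_functionD(2)[OF f] by (intro Bochner_Integration.integral_sum integrable_mult_right integrable_real_indicator) (auto simp: emeasure_eq_measure)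
  finally show ?thesis by simp
qed

text \<open>The Jordan parts are uncountable suprema, so their dependence on \<open>s\<close> is not
  visibly measurable. For a simple function the two parts recombine to finitely many values of
  \<open>\<sigma> s\<close>; a bounded function is a dominated limit of these.\<close>

lemma borel_measurable_signed_integral:
  fixes \<sigma> :: "'s \<Rightarrow> 'a::euclidean_space set \<Rightarrow> real"
  assumes \<sigma>: "\<And>s. s \<in> space M \<Longrightarrow> vec_measure (\<sigma> s)"
    and K: "\<And>s B. s \<in> space M \<Longrightarrow> B \<in> sets borel \<Longrightarrow> \<bar>\<sigma> s B\<bar> \<le> K s"
    and meas: "\<And>B. B \<in> sets borel \<Longrightarrow> (\<lambda>s. \<sigma> s B) \<in> borel_measurable M"
    and g[measurable]: "g \<in> borel_measurable borel" and G: "\<And>x. \<bar>g x\<bar> \<le> G"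
  shows "(\<lambda>s. signed_integral (\<sigma> s) g) \<in> borel_measurable M"
proof -
  obtain F where F: "\<And>i. simple_function borel (F i)" "\<And>x. (\<lambda>i. F i x) \<longlonglongrightarrow> g x"
    "\<And>i x. \<bar>F i x\<bar> \<le> 2 * \<bar>g x\<bar>"
    using borel_measurable_implies_sequence_metric[OF g, of 0] by (auto simp: dist_real_def)
  have [measurable]: "F i \<in> borel_measurable borel" for i
    using borel_measurable_simple_function[OF F(1)] .
  have FG: "\<bar>F i x\<bar> \<le> 2 * G" for i x using F(3)[of i x] G[of x] by linarith
  have lim: "(\<lambda>i. signed_integral (\<sigma> s) (F i)) \<longlonglongrightarrow> signed_integral (\<sigma> s) g" if s: "s \<in> space M" for s
  proof -
    have *: "(\<lambda>i. LINT x|N. F i x) \<longlonglongrightarrow> (LINT x|N. g x)" if "finite_measure N" "sets N = sets borel" for N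
    proof -
      interpret finite_measure N by fact
      note [measurable_cong] = that(2)
      show ?thesis
        by (rule integral_dominated_convergence[where w = "\<lambda>_. 2 * G"]) (auto simp: F(2) FG)
    qed
    have K': "\<bar>- \<sigma> s B\<bar> \<le> K s" if "B \<in> sets borel" for B using K[OF s that] by simp
    show ?thesis unfolding signed_integral_def
      by (intro tendsto_diff * finite_pos_part_measure[OF \<sigma>[OF s] K[OF s]]
          finite_pos_part_measure[OF vec_measure_uminus[OF \<sigma>[OF s]] K']) auto
  qed
  have eq: "signed_integral (\<sigma> s) (F i) = (\<Sum>y\<in>range (F i). y * \<sigma> s (F i -` {y}))" if s: "s \<in> space M" for s i
  proof -
    have K': "\<bar>- \<sigma> s B\<bar> \<le> K s" if "B \<in> sets borel" for B using K[OF s that] by simp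
    have simp: "simple_function N (F i)" if "sets N = sets borel" for N
      using F(1)[of i] that by (simp add: simple_function_def sets_eq_imp_space_eq[OF that])
    have b: "F i -` {y} \<in> sets borel" for y
      using measurable_sets[of "F i" borel borel "{y}"] by simp
    have "signed_integral (\<sigma> s) (F i) = (\<Sum>y\<in>range (F i). y * measure (pos_part_measure (\<sigma> s)) (F i -` {y}))
      - (\<Sum>y\<in>range (F i). y * measure (pos_part_measure (\<lambda>B. - \<sigma> s B)) (F i -` {y}))"
      unfolding signed_integral_def
      by (simp add: integral_sum_indicator_simple[OF finite_pos_part_measure[OF \<sigma>[OF s] K[OF s]] simp]
           integral_sum_indicator_simple[OF finite_pos_part_measure[OF vec_measure_uminus[OF \<sigma>[OF s]] K'] simp])
    also have "\<dots> = (\<Sum>y\<in>range (F i). y * (measure (pos_part_measure (\<sigma> s)) (F i -` {y})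
      - measure (pos_part_measure (\<lambda>B. - \<sigma> s B)) (F i -` {y})))"
      by (simp add: sum_subtractf right_diff_distrib)
    finally show ?thesis by (simp add: pos_part_measure_diff[OF \<sigma>[OF s] K[OF s] b])
  qed
  show ?thesis
  proof (rule borel_measurable_LIMSEQ_real[OF lim])
    fix i
    have "(\<lambda>s. \<Sum>y\<in>range (F i). y * \<sigma> s (F i -` {y})) \<in> borel_measurable M"
    proof (intro borel_measurable_sum borel_measurable_times borel_measurable_const meas)
      show "F i -` {y} \<in> sets borel" for y using measurable_sets[of "F i" borel borel "{y}"] by simp
    qed
    then show "(\<lambda>s. signed_integral (\<sigma> s) (F i)) \<in> borel_measurable M"
      using measurable_cong[of M "\<lambda>s. signed_integral (\<sigma> s) (F i)"] eq by simp
  qed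
qed

section \<open>Total variation and measures with a density\<close>

lemma norm_le_total_var: "B \<in> sets borel \<Longrightarrow> B \<subseteq> C \<Longrightarrow> ennreal (norm (\<nu> B)) \<le> total_var \<nu> C"
  unfolding total_var_def by (rule SUP_upper2[of "{B}"]) (auto simp: disjoint_def)

lemma total_var_mono: "B \<subseteq> C \<Longrightarrow> total_var \<nu> B \<le> total_var \<nu> C"
  unfolding total_var_def by (intro SUP_subset_mono) auto

lemma total_var_cong:
  assumes "\<And>B. B \<in> sets borel \<Longrightarrow> B \<subseteq> C \<Longrightarrow> norm (\<nu> B) = norm (\<nu>' B)"
  shows "total_var \<nu> C = total_var \<nu>' C"
  unfolding total_var_def using assms by (intro SUP_cong refl sum.cong) (auto simp: subset_iff)

lemma total_var_eq_0:
  assumes "\<And>B. B \<in> sets borel \<Longrightarrow> B \<subseteq> C \<Longrightarrow> \<nu> B = 0" shows "total_var \<nu> C = 0"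
proof -
  have "total_var \<nu> C \<le> 0"
    unfolding total_var_def
  proof (rule SUP_least)
    fix P assume "P \<in> {P. finite P \<and> disjoint P \<and> P \<subseteq> sets borel \<and> \<Union>P \<subseteq> C}"
    then have "\<nu> A = 0" if "A \<in> P" for A using that assms by auto
    then show "(\<Sum>A\<in>P. ennreal (norm (\<nu> A))) \<le> 0" by simp
  qed
  then show ?thesis by simp
qed

lemma total_var_scaleR: "total_var (\<lambda>B. r *\<^sub>R \<nu> B) C = ennreal \<bar>r\<bar> * total_var \<nu> C"
  unfolding total_var_def
  by (subst SUP_mult_left_ennreal) (simp add: ennreal_mult' sum_distrib_left del: sum_ennreal)

lemma total_var_le_measure:
  assumes M: "sets M = sets borel" and le: "\<And>B. B \<in> sets borel \<Longrightarrow> ennreal (norm (\<nu> B)) \<le> emeasure M B"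
    and C: "C \<in> sets borel"
  shows "total_var \<nu> C \<le> emeasure M C"
  unfolding total_var_def
proof (rule SUP_least)
  fix P assume P: "P \<in> {P. finite P \<and> disjoint P \<and> P \<subseteq> sets borel \<and> \<Union>P \<subseteq> C}"
  have "(\<Sum>A\<in>P. ennreal (norm (\<nu> A))) \<le> (\<Sum>A\<in>P. emeasure M A)" using P le by (intro sum_mono) auto
  also have "\<dots> = emeasure M (\<Union>P)"
    using P M by (intro sum_emeasure[of "\<lambda>x. x", simplified]) (auto simp: disjoint_def disjoint_family_on_def)
  also have "\<dots> \<le> emeasure M C" using P C M by (intro emeasure_mono) auto
  finally show "(\<Sum>A\<in>P. ennreal (norm (\<nu> A))) \<le> emeasure M C" .
qed

lemma vec_measure_set_integral:
  fixes w :: "'a::euclidean_space \<Rightarrow> 'b::euclidean_space"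
  assumes [measurable_cong]: "sets M = sets borel" and w: "integrable M w"
  shows "vec_measure (\<lambda>B. LINT x:B|M. w x)"
  unfolding vec_measure_def
proof (intro allI impI)
  fix A :: "nat \<Rightarrow> 'a set" assume A: "range A \<subseteq> sets borel" "disjoint_family A"
  have int: "set_integrable M B w" if "B \<in> sets borel" for B
    using that unfolding set_integrable_def by (intro integrable_mult_indicator w) (auto simp: assms(1))
  have "(\<lambda>n. LINT x:(\<Union>i<n. A i)|M. w x) \<longlonglongrightarrow> (LINT x:(\<Union>n. \<Union>i<n. A i)|M. w x)"
    using A assms(1) by (intro set_integral_cont_up int) (auto simp: incseq_def intro: less_le_trans)
  moreover have "(LINT x:(\<Union>i<n. A i)|M. w x) = (\<Sum>i<n. LINT x:A i|M. w x)" for n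
    using A assms(1) by (intro set_integral_finite_Union int) (auto simp: disjoint_family_on_def)
  moreover have "(\<Union>n. \<Union>i<n. A i) = (\<Union>i. A i)" by auto
  ultimately show "(\<lambda>i. LINT x:A i|M. w x) sums (LINT x:(\<Union>i. A i)|M. w x)"
    unfolding sums_def by simp
qed

text \<open>In each coordinate the positive and the negative part of the density define two finite
  measures whose difference is the coordinate of \<nu>, so \<open>signed_integral_eq\<close>
  applies.\<close>

lemma vec_integral_set_integral:
  fixes w :: "'a::euclidean_space \<Rightarrow> 'a"
  assumes M: "sets M = sets borel" and w: "integrable M w"
    and \<nu>: "\<And>B. B \<in> sets borel \<Longrightarrow> \<nu> B = (LINT x:B|M. w x)"
    and \<xi>[measurable]: "\<xi> \<in> borel_measurable borel" and K: "\<And>x. norm (\<xi> x) \<le> K"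
  shows "vec_integral \<nu> \<xi> = (LINT x|M. \<xi> x \<bullet> w x)"
proof -
  note [measurable_cong] = M
  have [measurable]: "w \<in> borel_measurable M" using w by auto
  have \<xi>b: "\<bar>\<xi> x \<bullet> b\<bar> \<le> K" if "b \<in> Basis" for b x
    using Basis_le_norm[OF that, of "\<xi> x"] K[of x] by linarith
  have intb: "integrable M (\<lambda>x. (\<xi> x \<bullet> b) * (w x \<bullet> b))" if "b \<in> Basis" for b
  proof (rule Bochner_Integration.integrable_bound[of _ "\<lambda>x. K * norm (w x)"])
    have "\<bar>\<xi> x \<bullet> b\<bar> * \<bar>w x \<bullet> b\<bar> \<le> K * norm (w x)" for x
      using \<xi>b[OF that, of x] Basis_le_norm[OF that, of "w x"] by (intro mult_mono) auto
    then show "AE x in M. norm ((\<xi> x \<bullet> b) * (w x \<bullet> b)) \<le> norm (K * norm (w x))"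
      by (intro AE_I2) (metis abs_ge_self abs_mult order_trans real_norm_def)
  qed (use w in auto)
  have "signed_integral (\<lambda>B. \<nu> B \<bullet> b) (\<lambda>x. \<xi> x \<bullet> b) = (LINT x|M. (\<xi> x \<bullet> b) * (w x \<bullet> b))"
    if b: "b \<in> Basis" for b
  proof -
    define p where "p x = max 0 (w x \<bullet> b)" for x
    define n where "n x = max 0 (- (w x \<bullet> b))" for x
    have [measurable]: "p \<in> borel_measurable M" "n \<in> borel_measurable M" unfolding p_def n_def by measurable
    have wb: "integrable M (\<lambda>x. w x \<bullet> b)" using w by simp
    have pn: "integrable M p" "integrable M n" unfolding p_def n_def using wb by auto
    have pn0: "0 \<le> p x" "0 \<le> n x" for x by (auto simp: p_def n_def)
    define P where "P = density M (\<lambda>x. ennreal (p x))"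
    define N where "N = density M (\<lambda>x. ennreal (n x))"
    have fin: "finite_measure P" "finite_measure N"
      using integrableD(2)[OF pn(1)] integrableD(2)[OF pn(2)] pn0 unfolding P_def N_def
      by (auto intro!: finite_measureI simp: emeasure_density less_top[symmetric])
    have meas: "measure (density M (\<lambda>x. ennreal (q x))) B = (LINT x|M. q x * indicator B x)"
      if "integrable M q" "\<And>x. 0 \<le> q x" "B \<in> sets borel" for q B
    proof -
      have [measurable]: "q \<in> borel_measurable M" "B \<in> sets M" using that M by auto
      have "integrable M (\<lambda>x. q x * indicator B x)"
        using that(1,3) M by (intro integrable_real_mult_indicator) auto
      then show ?thesis using that(2)
        unfolding measure_def by (subst emeasure_density) (auto simp: integral_eq_nn_integral ennreal_mult ennreal_indicator)
    qed
    have "signed_integral (\<lambda>B. \<nu> B \<bullet> b) (\<lambda>x. \<xi> x \<bullet> b) = (LINT x|P. \<xi> x \<bullet> b) - (LINT x|N. \<xi> x \<bullet> b)"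
    proof (rule signed_integral_eq[OF _ _ fin, where K = K])
      fix B :: "'a set" assume B: "B \<in> sets borel"
      have i: "integrable M (\<lambda>x. p x * indicator B x)" "integrable M (\<lambda>x. n x * indicator B x)"
        using pn B M by (auto intro!: integrable_real_mult_indicator)
      have "set_integrable M B w" unfolding set_integrable_def
        using B M by (intro integrable_mult_indicator w) auto
      then have "\<nu> B \<bullet> b = (LINT x|M. indicator B x *\<^sub>R w x \<bullet> b)"
        unfolding \<nu>[OF B] set_lebesgue_integral_def set_integrable_def
        by (simp add: integral_inner_left del: inner_scaleR_left)
      also have "\<dots> = (LINT x|M. p x * indicator B x - n x * indicator B x)"
        by (intro Bochner_Integration.integral_cong) (auto simp: p_def n_def indicator_def max_def)
      also have "\<dots> = measure P B - measure N B"
        unfolding P_def N_def using i by (simp add: meas[OF pn(1) pn0(1) B] meas[OF pn(2) pn0(2) B])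
      finally show "\<nu> B \<bullet> b = measure P B - measure N B" .
    qed (auto simp: P_def N_def M \<xi>b[OF b])
    also have "(LINT x|P. \<xi> x \<bullet> b) = (LINT x|M. p x * (\<xi> x \<bullet> b))"
      unfolding P_def using pn0 by (subst integral_density) auto
    also have "(LINT x|N. \<xi> x \<bullet> b) = (LINT x|M. n x * (\<xi> x \<bullet> b))"
      unfolding N_def using pn0 by (subst integral_density) auto
    also have "(LINT x|M. p x * (\<xi> x \<bullet> b)) - (LINT x|M. n x * (\<xi> x \<bullet> b)) = (LINT x|M. p x * (\<xi> x \<bullet> b) - n x * (\<xi> x \<bullet> b))"
    proof (rule Bochner_Integration.integral_diff[symmetric])
      show "integrable M (\<lambda>x. p x * (\<xi> x \<bullet> b))"
        by (rule Bochner_Integration.integrable_bound[OF intb[OF b]]) (auto simp: p_def abs_mult mult.commute[of "\<bar>\<xi> _ \<bullet> b\<bar>"] intro!: AE_I2 mult_right_mono)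
      show "integrable M (\<lambda>x. n x * (\<xi> x \<bullet> b))"
        by (rule Bochner_Integration.integrable_bound[OF intb[OF b]]) (auto simp: n_def abs_mult mult.commute[of "\<bar>\<xi> _ \<bullet> b\<bar>"] intro!: AE_I2 mult_right_mono)
    qed
    also have "\<dots> = (LINT x|M. (\<xi> x \<bullet> b) * (w x \<bullet> b))"
      by (intro Bochner_Integration.integral_cong refl) (auto simp: p_def n_def max_def)
    finally show ?thesis .
  qed
  then have "vec_integral \<nu> \<xi> = (\<Sum>b\<in>Basis. LINT x|M. (\<xi> x \<bullet> b) * (w x \<bullet> b))"
    unfolding vec_integral_def by simp
  also have "\<dots> = (LINT x|M. (\<Sum>b\<in>Basis. (\<xi> x \<bullet> b) * (w x \<bullet> b)))"
    by (intro Bochner_Integration.integral_sum[symmetric] intb)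
  also have "\<dots> = (LINT x|M. \<xi> x \<bullet> w x)" by (simp add: euclidean_inner[symmetric])
  finally show ?thesis .
qed

section \<open>Flux measures on the closed domain\<close>

lemma MvecD:
  assumes "\<nu> \<in> Mvec \<Omega>"
  shows "vec_measure \<nu>" "total_var \<nu> UNIV < \<infinity>" "total_var \<nu> (- closure \<Omega>) = 0"
    "B \<in> sets borel \<Longrightarrow> norm (\<nu> B) \<le> enn2real (total_var \<nu> UNIV)"
    "B \<in> sets borel \<Longrightarrow> B \<inter> closure \<Omega> = {} \<Longrightarrow> \<nu> B = 0"
proof -
  show *: "vec_measure \<nu>" "total_var \<nu> UNIV < \<infinity>" "total_var \<nu> (- closure \<Omega>) = 0"
    using assms by (auto simp: Mvec_def)
  show "norm (\<nu> B) \<le> enn2real (total_var \<nu> UNIV)" if "B \<in> sets borel"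
    using norm_le_total_var[OF that, of UNIV \<nu>] *(2) by (simp add: ennreal_le_iff2 flip: ennreal_enn2real_if)
       (metis enn2real_le enn2real_mono ennreal_enn2real_if norm_ge_zero enn2real_ennreal)
  show "\<nu> B = 0" if "B \<in> sets borel" "B \<inter> closure \<Omega> = {}"
    using norm_le_total_var[of B "- closure \<Omega>" \<nu>] that *(3) by (auto simp: disjoint_eq_subset_Compl)
qed

lemma vec_integral_bound:
  fixes \<nu> :: "'a::euclidean_space set \<Rightarrow> 'a"
  assumes \<nu>: "vec_measure \<nu>" and K: "\<And>B. B \<in> sets borel \<Longrightarrow> norm (\<nu> B) \<le> K"
    and C: "C \<in> sets borel" "\<And>B. B \<in> sets borel \<Longrightarrow> B \<inter> C = {} \<Longrightarrow> \<nu> B = 0"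
    and \<xi>_meas[measurable]: "\<xi> \<in> borel_measurable borel"
    and \<xi>: "\<And>x. x \<in> C \<Longrightarrow> norm (\<xi> x) \<le> G" and G: "0 \<le> G"
  shows "\<bar>vec_integral \<nu> \<xi>\<bar> \<le> real DIM('a) * (2 * K * G)"
proof -
  have "\<bar>vec_integral \<nu> \<xi>\<bar> \<le> (\<Sum>b\<in>(Basis::'a set). 2 * K * G)"
    unfolding vec_integral_def
  proof (rule order_trans[OF sum_abs sum_mono])
    fix b :: 'a assume b: "b \<in> Basis"
    show "\<bar>signed_integral (\<lambda>B. \<nu> B \<bullet> b) (\<lambda>x. \<xi> x \<bullet> b)\<bar> \<le> 2 * K * G"
      by (rule signed_integral_bound[OF vec_measure_inner[OF \<nu>] _ C(1) _ _ _ G])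
        (use b K C(2) \<xi> in \<open>auto intro: order_trans[OF Basis_le_norm]\<close>)
  qed
  then show ?thesis by simp
qed

lemma borel_measurable_vec_integral:
  fixes \<nu> :: "'s \<Rightarrow> 'a::euclidean_space set \<Rightarrow> 'a"
  assumes \<nu>: "\<And>s. s \<in> space M \<Longrightarrow> \<nu> s \<in> Mvec \<Omega>"
    and meas: "\<And>B. B \<in> sets borel \<Longrightarrow> (\<lambda>s. \<nu> s B) \<in> borel_measurable M"
    and \<xi>[measurable]: "\<xi> \<in> borel_measurable borel" and K: "\<And>x. norm (\<xi> x) \<le> K"
  shows "(\<lambda>s. vec_integral (\<nu> s) \<xi>) \<in> borel_measurable M"
  unfolding vec_integral_def
proof (rule borel_measurable_sum)
  fix b :: 'a assume b: "b \<in> Basis"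
  show "(\<lambda>s. signed_integral (\<lambda>B. \<nu> s B \<bullet> b) (\<lambda>x. \<xi> x \<bullet> b)) \<in> borel_measurable M"
  proof (rule borel_measurable_signed_integral[where G = K and K = "\<lambda>s. enn2real (total_var (\<nu> s) UNIV)"])
    show "\<bar>\<nu> s B \<bullet> b\<bar> \<le> enn2real (total_var (\<nu> s) UNIV)" if "s \<in> space M" "B \<in> sets borel" for s B
      using MvecD(4)[OF \<nu>[OF that(1)] that(2)] Basis_le_norm[OF b, of "\<nu> s B"] by linarith
    show "\<bar>\<xi> x \<bullet> b\<bar> \<le> K" for x using Basis_le_norm[OF b, of "\<xi> x"] K[of x] by linarith
  qed (use \<nu> meas in \<open>auto intro!: vec_measure_inner MvecD(1)\<close>)
qed

text \<open>Uniqueness of the vector integral makes it linear in the measure.\<close>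

lemma vec_integral_scaleR:
  assumes \<nu>: "\<nu> \<in> Mvec \<Omega>" and \<xi>[measurable]: "\<xi> \<in> borel_measurable borel" and K: "\<And>x. norm (\<xi> x) \<le> K"
  shows "vec_integral (\<lambda>B. r *\<^sub>R \<nu> B) \<xi> = r * vec_integral \<nu> \<xi>"
proof -
  have "signed_integral (\<lambda>B. r *\<^sub>R \<nu> B \<bullet> b) (\<lambda>x. \<xi> x \<bullet> b) = r * signed_integral (\<lambda>B. \<nu> B \<bullet> b) (\<lambda>x. \<xi> x \<bullet> b)"
    if b: "b \<in> Basis" for b
  proof -
    have \<sigma>: "vec_measure (\<lambda>B. \<nu> B \<bullet> b)" using vec_measure_inner MvecD(1)[OF \<nu>] .
    have bd: "\<bar>\<nu> B \<bullet> b\<bar> \<le> enn2real (total_var \<nu> UNIV)" if "B \<in> sets borel" for B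
      using MvecD(4)[OF \<nu> that] Basis_le_norm[OF b, of "\<nu> B"] by linarith
    have bd': "\<bar>- (\<nu> B \<bullet> b)\<bar> \<le> enn2real (total_var \<nu> UNIV)" if "B \<in> sets borel" for B
      using bd[OF that] by simp
    let ?P = "pos_part_measure (\<lambda>B. \<nu> B \<bullet> b)" and ?N = "pos_part_measure (\<lambda>B. - (\<nu> B \<bullet> b))"
    have fin: "finite_measure ?P" "finite_measure ?N"
      using finite_pos_part_measure[OF \<sigma> bd] finite_pos_part_measure[OF vec_measure_uminus[OF \<sigma>] bd'] by auto
    have d: "finite_measure (density M (\<lambda>_. ennreal c))" "measure (density M (\<lambda>_. ennreal c)) B = c * measure M B"
      if "finite_measure M" "0 \<le> c" "sets M = sets borel" "B \<in> sets borel" for c B and M :: "'a measure"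
      using that finite_measure.emeasure_finite[OF that(1), of UNIV] sets_eq_imp_space_eq[OF that(3)]
      by (auto intro!: finite_measureI simp: emeasure_density nn_integral_cmult_indicator measure_def
            enn2real_mult ennreal_mult_eq_top_iff nn_integral_const)
    have \<xi>b: "\<bar>\<xi> x \<bullet> b\<bar> \<le> K" for x
      using Basis_le_norm[OF b, of "\<xi> x"] K[of x] by linarith
    have \<sigma>eq: "\<nu> B \<bullet> b = measure ?P B - measure ?N B" if "B \<in> sets borel" for B
      using pos_part_measure_diff[OF \<sigma> bd that] by simp
    show ?thesis
    proof (cases "0 \<le> r")
      case True
      have "signed_integral (\<lambda>B. r *\<^sub>R \<nu> B \<bullet> b) (\<lambda>x. \<xi> x \<bullet> b) =
        (LINT x|density ?P (\<lambda>_. ennreal r). \<xi> x \<bullet> b) - (LINT x|density ?N (\<lambda>_. ennreal r). \<xi> x \<bullet> b)"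
        using True fin by (intro signed_integral_eq[where K = K])
          (auto simp: d(2) \<sigma>eq \<xi>b right_diff_distrib intro!: d(1)[where B = "{}"])
      then show ?thesis using True by (simp add: signed_integral_def integral_density right_diff_distrib)
    next
      \<comment> \<open>A negative factor exchanges the roles of the two Jordan parts.\<close>
      case False
      have "signed_integral (\<lambda>B. r *\<^sub>R \<nu> B \<bullet> b) (\<lambda>x. \<xi> x \<bullet> b) =
        (\<integral>x. \<xi> x \<bullet> b \<partial>density ?N (\<lambda>_. ennreal (-r))) - (\<integral>x. \<xi> x \<bullet> b \<partial>density ?P (\<lambda>_. ennreal (-r)))"
        using False fin by (intro signed_integral_eq[where K = K])
          (auto simp: d(2) \<sigma>eq \<xi>b right_diff_distrib intro!: d(1)[where B = "{}"])
      then show ?thesis using False by (simp add: signed_integral_def integral_density right_diff_distrib)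
    qed
  qed
  then show ?thesis unfolding vec_integral_def by (simp add: sum_distrib_left del: inner_scaleR_left)
qed

section \<open>Mobilities\<close>

lemma mobility_nonneg: "mobility m \<Longrightarrow> 0 \<le> r \<Longrightarrow> 0 \<le> m r"
  and mobility_pos: "mobility m \<Longrightarrow> 0 < r \<Longrightarrow> 0 < m r"
  by (auto simp: mobility_def)

lemma mobility_concave:
  assumes "mobility m" "0 \<le> x" "0 \<le> y" "0 \<le> t" "t \<le> 1"
  shows "(1 - t) * m x + t * m y \<le> m ((1 - t) * x + t * y)"
  using assms concave_onD[of "{0..}" m t x y] by (auto simp: mobility_def)

text \<open>Concavity between 0 and \<open>r\<close>, where \<open>m 0\<close> is
  nonnegative.\<close>

lemma mobility_scale:
  assumes "mobility m" "0 \<le> r" "0 \<le> t" "t \<le> 1"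
  shows "t * m r \<le> m (t * r)"
  using mobility_concave[OF assms(1), of 0 r t] mobility_nonneg[OF assms(1), of 0] assms
  by (simp add: mult_nonneg_nonneg) (smt (verit) mult_nonneg_nonneg)

text \<open>A concave function that decreases somewhere becomes negative far out, which positivity
  excludes.\<close>

lemma mobility_mono:
  assumes m: "mobility m" and xy: "0 \<le> x" "x \<le> y" shows "m x \<le> m y"
proof (rule ccontr)
  assume "\<not> m x \<le> m y"
  then have lt: "m y < m x" and "x \<noteq> y" by auto
  with xy have "x < y" by simp
  \<comment> \<open>With this weight \<open>t * m x\<close> is half of the drop
    \<open>m x - m y\<close>. As \<open>y\<close> lies between \<open>x\<close> and \<open>z\<close>
    with weight \<open>t\<close>, concavity puts \<open>m y\<close> above the mean of
    \<open>m x\<close> and \<open>m y\<close>.\<close>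
  define t where "t = (m x - m y) / (2 * m x)"
  have mx: "0 < m x" using lt mobility_nonneg[OF m, of y] xy by simp
  have t: "0 < t" "t \<le> 1" using lt mx mobility_nonneg[OF m, of y] xy by (auto simp: t_def field_simps)
  define z where "z = x + (y - x) / t"
  have z: "(1 - t) * x + t * z = y" using t by (simp add: z_def field_simps)
  have "0 \<le> z" using xy t by (simp add: z_def)
  then have "(1 - t) * m x + t * m z \<le> m y"
    using mobility_concave[OF m, of x z t] xy t z by simp
  moreover have "0 \<le> t * m z" using t \<open>0 \<le> z\<close> mobility_nonneg[OF m] by simp
  moreover have "t * m x = (m x - m y) / 2" using mx by (simp add: t_def)
  ultimately have "m x - (m x - m y) / 2 \<le> m y" by (simp add: left_diff_distrib)
  then have "m x \<le> m y" by (simp add: field_simps)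
  then show False using lt by simp
qed

lemma mobility_le_linear:
  assumes m: "mobility m" and r: "0 \<le> r" shows "m r \<le> m 1 * (1 + r)"
proof (cases "r \<le> 1")
  case True
  then have "m r \<le> m 1" using mobility_mono[OF m r] by simp
  also have "\<dots> \<le> m 1 * (1 + r)" using r mobility_nonneg[OF m, of 1] by (simp add: algebra_simps)
  finally show ?thesis .
next
  case False
  then have "(1 / r) * m r \<le> m 1" using mobility_scale[OF m, of r "1 / r"] by simp
  then have "m r \<le> m 1 * r" using False by (simp add: field_simps)
  then show ?thesis using mobility_nonneg[OF m, of 1] by (simp add: algebra_simps)
qed

text \<open>This is the monotonicity of slopes from the origin; it lets the largest value of a
  density control the ratio everywhere.\<close>

lemma mobility_ratio_mono:
  assumes m: "mobility m" and r: "0 < r" "r \<le> R" shows "r / m r \<le> R / m R"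
proof -
  have "(r / R) * m R \<le> m r" using mobility_scale[OF m, of R "r / R"] r by simp
  then show ?thesis using r mobility_pos[OF m, of r] mobility_pos[OF m, of R] by (simp add: field_simps)
qed

text \<open>The quotient \<open>m r / r\<close> is nonincreasing, so its limit is its infimum, and r
  = 1 gives the upper bound. That bound allows the same constant for the singular part of the action
  as for the linear growth of \<open>m\<close>.\<close>

lemma mob_slope_bounds:
  assumes m: "mobility m" shows "0 \<le> mob_slope m" "mob_slope m \<le> m 1"
proof -
  define L where "L = Inf ((\<lambda>r. m r / r) ` {0<..})"
  have bdd: "bdd_below ((\<lambda>r. m r / r) ` {0<..})"
    using mobility_nonneg[OF m] by (intro bdd_belowI2[where m = 0]) simp
  have anti: "m R / R \<le> m r / r" if "0 < r" "r \<le> R" for r R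
    using mobility_ratio_mono[OF m that] mobility_pos[OF m, of r] mobility_pos[OF m, of R] that
    by (simp add: field_simps)
  have "((\<lambda>r. m r / r) \<longlongrightarrow> L) at_top"
  proof (rule order_tendstoI)
    fix a assume "a < L"
    moreover have "L \<le> m r / r" if "r > 0" for r
      unfolding L_def using that bdd by (intro cInf_lower) auto
    ultimately show "\<forall>\<^sub>F r in at_top. a < m r / r"
      by (intro eventually_mono[OF eventually_gt_at_top[of 0]]) (meson less_le_trans)
  next
    fix a assume "L < a"
    then obtain r where r: "r > 0" "m r / r < a"
      unfolding L_def using bdd by (auto simp: cInf_less_iff)
    then show "\<forall>\<^sub>F r in at_top. m r / r < a"
      using anti by (intro eventually_mono[OF eventually_ge_at_top[of r]]) (meson le_less_trans)
  qed
  then have "mob_slope m = L" unfolding mob_slope_def by (intro tendsto_Lim) auto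
  moreover have "0 \<le> L" unfolding L_def by (rule cINF_greatest) (use mobility_nonneg[OF m] in auto)
  moreover have "L \<le> m 1 / 1" unfolding L_def by (rule cINF_lower[OF bdd]) simp
  ultimately show "0 \<le> mob_slope m" "mob_slope m \<le> m 1" by auto
qed

lemma borel_measurable_mobility:
  assumes m: "mobility m" and f[measurable]: "f \<in> borel_measurable M" and nn: "\<And>x. 0 \<le> f x"
  shows "(\<lambda>x. m (f x)) \<in> borel_measurable M"
proof -
  have c: "continuous_on {0..} m" using m by (simp add: mobility_def)
  \<comment> \<open>The values of \<open>m\<close> on negative numbers are arbitrary; cutting off at
    0 gives a function continuous on the whole line.\<close>
  have "continuous_on UNIV (\<lambda>r. m (max 0 r))"
    by (rule continuous_on_compose2[OF c]) (auto intro!: continuous_intros)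
  then have [measurable]: "(\<lambda>r. m (max 0 r)) \<in> borel_measurable borel"
    by (rule borel_measurable_continuous_onI)
  have "(\<lambda>x. m (max 0 (f x))) \<in> borel_measurable M" by measurable
  then show ?thesis using nn by (simp add: max_absorb2)
qed

lemma borel_measurable_act_density:
  assumes m: "mobility m" and f[measurable]: "f \<in> borel_measurable M" "w \<in> borel_measurable M" and nn: "\<And>x. 0 \<le> f x"
  shows "(\<lambda>x. act_density m (f x) (w x)) \<in> borel_measurable M"
  unfolding act_density_def using nn borel_measurable_mobility[OF m f(1) nn] by simp

lemma act_density_scaleR: "act_density m r (t *\<^sub>R w) = ennreal (t\<^sup>2) * act_density m r w" if "t \<noteq> 0"
  using that by (auto simp: act_density_def power_mult_distrib ennreal_mult ennreal_times_divide ennreal_mult_top)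

lemma act_density_zero [simp]: "0 \<le> r \<Longrightarrow> act_density m r 0 = 0"
  by (simp add: act_density_def)

lemma act_density_eq: "0 \<le> r \<Longrightarrow> 0 < m r \<Longrightarrow> act_density m r w = ennreal ((norm w)\<^sup>2 / m r)"
  by (simp add: act_density_def divide_ennreal)

lemma am_gm_scaled: "0 < l \<Longrightarrow> 0 < k \<Longrightarrow> 2 * a \<le> l * (a\<^sup>2 / k) + k / l" for a k l :: real
proof -
  assume "0 < l" "0 < k"
  have "0 \<le> (l * a - k)\<^sup>2 / (l * k)" using \<open>0 < l\<close> \<open>0 < k\<close> by simp
  also have "\<dots> = l * (a\<^sup>2 / k) + k / l - 2 * a"
    using \<open>0 < l\<close> \<open>0 < k\<close> by (simp add: field_simps power2_eq_square)
  finally show ?thesis by simp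
qed

lemma act_density_am_gm:
  assumes m: "mobility m" and r: "0 \<le> r" and l: "0 < l"
  shows "ennreal (2 * norm w) \<le> ennreal l * act_density m r w + ennreal (m r / l)"
proof (cases "m r = 0")
  case True
  \<comment> \<open>Where the mobility vanishes the density is 0 for w = 0 and infinite for any
    other w.\<close>
  then show ?thesis using r l by (cases "w = 0") (auto simp: act_density_def ennreal_mult_top)
next
  case False
  then have p: "0 < m r" using mobility_nonneg[OF m r] by simp
  have "ennreal (2 * norm w) \<le> ennreal (l * ((norm w)\<^sup>2 / m r) + m r / l)"
    by (intro ennreal_leI am_gm_scaled l p)
  also have "\<dots> = ennreal l * act_density m r w + ennreal (m r / l)"
    using l p r by (simp add: act_density_eq ennreal_mult[symmetric] ennreal_plus[symmetric] del: ennreal_plus)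
  finally show ?thesis .
qed

section \<open>Lebesgue decompositions\<close>

text \<open>Exhaustion: the supremum of \<kappa> over Lebesgue null sets is attained by a countable
  union \<open>N\<close>. Off \<open>N\<close> the measure charges no null set, so Radon-Nikodym
  applies there.\<close>

lemma finite_measure_density_decomp:
  fixes \<kappa> :: "'a::euclidean_space measure"
  assumes \<kappa>: "finite_measure \<kappa>" "sets \<kappa> = sets borel"
  shows "\<exists>N h. N \<in> null_sets lborel \<and> h \<in> borel_measurable borel \<and> (\<forall>x. 0 \<le> h x) \<and> integrable lborel h \<and>
     (\<forall>B\<in>sets borel. emeasure \<kappa> (B - N) = (\<integral>\<^sup>+x\<in>B. ennreal (h x) \<partial>lborel))"
proof -
  interpret finite_measure \<kappa> by fact
  note [measurable_cong] = \<kappa>(2)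
  define A where "A = emeasure \<kappa> ` null_sets lborel"
  have "A \<noteq> {}" by (auto simp: A_def intro: null_sets.empty_sets)
  then obtain f :: "nat \<Rightarrow> ennreal" where f: "range f \<subseteq> A" "Sup A = (SUP i. f i)"
    using ennreal_Sup_countable_SUP by metis
  then have "\<forall>i. \<exists>N. N \<in> null_sets lborel \<and> f i = emeasure \<kappa> N" by (auto simp: A_def)
  then obtain Ni where Ni: "\<And>i. Ni i \<in> null_sets lborel" "\<And>i. f i = emeasure \<kappa> (Ni i)" by metis
  define N where "N = (\<Union>i. Ni i)"
  have N: "N \<in> null_sets lborel" unfolding N_def using Ni(1) by (intro null_sets_UN) auto
  then have Nb[measurable]: "N \<in> sets borel" by auto
  \<comment> \<open>Uniting \<open>N\<close> with a further null set cannot raise the attained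
    supremum.\<close>
  have max: "emeasure \<kappa> (B - N) = 0" if B: "B \<in> null_sets lborel" for B
  proof -
    have Bb: "B \<in> sets borel" using B by auto
    have "emeasure \<kappa> N + emeasure \<kappa> (B - N) = emeasure \<kappa> (N \<union> (B - N))"
      using Bb Nb \<kappa>(2) by (intro plus_emeasure) auto
    also have "\<dots> \<le> Sup A" unfolding A_def using N B by (intro Sup_upper imageI) (auto simp: Un_Diff_cancel)
    also have "\<dots> \<le> emeasure \<kappa> N"
      unfolding f(2) Ni(2) N_def using Nb \<kappa>(2) by (intro SUP_least emeasure_mono) (auto simp: N_def)
    finally show ?thesis
      using emeasure_finite[of N] by (cases "emeasure \<kappa> N"; cases "emeasure \<kappa> (B - N)") (auto simp: ennreal_plus[symmetric] simp del: ennreal_plus)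
  qed
  define \<kappa>a where "\<kappa>a = density \<kappa> (indicator (- N))"
  have \<kappa>a: "emeasure \<kappa>a B = emeasure \<kappa> (B - N)" if "B \<in> sets borel" for B
    using that \<kappa>(2) unfolding \<kappa>a_def by (subst emeasure_density) (auto simp: Diff_eq Int_commute nn_integral_cmult_indicator simp flip: indicator_inter_arith)
  have "absolutely_continuous lborel \<kappa>a"
    unfolding absolutely_continuous_def using max \<kappa>a \<kappa>(2) by (auto simp: null_sets_def \<kappa>a_def)
  moreover have "sets \<kappa>a = sets lborel" using \<kappa>(2) by (simp add: \<kappa>a_def)
  ultimately obtain g where g[measurable]: "g \<in> borel_measurable lborel" "density lborel g = \<kappa>a"
    using sigma_finite_measure.Radon_Nikodym[OF sigma_finite_lborel] by metis
  define h where "h x = enn2real (g x)" for x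
  have h[measurable]: "h \<in> borel_measurable borel" unfolding h_def using g(1) by measurable
  have gint: "(\<integral>\<^sup>+x\<in>B. g x \<partial>lborel) = emeasure \<kappa> (B - N)" if "B \<in> sets borel" for B
    using \<kappa>a[OF that] that unfolding g(2)[symmetric] by (subst (asm) emeasure_density) auto
  have "(\<integral>\<^sup>+x. g x \<partial>lborel) \<noteq> \<infinity>" using gint[of UNIV] emeasure_finite by simp
  then have fin: "AE x in lborel. g x \<noteq> \<infinity>" by (intro nn_integral_PInf_AE) auto
  then have gh: "AE x in lborel. g x = ennreal (h x)"
    by eventually_elim (auto simp: h_def less_top[symmetric])
  have hint: "(\<integral>\<^sup>+x\<in>B. ennreal (h x) \<partial>lborel) = emeasure \<kappa> (B - N)" if "B \<in> sets borel" for B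
    unfolding gint[OF that, symmetric] using gh by (intro nn_integral_cong_AE) (auto elim: eventually_mono)
  have "integrable lborel h"
    using hint[of UNIV] emeasure_finite[of "UNIV - N"]
    by (intro integrableI_nonneg) (auto simp: h_def less_top[symmetric] top_unique)
  then show ?thesis using N h hint by (intro exI[of _ N] exI[of _ h]) (auto simp: h_def)
qed

lemma lebesgue_decomp_exists:
  assumes "finite_measure \<mu>" "sets \<mu> = sets borel"
  shows "\<exists>p. lebesgue_decomp \<mu> p"
proof -
  obtain N h where N: "N \<in> null_sets lborel" and h: "h \<in> borel_measurable borel" "\<forall>x. 0 \<le> h x"
    and eq: "\<And>B. B \<in> sets borel \<Longrightarrow> emeasure \<mu> (B - N) = (\<integral>\<^sup>+x\<in>B. ennreal (h x) \<partial>lborel)"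
    using finite_measure_density_decomp[OF assms] by blast
  note [measurable_cong] = assms(2)
  have Nb[measurable]: "N \<in> sets borel" using N by auto
  have s: "emeasure (density \<mu> (indicator N)) B = emeasure \<mu> (B \<inter> N)" if "B \<in> sets borel" for B
    using that assms(2) by (subst emeasure_density) (auto simp: Int_commute nn_integral_cmult_indicator simp flip: indicator_inter_arith)
  have "emeasure \<mu> B = (\<integral>\<^sup>+x\<in>B. ennreal (h x) \<partial>lborel) + emeasure (density \<mu> (indicator N)) B" if B: "B \<in> sets borel" for B
  proof -
    have "emeasure \<mu> (B - N) + emeasure \<mu> (B \<inter> N) = emeasure \<mu> ((B - N) \<union> (B \<inter> N))"
      using B Nb assms(2) by (intro plus_emeasure) auto
    also have "(B - N) \<union> (B \<inter> N) = B" by auto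
    finally show ?thesis using eq[OF B] s[OF B] by simp
  qed
  then have "lebesgue_decomp \<mu> (h, density \<mu> (indicator N))"
    unfolding lebesgue_decomp_def prod.case using h N s[of "- N"] assms(2) Nb
    by (intro conjI bexI[of _ N]) auto
  then show ?thesis by blast
qed

text \<open>Let \<open>N\<close> be the union of the null sets that carry the two singular parts.
  Both singular parts are then \<mu> restricted to \<open>N\<close>, and both densities represent
  \<mu> off \<open>N\<close>.\<close>

lemma lebesgue_decomp_unique:
  fixes \<mu> :: "'a::euclidean_space measure"
  assumes \<mu>: "finite_measure \<mu>" and d1: "lebesgue_decomp \<mu> (\<rho>1, \<mu>1)" and d2: "lebesgue_decomp \<mu> (\<rho>2, \<mu>2)"
  shows "\<mu>1 = \<mu>2" "AE x in lborel. \<rho>1 x = \<rho>2 x"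
proof -
  obtain N1 N2 where N: "N1 \<in> null_sets lborel" "emeasure \<mu>1 (- N1) = 0" "N2 \<in> null_sets lborel" "emeasure \<mu>2 (- N2) = 0"
    using d1 d2 by (auto simp: lebesgue_decomp_def)
  define N where "N = N1 \<union> N2"
  have Nn: "N \<in> null_sets lborel" using N by (simp add: N_def null_sets.Un)
  then have Nb[measurable]: "N \<in> sets borel" by auto
  have *: "emeasure \<mu>' B = emeasure \<mu> (B \<inter> N)" "(\<integral>\<^sup>+x\<in>B. ennreal (\<rho> x) \<partial>lborel) = emeasure \<mu> (B - N)"
    if d: "lebesgue_decomp \<mu> (\<rho>, \<mu>')" and z: "emeasure \<mu>' (- N') = 0" "N' \<subseteq> N" "N' \<in> sets borel" and B[measurable]: "B \<in> sets borel" for \<rho> \<mu>' B N'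
  proof -
    have [simp]: "sets \<mu>' = sets borel" and [measurable]: "\<rho> \<in> borel_measurable borel"
      and eq: "\<And>B. B \<in> sets borel \<Longrightarrow> emeasure \<mu> B = (\<integral>\<^sup>+ x \<in> B. ennreal (\<rho> x) \<partial>lborel) + emeasure \<mu>' B"
      using d by (auto simp: lebesgue_decomp_def)
    have z': "emeasure \<mu>' (B - N) = 0"
      using z emeasure_mono[of "B - N" "- N'" \<mu>'] by auto
    have AEN: "AE x in lborel. x \<notin> N" using Nn by (rule AE_not_in)
    have "emeasure \<mu>' (B \<inter> N) + emeasure \<mu>' (B - N) = emeasure \<mu>' ((B \<inter> N) \<union> (B - N))"
      by (intro plus_emeasure) auto
    also have "(B \<inter> N) \<union> (B - N) = B" by auto
    finally have "emeasure \<mu>' B = emeasure \<mu>' (B \<inter> N)" using z' by simp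
    moreover have "(\<integral>\<^sup>+ x \<in> B \<inter> N. ennreal (\<rho> x) \<partial>lborel) = (\<integral>\<^sup>+ (x::'a). 0 \<partial>lborel)"
      by (rule nn_integral_cong_AE, use AEN in eventually_elim) (simp add: indicator_def)
    ultimately show "emeasure \<mu>' B = emeasure \<mu> (B \<inter> N)" using eq[of "B \<inter> N"] by simp
    have "(\<integral>\<^sup>+ x \<in> B. ennreal (\<rho> x) \<partial>lborel) = (\<integral>\<^sup>+ x \<in> B - N. ennreal (\<rho> x) \<partial>lborel)"
      using AEN by (intro nn_integral_cong_AE) (auto elim!: eventually_mono simp: indicator_def)
    then show "(\<integral>\<^sup>+x\<in>B. ennreal (\<rho> x) \<partial>lborel) = emeasure \<mu> (B - N)" using eq[of "B - N"] z' by simp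
  qed
  have N': "N1 \<subseteq> N" "N1 \<in> sets borel" "N2 \<subseteq> N" "N2 \<in> sets borel" using N by (auto simp: N_def)
  show "\<mu>1 = \<mu>2"
  proof (rule measure_eqI)
    show s: "sets \<mu>1 = sets \<mu>2" using d1 d2 by (simp add: lebesgue_decomp_def)
    fix B assume "B \<in> sets \<mu>1"
    then have B: "B \<in> sets borel" using d1 by (simp add: lebesgue_decomp_def)
    show "emeasure \<mu>1 B = emeasure \<mu>2 B"
      unfolding *(1)[OF d1 N(2) N'(1,2) B] *(1)[OF d2 N(4) N'(3,4) B] ..
  qed
  have [measurable]: "\<rho>1 \<in> borel_measurable borel" "\<rho>2 \<in> borel_measurable borel"
    and pos: "\<And>x. 0 \<le> \<rho>1 x" "\<And>x. 0 \<le> \<rho>2 x" using d1 d2 by (auto simp: lebesgue_decomp_def)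
  have "density lborel (\<lambda>x. ennreal (\<rho>1 x)) = density lborel (\<lambda>x. ennreal (\<rho>2 x))"
    using *(2)[OF d1 N(2) N'(1,2)] *(2)[OF d2 N(4) N'(3,4)]
    by (intro measure_eqI) (auto simp: emeasure_density)
  then have "AE x in lborel. ennreal (\<rho>1 x) = ennreal (\<rho>2 x)"
    by (intro sigma_finite_measure.density_unique[OF sigma_finite_lborel]) auto
  then show "AE x in lborel. \<rho>1 x = \<rho>2 x" using pos by simp
qed

text \<open>The Jordan parts of all coordinates are decomposed separately. The union
  \<open>N\<close> of their exceptional null sets serves for all of them, and the singular part is
  \<nu> restricted to \<open>N\<close>.\<close>

lemma vec_lebesgue_decomp_exists:
  fixes \<nu> :: "'a::euclidean_space set \<Rightarrow> 'a"
  assumes \<nu>: "\<nu> \<in> Mvec \<Omega>"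
  shows "\<exists>p. vec_lebesgue_decomp \<nu> p"
proof -
  let ?K = "enn2real (total_var \<nu> UNIV)"
  define P where "P b = pos_part_measure (\<lambda>B. \<nu> B \<bullet> b)" for b
  define Q where "Q b = pos_part_measure (\<lambda>B. - (\<nu> B \<bullet> b))" for b
  have \<sigma>: "vec_measure (\<lambda>B. \<nu> B \<bullet> b)" for b using vec_measure_inner MvecD(1)[OF \<nu>] .
  have bd: "\<bar>\<nu> B \<bullet> b\<bar> \<le> ?K" if "b \<in> Basis" "B \<in> sets borel" for b B
    using MvecD(4)[OF \<nu> that(2)] Basis_le_norm[OF that(1), of "\<nu> B"] by linarith
  have bd': "\<bar>- (\<nu> B \<bullet> b)\<bar> \<le> ?K" if "b \<in> Basis" "B \<in> sets borel" for b B
    using bd[OF that] by simp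
  have finP: "finite_measure (P b)" if "b \<in> Basis" for b
    unfolding P_def by (rule finite_pos_part_measure[OF \<sigma> bd[OF that]])
  have finQ: "finite_measure (Q b)" if "b \<in> Basis" for b
    unfolding Q_def by (rule finite_pos_part_measure[OF vec_measure_uminus[OF \<sigma>] bd'[OF that]])
  have diff: "measure (P b) B - measure (Q b) B = \<nu> B \<bullet> b" if "b \<in> Basis" "B \<in> sets borel" for b B
    unfolding P_def Q_def by (rule pos_part_measure_diff[OF \<sigma> bd[OF that(1)] that(2)])
  have "\<forall>b. \<exists>N h. b \<in> Basis \<longrightarrow> N \<in> null_sets lborel \<and> h \<in> borel_measurable borel \<and> (\<forall>x. 0 \<le> h x) \<and> integrable lborel h \<and>
     (\<forall>B\<in>sets borel. emeasure (P b) (B - N) = (\<integral>\<^sup>+x\<in>B. ennreal (h x) \<partial>lborel))"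
    using finite_measure_density_decomp[OF finP] unfolding P_def sets_pos_part_measure by blast
  then obtain NP hP where 1: "\<And>b. b \<in> Basis \<Longrightarrow> NP b \<in> null_sets lborel \<and> hP b \<in> borel_measurable borel \<and> (\<forall>x. 0 \<le> hP b x) \<and> integrable lborel (hP b) \<and>
     (\<forall>B\<in>sets borel. emeasure (P b) (B - NP b) = (\<integral>\<^sup>+x\<in>B. ennreal (hP b x) \<partial>lborel))"
    unfolding choice_iff by blast
  have "\<forall>b. \<exists>N h. b \<in> Basis \<longrightarrow> N \<in> null_sets lborel \<and> h \<in> borel_measurable borel \<and> (\<forall>x. 0 \<le> h x) \<and> integrable lborel h \<and>
     (\<forall>B\<in>sets borel. emeasure (Q b) (B - N) = (\<integral>\<^sup>+x\<in>B. ennreal (h x) \<partial>lborel))"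
    using finite_measure_density_decomp[OF finQ] unfolding Q_def sets_pos_part_measure by blast
  then obtain NQ hQ where 2: "\<And>b. b \<in> Basis \<Longrightarrow> NQ b \<in> null_sets lborel \<and> hQ b \<in> borel_measurable borel \<and> (\<forall>x. 0 \<le> hQ b x) \<and> integrable lborel (hQ b) \<and>
     (\<forall>B\<in>sets borel. emeasure (Q b) (B - NQ b) = (\<integral>\<^sup>+x\<in>B. ennreal (hQ b x) \<partial>lborel))"
    unfolding choice_iff by blast
  define N where "N = (\<Union>b\<in>Basis. NP b \<union> NQ b)"
  have N: "N \<in> null_sets lborel"
    unfolding N_def using 1 2 by (intro null_sets_UN' countable_finite null_sets.Un) auto
  then have Nb: "N \<in> sets borel" by auto
  have AEN: "AE x in lborel. x \<notin> N" using N by (rule AE_not_in)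
  have m: "measure \<kappa> (B - N) = (LINT x:B|lborel. h x)"
    if "h \<in> borel_measurable borel" "\<forall>x. 0 \<le> h x" "integrable lborel h" "N' \<subseteq> N"
     "\<forall>B\<in>sets borel. emeasure \<kappa> (B - N') = (\<integral>\<^sup>+x\<in>B. ennreal (h x) \<partial>lborel)" "B \<in> sets borel"
    for \<kappa> h N' B
  proof -
    note [measurable] = that(1,6)
    have "B - N = (B - N) - N'" using that by auto
    then have "emeasure \<kappa> (B - N) = (\<integral>\<^sup>+x\<in>(B - N). ennreal (h x) \<partial>lborel)" using that(5)[rule_format, of "B - N"] that(6) Nb by simp
    also have "\<dots> = (\<integral>\<^sup>+x. ennreal (indicator B x * h x) \<partial>lborel)"
      using AEN by (intro nn_integral_cong_AE) (auto elim!: eventually_mono simp: indicator_def)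
    also have "\<dots> = ennreal (LINT x:B|lborel. h x)"
      unfolding set_lebesgue_integral_def real_scaleR_def using that
      by (intro nn_integral_eq_integral integrable_mult_indicator[where 'b = real, unfolded real_scaleR_def]) auto
    finally show ?thesis using that(2)
      by (auto simp: measure_def set_lebesgue_integral_def intro!: Bochner_Integration.integral_nonneg)
  qed
  define w where "w x = (\<Sum>b\<in>Basis. (hP b x - hQ b x) *\<^sub>R b)" for x
  have wint: "integrable lborel w"
    unfolding w_def using 1 2 by (intro Bochner_Integration.integrable_sum integrable_scaleR_left Bochner_Integration.integrable_diff) auto
  define \<nu>s where "\<nu>s B = \<nu> (B \<inter> N)" for B
  have "vec_measure \<nu>s"
    unfolding vec_measure_def
  proof (intro allI impI)
    fix A :: "nat \<Rightarrow> 'a set" assume A: "range A \<subseteq> sets borel" "disjoint_family A"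
    then have "range (\<lambda>i. A i \<inter> N) \<subseteq> sets borel" "disjoint_family (\<lambda>i. A i \<inter> N)"
      using Nb by (auto simp: disjoint_family_on_def)
    then have "(\<lambda>i. \<nu> (A i \<inter> N)) sums \<nu> (\<Union>i. A i \<inter> N)"
      using MvecD(1)[OF \<nu>] unfolding vec_measure_def by blast
    then show "(\<lambda>i. \<nu>s (A i)) sums \<nu>s (\<Union>i. A i)" by (simp add: \<nu>s_def)
  qed
  moreover have "total_var \<nu>s (- N) = 0"
  proof (rule total_var_eq_0)
    fix B assume "B \<subseteq> - N"
    then have "B \<inter> N = {}" by auto
    then show "\<nu>s B = 0" using vec_measure_empty[OF MvecD(1)[OF \<nu>]] by (simp add: \<nu>s_def)
  qed
  moreover have "\<nu> B = (LINT x:B|lborel. w x) + \<nu>s B" if B: "B \<in> sets borel" for B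
  proof -
    have "set_integrable lborel B w" unfolding set_integrable_def
      using B by (intro integrable_mult_indicator wint) auto
    then have "(LINT x:B|lborel. w x) \<bullet> b = \<nu> (B - N) \<bullet> b" if b: "b \<in> Basis" for b
    proof -
      assume si: "set_integrable lborel B w"
      have w: "w x \<bullet> b = hP b x - hQ b x" for x
        unfolding w_def using b by (simp add: inner_sum_left inner_Basis if_distrib sum.delta' cong: if_cong)
      have s: "set_integrable lborel B (hP b)" "set_integrable lborel B (hQ b)"
        unfolding set_integrable_def using 1[OF b] 2[OF b] B by (intro integrable_mult_indicator; simp)+
      have "(LINT x:B|lborel. w x) \<bullet> b = (LINT x:B|lborel. w x \<bullet> b)"
        using si unfolding set_lebesgue_integral_def set_integrable_def
        by (subst integral_inner_left[symmetric]) auto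
      also have "\<dots> = (LINT x:B|lborel. hP b x) - (LINT x:B|lborel. hQ b x)"
        unfolding w using s by (rule set_integral_diff(2))
      also have "(LINT x:B|lborel. hP b x) = measure (P b) (B - N)"
        using 1[OF b] b B by (intro m[symmetric, where N' = "NP b"]) (auto simp: N_def)
      also have "(LINT x:B|lborel. hQ b x) = measure (Q b) (B - N)"
        using 2[OF b] b B by (intro m[symmetric, where N' = "NQ b"]) (auto simp: N_def)
      also have "measure (P b) (B - N) - measure (Q b) (B - N) = \<nu> (B - N) \<bullet> b"
        using B Nb by (intro diff b) auto
      finally show ?thesis .
    qed
    then have "(LINT x:B|lborel. w x) = \<nu> (B - N)" by (rule euclidean_eqI)
    moreover have "\<nu> ((B - N) \<union> (B \<inter> N)) = \<nu> (B - N) + \<nu> (B \<inter> N)"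
      using B Nb by (intro vec_measure_Un[OF MvecD(1)[OF \<nu>]]) auto
    moreover have "(B - N) \<union> (B \<inter> N) = B" by auto
    ultimately show ?thesis by (simp add: \<nu>s_def)
  qed
  ultimately have "vec_lebesgue_decomp \<nu> (w, \<nu>s)"
    unfolding vec_lebesgue_decomp_def using wint N by auto
  then show ?thesis by blast
qed

lemma vec_lebesgue_decomp_unique:
  fixes \<nu> :: "'a::euclidean_space set \<Rightarrow> 'a"
  assumes d1: "vec_lebesgue_decomp \<nu> (w1, \<nu>1)" and d2: "vec_lebesgue_decomp \<nu> (w2, \<nu>2)"
  shows "\<And>B. B \<in> sets borel \<Longrightarrow> \<nu>1 B = \<nu>2 B" "AE x in lborel. w1 x = w2 x"
proof -
  obtain N1 N2 where N: "N1 \<in> null_sets lborel" "total_var \<nu>1 (- N1) = 0" "N2 \<in> null_sets lborel" "total_var \<nu>2 (- N2) = 0"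
    using d1 d2 by (auto simp: vec_lebesgue_decomp_def)
  define N where "N = N1 \<union> N2"
  have Nn: "N \<in> null_sets lborel" using N by (simp add: N_def null_sets.Un)
  then have Nb[measurable]: "N \<in> sets borel" by auto
  have AEN: "AE x in lborel. x \<notin> N" using Nn by (rule AE_not_in)
  have *: "\<nu>' B = \<nu> (B \<inter> N)"
    if d: "vec_lebesgue_decomp \<nu> (w, \<nu>')" and z: "total_var \<nu>' (- N') = 0" "N' \<subseteq> N" and B[measurable]: "B \<in> sets borel" for w \<nu>' B N'
  proof -
    have vm: "vec_measure \<nu>'" and [measurable]: "w \<in> borel_measurable borel"
      and eq: "\<And>B. B \<in> sets borel \<Longrightarrow> \<nu> B = (LINT x:B|lborel. w x) + \<nu>' B"
      using d by (auto simp: vec_lebesgue_decomp_def)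
    have "\<nu>' (B - N) = 0"
      using norm_le_total_var[of "B - N" "- N'" \<nu>'] z by auto
    moreover have "\<nu>' ((B - N) \<union> (B \<inter> N)) = \<nu>' (B - N) + \<nu>' (B \<inter> N)"
      by (intro vec_measure_Un[OF vm]) auto
    moreover have "(B - N) \<union> (B \<inter> N) = B" by auto
    ultimately have "\<nu>' B = \<nu>' (B \<inter> N)" by simp
    moreover have "(LINT x:B \<inter> N|lborel. w x) = (LINT (x::'a)|lborel. 0)"
      unfolding set_lebesgue_integral_def
    proof (rule integral_cong_AE)
      show "AE x in lborel. indicator (B \<inter> N) x *\<^sub>R w x = 0"
        using AEN by eventually_elim (simp add: indicator_def)
    qed auto
    ultimately show ?thesis using eq[of "B \<inter> N"] by simp
  qed
  have N': "N1 \<subseteq> N" "N2 \<subseteq> N" by (auto simp: N_def)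
  show 1: "\<nu>1 B = \<nu>2 B" if "B \<in> sets borel" for B
    using *[OF d1 N(2) N'(1) that] *[OF d2 N(4) N'(2) that] by simp
  show "AE x in lborel. w1 x = w2 x"
  proof (rule sigma_finite_measure.density_unique_banach[OF sigma_finite_lborel])
    fix B :: "'a set" assume "B \<in> sets lborel"
    then have B: "B \<in> sets borel" by simp
    have "\<nu> B = (LINT x:B|lborel. w1 x) + \<nu>1 B" "\<nu> B = (LINT x:B|lborel. w2 x) + \<nu>2 B"
      using d1 d2 B by (auto simp: vec_lebesgue_decomp_def)
    then show "(LINT x:B|lborel. w1 x) = (LINT x:B|lborel. w2 x)" using 1[OF B] by simp
  qed (use d1 d2 in \<open>auto simp: vec_lebesgue_decomp_def\<close>)
qed

section \<open>The action functional\<close>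

lemma MplusD:
  assumes "\<mu> \<in> Mplus \<Omega>"
  shows "sets \<mu> = sets borel" "finite_measure \<mu>" "emeasure \<mu> (- closure \<Omega>) = 0" "space \<mu> = UNIV"
  using assms sets_eq_imp_space_eq[of \<mu> borel] by (auto simp: Mplus_def)

text \<open>\<open>action\<close> selects decompositions and densities by \<open>SOME\<close>; by
  uniqueness every other choice gives the same value. All computations of the action go through
  these three rules.\<close>

lemma
  assumes m: "mobility m" and \<mu>: "\<mu> \<in> Mplus \<Omega>" and \<nu>: "\<nu> \<in> Mvec \<Omega>"
    and d: "lebesgue_decomp \<mu> (\<rho>, \<mu>s)" "vec_lebesgue_decomp \<nu> (w, \<nu>s)"
  defines "ac \<equiv> (\<integral>\<^sup>+ x \<in> \<Omega>. act_density m (\<rho> x) (w x) \<partial>lborel)"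
  shows action_sublinear: "mob_slope m = 0 \<Longrightarrow> action m \<Omega> \<mu> \<nu> = (if \<forall>B\<in>sets borel. \<nu>s B = 0 then ac else \<infinity>)"
    and action_linear: "mob_slope m \<noteq> 0 \<Longrightarrow> vec_density \<mu>s \<nu>s ws \<Longrightarrow>
      action m \<Omega> \<mu> \<nu> = ac + (\<integral>\<^sup>+ x \<in> closure \<Omega>. ennreal ((norm (ws x))\<^sup>2 / mob_slope m) \<partial>\<mu>s)"
    and action_linear_top: "mob_slope m \<noteq> 0 \<Longrightarrow> \<nexists>ws. vec_density \<mu>s \<nu>s ws \<Longrightarrow> action m \<Omega> \<mu> \<nu> = \<infinity>"
proof -
  obtain \<rho>' \<mu>s' where p': "(SOME p. lebesgue_decomp \<mu> p) = (\<rho>', \<mu>s')" by (meson surj_pair)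
  have d1': "lebesgue_decomp \<mu> (\<rho>', \<mu>s')"
    using someI_ex[of "lebesgue_decomp \<mu>"] d(1) p' by auto
  obtain w' \<nu>s' where q': "(SOME p. vec_lebesgue_decomp \<nu> p) = (w', \<nu>s')" by (meson surj_pair)
  have d2': "vec_lebesgue_decomp \<nu> (w', \<nu>s')"
    using someI_ex[of "vec_lebesgue_decomp \<nu>"] d(2) q' by auto
  note u1 = lebesgue_decomp_unique[OF MplusD(2)[OF \<mu>] d1' d(1)]
  note u2 = vec_lebesgue_decomp_unique[OF d2' d(2)]
  have ac: "(\<integral>\<^sup>+ x \<in> \<Omega>. act_density m (\<rho>' x) (w' x) \<partial>lborel) = ac"
    unfolding ac_def by (rule nn_integral_cong_AE, use u1(2) u2(2) in eventually_elim) simp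
  have vd: "vec_density \<mu>s \<nu>s' = vec_density \<mu>s \<nu>s"
    unfolding vec_density_def[abs_def] u1(1) using u2(1) by (simp cong: ball_cong)
  have f: "emeasure \<mu> (- closure \<Omega>) = 0" "total_var \<nu> (- closure \<Omega>) = 0"
    using MplusD(3)[OF \<mu>] MvecD(3)[OF \<nu>] by auto
  have unf: "action m \<Omega> \<mu> \<nu> = (if mob_slope m = 0 then (if \<forall>B\<in>sets borel. \<nu>s' B = 0 then ac else \<infinity>)
      else (if \<exists>ws. vec_density \<mu>s \<nu>s ws then ac + (\<integral>\<^sup>+ x \<in> closure \<Omega>. ennreal ((norm ((SOME ws. vec_density \<mu>s \<nu>s ws) x))\<^sup>2 / mob_slope m) \<partial>\<mu>s) else \<infinity>))"
    using f by (simp only: action_def p' q' prod.case Let_def ac vd u1(1)) auto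
  show "mob_slope m = 0 \<Longrightarrow> action m \<Omega> \<mu> \<nu> = (if \<forall>B\<in>sets borel. \<nu>s B = 0 then ac else \<infinity>)"
    unfolding unf using u2(1) by (simp cong: ball_cong)
  show "mob_slope m \<noteq> 0 \<Longrightarrow> \<nexists>ws. vec_density \<mu>s \<nu>s ws \<Longrightarrow> action m \<Omega> \<mu> \<nu> = \<infinity>"
    unfolding unf by auto
  assume sl: "mob_slope m \<noteq> 0" and ws: "vec_density \<mu>s \<nu>s ws"
  define ws' where "ws' = (SOME ws. vec_density \<mu>s \<nu>s ws)"
  have ws': "vec_density \<mu>s \<nu>s ws'" unfolding ws'_def using someI[of "vec_density \<mu>s \<nu>s", OF ws] by simp
  have s[simp]: "sets \<mu>s = sets borel" using d(1) by (simp add: lebesgue_decomp_def)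
  have "emeasure \<mu>s UNIV \<le> emeasure \<mu> UNIV" using d(1) by (simp add: lebesgue_decomp_def)
  then interpret S: finite_measure \<mu>s
    using finite_measure.emeasure_finite[OF MplusD(2)[OF \<mu>], of UNIV] sets_eq_imp_space_eq[OF s]
    by (intro finite_measureI) (auto simp: top_unique)
  have "AE x in \<mu>s. ws' x = ws x"
    by (rule S.density_unique_banach) (use ws ws' in \<open>auto simp: vec_density_def\<close>)
  then have "(\<integral>\<^sup>+ x \<in> closure \<Omega>. ennreal ((norm (ws' x))\<^sup>2 / mob_slope m) \<partial>\<mu>s)
    = (\<integral>\<^sup>+ x \<in> closure \<Omega>. ennreal ((norm (ws x))\<^sup>2 / mob_slope m) \<partial>\<mu>s)"
    by (intro nn_integral_cong_AE) (auto elim!: eventually_mono)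
  then show "action m \<Omega> \<mu> \<nu> = ac + (\<integral>\<^sup>+ x \<in> closure \<Omega>. ennreal ((norm (ws x))\<^sup>2 / mob_slope m) \<partial>\<mu>s)"
    unfolding unf ws'_def using sl ws by auto
qed

lemma vec_lebesgue_decomp_scaleR:
  assumes "vec_lebesgue_decomp \<nu> (w, \<nu>s)"
  shows "vec_lebesgue_decomp (\<lambda>B. r *\<^sub>R \<nu> B) (\<lambda>x. r *\<^sub>R w x, \<lambda>B. r *\<^sub>R \<nu>s B)"
proof -
  have "(LINT x:B|lborel. r *\<^sub>R w x) = r *\<^sub>R (LINT x:B|lborel. w x)" for B
    unfolding set_lebesgue_integral_def by (simp add: scaleR_left_commute[of _ r] del: scaleR_scaleR)
  then show ?thesis
    using assms vec_measure_scaleR[of \<nu>s r] by (auto simp: vec_lebesgue_decomp_def total_var_scaleR scaleR_add_right)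
qed

lemma Mvec_scaleR: "\<nu> \<in> Mvec \<Omega> \<Longrightarrow> (\<lambda>B. r *\<^sub>R \<nu> B) \<in> Mvec \<Omega>"
  by (auto simp: Mvec_def vec_measure_scaleR total_var_scaleR ennreal_mult_less_top)

lemma Mvec_zero [simp]: "(\<lambda>B. 0) \<in> Mvec \<Omega>"
  by (auto simp: Mvec_def vec_measure_def total_var_eq_0)

lemma action_scaleR:
  assumes "\<Omega> \<in> sets borel" and m: "mobility m" and \<mu>: "\<mu> \<in> Mplus \<Omega>" and \<nu>: "\<nu> \<in> Mvec \<Omega>" and r: "r \<noteq> 0"
  shows "action m \<Omega> \<mu> (\<lambda>B. r *\<^sub>R \<nu> B) = ennreal (r\<^sup>2) * action m \<Omega> \<mu> \<nu>"
proof -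
  obtain \<rho> \<mu>s where d1: "lebesgue_decomp \<mu> (\<rho>, \<mu>s)"
    using lebesgue_decomp_exists[OF MplusD(2,1)[OF \<mu>]] by auto
  obtain w \<nu>s where d2: "vec_lebesgue_decomp \<nu> (w, \<nu>s)"
    using vec_lebesgue_decomp_exists[OF \<nu>] by auto
  note d2r = vec_lebesgue_decomp_scaleR[OF d2, of r]
  note \<nu>r = Mvec_scaleR[OF \<nu>, of r]
  have [measurable]: "\<rho> \<in> borel_measurable borel" "w \<in> borel_measurable borel" and \<rho>0: "\<And>x. 0 \<le> \<rho> x"
    using d1 d2 by (auto simp: lebesgue_decomp_def vec_lebesgue_decomp_def)
  have s[measurable_cong]: "sets \<mu>s = sets borel" using d1 by (simp add: lebesgue_decomp_def)
  have top: "ennreal (r\<^sup>2) * \<infinity> = \<infinity>" using r by (simp add: ennreal_mult_top)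
  have ac: "(\<integral>\<^sup>+ x \<in> \<Omega>. act_density m (\<rho> x) (r *\<^sub>R w x) \<partial>lborel) =
      ennreal (r\<^sup>2) * (\<integral>\<^sup>+ x \<in> \<Omega>. act_density m (\<rho> x) (w x) \<partial>lborel)"
  proof -
    have [measurable]: "(\<lambda>x. act_density m (\<rho> x) (w x)) \<in> borel_measurable borel"
      by (rule borel_measurable_act_density[OF m _ _ \<rho>0]) auto
    show ?thesis using assms(1)
      by (subst nn_integral_cmult[symmetric]) (auto simp: act_density_scaleR[OF r] ac_simps)
  qed
  show ?thesis
  proof (cases "mob_slope m = 0")
    case True
    have "(\<forall>B\<in>sets borel. r *\<^sub>R \<nu>s B = 0) \<longleftrightarrow> (\<forall>B\<in>sets borel. \<nu>s B = 0)" using r by simp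
    then show ?thesis
      unfolding action_sublinear[OF m \<mu> \<nu> d1 d2 True] action_sublinear[OF m \<mu> \<nu>r d1 d2r True]
      using ac top by auto
  next
    case False
    show ?thesis
    proof (cases "\<exists>ws. vec_density \<mu>s \<nu>s ws")
      case True
      then obtain ws where ws: "vec_density \<mu>s \<nu>s ws" ..
      then have wsr: "vec_density \<mu>s (\<lambda>B. r *\<^sub>R \<nu>s B) (\<lambda>x. r *\<^sub>R ws x)"
        unfolding vec_density_def set_lebesgue_integral_def
        by (auto simp: scaleR_left_commute[of _ r] simp del: scaleR_scaleR)
      have [measurable]: "ws \<in> borel_measurable borel"
        using borel_measurable_integrable[of \<mu>s ws] ws s by (auto simp: vec_density_def)
      have "(\<integral>\<^sup>+ x \<in> closure \<Omega>. ennreal ((norm (r *\<^sub>R ws x))\<^sup>2 / mob_slope m) \<partial>\<mu>s) =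
        (\<integral>\<^sup>+ x. ennreal (r\<^sup>2) * (ennreal ((norm (ws x))\<^sup>2 / mob_slope m) * indicator (closure \<Omega>) x) \<partial>\<mu>s)"
        using mob_slope_bounds(1)[OF m]
        by (intro nn_integral_cong) (auto simp: power_mult_distrib ennreal_mult[symmetric] indicator_def)
      also have "\<dots> = ennreal (r\<^sup>2) * (\<integral>\<^sup>+ x \<in> closure \<Omega>. ennreal ((norm (ws x))\<^sup>2 / mob_slope m) \<partial>\<mu>s)"
        by (rule nn_integral_cmult) (auto simp: s intro!: borel_measurable_times_ennreal borel_measurable_indicator)
      finally show ?thesis
        unfolding action_linear[OF m \<mu> \<nu> d1 d2 False ws] action_linear[OF m \<mu> \<nu>r d1 d2r False wsr]
        using ac by (simp add: distrib_left)
    next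
      case no: False
      \<comment> \<open>A density of the scaled singular part, divided by \<open>r\<close>, would be
        one of the original.\<close>
      have "vec_density \<mu>s \<nu>s (\<lambda>x. inverse r *\<^sub>R ws x)" if "vec_density \<mu>s (\<lambda>B. r *\<^sub>R \<nu>s B) ws" for ws
      proof -
        have "\<nu>s B = (LINT x:B|\<mu>s. inverse r *\<^sub>R ws x)" if "B \<in> sets borel" for B
        proof -
          have "r *\<^sub>R \<nu>s B = (LINT x:B|\<mu>s. ws x)"
            using that \<open>vec_density \<mu>s (\<lambda>B. r *\<^sub>R \<nu>s B) ws\<close> by (auto simp: vec_density_def)
          then have "\<nu>s B = inverse r *\<^sub>R (LINT x:B|\<mu>s. ws x)" using r by (metis scaleR_left_imp_eq scaleR_scaleR right_inverse scaleR_one)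
          then show ?thesis unfolding set_lebesgue_integral_def
            by (simp add: scaleR_left_commute[of _ "inverse r"] del: scaleR_scaleR)
        qed
        then show ?thesis using that by (auto simp: vec_density_def)
      qed
      then have "\<nexists>ws. vec_density \<mu>s (\<lambda>B. r *\<^sub>R \<nu>s B) ws" using no by blast
      then show ?thesis
        using action_linear_top[OF m \<mu> \<nu> d1 d2 False no] action_linear_top[OF m \<mu> \<nu>r d1 d2r False] top by simp
    qed
  qed
qed

text \<open>Both singular parts vanish, so the sublinear and the linear case reduce to the same
  integral.\<close>

lemma action_density:
  assumes m: "mobility m" and \<Omega>: "\<Omega> \<in> sets borel" and \<mu>: "density lborel (\<lambda>x. ennreal (\<rho> x)) \<in> Mplus \<Omega>" and \<nu>: "\<nu> \<in> Mvec \<Omega>"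
    and \<rho>: "\<rho> \<in> borel_measurable borel" "\<And>x. 0 \<le> \<rho> x" and w: "integrable lborel w"
    and \<nu>w: "\<And>B. B \<in> sets borel \<Longrightarrow> \<nu> B = (LINT x:B|lborel. w x)"
  shows "action m \<Omega> (density lborel (\<lambda>x. ennreal (\<rho> x))) \<nu> = (\<integral>\<^sup>+ x \<in> \<Omega>. act_density m (\<rho> x) (w x) \<partial>lborel)"
proof -
  have d1: "lebesgue_decomp (density lborel (\<lambda>x. ennreal (\<rho> x))) (\<rho>, null_measure borel)"
    using \<rho> by (auto simp: lebesgue_decomp_def emeasure_density intro!: bexI[of _ "{}"])
  have d2: "vec_lebesgue_decomp \<nu> (w, \<lambda>B. 0)"
    using w \<nu>w by (auto simp: vec_lebesgue_decomp_def vec_measure_def total_var_eq_0 intro!: bexI[of _ "{}"])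
  show ?thesis
  proof (cases "mob_slope m = 0")
    case True
    then show ?thesis by (subst action_sublinear[OF m \<mu> \<nu> d1 d2]) auto
  next
    case False
    have "vec_density (null_measure borel) (\<lambda>B. 0) (\<lambda>x. 0::'a)" by (auto simp: vec_density_def)
    from action_linear[OF m \<mu> \<nu> d1 d2 False this] show ?thesis by simp
  qed
qed

lemma action_zero:
  assumes m: "mobility m" and \<mu>: "\<mu> \<in> Mplus \<Omega>"
  shows "action m \<Omega> \<mu> (\<lambda>B. 0) = 0"
proof -
  obtain \<rho> \<mu>s where d1: "lebesgue_decomp \<mu> (\<rho>, \<mu>s)"
    using lebesgue_decomp_exists[OF MplusD(2,1)[OF \<mu>]] by auto
  then have \<rho>: "\<And>x. 0 \<le> \<rho> x" by (simp add: lebesgue_decomp_def)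
  have d2: "vec_lebesgue_decomp (\<lambda>B. 0) (\<lambda>x. 0::'a, \<lambda>B. 0)"
    by (auto simp: vec_lebesgue_decomp_def vec_measure_def total_var_eq_0 intro!: bexI[of _ "{}"])
  show ?thesis
  proof (cases "mob_slope m = 0")
    case True
    then show ?thesis using \<rho> by (subst action_sublinear[OF m \<mu> _ d1 d2]) auto
  next
    case False
    have "vec_density \<mu>s (\<lambda>B. 0) (\<lambda>x. 0::'a)" by (auto simp: vec_density_def)
    from action_linear[OF m \<mu> _ d1 d2 False this] show ?thesis using \<rho> by simp
  qed
qed

lemma norm_set_integral_le_nn_integral:
  fixes w :: "'a \<Rightarrow> 'b::euclidean_space"
  assumes w: "integrable M w" and B: "B \<in> sets M" and C: "AE x in M. x \<notin> C \<longrightarrow> w x = 0"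
  shows "ennreal (norm (LINT x:B|M. w x)) \<le> (\<integral>\<^sup>+x\<in>C. ennreal (norm (w x)) \<partial>M)"
proof -
  have i: "integrable M (\<lambda>x. indicator B x *\<^sub>R w x)" by (rule integrable_mult_indicator[OF B w])
  have "ennreal (norm (LINT x:B|M. w x)) \<le> (\<integral>\<^sup>+x. ennreal (norm (indicator B x *\<^sub>R w x)) \<partial>M)"
    unfolding set_lebesgue_integral_def by (rule integral_norm_bound_ennreal[OF i])
  also have "\<dots> \<le> (\<integral>\<^sup>+x\<in>C. ennreal (norm (w x)) \<partial>M)"
    by (rule nn_integral_mono_AE, use C in eventually_elim) (auto simp: indicator_def)
  finally show ?thesis .
qed

text \<open>The action controls the flux through the elementary inequality
  \<open>2|w| \<le> l |w|\<^sup>2 / m(\<rho>) + m(\<rho>) / l\<close>, and \<open>m(\<rho>)\<close> is integrable because \<open>m\<close> grows at most linearly.\<close>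

lemma action_controls_flux:
  fixes \<Omega> :: "'a::euclidean_space set"
  assumes m: "mobility m" and \<Omega>: "bounded \<Omega>" "open \<Omega>" "convex \<Omega>" and \<mu>: "\<mu> \<in> Mplus_mass \<Omega> c" and c: "0 \<le> c"
    and \<nu>: "\<nu> \<in> Mvec \<Omega>" and l: "0 < l" and B: "B \<in> sets borel"
  shows "ennreal (2 * norm (\<nu> B)) \<le> ennreal l * action m \<Omega> \<mu> \<nu> + ennreal (m 1 * (measure lborel \<Omega> + c) / l)"
proof (cases "action m \<Omega> \<mu> \<nu> = \<infinity>")
  case True
  then show ?thesis using l by (simp add: ennreal_mult_top)
next
  case fin: False
  have \<mu>': "\<mu> \<in> Mplus \<Omega>" and mass: "emeasure \<mu> UNIV = ennreal c" using \<mu> by (auto simp: Mplus_mass_def)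
  obtain \<rho> \<mu>s where d1: "lebesgue_decomp \<mu> (\<rho>, \<mu>s)"
    using lebesgue_decomp_exists[OF MplusD(2,1)[OF \<mu>']] by auto
  obtain w \<nu>s where d2: "vec_lebesgue_decomp \<nu> (w, \<nu>s)"
    using vec_lebesgue_decomp_exists[OF \<nu>] by auto
  let ?A = "\<integral>\<^sup>+x\<in>\<Omega>. act_density m (\<rho> x) (w x) \<partial>lborel" and ?W = "\<integral>\<^sup>+x\<in>\<Omega>. ennreal (2 * norm (w x)) \<partial>lborel"
    and ?L = "\<integral>\<^sup>+x\<in>\<Omega>. ennreal (m (\<rho> x) / l) \<partial>lborel" and ?vol = "ennreal (measure lborel \<Omega>)" and ?k = "ennreal (m 1 / l)"
    and ?R = "\<integral>\<^sup>+x\<in>\<Omega>. ennreal (\<rho> x) \<partial>lborel"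
  have [measurable]: "\<rho> \<in> borel_measurable borel" "w \<in> borel_measurable borel" and \<rho>0: "\<And>x. 0 \<le> \<rho> x"
    and w: "integrable lborel w"
    using d1 d2 by (auto simp: lebesgue_decomp_def vec_lebesgue_decomp_def)
  have s[measurable_cong]: "sets \<mu>s = sets borel" using d1 by (simp add: lebesgue_decomp_def)
  have [measurable]: "\<Omega> \<in> sets borel" "closure \<Omega> \<in> sets borel" using \<Omega>(2) by auto
  have \<mu>eq: "emeasure \<mu> B = (\<integral>\<^sup>+ x \<in> B. ennreal (\<rho> x) \<partial>lborel) + emeasure \<mu>s B" if "B \<in> sets borel" for B
    using d1 that by (auto simp: lebesgue_decomp_def)
  have \<nu>eq: "\<nu> B = (LINT x:B|lborel. w x) + \<nu>s B" if "B \<in> sets borel" for B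
    using d2 that by (auto simp: vec_lebesgue_decomp_def)
  have act[measurable]: "(\<lambda>x. act_density m (\<rho> x) (w x)) \<in> borel_measurable borel"
    by (rule borel_measurable_act_density[OF m _ _ \<rho>0]) auto
  have mm[measurable]: "(\<lambda>x. m (\<rho> x)) \<in> borel_measurable borel"
    by (rule borel_measurable_mobility[OF m _ \<rho>0]) auto
  have vol: "emeasure lborel \<Omega> = ?vol"
    using emeasure_bounded_finite[OF \<Omega>(1)] by (simp add: emeasure_eq_ennreal_measure less_top)
  \<comment> \<open>The flux is concentrated on the closure, whereas the action integrates over the
    open set. The difference is the frontier, which is a null set because the domain is
    convex.\<close>
  have w0: "AE x in lborel. x \<notin> \<Omega> \<longrightarrow> w x = 0"
  proof -
    obtain N where N: "N \<in> null_sets lborel" "total_var \<nu>s (- N) = 0" using d2 by (auto simp: vec_lebesgue_decomp_def)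
    have Nb[measurable]: "N \<in> sets borel" using N by auto
    have AEN: "AE x in lborel. x \<notin> N" using N(1) by (rule AE_not_in)
    define g where "g x = indicator (- closure \<Omega>) x *\<^sub>R w x" for x
    have [measurable]: "g \<in> borel_measurable borel" unfolding g_def by measurable
    have gi: "integrable lborel g" unfolding g_def by (intro integrable_mult_indicator w) auto
    have "AE x in lborel. g x = 0"
    proof (rule sigma_finite_measure.density_zero[OF sigma_finite_lborel gi])
      fix A :: "'a set" assume "A \<in> sets lborel"
      then have [measurable]: "A \<in> sets borel" by simp
      define A' where "A' = (A - N) \<inter> (- closure \<Omega>)"
      have A'[measurable]: "A' \<in> sets borel" unfolding A'_def by measurable
      have "\<nu> A' = 0" using MvecD(5)[OF \<nu> A'] by (auto simp: A'_def)
      moreover have "\<nu>s A' = 0" using norm_le_total_var[OF A', of "- N" \<nu>s] N(2) by (auto simp: A'_def)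
      ultimately have "(LINT x:A'|lborel. w x) = 0" using \<nu>eq[OF A'] by simp
      moreover have "(LINT x:A|lborel. g x) = (LINT x:A'|lborel. w x)"
        unfolding set_lebesgue_integral_def
      proof (rule integral_cong_AE)
        show "AE x in lborel. indicator A x *\<^sub>R g x = indicator A' x *\<^sub>R w x"
          using AEN by eventually_elim (auto simp: A'_def g_def indicator_def)
      qed auto
      ultimately show "(LINT x:A|lborel. g x) = 0" by simp
    qed
    moreover have "AE x in lborel. x \<notin> frontier \<Omega>"
      using negligible_convex_frontier[OF \<Omega>(3)] negligible_iff_null_sets AE_not_in
      by (metis AE_completion_iff completion.AE_iff_null_sets)
    ultimately show ?thesis
      by eventually_elim (use \<Omega>(2) in \<open>auto simp: g_def indicator_def frontier_def interior_open split: if_splits\<close>)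
  qed
  have E1: "?W \<le>
     ennreal l * ?A + ?L"
  proof -
    have "?W \<le>
      (\<integral>\<^sup>+x. ennreal l * (act_density m (\<rho> x) (w x) * indicator \<Omega> x) + ennreal (m (\<rho> x) / l) * indicator \<Omega> x \<partial>lborel)"
      using act_density_am_gm[OF m \<rho>0 l] by (intro nn_integral_mono) (auto simp: indicator_def)
    also have "\<dots> = (\<integral>\<^sup>+x. ennreal l * (act_density m (\<rho> x) (w x) * indicator \<Omega> x) \<partial>lborel) + ?L"
      by (rule nn_integral_add) auto
    finally show ?thesis by (simp add: nn_integral_cmult)
  qed
  have E2: "?L \<le> ?k * (?vol + ?R)"
  proof -
    have "ennreal (m (\<rho> x) / l) \<le> ?k * (1 + ennreal (\<rho> x))" for x
    proof -
      have "m (\<rho> x) / l \<le> m 1 / l * (1 + \<rho> x)"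
        using mobility_le_linear[OF m \<rho>0[of x]] l by (simp add: divide_right_mono)
      then show ?thesis using \<rho>0[of x] l mobility_nonneg[OF m, of 1]
        ennreal_plus[of 1 "\<rho> x"] ennreal_mult[of "m 1 / l" "1 + \<rho> x"]
        by (metis add_nonneg_nonneg divide_nonneg_pos ennreal_1 ennreal_leI zero_le_one)
    qed
    then have "?L \<le>
       (\<integral>\<^sup>+x. ?k * (indicator \<Omega> x + ennreal (\<rho> x) * indicator \<Omega> x) \<partial>lborel)"
      by (intro nn_integral_mono) (auto simp: indicator_def)
    also have "\<dots> = ?k * (emeasure lborel \<Omega> + ?R)"
      by (subst nn_integral_cmult) (auto simp: nn_integral_add)
    finally show ?thesis by (simp add: vol)
  qed
  have Rmono: "?R \<le> (\<integral>\<^sup>+x\<in>UNIV. ennreal (\<rho> x) \<partial>lborel)"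
    by (intro nn_integral_mono) (auto simp: indicator_def)
  have m1: "0 \<le> m 1" using mobility_nonneg[OF m] by simp
  have wB: "ennreal (norm (LINT x:B|lborel. w x)) \<le> (\<integral>\<^sup>+x\<in>\<Omega>. ennreal (norm (w x)) \<partial>lborel)"
    by (rule norm_set_integral_le_nn_integral[OF w _ w0]) (use B in auto)
  have two: "(\<integral>\<^sup>+x\<in>C. ennreal (2 * norm (f x)) \<partial>M) = 2 * (\<integral>\<^sup>+x\<in>C. ennreal (norm (f x)) \<partial>M)"
    if "f \<in> borel_measurable M" "C \<in> sets M" for C M and f :: "'a \<Rightarrow> 'a"
    using that by (subst nn_integral_cmult[symmetric]) (auto simp: ennreal_mult mult.assoc)
  \<comment> \<open>Absolutely continuous mass in the domain and singular mass: together they stay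
    below \<open>c\<close>, so one constant covers both error terms.\<close>
  define T where "T = ?R"
  define S where "S = emeasure \<mu>s UNIV"
  have TS: "T + S \<le> ennreal c" using \<mu>eq[of UNIV] mass Rmono unfolding T_def S_def
    by (metis UNIV_I add_right_mono sets.top space_borel)
  have b: "?k * (?vol + T) + ?k * S \<le> ennreal (m 1 * (measure lborel \<Omega> + c) / l)"
  proof -
    have "?k * (?vol + T) + ?k * S
       = ?k * (?vol + (T + S))" by (simp add: distrib_left add.assoc)
    also have "\<dots> \<le> ?k * (?vol + ennreal c)"
      by (intro mult_left_mono add_left_mono TS) auto
    also have "\<dots> = ennreal (m 1 * (measure lborel \<Omega> + c) / l)"
      using m1 l c by (simp add: ennreal_plus[symmetric] ennreal_mult[symmetric] del: ennreal_plus)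
    finally show ?thesis .
  qed
  show ?thesis
  proof (cases "mob_slope m = 0")
    case True
    with fin have z: "\<forall>B\<in>sets borel. \<nu>s B = 0" and
      A: "action m \<Omega> \<mu> \<nu> = ?A"
      using action_sublinear[OF m \<mu>' \<nu> d1 d2 True] by (auto split: if_splits)
    have "ennreal (2 * norm (\<nu> B)) = 2 * ennreal (norm (LINT x:B|lborel. w x))"
      using \<nu>eq[OF B] z B by (simp add: ennreal_mult)
    also have "\<dots> \<le> ?W"
      using wB w by (simp add: two mult_left_mono)
    also have "\<dots> \<le> ennreal l * action m \<Omega> \<mu> \<nu> + ?k * (?vol + T)"
      using order_trans[OF E1 add_left_mono[OF E2]] by (simp add: A T_def)
    also have "\<dots> \<le> ennreal l * action m \<Omega> \<mu> \<nu> + ennreal (m 1 * (measure lborel \<Omega> + c) / l)"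
      using b by (intro add_left_mono) (metis add.right_neutral add_left_mono order_trans zero_le)
    finally show ?thesis .
  next
    case False
    with fin obtain ws where ws: "vec_density \<mu>s \<nu>s ws"
      using action_linear_top[OF m \<mu>' \<nu> d1 d2 False] by auto
    note A = action_linear[OF m \<mu>' \<nu> d1 d2 False ws]
    have wsi: "integrable \<mu>s ws" using ws by (simp add: vec_density_def)
    have [measurable]: "ws \<in> borel_measurable borel"
      using borel_measurable_integrable[OF wsi] s by simp
    have sl: "0 < mob_slope m" "mob_slope m \<le> m 1" using mob_slope_bounds[OF m] False by auto
    have "emeasure \<mu>s (- closure \<Omega>) = 0"
      using \<mu>eq[of "- closure \<Omega>"] MplusD(3)[OF \<mu>'] by simp
    then have "AE x in \<mu>s. x \<in> closure \<Omega>"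
      using sets_eq_imp_space_eq[OF s] by (intro AE_I[of _ _ "- closure \<Omega>"]) (auto simp: s)
    then have wsB: "ennreal (norm (LINT x:B|\<mu>s. ws x)) \<le> (\<integral>\<^sup>+x\<in>closure \<Omega>. ennreal (norm (ws x)) \<partial>\<mu>s)"
      by (intro norm_set_integral_le_nn_integral[OF wsi]) (use B in \<open>auto simp: s elim: eventually_mono\<close>)
    have E3: "(\<integral>\<^sup>+x\<in>closure \<Omega>. ennreal (2 * norm (ws x)) \<partial>\<mu>s) \<le>
       ennreal l * (\<integral>\<^sup>+ x \<in> closure \<Omega>. ennreal ((norm (ws x))\<^sup>2 / mob_slope m) \<partial>\<mu>s) + ?k * S"
    proof -
      \<comment> \<open>On the singular part the slope replaces the mobility; as it is at most
        \<open>m 1\<close>, the error is again bounded by \<open>?k\<close>.\<close>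
      have p: "ennreal (2 * norm (ws x)) \<le> ennreal l * ennreal ((norm (ws x))\<^sup>2 / mob_slope m) + ?k" for x
      proof -
        have "2 * norm (ws x) \<le> l * ((norm (ws x))\<^sup>2 / mob_slope m) + m 1 / l"
          using am_gm_scaled[OF l sl(1), of "norm (ws x)"] divide_right_mono[OF sl(2), of l] l by linarith
        then show ?thesis using l sl m1 by (simp add: ennreal_mult[symmetric] ennreal_plus[symmetric] ennreal_leI del: ennreal_plus)
      qed
      have "(\<integral>\<^sup>+x\<in>closure \<Omega>. ennreal (2 * norm (ws x)) \<partial>\<mu>s) \<le>
        (\<integral>\<^sup>+x. ennreal l * (ennreal ((norm (ws x))\<^sup>2 / mob_slope m) * indicator (closure \<Omega>) x) + ?k \<partial>\<mu>s)"
        using p by (intro nn_integral_mono) (auto simp: indicator_def)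
      also have "\<dots> = (\<integral>\<^sup>+x. ennreal l * (ennreal ((norm (ws x))\<^sup>2 / mob_slope m) * indicator (closure \<Omega>) x) \<partial>\<mu>s) + (\<integral>\<^sup>+x. ?k \<partial>\<mu>s)"
        by (rule nn_integral_add) measurable
      finally show ?thesis
        using sets_eq_imp_space_eq[OF s] by (simp add: nn_integral_cmult S_def)
    qed
    have "ennreal (2 * norm (\<nu> B)) \<le> ennreal (2 * norm (LINT x:B|lborel. w x) + 2 * norm (LINT x:B|\<mu>s. ws x))"
      using \<nu>eq[OF B] ws B norm_triangle_ineq[of "LINT x:B|lborel. w x" "LINT x:B|\<mu>s. ws x"]
      by (intro ennreal_leI) (auto simp: vec_density_def)
    also have "\<dots> = 2 * ennreal (norm (LINT x:B|lborel. w x)) + 2 * ennreal (norm (LINT x:B|\<mu>s. ws x))"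
      by (simp add: ennreal_mult)
    also have "\<dots> \<le> ?W + (\<integral>\<^sup>+x\<in>closure \<Omega>. ennreal (2 * norm (ws x)) \<partial>\<mu>s)"
      using add_mono[OF mult_left_mono[OF wB, of 2] mult_left_mono[OF wsB, of 2]] two[of w lborel \<Omega>] two[of ws \<mu>s "closure \<Omega>"]
      by (simp add: s)
    also have "\<dots> \<le> (ennreal l * ?A + ?k * (?vol + T)) +
       (ennreal l * (\<integral>\<^sup>+ x \<in> closure \<Omega>. ennreal ((norm (ws x))\<^sup>2 / mob_slope m) \<partial>\<mu>s) + ?k * S)"
      using order_trans[OF E1 add_left_mono[OF E2]] E3 unfolding T_def by (rule add_mono)
    also have "\<dots> = ennreal l * action m \<Omega> \<mu> \<nu> + (?k * (?vol + T) + ?k * S)"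
      unfolding A by (simp add: distrib_left ac_simps)
    also have "\<dots> \<le> ennreal l * action m \<Omega> \<mu> \<nu> + ennreal (m 1 * (measure lborel \<Omega> + c) / l)"
      using b by (rule add_left_mono)
    finally show ?thesis .
  qed
qed

section \<open>Compactly supported smooth functions\<close>

text \<open>Unlike members of \<open>test_functions\<close>, such a function of time and space may
  be nonzero at the end times.\<close>

definition smooth_compact :: "('v::euclidean_space \<Rightarrow> real) \<Rightarrow> bool" where
  "smooth_compact f \<longleftrightarrow> (\<forall>k. Ck k f) \<and> bounded {x. f x \<noteq> 0}"

lemma smooth_compactD:
  assumes "smooth_compact f"
  shows "Ck k f" "bounded {x. f x \<noteq> 0}" "continuous_on UNIV f"
    "(f has_derivative frechet_derivative f (at x)) (at x)"
  using assms Ck.simps(1)[of f] Ck_Suc_has_derivative[of 0 f x] by (auto simp: smooth_compact_def simp del: Ck.simps)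

lemma frechet_derivative_eq_0:
  assumes "x \<notin> closure {x. f x \<noteq> 0}" shows "frechet_derivative f (at x) v = 0"
proof -
  have "(f has_derivative (\<lambda>v. 0)) (at x)"
  proof (rule has_derivative_transform_within_open[of "\<lambda>_. 0" _ _ _ "- closure {x. f x \<noteq> 0}"])
    show "0 = f y" if "y \<in> - closure {x. f x \<noteq> 0}" for y
      using that closure_subset[of "{x. f x \<noteq> 0}"] by force
  qed (use assms in auto)
  from frechet_derivative_at[OF this] show ?thesis by metis
qed

lemma smooth_compact_frechet_derivative:
  assumes "smooth_compact f" shows "smooth_compact (\<lambda>x. frechet_derivative f (at x) v)"
proof -
  have "{x. frechet_derivative f (at x) v \<noteq> 0} \<subseteq> closure {x. f x \<noteq> 0}"
    using frechet_derivative_eq_0 by blast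
  then have "bounded {x. frechet_derivative f (at x) v \<noteq> 0}"
    using assms bounded_subset bounded_closure by (auto simp: smooth_compact_def)
  moreover have "Ck k (\<lambda>x. frechet_derivative f (at x) v)" for k
    using smooth_compactD(1)[OF assms, of "Suc k"] by simp
  ultimately show ?thesis by (simp add: smooth_compact_def)
qed

lemma bounded_support_bounded:
  fixes f :: "'v::euclidean_space \<Rightarrow> real"
  assumes "continuous_on UNIV f" "bounded {x. f x \<noteq> 0}"
  shows "\<exists>K\<ge>0. \<forall>x. \<bar>f x\<bar> \<le> K"
proof -
  have "compact (f ` closure {x. f x \<noteq> 0})"
    using assms by (intro compact_continuous_image continuous_on_subset[OF assms(1)]) (auto simp: compact_closure)
  then obtain K where K: "\<And>x. x \<in> closure {x. f x \<noteq> 0} \<Longrightarrow> \<bar>f x\<bar> \<le> K"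
    using compact_imp_bounded bounded_iff by (metis imageI real_norm_def)
  have "\<bar>f x\<bar> \<le> \<bar>K\<bar>" for x
    using K[of x] closure_subset[of "{x. f x \<noteq> 0}"] by (cases "f x = 0") (auto intro: order_trans)
  then show ?thesis by (intro exI[of _ "\<bar>K\<bar>"]) auto
qed

lemma smooth_compact_bounded:
  "smooth_compact f \<Longrightarrow> \<exists>K\<ge>0. \<forall>x. \<bar>f x\<bar> \<le> K"
  using bounded_support_bounded smooth_compactD(2,3) by blast

lemma smooth_compact_mult:
  assumes "\<And>k. Ck k g" "smooth_compact f" shows "smooth_compact (\<lambda>x. g x * f x)"
proof -
  have "{x. g x * f x \<noteq> 0} \<subseteq> {x. f x \<noteq> 0}" by auto
  then have "bounded {x. g x * f x \<noteq> 0}" using smooth_compactD(2)[OF assms(2)] bounded_subset by blast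
  moreover have "Ck k (\<lambda>x. g x * f x)" for k
    by (rule Ck_mult[OF assms(1) smooth_compactD(1)[OF assms(2)]])
  ultimately show ?thesis by (simp add: smooth_compact_def)
qed

text \<open>The dual form of changing the speed, or with negative \<open>c\<close> the direction, of
  a solution.\<close>

lemma smooth_compact_time_affine:
  fixes \<zeta> :: "real \<times> 'a::euclidean_space \<Rightarrow> real"
  assumes "smooth_compact \<zeta>" "c \<noteq> 0"
  shows "smooth_compact (\<lambda>z. \<zeta> (t + c * fst z, snd z))"
    "time_deriv (\<lambda>z. \<zeta> (t + c * fst z, snd z)) r x = c * time_deriv \<zeta> (t + c * r) x"
    "space_grad (\<lambda>z. \<zeta> (t + c * fst z, snd z)) r x = space_grad \<zeta> (t + c * r) x"
proof -
  define L where "L z = (c * fst z, snd z)" for z :: "real \<times> 'a"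
  have L: "bounded_linear L" unfolding L_def
    by (intro bounded_linear_Pair bounded_linear_const_mult bounded_linear_fst bounded_linear_snd)
  have eq: "(\<lambda>z. \<zeta> (t + c * fst z, snd z)) = (\<lambda>z. \<zeta> ((t, 0) + L z))" by (simp add: L_def)
  have dL: "((\<lambda>z. (t, 0) + L z) has_derivative L) (at z)" for z
    using has_derivative_add[OF has_derivative_const bounded_linear_imp_has_derivative[OF L]] by simp
  have D: "frechet_derivative (\<lambda>z. \<zeta> ((t, 0) + L z)) (at z) = (\<lambda>v. frechet_derivative \<zeta> (at ((t, 0) + L z)) (L v))" for z
    using frechet_derivative_at[OF has_derivative_compose[OF dL smooth_compactD(4)[OF assms(1)]]] by simp
  have lin: "linear (frechet_derivative \<zeta> (at z))" for z
    using has_derivative_linear[OF smooth_compactD(4)[OF assms(1)]] .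
  have "{z. \<zeta> ((t, 0) + L z) \<noteq> 0} \<subseteq> (\<lambda>z. ((fst z - t) / c, snd z)) ` closure {z. \<zeta> z \<noteq> 0}"
  proof
    fix z assume "z \<in> {z. \<zeta> ((t, 0) + L z) \<noteq> 0}"
    then have "(t, 0) + L z \<in> closure {z. \<zeta> z \<noteq> 0}" using closure_subset[of "{z. \<zeta> z \<noteq> 0}"] by auto
    then show "z \<in> (\<lambda>z. ((fst z - t) / c, snd z)) ` closure {z. \<zeta> z \<noteq> 0}"
      by (intro image_eqI[of _ _ "(t, 0) + L z"]) (auto simp: L_def assms(2) prod_eq_iff)
  qed
  moreover have "compact ((\<lambda>z. ((fst z - t) / c, snd z)) ` closure {z. \<zeta> z \<noteq> 0})"
    using smooth_compactD(2)[OF assms(1)] assms(2)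
    by (intro compact_continuous_image continuous_intros) (auto simp: compact_closure)
  ultimately have "bounded {z. \<zeta> ((t, 0) + L z) \<noteq> 0}"
    using compact_imp_bounded bounded_subset by blast
  then show "smooth_compact (\<lambda>z. \<zeta> (t + c * fst z, snd z))"
    unfolding eq smooth_compact_def using Ck_comp_affine[OF L smooth_compactD(1)[OF assms(1)]] by auto
  have "L (1, 0) = c *\<^sub>R (1, 0)" "(t, 0) + L (r, x) = (t + c * r, x)" "L (0, b) = (0, b)" for b
    by (auto simp: L_def)
  then show "time_deriv (\<lambda>z. \<zeta> (t + c * fst z, snd z)) r x = c * time_deriv \<zeta> (t + c * r) x"
    "space_grad (\<lambda>z. \<zeta> (t + c * fst z, snd z)) r x = space_grad \<zeta> (t + c * r) x"
    unfolding eq time_deriv_def space_grad_def D using linear_cmul[OF lin, of _ c "(1, 0)"] by (simp_all only: real_scaleR_def)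
qed

lemma
  fixes \<zeta> :: "real \<times> 'a::euclidean_space \<Rightarrow> real"
  assumes \<zeta>: "smooth_compact \<zeta>"
  shows continuous_time_deriv: "continuous_on UNIV (\<lambda>z. time_deriv \<zeta> (fst z) (snd z))"
    and continuous_space_grad: "continuous_on UNIV (\<lambda>z. space_grad \<zeta> (fst z) (snd z))"
    and bounded_time_deriv: "\<exists>K\<ge>0. \<forall>s x. \<bar>time_deriv \<zeta> s x\<bar> \<le> K"
    and bounded_space_grad: "\<exists>K\<ge>0. \<forall>s x. norm (space_grad \<zeta> s x) \<le> K"
proof -
  note D = smooth_compact_frechet_derivative[OF \<zeta>]
  show "continuous_on UNIV (\<lambda>z. time_deriv \<zeta> (fst z) (snd z))"
    unfolding time_deriv_def using smooth_compactD(3)[OF D] by simp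
  show "continuous_on UNIV (\<lambda>z. space_grad \<zeta> (fst z) (snd z))"
    unfolding space_grad_def using smooth_compactD(3)[OF D] by (intro continuous_intros) simp
  show "\<exists>K\<ge>0. \<forall>s x. \<bar>time_deriv \<zeta> s x\<bar> \<le> K"
    unfolding time_deriv_def using smooth_compact_bounded[OF D] by fast
  have "\<forall>b. \<exists>K. 0 \<le> K \<and> (\<forall>z. \<bar>frechet_derivative \<zeta> (at z) (0, b)\<bar> \<le> K)"
    using smooth_compact_bounded[OF D] by blast
  then obtain K where K: "\<And>b. 0 \<le> K b" "\<And>b z. \<bar>frechet_derivative \<zeta> (at z) (0, b)\<bar> \<le> K b" by metis
  have "norm (space_grad \<zeta> s x) \<le> (\<Sum>b\<in>Basis. K b)" for s x
    unfolding space_grad_def by (rule order_trans[OF norm_sum sum_mono]) (use K in auto)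
  then show "\<exists>K\<ge>0. \<forall>s x. norm (space_grad \<zeta> s x) \<le> K"
    using K(1) by (intro exI[of _ "\<Sum>b\<in>Basis. K b"]) (auto intro: sum_nonneg)
qed

text \<open>For cutoffs in time: the factor commutes with the space gradient and adds one term to
  the time derivative.\<close>

lemma time_factor_derivs:
  fixes \<zeta> :: "real \<times> 'a::euclidean_space \<Rightarrow> real"
  assumes \<zeta>: "(\<zeta> has_derivative D) (at (s, x))" and \<eta>: "(\<eta> has_real_derivative \<eta>') (at s)"
  shows "time_deriv (\<lambda>z. \<eta> (fst z) * \<zeta> z) s x = \<eta> s * time_deriv \<zeta> s x + \<eta>' * \<zeta> (s, x)"
    "space_grad (\<lambda>z. \<eta> (fst z) * \<zeta> z) s x = \<eta> s *\<^sub>R space_grad \<zeta> s x"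
proof -
  have "((\<lambda>z. \<eta> (fst z)) has_derivative (\<lambda>v. \<eta>' * fst v)) (at (s, x))"
    using has_derivative_compose[OF has_derivative_fst[OF has_derivative_ident], of \<eta> "\<lambda>v. \<eta>' * v" "(s, x)" UNIV] \<eta>
    by (simp add: has_field_derivative_def)
  from has_derivative_mult[OF this \<zeta>]
  have "frechet_derivative (\<lambda>z. \<eta> (fst z) * \<zeta> z) (at (s, x)) = (\<lambda>v. \<eta> s * D v + \<eta>' * fst v * \<zeta> (s, x))"
    using frechet_derivative_at by fastforce
  then show "time_deriv (\<lambda>z. \<eta> (fst z) * \<zeta> z) s x = \<eta> s * time_deriv \<zeta> s x + \<eta>' * \<zeta> (s, x)"
    "space_grad (\<lambda>z. \<eta> (fst z) * \<zeta> z) s x = \<eta> s *\<^sub>R space_grad \<zeta> s x"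
    unfolding time_deriv_def space_grad_def frechet_derivative_at[OF \<zeta>, symmetric]
    by (auto simp: scaleR_sum_right)
qed

text \<open>A smooth step of R^2 + 1 - |x|^2. It equals 1 on a neighbourhood of \<open>C\<close>,
  and not merely on \<open>C\<close>, so that its derivatives vanish on \<open>C\<close>
  too.\<close>

lemma smooth_cutoff:
  fixes C :: "'a::euclidean_space set"
  assumes "bounded C"
  shows "\<exists>\<psi>. smooth_compact \<psi> \<and> (\<forall>x\<in>C. \<psi> x = 1) \<and> (\<forall>x. 0 \<le> \<psi> x \<and> \<psi> x \<le> 1) \<and>
    (\<exists>U. open U \<and> C \<subseteq> U \<and> (\<forall>x\<in>U. \<psi> x = 1))"
proof -
  obtain S :: "real \<Rightarrow> real" where S: "\<And>k. Ck k S" "\<And>x. x \<le> 0 \<Longrightarrow> S x = 0" "\<And>x. 1 \<le> x \<Longrightarrow> S x = 1" "mono S"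
    using smooth_step_exists by blast
  have S01: "0 \<le> S x" "S x \<le> 1" for x
    using monoD[OF S(4), of "min x 0" x] monoD[OF S(4), of x "max x 1"] S(2)[of "min x 0"] S(3)[of "max x 1"] by auto
  obtain R where R: "0 < R" "\<And>x. x \<in> C \<Longrightarrow> norm x < R"
    using assms bounded_pos_less by blast
  define \<psi> where "\<psi> x = S (R\<^sup>2 + 1 + (-1) * (x \<bullet> x))" for x :: 'a
  have Ck_in: "Ck k (\<lambda>x::'a. x \<bullet> x)" for k
  proof -
    have "(\<lambda>x::'a. x \<bullet> x) = (\<lambda>x. \<Sum>b\<in>Basis. (x \<bullet> b) * (x \<bullet> b))" by (simp add: euclidean_inner[symmetric])
    moreover have "real_polynomial_function (\<lambda>x::'a. \<Sum>b\<in>Basis. (x \<bullet> b) * (x \<bullet> b))"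
      by (intro real_polynomial_function_sum real_polynomial_function.intros(4) real_polynomial_function.intros(1) bounded_linear_inner_left) auto
    ultimately show ?thesis using Ck_real_polynomial_function by metis
  qed
  have "Ck k \<psi>" for k
    unfolding \<psi>_def by (intro Ck_compose[OF S(1)] Ck_add Ck_mult Ck_const Ck_in)
  moreover have one: "\<psi> x = 1" if "norm x < R" for x
  proof -
    have "x \<bullet> x \<le> R\<^sup>2" using that R(1) by (simp add: power2_norm_eq_inner[symmetric] power_mono)
    then show ?thesis unfolding \<psi>_def by (intro S(3)) simp
  qed
  moreover have "{x. \<psi> x \<noteq> 0} \<subseteq> cball 0 (R + 1)"
  proof
    fix x assume "x \<in> {x. \<psi> x \<noteq> 0}"
    then have "0 < R\<^sup>2 + 1 + (-1) * (x \<bullet> x)" unfolding \<psi>_def using S(2) by (rule_tac ccontr) (auto simp: not_less)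
    then have "(norm x)\<^sup>2 \<le> (R + 1)\<^sup>2" using R(1) by (simp add: power2_norm_eq_inner power2_sum)
    then show "x \<in> cball 0 (R + 1)" using R(1) by (simp add: power2_le_iff_abs_le)
  qed
  then have "bounded {x. \<psi> x \<noteq> 0}" using bounded_cball bounded_subset by blast
  ultimately show ?thesis
    using R(2) S01 one by (intro exI[of _ \<psi>] conjI exI[of _ "ball 0 R"])
      (auto simp: smooth_compact_def \<psi>_def[symmetric], auto simp: \<psi>_def)
qed

section \<open>Weak-star topology\<close>

text \<open>The universal property of an initial topology, which reduces continuity into
  \<open>weak_star X\<close> to continuity of scalar functions.\<close>

lemma weak_star_continuous_map:
  fixes X :: "'a::euclidean_space measure set"
  shows "continuous_map T (weak_star X) \<mu> \<longleftrightarrow> (\<forall>s\<in>topspace T. \<mu> s \<in> X) \<and>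
    (\<forall>f. continuous_on UNIV f \<and> bounded {x. f x \<noteq> 0} \<longrightarrow> continuous_map T euclideanreal (\<lambda>s. LINT x|\<mu> s. f x))"
    (is "?L \<longleftrightarrow> ?R")
proof -
  define S where "S = {{\<mu> \<in> X. (LINT x|\<mu>. f x) \<in> U} | (f :: 'a \<Rightarrow> real) U.
        continuous_on UNIV f \<and> bounded {x. f x \<noteq> 0} \<and> open U}"
  have ws: "weak_star X = topology_generated_by S" by (simp add: weak_star_def S_def compact_closure)
  have US: "\<Union>S = X"
  proof
    show "X \<subseteq> \<Union>S"
    proof
      fix \<mu> assume "\<mu> \<in> X"
      \<comment> \<open>The zero test function puts \<open>X\<close> itself into the
        subbasis.\<close>
      then have "\<mu> \<in> {\<mu> \<in> X. (LINT x|\<mu>. 0) \<in> (UNIV :: real set)}" by simp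
      moreover have "\<dots> \<in> S" unfolding S_def by (intro CollectI exI[of _ "\<lambda>_. 0"] exI[of _ UNIV]) auto
      ultimately show "\<mu> \<in> \<Union>S" by blast
    qed
  qed (auto simp: S_def)
  have "?L \<longleftrightarrow> (\<forall>U\<in>S. openin T (\<mu> -` U \<inter> topspace T)) \<and> \<mu> ` topspace T \<subseteq> X"
    unfolding ws continuous_on_generated_topo_iff US Ball_def by (rule refl)
  also have "\<dots> \<longleftrightarrow> ?R"
  proof safe
    fix f :: "'a \<Rightarrow> real" assume H: "\<forall>U\<in>S. openin T (\<mu> -` U \<inter> topspace T)" "\<mu> ` topspace T \<subseteq> X"
      and f: "continuous_on UNIV f" "bounded {x. f x \<noteq> 0}"
    show "continuous_map T euclideanreal (\<lambda>s. LINT x|\<mu> s. f x)"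
      unfolding continuous_map
    proof (intro conjI allI impI)
      fix U :: "real set" assume "openin euclideanreal U"
      then have "{\<mu> \<in> X. (LINT x|\<mu>. f x) \<in> U} \<in> S" unfolding S_def using f by auto
      then have "openin T (\<mu> -` {\<mu> \<in> X. (LINT x|\<mu>. f x) \<in> U} \<inter> topspace T)" using H by blast
      also have "\<mu> -` {\<mu> \<in> X. (LINT x|\<mu>. f x) \<in> U} \<inter> topspace T = {s \<in> topspace T. (LINT x|\<mu> s. f x) \<in> U}"
        using H(2) by auto
      finally show "openin T {s \<in> topspace T. (LINT x|\<mu> s. f x) \<in> U}" .
    qed auto
  next
    fix V assume H: "\<forall>s\<in>topspace T. \<mu> s \<in> X"
      "\<forall>f. continuous_on UNIV f \<and> bounded {x. f x \<noteq> 0} \<longrightarrow> continuous_map T euclideanreal (\<lambda>s. LINT x|\<mu> s. f x)"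
      and "V \<in> S"
    then obtain f :: "'a \<Rightarrow> real" and U where V: "V = {\<mu> \<in> X. (LINT x|\<mu>. f x) \<in> U}"
      and f: "continuous_on UNIV f" "bounded {x. f x \<noteq> 0}" "open U" by (auto simp: S_def)
    have "openin T {s \<in> topspace T. (LINT x|\<mu> s. f x) \<in> U}"
      using H(2) f by (auto simp: continuous_map)
    also have "{s \<in> topspace T. (LINT x|\<mu> s. f x) \<in> U} = \<mu> -` V \<inter> topspace T"
      using H(1) by (auto simp: V)
    finally show "openin T (\<mu> -` V \<inter> topspace T)" .
  qed auto
  finally show ?thesis .
qed

lemma Mplus_integral_cong:
  fixes f g :: "'a::euclidean_space \<Rightarrow> real"
  assumes \<mu>: "\<mu> \<in> Mplus \<Omega>" and fg: "\<And>x. x \<in> closure \<Omega> \<Longrightarrow> f x = g x"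
    and [measurable]: "f \<in> borel_measurable borel" "g \<in> borel_measurable borel"
  shows "(LINT x|\<mu>. f x) = (LINT x|\<mu>. g x)"
proof (rule integral_cong_AE)
  have "AE x in \<mu>. x \<in> closure \<Omega>"
    using MplusD[OF \<mu>] by (intro AE_I[of _ _ "- closure \<Omega>"]) auto
  then show "AE x in \<mu>. f x = g x" by eventually_elim (rule fg)
qed (use MplusD(1)[OF \<mu>] in \<open>simp_all cong: measurable_cong_sets\<close>)

lemma Mplus_integrable:
  fixes f :: "'a::euclidean_space \<Rightarrow> real"
  assumes \<Omega>: "bounded \<Omega>" and \<mu>: "\<mu> \<in> Mplus \<Omega>" and f: "continuous_on UNIV f"
  shows "integrable \<mu> f"
proof -
  interpret finite_measure \<mu> using MplusD(2)[OF \<mu>] .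
  have "bounded (f ` closure \<Omega>)"
    using \<Omega> by (intro compact_imp_bounded compact_continuous_image continuous_on_subset[OF f]) (auto simp: compact_closure)
  then obtain K where K: "\<And>x. x \<in> closure \<Omega> \<Longrightarrow> \<bar>f x\<bar> \<le> K" by (auto simp: bounded_iff)
  have "AE x in \<mu>. x \<in> closure \<Omega>"
    using MplusD[OF \<mu>] by (intro AE_I[of _ _ "- closure \<Omega>"]) auto
  then have "AE x in \<mu>. norm (f x) \<le> K" by eventually_elim (simp add: K)
  moreover have "f \<in> borel_measurable \<mu>"
    using borel_measurable_continuous_onI[OF f] MplusD(1)[OF \<mu>] by (simp cong: measurable_cong_sets)
  ultimately show ?thesis by (rule integrable_const_bound)
qed

lemma Mplus_integral_bound:
  fixes f :: "'a::euclidean_space \<Rightarrow> real"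
  assumes \<Omega>: "bounded \<Omega>" and \<mu>: "\<mu> \<in> Mplus \<Omega>" and f: "continuous_on UNIV f"
    and K: "\<And>x. x \<in> closure \<Omega> \<Longrightarrow> \<bar>f x\<bar> \<le> K"
  shows "\<bar>\<integral>x. f x \<partial>\<mu>\<bar> \<le> K * measure \<mu> UNIV"
proof -
  interpret finite_measure \<mu> using MplusD(2)[OF \<mu>] .
  have "AE x in \<mu>. x \<in> closure \<Omega>"
    using MplusD[OF \<mu>] by (intro AE_I[of _ _ "- closure \<Omega>"]) auto
  then have "AE x in \<mu>. norm (f x) \<le> K" by eventually_elim (simp add: K)
  then have "norm (LINT x|\<mu>. f x) \<le> (LINT x|\<mu>. K)"
    using Mplus_integrable[OF assms(1-3)] by (intro order_trans[OF integral_norm_bound] integral_mono_AE) auto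
  then show ?thesis using MplusD(4)[OF \<mu>] by (simp add: mult.commute)
qed

text \<open>A cutoff equal to 1 on the closure of the domain gives \<open>f\<close> compact support
  without changing its integrals.\<close>

lemma weak_star_continuous_integral:
  fixes f :: "'a::euclidean_space \<Rightarrow> real"
  assumes \<Omega>: "bounded \<Omega>" and X: "X \<subseteq> Mplus \<Omega>" and \<mu>: "continuous_map T (weak_star X) \<mu>" and f: "continuous_on UNIV f"
  shows "continuous_map T euclideanreal (\<lambda>s. LINT x|\<mu> s. f x)"
proof -
  obtain \<psi> where \<psi>: "smooth_compact \<psi>" "\<And>x. x \<in> closure \<Omega> \<Longrightarrow> \<psi> x = 1"
    using smooth_cutoff[of "closure \<Omega>"] \<Omega> by (auto simp: bounded_closure)
  have c: "continuous_on UNIV (\<lambda>x. \<psi> x * f x)"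
    by (intro continuous_intros f smooth_compactD(3)[OF \<psi>(1)])
  have b: "bounded {x. \<psi> x * f x \<noteq> 0}"
    by (rule bounded_subset[OF smooth_compactD(2)[OF \<psi>(1)]]) auto
  have "continuous_map T euclideanreal (\<lambda>s. LINT x|\<mu> s. \<psi> x * f x)"
    using \<mu> c b by (auto simp: weak_star_continuous_map)
  moreover have "(LINT x|\<mu> s. \<psi> x * f x) = (LINT x|\<mu> s. f x)" if "s \<in> topspace T" for s
  proof (rule Mplus_integral_cong)
    show "\<mu> s \<in> Mplus \<Omega>" using \<mu> X that by (auto simp: weak_star_continuous_map)
  qed (auto simp: \<psi>(2) intro!: borel_measurable_continuous_onI f c)
  ultimately show ?thesis by (rule continuous_map_eq)
qed

lemma continuous_integral_time_dependent:
  fixes \<zeta> :: "real \<times> 'a::euclidean_space \<Rightarrow> real"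
  assumes \<Omega>: "bounded \<Omega>" and \<mu>: "continuous_map (top_of_set {0..1}) (weak_star (Mplus \<Omega>)) \<mu>"
    and \<zeta>: "continuous_on UNIV \<zeta>"
  shows "continuous_on {0..1} (\<lambda>s. LINT x|\<mu> s. \<zeta> (s, x))"
proof -
  have M: "\<mu> s \<in> Mplus \<Omega>" if "s \<in> {0..1}" for s using \<mu> that by (auto simp: weak_star_continuous_map)
  have cont: "continuous_on {0..1} (\<lambda>s. LINT x|\<mu> s. f x)" if "continuous_on UNIV f" for f :: "'a \<Rightarrow> real"
    using weak_star_continuous_integral[OF \<Omega> order_refl \<mu> that] by simp
  have "continuous_on {0..1} (\<lambda>s. measure (\<mu> s) UNIV)"
  proof (rule continuous_on_eq)
    show "continuous_on {0..1} (\<lambda>s. LINT x|\<mu> s. (1::real))" by (rule cont) simp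
  qed (simp add: MplusD(4)[OF M])
  then have "bounded ((\<lambda>s. measure (\<mu> s) UNIV) ` {0..1})"
    by (intro compact_imp_bounded compact_continuous_image) auto
  then obtain K0 where K0: "\<And>s. s \<in> {0..1} \<Longrightarrow> \<bar>measure (\<mu> s) UNIV\<bar> \<le> K0" unfolding bounded_iff by fastforce
  define K where "K = max K0 0"
  have K: "measure (\<mu> s) UNIV \<le> K" "0 \<le> K" if "s \<in> {0..1}" for s using K0[OF that] by (auto simp: K_def)
  have \<zeta>s: "continuous_on UNIV (\<lambda>x. \<zeta> (s, x))" for s
    by (rule continuous_on_compose2[OF \<zeta>]) (auto intro!: continuous_intros)
  have uc: "uniformly_continuous_on ({0..1} \<times> closure \<Omega>) \<zeta>"
    using \<Omega> by (intro compact_uniformly_continuous continuous_on_subset[OF \<zeta>] compact_Times) (auto simp: compact_closure)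
  show ?thesis
    unfolding continuous_on_iff
  proof (intro ballI allI impI)
    fix s0 e :: real assume s0: "s0 \<in> {0..1}" and e: "0 < e"
    have "0 < e / (2 * (K + 1))" using e K(2)[OF s0] by simp
    then obtain d1 where d1: "0 < d1" "\<And>z z'. z \<in> {0..1} \<times> closure \<Omega> \<Longrightarrow> z' \<in> {0..1} \<times> closure \<Omega> \<Longrightarrow> dist z' z < d1 \<Longrightarrow> dist (\<zeta> z') (\<zeta> z) < e / (2 * (K + 1))"
      using uc unfolding uniformly_continuous_on_def by metis
    obtain d2 where d2: "0 < d2" "\<And>s. s \<in> {0..1} \<Longrightarrow> dist s s0 < d2 \<Longrightarrow> dist (LINT x|\<mu> s. \<zeta> (s0, x)) (LINT x|\<mu> s0. \<zeta> (s0, x)) < e / 2"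
      using cont[OF \<zeta>s[of s0]] s0 e unfolding continuous_on_iff by (metis half_gt_zero)
    show "\<exists>d>0. \<forall>s\<in>{0..1}. dist s s0 < d \<longrightarrow> dist (LINT x|\<mu> s. \<zeta> (s, x)) (LINT x|\<mu> s0. \<zeta> (s0, x)) < e"
    proof (intro exI[of _ "min d1 d2"] conjI ballI impI)
      fix s assume s: "s \<in> {0..1}" "dist s s0 < min d1 d2"
      have "\<bar>\<integral>x. \<zeta> (s, x) - \<zeta> (s0, x) \<partial>\<mu> s\<bar> \<le> e / (2 * (K + 1)) * measure (\<mu> s) UNIV"
      proof (rule Mplus_integral_bound[OF \<Omega> M[OF s(1)]])
        show "\<bar>\<zeta> (s, x) - \<zeta> (s0, x)\<bar> \<le> e / (2 * (K + 1))" if "x \<in> closure \<Omega>" for x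
          using d1(2)[of "(s0, x)" "(s, x)"] s s0 that by (auto simp: dist_Pair_Pair dist_real_def intro: less_imp_le)
      qed (intro continuous_intros \<zeta>s)
      also have "\<dots> \<le> e / (2 * (K + 1)) * K" using K[OF s(1)] e by (intro mult_left_mono) auto
      also have "\<dots> \<le> e / 2" using K(2)[OF s(1)] e by (simp add: field_simps)
      finally have "\<bar>(LINT x|\<mu> s. \<zeta> (s, x)) - (LINT x|\<mu> s. \<zeta> (s0, x))\<bar> \<le> e / 2"
        using Mplus_integrable[OF \<Omega> M[OF s(1)] \<zeta>s] by simp
      then show "dist (LINT x|\<mu> s. \<zeta> (s, x)) (LINT x|\<mu> s0. \<zeta> (s0, x)) < e"
        using d2(2)[OF s(1)] s(2) unfolding dist_real_def min_less_iff_conj by linarith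
    qed (use d1 d2 in auto)
  qed
qed

section \<open>Integrals of possibly non-measurable functions\<close>

text \<open>The action and the total variation along a path enter \<open>nn_integral\<close> without
  a proof of measurability in time. The integral is then the supremum over measurable minorants, and
  an upper bound has to be checked on these.\<close>

lemma nn_integral_lower_le:
  assumes "\<And>g. g \<in> borel_measurable M \<Longrightarrow> (\<And>x. g x \<le> f x) \<Longrightarrow> (\<integral>\<^sup>+x. g x \<partial>M) \<le> c"
  shows "(\<integral>\<^sup>+x. f x \<partial>M) \<le> c"
  unfolding nn_integral_def
proof (rule SUP_least)
  fix g assume g: "g \<in> {g. simple_function M g \<and> g \<le> f}"
  then have "integral\<^sup>S M g = (\<integral>\<^sup>+x. g x \<partial>M)" by (simp add: nn_integral_eq_simple_integral)
  also have "\<dots> \<le> c" using g by (intro assms borel_measurable_simple_function) (auto simp: le_fun_def)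
  finally show "integral\<^sup>S M g \<le> c" .
qed

lemma nn_integral_cmult_lower:
  assumes K: "0 < K" shows "(\<integral>\<^sup>+x. ennreal K * f x \<partial>M) \<le> ennreal K * (\<integral>\<^sup>+x. f x \<partial>M)"
proof (rule nn_integral_lower_le)
  fix g assume g: "g \<in> borel_measurable M" "\<And>x. g x \<le> ennreal K * f x"
  have inv: "ennreal K * ennreal (1 / K) = 1" using K by (simp add: ennreal_mult[symmetric])
  have "g x = ennreal K * (ennreal (1 / K) * g x)" for x using inv by (simp add: mult.assoc[symmetric])
  then have "(\<integral>\<^sup>+x. g x \<partial>M) = (\<integral>\<^sup>+x. ennreal K * (ennreal (1 / K) * g x) \<partial>M)" by simp
  also have "\<dots> = ennreal K * (\<integral>\<^sup>+x. ennreal (1 / K) * g x \<partial>M)" using g by (intro nn_integral_cmult) auto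
  also have "\<dots> \<le> ennreal K * (\<integral>\<^sup>+x. f x \<partial>M)"
  proof (intro mult_left_mono nn_integral_mono)
    fix x
    have "ennreal (1 / K) * g x \<le> ennreal (1 / K) * (ennreal K * f x)" by (intro mult_left_mono g) auto
    then show "ennreal (1 / K) * g x \<le> f x" using inv by (simp add: mult.assoc[symmetric] mult.commute)
  qed auto
  finally show "(\<integral>\<^sup>+x. g x \<partial>M) \<le> ennreal K * (\<integral>\<^sup>+x. f x \<partial>M)" .
qed

lemma nn_integral_affine_lower:
  fixes f :: "real \<Rightarrow> ennreal"
  assumes c: "c \<noteq> 0"
  shows "(\<integral>\<^sup>+s. f ((s - t) / c) \<partial>lborel) \<le> ennreal \<bar>c\<bar> * (\<integral>\<^sup>+s. f s \<partial>lborel)"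
proof (rule nn_integral_lower_le)
  fix g :: "real \<Rightarrow> ennreal" assume g: "g \<in> borel_measurable lborel" "\<And>x. g x \<le> f ((x - t) / c)"
  have "(\<integral>\<^sup>+s. g s \<partial>lborel) = ennreal \<bar>c\<bar> * (\<integral>\<^sup>+s. g (t + c * s) \<partial>lborel)"
    using g(1) c by (intro nn_integral_real_affine) auto
  also have "\<dots> \<le> ennreal \<bar>c\<bar> * (\<integral>\<^sup>+s. f s \<partial>lborel)"
    using g(2)[of "t + c * _"] c by (intro mult_left_mono nn_integral_mono) auto
  finally show "(\<integral>\<^sup>+s. g s \<partial>lborel) \<le> ennreal \<bar>c\<bar> * (\<integral>\<^sup>+s. f s \<partial>lborel)" .
qed

text \<open>Lower integrals are superadditive; this is the reverse inequality. It holds because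
  \<open>f1\<close> and \<open>f2\<close> live on complementary measurable sets, along which every
  minorant can be cut.\<close>

lemma nn_integral_split_lower:
  assumes A: "A \<in> sets M" and f: "AE x in M. f x \<le> f1 x + f2 x"
    and f1: "\<And>x. x \<in> A \<Longrightarrow> f2 x = 0" and f2: "\<And>x. x \<notin> A \<Longrightarrow> f1 x = 0"
  shows "(\<integral>\<^sup>+x. f x \<partial>M) \<le> (\<integral>\<^sup>+x. f1 x \<partial>M) + (\<integral>\<^sup>+x. f2 x \<partial>M)"
proof (rule nn_integral_lower_le)
  fix g assume g[measurable]: "g \<in> borel_measurable M" and gf: "\<And>x. g x \<le> f x"
  note [measurable] = A
  have "(\<integral>\<^sup>+x. g x \<partial>M) = (\<integral>\<^sup>+x. g x * indicator A x + g x * indicator (space M - A) x \<partial>M)"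
    by (intro nn_integral_cong) (auto simp: indicator_def)
  also have "\<dots> = (\<integral>\<^sup>+x. g x * indicator A x \<partial>M) + (\<integral>\<^sup>+x. g x * indicator (space M - A) x \<partial>M)"
    by (intro nn_integral_add) auto
  also have "\<dots> \<le> (\<integral>\<^sup>+x. f1 x \<partial>M) + (\<integral>\<^sup>+x. f2 x \<partial>M)"
  proof (intro add_mono nn_integral_mono_AE)
    show "AE x in M. g x * indicator A x \<le> f1 x"
      using f by eventually_elim (use gf f1 in \<open>auto simp: indicator_def intro: order_trans\<close>, metis add.right_neutral f1 gf order_trans)
    show "AE x in M. g x * indicator (space M - A) x \<le> f2 x"
      using f by eventually_elim (use gf f2 in \<open>auto simp: indicator_def intro: order_trans\<close>, metis add.left_neutral f2 gf order_trans)
  qed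
  finally show "(\<integral>\<^sup>+x. g x \<partial>M) \<le> (\<integral>\<^sup>+x. f1 x \<partial>M) + (\<integral>\<^sup>+x. f2 x \<partial>M)" .
qed

section \<open>The continuity equation up to the boundary in time\<close>

lemma CED:
  assumes "(\<mu>, \<nu>) \<in> CE \<Omega> \<mu>0 \<mu>1"
  shows "s \<in> {0..1} \<Longrightarrow> \<mu> s \<in> Mplus \<Omega>" "s \<in> {0<..<1} \<Longrightarrow> \<nu> s \<in> Mvec \<Omega>"
    "continuous_map (top_of_set {0..1}) (weak_star (Mplus \<Omega>)) \<mu>" "\<mu> 0 = \<mu>0" "\<mu> 1 = \<mu>1"
    "B \<in> sets borel \<Longrightarrow> (\<lambda>s. \<nu> s B) \<in> borel_measurable (restrict_space borel {0<..<1})"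
    "(\<integral>\<^sup>+ s \<in> {0<..<1}. total_var (\<nu> s) (closure \<Omega>) \<partial>lborel) < \<infinity>"
    "\<zeta> \<in> test_functions \<Longrightarrow> (LINT s:{0<..<1}|lborel. (LINT x|\<mu> s. time_deriv \<zeta> s x) + vec_integral (\<nu> s) (space_grad \<zeta> s)) = 0"
  using assms by (auto simp: CE_def)

definition CE_integrand where
  "CE_integrand \<mu> \<nu> \<zeta> s = (LINT x|\<mu> s. time_deriv \<zeta> s x) + vec_integral (\<nu> s) (space_grad \<zeta> s)"

lemma Mvec_norm_le:
  assumes \<nu>: "\<nu> \<in> Mvec \<Omega>" and B: "B \<in> sets borel"
  shows "ennreal (norm (\<nu> B)) \<le> total_var \<nu> (closure \<Omega>)"
proof -
  have "\<nu> ((B \<inter> closure \<Omega>) \<union> (B - closure \<Omega>)) = \<nu> (B \<inter> closure \<Omega>) + \<nu> (B - closure \<Omega>)"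
    using B by (intro vec_measure_Un[OF MvecD(1)[OF \<nu>]]) auto
  moreover have "(B \<inter> closure \<Omega>) \<union> (B - closure \<Omega>) = B" by auto
  moreover have "\<nu> (B - closure \<Omega>) = 0" using B by (intro MvecD(5)[OF \<nu>]) auto
  ultimately show ?thesis using norm_le_total_var[of "B \<inter> closure \<Omega>" "closure \<Omega>" \<nu>] B by simp
qed

lemma vec_integral_Mvec_bound:
  fixes \<nu> :: "'a::euclidean_space set \<Rightarrow> 'a"
  assumes \<nu>: "\<nu> \<in> Mvec \<Omega>" and \<xi>: "\<xi> \<in> borel_measurable borel" "\<And>x. x \<in> closure \<Omega> \<Longrightarrow> norm (\<xi> x) \<le> G" "0 \<le> G"
  shows "ennreal \<bar>vec_integral \<nu> \<xi>\<bar> \<le> ennreal (2 * real DIM('a) * G) * total_var \<nu> (closure \<Omega>)"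
proof -
  have fin: "total_var \<nu> (closure \<Omega>) < \<infinity>"
    using MvecD(2)[OF \<nu>] total_var_mono[of "closure \<Omega>" UNIV \<nu>] by (auto intro: le_less_trans)
  define K where "K = enn2real (total_var \<nu> (closure \<Omega>))"
  have K: "total_var \<nu> (closure \<Omega>) = ennreal K" "0 \<le> K" using fin by (auto simp: K_def less_top[symmetric])
  have "\<bar>vec_integral \<nu> \<xi>\<bar> \<le> real DIM('a) * (2 * K * G)"
  proof (rule vec_integral_bound[OF MvecD(1)[OF \<nu>] _ _ MvecD(5)[OF \<nu>] \<xi>])
    show "norm (\<nu> B) \<le> K" if "B \<in> sets borel" for B
      using Mvec_norm_le[OF \<nu> that] K by (simp add: ennreal_le_iff)
  qed auto
  then show ?thesis using K \<xi>(3) by (simp add: ennreal_mult[symmetric] ennreal_leI ac_simps)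
qed

lemma vec_integral_tendsto:
  fixes \<nu> :: "'a::euclidean_space set \<Rightarrow> 'a"
  assumes \<nu>: "\<nu> \<in> Mvec \<Omega>" and meas: "\<And>n. \<xi>n n \<in> borel_measurable borel" "\<xi> \<in> borel_measurable borel"
    and lim: "\<And>x. (\<lambda>n. \<xi>n n x) \<longlonglongrightarrow> \<xi> x" and K: "\<And>n x. norm (\<xi>n n x) \<le> K"
  shows "(\<lambda>n. vec_integral \<nu> (\<xi>n n)) \<longlonglongrightarrow> vec_integral \<nu> \<xi>"
  unfolding vec_integral_def signed_integral_def
proof (intro tendsto_sum tendsto_diff)
  fix b :: 'a assume b: "b \<in> Basis"
  have \<sigma>: "vec_measure (\<lambda>B. \<nu> B \<bullet> b)" using vec_measure_inner MvecD(1)[OF \<nu>] .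
  have bd: "\<bar>\<nu> B \<bullet> b\<bar> \<le> enn2real (total_var \<nu> UNIV)" if "B \<in> sets borel" for B
    using MvecD(4)[OF \<nu> that] Basis_le_norm[OF b, of "\<nu> B"] by linarith
  have bd': "\<bar>- (\<nu> B \<bullet> b)\<bar> \<le> enn2real (total_var \<nu> UNIV)" if "B \<in> sets borel" for B
    using bd[OF that] by simp
  have *: "(\<lambda>n. LINT x|N. \<xi>n n x \<bullet> b) \<longlonglongrightarrow> (LINT x|N. \<xi> x \<bullet> b)" if "finite_measure N" "sets N = sets borel" for N
  proof -
    interpret finite_measure N by fact
    note [measurable_cong] = that(2) and [measurable] = meas
    have "\<bar>\<xi>n n x \<bullet> b\<bar> \<le> K" for n x using Basis_le_norm[OF b, of "\<xi>n n x"] K[of n x] by linarith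
    then show ?thesis
      by (intro integral_dominated_convergence[where w = "\<lambda>_. K"]) (auto intro!: tendsto_intros lim)
  qed
  show "(\<lambda>n. \<integral>x. \<xi>n n x \<bullet> b \<partial>pos_part_measure (\<lambda>B. \<nu> B \<bullet> b)) \<longlonglongrightarrow> (\<integral>x. \<xi> x \<bullet> b \<partial>pos_part_measure (\<lambda>B. \<nu> B \<bullet> b))"
    using finite_pos_part_measure[OF \<sigma> bd] by (intro *) auto
  show "(\<lambda>n. \<integral>x. \<xi>n n x \<bullet> b \<partial>pos_part_measure (\<lambda>B. - (\<nu> B \<bullet> b))) \<longlonglongrightarrow> (\<integral>x. \<xi> x \<bullet> b \<partial>pos_part_measure (\<lambda>B. - (\<nu> B \<bullet> b)))"
    using finite_pos_part_measure[OF vec_measure_uminus[OF \<sigma>] bd'] by (intro *) auto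
qed

lemma vec_integral_cmult: "vec_integral \<nu> (\<lambda>x. r *\<^sub>R \<xi> x) = r * vec_integral \<nu> \<xi>"
  unfolding vec_integral_def signed_integral_def by (simp add: sum_distrib_left right_diff_distrib)

lemma smooth_compact_slices:
  fixes \<zeta> :: "real \<times> 'a::euclidean_space \<Rightarrow> real"
  assumes \<zeta>: "smooth_compact \<zeta>"
  shows "continuous_on UNIV (\<lambda>x. \<zeta> (s, x))" "continuous_on UNIV (time_deriv \<zeta> s)" "continuous_on UNIV (space_grad \<zeta> s)"
    "space_grad \<zeta> s \<in> borel_measurable borel"
proof -
  have *: "continuous_on UNIV (\<lambda>x. g (s, x))" if "continuous_on UNIV g" for g :: "real \<times> 'a \<Rightarrow> 'c::topological_space"
    by (rule continuous_on_compose2[OF that]) (auto intro!: continuous_intros)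
  show "continuous_on UNIV (\<lambda>x. \<zeta> (s, x))" "continuous_on UNIV (time_deriv \<zeta> s)" "continuous_on UNIV (space_grad \<zeta> s)"
    using *[OF smooth_compactD(3)[OF \<zeta>]] *[OF continuous_time_deriv[OF \<zeta>]] *[OF continuous_space_grad[OF \<zeta>]] by simp_all
  then show "space_grad \<zeta> s \<in> borel_measurable borel" by (intro borel_measurable_continuous_onI)
qed

text \<open>For a fixed field the flux integral is measurable in time, but here the field moves with
  \<open>s\<close>. It is frozen at the times floor(n s) / n, which take countably many values,
  before n tends to infinity.\<close>

lemma integrable_CE_integrand:
  fixes \<zeta> :: "real \<times> 'a::euclidean_space \<Rightarrow> real"
  assumes CE: "(\<mu>, \<nu>) \<in> CE \<Omega> \<mu>0 \<mu>1" and \<Omega>: "bounded \<Omega>" and \<zeta>: "smooth_compact \<zeta>"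
  shows "set_integrable lborel {0<..<1} (CE_integrand \<mu> \<nu> \<zeta>)"
    "set_integrable lborel {0<..<1} (\<lambda>s. vec_integral (\<nu> s) (space_grad \<zeta> s))"
proof -
  let ?R = "restrict_space borel {0<..<1::real}"
  obtain K where K: "0 \<le> K" "\<And>s x. norm (space_grad \<zeta> s x) \<le> K" using bounded_space_grad[OF \<zeta>] by blast
  have [measurable]: "(\<lambda>s. vec_integral (\<nu> s) (space_grad \<zeta> s)) \<in> borel_measurable ?R"
  proof (rule borel_measurable_LIMSEQ_real)
    fix s assume s: "s \<in> space ?R"
    show "(\<lambda>n. vec_integral (\<nu> s) (space_grad \<zeta> (of_int \<lfloor>real (Suc n) * s\<rfloor> / real (Suc n)))) \<longlonglongrightarrow> vec_integral (\<nu> s) (space_grad \<zeta> s)"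
    proof (rule vec_integral_tendsto[where K = K])
      show "\<nu> s \<in> Mvec \<Omega>" using CED(2)[OF CE] s by (simp add: space_restrict_space)
      have "(\<lambda>n. of_int \<lfloor>real (Suc n) * s\<rfloor> / real (Suc n)) \<longlonglongrightarrow> s"
      proof (rule real_tendsto_sandwich)
        show "\<forall>\<^sub>F n in sequentially. s - 1 / real (Suc n) \<le> of_int \<lfloor>real (Suc n) * s\<rfloor> / real (Suc n)"
        proof (intro always_eventually allI)
          fix n
          have "real (Suc n) * s - 1 \<le> of_int \<lfloor>real (Suc n) * s\<rfloor>" by linarith
          then have "(real (Suc n) * s - 1) / real (Suc n) \<le> of_int \<lfloor>real (Suc n) * s\<rfloor> / real (Suc n)" by (rule divide_right_mono) simp
          then show "s - 1 / real (Suc n) \<le> of_int \<lfloor>real (Suc n) * s\<rfloor> / real (Suc n)" by (simp add: diff_divide_distrib)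
        qed
        show "\<forall>\<^sub>F n in sequentially. of_int \<lfloor>real (Suc n) * s\<rfloor> / real (Suc n) \<le> s"
        proof (intro always_eventually allI)
          fix n show "of_int \<lfloor>real (Suc n) * s\<rfloor> / real (Suc n) \<le> s"
            using of_int_floor_le[of "real (Suc n) * s"] by (simp add: pos_divide_le_eq mult.commute)
        qed
        show "(\<lambda>n. s - 1 / real (Suc n)) \<longlonglongrightarrow> s"
          using tendsto_diff[OF tendsto_const LIMSEQ_inverse_real_of_nat, of s] by (simp add: inverse_eq_divide)
      qed auto
      then have lim: "(\<lambda>n. (of_int \<lfloor>real (Suc n) * s\<rfloor> / real (Suc n), x)) \<longlonglongrightarrow> (s, x)" for x :: 'a
        by (intro tendsto_Pair tendsto_const)
      show "(\<lambda>n. space_grad \<zeta> (of_int \<lfloor>real (Suc n) * s\<rfloor> / real (Suc n)) x) \<longlonglongrightarrow> space_grad \<zeta> s x" for x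
        using continuous_on_tendsto_compose[OF continuous_space_grad[OF \<zeta>] lim] by simp
    qed (use K smooth_compact_slices(4)[OF \<zeta>] in auto)
  next
    fix n
    show "(\<lambda>s. vec_integral (\<nu> s) (space_grad \<zeta> (of_int \<lfloor>real (Suc n) * s\<rfloor> / real (Suc n)))) \<in> borel_measurable ?R"
    proof (rule measurable_compose_countable[where f = "\<lambda>i s. vec_integral (\<nu> s) (space_grad \<zeta> (of_int i / real (Suc n)))"])
      show "(\<lambda>s. vec_integral (\<nu> s) (space_grad \<zeta> (of_int i / real (Suc n)))) \<in> borel_measurable ?R" for i
        by (rule borel_measurable_vec_integral[where \<Omega> = \<Omega> and K = K])
          (use CED(2,6)[OF CE] smooth_compact_slices(4)[OF \<zeta>] K in \<open>auto simp: space_restrict_space\<close>)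
      have "(\<lambda>s::real. \<lfloor>real (Suc n) * s\<rfloor>) \<in> borel \<rightarrow>\<^sub>M count_space UNIV" by measurable
      then show "(\<lambda>s::real. \<lfloor>real (Suc n) * s\<rfloor>) \<in> ?R \<rightarrow>\<^sub>M count_space UNIV" by (rule measurable_restrict_space1)
    qed
  qed
  \<comment> \<open>The added 1 makes the factor positive, as \<open>nn_integral_cmult_lower\<close>
    demands.\<close>
  let ?C = "2 * real DIM('a) * (K + 1)"
  have "(\<integral>\<^sup>+s. ennreal (norm (indicator {0<..<1} s *\<^sub>R vec_integral (\<nu> s) (space_grad \<zeta> s))) \<partial>lborel) \<le>
    (\<integral>\<^sup>+s. ennreal ?C * (total_var (\<nu> s) (closure \<Omega>) * indicator {0<..<1} s) \<partial>lborel)"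
  proof (rule nn_integral_mono)
    fix s :: real
    have "ennreal \<bar>vec_integral (\<nu> s) (space_grad \<zeta> s)\<bar> \<le> ennreal ?C * total_var (\<nu> s) (closure \<Omega>)" if "s \<in> {0<..<1}"
      using K by (intro vec_integral_Mvec_bound[OF CED(2)[OF CE that]] smooth_compact_slices(4)[OF \<zeta>]) (auto intro: order_trans[OF K(2)])
    then show "ennreal (norm (indicator {0<..<1} s *\<^sub>R vec_integral (\<nu> s) (space_grad \<zeta> s))) \<le> ennreal ?C * (total_var (\<nu> s) (closure \<Omega>) * indicator {0<..<1} s)"
      by (auto simp: indicator_def)
  qed
  also have "\<dots> \<le> ennreal ?C * (\<integral>\<^sup>+s. total_var (\<nu> s) (closure \<Omega>) * indicator {0<..<1} s \<partial>lborel)"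
    using K by (intro nn_integral_cmult_lower) simp
  also have "\<dots> < \<infinity>" using CED(7)[OF CE] by (simp add: ennreal_mult_less_top)
  finally have fin: "(\<integral>\<^sup>+s. ennreal (norm (indicator {0<..<1} s *\<^sub>R vec_integral (\<nu> s) (space_grad \<zeta> s))) \<partial>lborel) < \<infinity>" .
  have "(\<lambda>s. indicator {0<..<1} s *\<^sub>R vec_integral (\<nu> s) (space_grad \<zeta> s)) \<in> borel_measurable borel"
    by (subst borel_measurable_restrict_space_iff[symmetric]) auto
  then show 2: "set_integrable lborel {0<..<1} (\<lambda>s. vec_integral (\<nu> s) (space_grad \<zeta> s))"
    unfolding set_integrable_def using fin by (intro integrableI_bounded) auto
  have "continuous_on {0..1} (\<lambda>s. LINT x|\<mu> s. time_deriv \<zeta> s x)"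
    using continuous_integral_time_dependent[OF \<Omega> CED(3)[OF CE] continuous_time_deriv[OF \<zeta>]] by simp
  then have "set_integrable lborel {0..1} (\<lambda>s. LINT x|\<mu> s. time_deriv \<zeta> s x)"
    by (rule borel_integrable_atLeastAtMost')
  then have 1: "set_integrable lborel {0<..<1} (\<lambda>s. LINT x|\<mu> s. time_deriv \<zeta> s x)"
    by (rule set_integrable_subset) auto
  show "set_integrable lborel {0<..<1} (CE_integrand \<mu> \<nu> \<zeta>)"
    unfolding CE_integrand_def[abs_def] using set_integral_add(1)[OF 1 2] .
qed

text \<open>The substitution s = p n + c n t moves the concentration into the argument of
  \<open>F\<close>. A negative \<open>c n\<close> mirrors the kernel, as is needed at the right end
  of an interval.\<close>

lemma approximate_identity:
  fixes F :: "real \<Rightarrow> real"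
  assumes S: "continuous_on UNIV S'" "\<And>x. x \<le> 0 \<or> 1 \<le> x \<Longrightarrow> S' x = 0" "\<And>x. (S has_real_derivative S' x) (at x)"
    "S 0 = 0" "S 1 = 1"
    and F: "continuous_on UNIV F" "\<And>x. \<bar>F x\<bar> \<le> K"
    and p: "p \<longlonglongrightarrow> p0" and c: "c \<longlonglongrightarrow> 0" "\<And>n. c n \<noteq> 0"
  shows "(\<lambda>n. LINT s|lborel. S' ((s - p n) / c n) / \<bar>c n\<bar> * F s) \<longlonglongrightarrow> F p0"
proof -
  have hb: "has_bochner_integral lborel (\<lambda>x. S' x * indicator {0..1} x) (S 1 - S 0)"
    using S(1,3) by (intro has_bochner_integral_FTC_Icc_real) (auto simp: continuous_on_eq_continuous_at)
  have ind: "(\<lambda>x. S' x * indicator {0..1} x) = S'"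
  proof
    fix x show "S' x * indicator {0..1} x = S' x" using S(2)[of x] by (cases "x \<in> {0..1}") auto
  qed
  have Si: "integrable lborel S'" "(LINT x|lborel. S' x) = 1"
    using hb S(4,5) unfolding ind has_bochner_integral_iff by auto
  have [measurable]: "S' \<in> borel_measurable borel" "F \<in> borel_measurable borel"
    using S(1) F(1) by (auto intro: borel_measurable_continuous_onI)
  have eq: "(LINT s|lborel. S' ((s - p n) / c n) / \<bar>c n\<bar> * F s) = (LINT t|lborel. S' t * F (p n + c n * t))" for n
    using c(2)[of n] by (subst lborel_integral_real_affine[of "c n" _ "p n"]) (auto simp: mult.assoc[symmetric])
  have "(\<lambda>n. LINT t|lborel. S' t * F (p n + c n * t)) \<longlonglongrightarrow> (LINT t|lborel. S' t * F p0)"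
  proof (rule integral_dominated_convergence[where w = "\<lambda>t. K * norm (S' t)"])
    show "AE t in lborel. (\<lambda>n. S' t * F (p n + c n * t)) \<longlonglongrightarrow> S' t * F p0"
    proof (intro AE_I2 tendsto_mult tendsto_const)
      fix t
      have "(\<lambda>n. p n + c n * t) \<longlonglongrightarrow> p0 + 0 * t" by (intro tendsto_intros p c)
      then show "(\<lambda>n. F (p n + c n * t)) \<longlonglongrightarrow> F p0"
        using continuous_on_tendsto_compose[OF F(1), of "\<lambda>n. p n + c n * t" p0] by simp
    qed
    show "AE t in lborel. norm (S' t * F (p n + c n * t)) \<le> K * norm (S' t)" for n
      using F(2) by (intro AE_I2) (simp add: abs_mult mult.commute[of K] mult_left_mono)
  qed (use Si in auto)
  then show ?thesis unfolding eq using Si by simp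
qed

text \<open>The test function is multiplied by a time cutoff that rises just after \<open>a\<close>
  and falls just before \<open>b\<close>. The derivative of the cutoff tends to a point mass at
  \<open>a\<close> minus one at \<open>b\<close>, and weak* continuity makes them boundary terms.
  Reversal, gluing and conservation of mass rest on this form.\<close>

theorem CE_boundary:
  fixes \<zeta> :: "real \<times> 'a::euclidean_space \<Rightarrow> real"
  assumes CE: "(\<mu>, \<nu>) \<in> CE \<Omega> \<mu>0 \<mu>1" and \<Omega>: "bounded \<Omega>" and \<zeta>: "smooth_compact \<zeta>" and ab: "0 \<le> a" "a < b" "b \<le> 1"
  shows "(LINT s:{a<..<b}|lborel. CE_integrand \<mu> \<nu> \<zeta> s) = (LINT x|\<mu> b. \<zeta> (b, x)) - (LINT x|\<mu> a. \<zeta> (a, x))"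
proof -
  obtain S S' :: "real \<Rightarrow> real" where S: "\<And>k. Ck k S" "\<And>x. x \<le> 0 \<Longrightarrow> S x = 0" "\<And>x. 1 \<le> x \<Longrightarrow> S x = 1" "mono S"
    and S': "continuous_on UNIV S'" "\<And>x. x \<le> 0 \<or> 1 \<le> x \<Longrightarrow> S' x = 0" "\<And>x. (S has_real_derivative S' x) (at x)"
    using smooth_step_exists by blast
  have S01: "0 \<le> S x" "S x \<le> 1" for x
    using monoD[OF S(4), of "min x 0" x] monoD[OF S(4), of x "max x 1"] S(2)[of "min x 0"] S(3)[of "max x 1"] by auto
  define F where "F s = (LINT x|\<mu> s. \<zeta> (s, x))" for s
  define H where "H = CE_integrand \<mu> \<nu> \<zeta>"
  have Fc: "continuous_on {0..1} F"
    unfolding F_def using continuous_integral_time_dependent[OF \<Omega> CED(3)[OF CE] smooth_compactD(3)[OF \<zeta>]] .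
  \<comment> \<open>Extension by constants, since the approximate identity works on the whole
    line.\<close>
  define F' where "F' s = F (max 0 (min 1 s))" for s
  have F'c: "continuous_on UNIV F'"
    unfolding F'_def by (rule continuous_on_compose2[OF Fc]) (auto intro!: continuous_intros)
  have "bounded (F ` {0..1})" using Fc by (intro compact_imp_bounded compact_continuous_image) auto
  then obtain K where K: "\<And>s. s \<in> {0..1} \<Longrightarrow> \<bar>F s\<bar> \<le> K" unfolding bounded_iff real_norm_def by (meson image_eqI)
  have F'K: "\<bar>F' s\<bar> \<le> K" for s unfolding F'_def by (rule K) auto
  have FF': "F' s = F s" if "s \<in> {0..1}" for s using that by (simp add: F'_def)
  have Hint: "set_integrable lborel {0<..<1} H"
    unfolding H_def by (rule integrable_CE_integrand[OF CE \<Omega> \<zeta>])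
  \<comment> \<open>The shift by 5 gives \<open>5 * h n \<le> b - a\<close>, so that the rise on
    [a + h, a + 2 h] and the fall on [b - 2 h, b - h] do not overlap.\<close>
  define h where "h n = (b - a) / real (n + 5)" for n :: nat
  have h0: "0 < h n" "5 * h n \<le> b - a" for n
  proof -
    show "0 < h n" using ab by (simp add: h_def)
    have "h n * real (n + 5) = b - a" by (simp add: h_def)
    moreover have "h n * 5 \<le> h n * real (n + 5)" using \<open>0 < h n\<close> by (intro mult_left_mono) auto
    ultimately show "5 * h n \<le> b - a" by simp
  qed
  have hlim: "h \<longlonglongrightarrow> 0"
    unfolding h_def using LIMSEQ_ignore_initial_segment[OF lim_const_over_n, of "b - a" 5] .
  let ?p = "\<lambda>n s. (s - a) / h n - 1" and ?q = "\<lambda>n s. (b - s) / h n - 1"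
  define \<eta> where "\<eta> n s = S (?p n s) * S (?q n s)" for n s
  define \<eta>' where "\<eta>' n s = S' ((s - (a + h n)) / h n) / \<bar>h n\<bar> - S' ((s - (b - h n)) / (- h n)) / \<bar>- h n\<bar>" for n s
  have \<eta>0: "\<eta> n s = 0" if "s \<le> a + h n \<or> b - h n \<le> s" for n s
    unfolding \<eta>_def using that h0(1)[of n] S(2)[of "?p n s"] S(2)[of "?q n s"] by (auto simp: field_simps)
  have \<eta>1: "\<eta> n s = 1" if "a + 2 * h n \<le> s" "s \<le> b - 2 * h n" for n s
    unfolding \<eta>_def using that h0(1)[of n] S(3)[of "?p n s"] S(3)[of "?q n s"] by (auto simp: field_simps)
  have \<eta>01: "0 \<le> \<eta> n s" "\<eta> n s \<le> 1" for n s unfolding \<eta>_def using S01 by (auto intro: mult_le_one)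
  have sa: "?p n s = (s - (a + h n)) / h n" "?q n s = (s - (b - h n)) / (- h n)" for n s
    using h0(1)[of n] by (auto simp: field_simps)
  have \<eta>D: "(\<eta> n has_real_derivative \<eta>' n s) (at s)" for n s
  proof -
    have "(\<eta> n has_real_derivative S' (?p n s) * (1 / h n) * S (?q n s) + S (?p n s) * (S' (?q n s) * (- 1 / h n))) (at s)"
      unfolding \<eta>_def[abs_def] using h0(1)[of n]
      by (auto intro!: derivative_eq_intros DERIV_chain2[OF S'(3)] simp: field_simps)
    \<comment> \<open>Where one factor of the cutoff varies, the other is already 1; so the
      derivative is a difference of two kernels.\<close>
    moreover have "S' (?p n s) * S (?q n s) = S' (?p n s)"
    proof (cases "s \<le> a + 2 * h n")
      case True
      then have "1 \<le> ?q n s" using h0[of n] by (simp add: field_simps)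
      then show ?thesis using S(3) by simp
    next
      case False
      then have "1 \<le> ?p n s" using h0(1)[of n] by (simp add: field_simps)
      then show ?thesis using S'(2) by simp
    qed
    moreover have "S (?p n s) * S' (?q n s) = S' (?q n s)"
    proof (cases "b - 2 * h n \<le> s")
      case True
      then have "1 \<le> ?p n s" using h0[of n] by (simp add: field_simps)
      then show ?thesis using S(3) by simp
    next
      case False
      then have "1 \<le> ?q n s" using h0(1)[of n] by (simp add: field_simps)
      then show ?thesis using S'(2) by simp
    qed
    moreover have "\<eta>' n s = S' (?p n s) * (1 / h n) + S' (?q n s) * (- 1 / h n)"
      unfolding \<eta>'_def sa[symmetric] using h0(1)[of n] by simp
    moreover have "p * q * r + u * (v * w) = (p * r) * q + (u * v) * w" for p q r u v w :: real
      by (simp only: ac_simps)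
    ultimately show ?thesis by simp
  qed
  define \<zeta>n where "\<zeta>n n z = \<eta> n (fst z) * \<zeta> z" for n z
  have Ck\<eta>: "Ck k (\<eta> n)" for k n
  proof -
    have "\<eta> n = (\<lambda>s. S ((- a / h n - 1) + (1 / h n) * s) * S ((b / h n - 1) + (- 1 / h n) * s))"
      using h0(1)[of n] by (auto simp: \<eta>_def fun_eq_iff diff_divide_distrib algebra_simps)
    moreover have "Ck k (\<lambda>s. S (p + q * s))" for p q by (rule Ck_affine[OF S(1)])
    ultimately show ?thesis by (simp only: Ck_mult)
  qed
  have test: "\<zeta>n n \<in> test_functions" for n
  proof -
    have sc: "smooth_compact (\<zeta>n n)"
      unfolding \<zeta>n_def[abs_def] by (rule smooth_compact_mult[OF Ck_comp_linear[OF bounded_linear_fst Ck\<eta>] \<zeta>])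
    have "{z. \<zeta>n n z \<noteq> 0} \<subseteq> {a + h n..b - h n} \<times> UNIV"
      using \<eta>0 by (auto simp: \<zeta>n_def) (meson linear)+
    then have "closure {z. \<zeta>n n z \<noteq> 0} \<subseteq> {a + h n..b - h n} \<times> UNIV"
      by (rule closure_minimal) (intro closed_Times, auto)
    also have "\<dots> \<subseteq> {0<..<1} \<times> UNIV" using h0(1)[of n] ab by auto
    finally show ?thesis using sc by (auto simp: test_functions_def smooth_compact_def compact_closure)
  qed
  have split: "CE_integrand \<mu> \<nu> (\<zeta>n n) s = \<eta>' n s * F' s + \<eta> n s * H s" if s: "s \<in> {0<..<1}" for n s
  proof -
    have f1: "time_deriv (\<zeta>n n) s x = \<eta> n s * time_deriv \<zeta> s x + \<eta>' n s * \<zeta> (s, x)" for x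
      unfolding \<zeta>n_def[abs_def] by (rule time_factor_derivs(1)[OF smooth_compactD(4)[OF \<zeta>] \<eta>D])
    have f2: "space_grad (\<zeta>n n) s = (\<lambda>x. \<eta> n s *\<^sub>R space_grad \<zeta> s x)"
      unfolding \<zeta>n_def[abs_def] by (rule ext, rule time_factor_derivs(2)[OF smooth_compactD(4)[OF \<zeta>] \<eta>D])
    have M: "\<mu> s \<in> Mplus \<Omega>" using CED(1)[OF CE] s by auto
    have "(LINT x|\<mu> s. time_deriv (\<zeta>n n) s x) = \<eta> n s * (LINT x|\<mu> s. time_deriv \<zeta> s x) + \<eta>' n s * F s"
      unfolding f1 F_def
      using Mplus_integrable[OF \<Omega> M smooth_compact_slices(1)[OF \<zeta>]] Mplus_integrable[OF \<Omega> M smooth_compact_slices(2)[OF \<zeta>]] by simp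
    moreover have "vec_integral (\<nu> s) (space_grad (\<zeta>n n) s) = \<eta> n s * vec_integral (\<nu> s) (space_grad \<zeta> s)"
      unfolding f2 by (rule vec_integral_cmult)
    ultimately show ?thesis using FF'[of s] s unfolding CE_integrand_def H_def by (simp add: distrib_left)
  qed
  have \<eta>'c: "continuous_on UNIV (\<eta>' n)" for n
    unfolding \<eta>'_def using h0(1)[of n]
    by (intro continuous_intros continuous_on_compose2[OF S'(1)]) auto
  have \<eta>'0: "\<eta>' n s = 0" if "s \<notin> {0<..<1}" for n s
  proof -
    have "S' ((s - (a + h n)) / h n) = 0" using that h0[of n] ab by (intro S'(2)) (auto simp: field_simps)
    moreover have "S' ((s - (b - h n)) / (- h n)) = 0" unfolding sa(2)[symmetric] using that h0[of n] ab by (intro S'(2)) (auto simp: field_simps)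
    ultimately show ?thesis unfolding \<eta>'_def by simp
  qed
  have [measurable]: "\<eta> n \<in> borel_measurable borel" for n
    using Ck\<eta>[of 0 n] by (auto intro: borel_measurable_continuous_onI)
  have i1: "set_integrable lborel {0<..<1} (\<lambda>s. \<eta>' n s * F' s)" for n
  proof (rule set_integrable_subset)
    show "set_integrable lborel {0..1} (\<lambda>s. \<eta>' n s * F' s)"
      by (intro borel_integrable_atLeastAtMost' continuous_intros continuous_on_subset[OF \<eta>'c] continuous_on_subset[OF F'c]) auto
  qed auto
  have i2: "set_integrable lborel {0<..<1} (\<lambda>s. \<eta> n s * H s)" for n
    unfolding set_integrable_def
  proof (rule Bochner_Integration.integrable_bound[OF Hint[unfolded set_integrable_def]])
    have [measurable]: "(\<lambda>s. indicator {0<..<1} s *\<^sub>R H s) \<in> borel_measurable borel"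
      using Hint unfolding set_integrable_def by auto
    have "(\<lambda>s. \<eta> n s * (indicator {0<..<1} s *\<^sub>R H s)) \<in> borel_measurable borel" by measurable
    then show "(\<lambda>s. indicator {0<..<1} s *\<^sub>R (\<eta> n s * H s)) \<in> borel_measurable lborel"
      by (simp add: mult.left_commute)
    show "AE s in lborel. norm (indicator {0<..<1} s *\<^sub>R (\<eta> n s * H s)) \<le> norm (indicator {0<..<1} s *\<^sub>R H s)"
      using \<eta>01[of n] by (intro AE_I2) (auto simp: indicator_def abs_mult intro!: mult_left_le_one_le)
  qed
  have zero: "(LINT s|lborel. \<eta>' n s * F' s) + (LINT s:{0<..<1}|lborel. \<eta> n s * H s) = 0" for n
  proof -
    have "0 = (LINT s:{0<..<1}|lborel. CE_integrand \<mu> \<nu> (\<zeta>n n) s)"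
      using CED(8)[OF CE test] unfolding CE_integrand_def by simp
    also have "\<dots> = (LINT s:{0<..<1}|lborel. \<eta>' n s * F' s + \<eta> n s * H s)"
      by (rule set_lebesgue_integral_cong) (use split in auto)
    also have "\<dots> = (LINT s:{0<..<1}|lborel. \<eta>' n s * F' s) + (LINT s:{0<..<1}|lborel. \<eta> n s * H s)"
      by (rule set_integral_add(2)[OF i1 i2])
    also have "(LINT s:{0<..<1}|lborel. \<eta>' n s * F' s) = (LINT s|lborel. \<eta>' n s * F' s)"
      unfolding set_lebesgue_integral_def using \<eta>'0 by (intro Bochner_Integration.integral_cong) (auto simp: indicator_def)
    finally show ?thesis by simp
  qed
  have "(\<lambda>n. LINT s|lborel. \<eta>' n s * F' s) \<longlonglongrightarrow> F' a - F' b"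
  proof -
    have one: "(\<lambda>n. LINT s|lborel. S' ((s - (a + h n)) / h n) / \<bar>h n\<bar> * F' s) \<longlonglongrightarrow> F' a"
    proof (rule approximate_identity[OF S' S(2) S(3) F'c F'K _ hlim])
      show "(\<lambda>n. a + h n) \<longlonglongrightarrow> a" using tendsto_add[OF tendsto_const hlim, of a] by simp
      show "h n \<noteq> 0" for n using h0(1)[of n] by simp
    qed auto
    have two: "(\<lambda>n. LINT s|lborel. S' ((s - (b - h n)) / (- h n)) / \<bar>- h n\<bar> * F' s) \<longlonglongrightarrow> F' b"
    proof (rule approximate_identity[OF S' S(2) S(3) F'c F'K])
      show "(\<lambda>n. b - h n) \<longlonglongrightarrow> b" using tendsto_diff[OF tendsto_const hlim, of b] by simp
      show "(\<lambda>n. - h n) \<longlonglongrightarrow> 0" using tendsto_minus[OF hlim] by simp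
      show "- h n \<noteq> 0" for n using h0(1)[of n] by simp
    qed auto
    have int: "integrable lborel (\<lambda>s. S' ((s - p) / q) / \<bar>q\<bar> * F' s)" if "q \<noteq> 0" for p q
    proof -
      have "compact ((\<lambda>t. p + q * t) ` {0..1})" by (intro compact_continuous_image continuous_intros) auto
      then obtain R where R: "\<And>s. s \<in> (\<lambda>t. p + q * t) ` {0..1} \<Longrightarrow> \<bar>s\<bar> \<le> R" using compact_imp_bounded[of "(\<lambda>t. p + q * t) ` {0..1}"] unfolding bounded_iff real_norm_def by blast
      have z: "S' ((s - p) / q) = 0" if "s \<notin> {-R..R}" for s
      proof (rule ccontr)
        assume "S' ((s - p) / q) \<noteq> 0"
        then have "(s - p) / q \<in> {0..1}" using S'(2)[of "(s - p) / q"] by (cases "0 \<le> (s - p) / q"; cases "(s - p) / q \<le> 1") auto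
        then have "s \<in> (\<lambda>t. p + q * t) ` {0..1}" using \<open>q \<noteq> 0\<close> by (intro image_eqI[of _ _ "(s - p) / q"]) auto
        then show False using R[of s] that by auto
      qed
      have "set_integrable lborel {-R..R} (\<lambda>s. S' ((s - p) / q) / \<bar>q\<bar> * F' s)"
        using that by (intro borel_integrable_atLeastAtMost' continuous_intros continuous_on_compose2[OF S'(1)] continuous_on_subset[OF F'c]) auto
      then show ?thesis unfolding set_integrable_def
        by (rule Bochner_Integration.integrable_cong[THEN iffD1, rotated 2]) (use z in \<open>auto simp: indicator_def\<close>)
    qed
    have "(LINT s|lborel. \<eta>' n s * F' s) = (LINT s|lborel. S' ((s - (a + h n)) / h n) / \<bar>h n\<bar> * F' s) -
       (LINT s|lborel. S' ((s - (b - h n)) / (- h n)) / \<bar>- h n\<bar> * F' s)" for n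
      unfolding \<eta>'_def left_diff_distrib using h0(1)[of n] int[of "h n" "a + h n"] int[of "- h n" "b - h n"]
      by (intro Bochner_Integration.integral_diff) auto
    then show ?thesis using tendsto_diff[OF one two] by simp
  qed
  moreover have "(\<lambda>n. LINT s:{0<..<1}|lborel. \<eta> n s * H s) \<longlonglongrightarrow> (LINT s:{a<..<b}|lborel. H s)"
    unfolding set_lebesgue_integral_def
  proof (rule integral_dominated_convergence[where w = "\<lambda>s. norm (indicator {0<..<1} s *\<^sub>R H s)"])
    have [measurable]: "(\<lambda>s. indicator {0<..<1} s *\<^sub>R H s) \<in> borel_measurable borel"
      using Hint unfolding set_integrable_def by auto
    have "(\<lambda>s. indicator {a<..<b} s *\<^sub>R (indicator {0<..<1} s *\<^sub>R H s)) \<in> borel_measurable borel" by measurable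
    moreover have "(\<lambda>s. indicator {a<..<b} s *\<^sub>R (indicator {0<..<1} s *\<^sub>R H s)) = (\<lambda>s. indicator {a<..<b} s *\<^sub>R H s)"
      using ab by (auto simp: indicator_def fun_eq_iff)
    ultimately show "(\<lambda>s. indicator {a<..<b} s *\<^sub>R H s) \<in> borel_measurable lborel" by simp
    show "(\<lambda>s. indicator {0<..<1} s *\<^sub>R (\<eta> n s * H s)) \<in> borel_measurable lborel" for n
      using i2[of n] unfolding set_integrable_def by auto
    show "integrable lborel (\<lambda>s. norm (indicator {0<..<1} s *\<^sub>R H s))"
      using Hint unfolding set_integrable_def by (rule integrable_norm)
    show "AE s in lborel. norm (indicator {0<..<1} s *\<^sub>R (\<eta> n s * H s)) \<le> norm (indicator {0<..<1} s *\<^sub>R H s)" for n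
      using \<eta>01[of n] by (intro AE_I2) (auto simp: indicator_def abs_mult intro!: mult_left_le_one_le)
    show "AE s in lborel. (\<lambda>n. indicator {0<..<1} s *\<^sub>R (\<eta> n s * H s)) \<longlonglongrightarrow> indicator {a<..<b} s *\<^sub>R H s"
    proof (intro AE_I2)
      fix s
      show "(\<lambda>n. indicator {0<..<1} s *\<^sub>R (\<eta> n s * H s)) \<longlonglongrightarrow> indicator {a<..<b} s *\<^sub>R H s"
      proof (cases "s \<in> {a<..<b}")
        case True
        then have "0 < min (s - a) (b - s) / 2" by auto
        then have "\<forall>\<^sub>F n in sequentially. h n < min (s - a) (b - s) / 2" by (rule order_tendstoD(2)[OF hlim])
        then have "\<forall>\<^sub>F n in sequentially. indicator {a<..<b} s *\<^sub>R H s = indicator {0<..<1} s *\<^sub>R (\<eta> n s * H s)"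
        proof eventually_elim
          case (elim n)
          then have "\<eta> n s = 1" by (intro \<eta>1) (auto simp: min_def split: if_splits)
          then show ?case using True ab by (auto simp: indicator_def)
        qed
        then show ?thesis by (rule Lim_transform_eventually[OF tendsto_const])
      next
        case False
        then have "\<eta> n s = 0" for n using h0(1)[of n] by (intro \<eta>0) auto
        then show ?thesis using False by simp
      qed
    qed
  qed
  ultimately have "(\<lambda>n. (LINT s|lborel. \<eta>' n s * F' s) + (LINT s:{0<..<1}|lborel. \<eta> n s * H s)) \<longlonglongrightarrow> F' a - F' b + (LINT s:{a<..<b}|lborel. H s)"
    by (rule tendsto_add)
  then have "F' a - F' b + (LINT s:{a<..<b}|lborel. H s) = 0" unfolding zero by (simp add: LIMSEQ_const_iff)
  then show ?thesis using FF'[of a] FF'[of b] ab by (simp add: F_def H_def)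
qed

section \<open>Operations on solutions of the continuity equation\<close>

lemma nn_integral_affine_scaled:
  fixes f :: "real \<Rightarrow> ennreal"
  assumes "0 < K" "c \<noteq> 0"
  shows "(\<integral>\<^sup>+s. ennreal K * f ((s - t) / c) \<partial>lborel) \<le> ennreal (K * \<bar>c\<bar>) * (\<integral>\<^sup>+s. f s \<partial>lborel)"
proof -
  have "(\<integral>\<^sup>+s. ennreal K * f ((s - t) / c) \<partial>lborel) \<le> ennreal K * (ennreal \<bar>c\<bar> * (\<integral>\<^sup>+s. f s \<partial>lborel))"
    using nn_integral_cmult_lower[OF assms(1)] nn_integral_affine_lower[OF assms(2)]
    by (rule order_trans[OF _ mult_left_mono]) auto
  then show ?thesis using assms by (simp add: ennreal_mult mult.assoc)
qed

text \<open>A solution run between the times \<open>t\<close> and \<open>t + c\<close>, whose flux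
  acquires the factor 1 / c. A test then sees only boundary terms, up to \<open>sgn c\<close>, and
  so pieces with a common end point can be added.\<close>

lemma CE_affine:
  fixes \<zeta> :: "real \<times> 'a::euclidean_space \<Rightarrow> real" and t c :: real
  assumes CE: "(\<mu>, \<nu>) \<in> CE \<Omega> \<mu>0 \<mu>1" and \<Omega>: "bounded \<Omega>" and c: "c \<noteq> 0" and \<zeta>: "smooth_compact \<zeta>"
  defines "h \<equiv> (\<lambda>s. indicator {0<..<1} ((s - t) / c) * CE_integrand (\<lambda>s. \<mu> ((s - t) / c)) (\<lambda>s B. (1 / c) *\<^sub>R \<nu> ((s - t) / c) B) \<zeta> s)"
  shows "integrable lborel h"
    "(LINT s|lborel. h s) = sgn c * ((LINT x|\<mu>1. \<zeta> (t + c, x)) - (LINT x|\<mu>0. \<zeta> (t, x)))"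
proof -
  define \<zeta>' where "\<zeta>' z = \<zeta> (t + c * fst z, snd z)" for z :: "real \<times> 'a"
  note z = smooth_compact_time_affine[OF \<zeta> c, of t, folded \<zeta>'_def[abs_def]]
  have sg: "space_grad \<zeta>' r = space_grad \<zeta> (t + c * r)" for r using z(3) by auto
  have h: "h (t + c * r) = (1 / c) * (indicator {0<..<1} r *\<^sub>R CE_integrand \<mu> \<nu> \<zeta>' r)" for r
  proof (cases "r \<in> {0<..<1}")
    case True
    have "vec_integral (\<lambda>B. (1 / c) *\<^sub>R \<nu> r B) (space_grad \<zeta> (t + c * r)) = (1 / c) * vec_integral (\<nu> r) (space_grad \<zeta> (t + c * r))"
    proof -
      obtain K where "\<And>s x. norm (space_grad \<zeta> s x) \<le> K" using bounded_space_grad[OF \<zeta>] by blast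
      then show ?thesis by (intro vec_integral_scaleR[OF CED(2)[OF CE True]] smooth_compact_slices(4)[OF \<zeta>])
    qed
    then show ?thesis using True c unfolding h_def CE_integrand_def sg z(2) by (simp add: distrib_left)
  qed (use c in \<open>simp add: h_def\<close>)
  have i: "integrable lborel (\<lambda>r. h (t + c * r))"
    unfolding h using integrable_CE_integrand(1)[OF CE \<Omega> z(1)] unfolding set_integrable_def
    by (intro integrable_mult_right) auto
  then show "integrable lborel h" using lborel_integrable_real_affine_iff[OF c, of h t] by simp
  have "(LINT s|lborel. h s) = \<bar>c\<bar> * (LINT r|lborel. h (t + c * r))"
    using lborel_integral_real_affine[OF c, of h t] by simp
  also have "(LINT r|lborel. h (t + c * r)) = (1 / c) * (LINT r:{0<..<1}|lborel. CE_integrand \<mu> \<nu> \<zeta>' r)"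
    unfolding h set_lebesgue_integral_def by simp
  also have "(LINT r:{0<..<1}|lborel. CE_integrand \<mu> \<nu> \<zeta>' r) = (LINT x|\<mu>1. \<zeta> (t + c, x)) - (LINT x|\<mu>0. \<zeta> (t, x))"
    using CE_boundary[OF CE \<Omega> z(1), of 0 1] CED(4,5)[OF CE] by (simp add: \<zeta>'_def)
  finally show "(LINT s|lborel. h s) = sgn c * ((LINT x|\<mu>1. \<zeta> (t + c, x)) - (LINT x|\<mu>0. \<zeta> (t, x)))"
    using c by (simp add: sgn_if)
qed

lemma test_functions_smooth_compact:
  assumes "\<zeta> \<in> test_functions"
  shows "smooth_compact \<zeta>" "s \<le> 0 \<or> 1 \<le> s \<Longrightarrow> \<zeta> (s, x) = 0"
    "\<exists>a b. 0 < a \<and> a < b \<and> b < 1 \<and> (\<forall>s x. s \<notin> {a..b} \<longrightarrow> (s, x) \<notin> closure {z. \<zeta> z \<noteq> 0})"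
proof -
  show "smooth_compact \<zeta>" using assms by (auto simp: test_functions_def smooth_compact_def compact_closure)
  have sub: "closure {z. \<zeta> z \<noteq> 0} \<subseteq> {0<..<1} \<times> UNIV" using assms by (auto simp: test_functions_def)
  then show "\<zeta> (s, x) = 0" if "s \<le> 0 \<or> 1 \<le> s" using that closure_subset[of "{z. \<zeta> z \<noteq> 0}"] by force
  let ?T = "fst ` closure {z. \<zeta> z \<noteq> 0}"
  have T: "compact ?T" "?T \<subseteq> {0<..<1}"
    using assms sub by (auto simp: test_functions_def intro!: compact_continuous_image continuous_intros)
  show "\<exists>a b. 0 < a \<and> a < b \<and> b < 1 \<and> (\<forall>s x. s \<notin> {a..b} \<longrightarrow> (s, x) \<notin> closure {z. \<zeta> z \<noteq> 0})"
  proof (cases "?T = {}")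
    case True
    then have "(s, x) \<notin> closure {z. \<zeta> z \<noteq> 0}" for s x by (metis empty_iff image_is_empty)
    then show ?thesis by (intro exI[of _ "1/3"] exI[of _ "2/3"]) simp
  next
    case False
    obtain p where p: "p \<in> ?T" "\<And>t. t \<in> ?T \<Longrightarrow> p \<le> t" using compact_attains_inf[OF T(1) False] by blast
    obtain q where q: "q \<in> ?T" "\<And>t. t \<in> ?T \<Longrightarrow> t \<le> q" using compact_attains_sup[OF T(1) False] by blast
    have pos: "0 < p" "q < 1" using subsetD[OF T(2) p(1)] subsetD[OF T(2) q(1)] by simp_all
    have "p \<le> q" by (rule p(2)[OF q(1)])
    \<comment> \<open>The half keeps the interval nondegenerate when the support lies at a single
      time.\<close>
    then have "0 < p / 2" "p / 2 < q" "q < 1" using pos by simp_all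
    moreover have "s \<in> {p/2..q}" if "(s, x) \<in> closure {z. \<zeta> z \<noteq> 0}" for s x
    proof -
      have "s \<in> ?T" using that by force
      then have "p \<le> s" "s \<le> q" using p(2) q(2) by blast+
      then show ?thesis using pos by simp
    qed
    ultimately show ?thesis by (intro exI[of _ "p / 2"] exI[of _ q]) auto
  qed
qed

lemma vec_integral_zero [simp]: "vec_integral (\<lambda>B. 0) \<xi> = 0"
  by (simp add: vec_integral_def signed_integral_def)

lemma borel_measurable_CE_flux:
  assumes CE: "(\<mu>, \<nu>) \<in> CE \<Omega> \<mu>0 \<mu>1" and B: "B \<in> sets borel"
  shows "(\<lambda>s. indicator {0<..<1} s *\<^sub>R \<nu> s B) \<in> borel_measurable borel"
  using CED(6)[OF CE B] by (subst (asm) borel_measurable_restrict_space_iff) auto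

lemma CE_reverse:
  assumes CE: "(\<mu>, \<nu>) \<in> CE \<Omega> \<mu>0 \<mu>1" and \<Omega>: "bounded \<Omega>"
  shows "(\<lambda>s. \<mu> (1 - s), \<lambda>s B. - \<nu> (1 - s) B) \<in> CE \<Omega> \<mu>1 \<mu>0"
proof -
  have ind: "indicator {0<..<1} (1 - s) = (indicator {0<..<1} s :: real)" for s :: real by (auto simp: indicator_def)
  have "continuous_map (top_of_set {0..1}) (weak_star (Mplus \<Omega>)) (\<lambda>s. \<mu> (1 - s))"
  proof (rule continuous_map_compose[OF _ CED(3)[OF CE], unfolded o_def])
    show "continuous_map (top_of_set {0..1}) (top_of_set {0..1}) (\<lambda>s::real. 1 - s)"
      by (auto intro!: continuous_intros)
  qed
  moreover have "(\<lambda>s. - \<nu> (1 - s) B) \<in> borel_measurable (restrict_space borel {0<..<1})" if B: "B \<in> sets borel" for B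
  proof -
    have "(\<lambda>s. - (indicator {0<..<1} (1 - s) *\<^sub>R \<nu> (1 - s) B)) \<in> borel_measurable borel"
      using measurable_compose[OF _ borel_measurable_CE_flux[OF CE B], of "\<lambda>s. 1 - s" borel] by simp
    then show ?thesis by (subst borel_measurable_restrict_space_iff) (auto simp: ind)
  qed
  moreover have "(\<integral>\<^sup>+ s \<in> {0<..<1}. total_var (\<lambda>B. - \<nu> (1 - s) B) (closure \<Omega>) \<partial>lborel) < \<infinity>"
  proof -
    have "total_var (\<lambda>B. - \<nu> (1 - s) B) (closure \<Omega>) = total_var (\<nu> (1 - s)) (closure \<Omega>)" for s
      by (rule total_var_cong) simp
    \<comment> \<open>\<open>(s - 1) / - 1\<close> is \<open>1 - s\<close> in the shape expected by
      the affine substitution.\<close>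
    then have "(\<integral>\<^sup>+ s \<in> {0<..<1}. total_var (\<lambda>B. - \<nu> (1 - s) B) (closure \<Omega>) \<partial>lborel) =
      (\<integral>\<^sup>+ s. total_var (\<nu> ((s - 1) / - 1)) (closure \<Omega>) * indicator {0<..<1} ((s - 1) / - 1) \<partial>lborel)"
      by (intro nn_integral_cong) (auto simp: indicator_def)
    also have "\<dots> \<le> ennreal \<bar>- 1\<bar> * (\<integral>\<^sup>+ s. total_var (\<nu> s) (closure \<Omega>) * indicator {0<..<1} s \<partial>lborel)"
      using nn_integral_affine_lower[of "-1" "\<lambda>s. total_var (\<nu> s) (closure \<Omega>) * indicator {0<..<1} s" 1] by simp
    also have "\<dots> < \<infinity>" using CED(7)[OF CE] by simp
    finally show ?thesis .
  qed
  moreover have "(LINT s:{0<..<1}|lborel. (\<integral>x. time_deriv \<zeta> s x \<partial>\<mu> (1 - s)) + vec_integral (\<lambda>B. - \<nu> (1 - s) B) (space_grad \<zeta> s)) = 0"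
    if \<zeta>: "\<zeta> \<in> test_functions" for \<zeta>
  proof -
    note t = test_functions_smooth_compact[OF \<zeta>]
    have "(LINT s:{0<..<1}|lborel. (\<integral>x. time_deriv \<zeta> s x \<partial>\<mu> (1 - s)) + vec_integral (\<lambda>B. - \<nu> (1 - s) B) (space_grad \<zeta> s))
     = (LINT s|lborel. indicator {0<..<1} ((s - 1) / - 1) * CE_integrand (\<lambda>s. \<mu> ((s - 1) / - 1)) (\<lambda>s B. (1 / - 1) *\<^sub>R \<nu> ((s - 1) / - 1) B) \<zeta> s)"
      unfolding set_lebesgue_integral_def CE_integrand_def by (simp add: ind)
    also have "\<dots> = 0" using CE_affine(2)[OF CE \<Omega> _ t(1), of "-1" 1] by (simp add: t(2))
    finally show ?thesis .
  qed
  moreover have "(\<lambda>B. - \<nu> (1 - s) B) \<in> Mvec \<Omega>" if "s \<in> {0<..<1}" for s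
    using Mvec_scaleR[OF CED(2)[OF CE], of "1 - s" "-1"] that by simp
  ultimately show ?thesis
    using CED(1,4,5)[OF CE] unfolding CE_def by simp
qed

text \<open>Running the first piece in time \<tau> multiplies its flux by 1 / \<tau> and its action
  by the square of that, over an interval of length \<tau>: the cost gains the factor 1 / \<tau>.
  The second piece behaves in the same way with 1 - \<tau>.\<close>

lemma CE_glue:
  fixes \<Omega> :: "'a::euclidean_space set"
  assumes m: "mobility m" and \<Omega>: "bounded \<Omega>" "open \<Omega>"
    and CE1: "(\<mu>1, \<nu>1) \<in> CE \<Omega> \<alpha> \<beta>" and CE2: "(\<mu>2, \<nu>2) \<in> CE \<Omega> \<beta> \<gamma>" and \<tau>: "0 < \<tau>" "\<tau> < 1"
  shows "\<exists>(M, N) \<in> CE \<Omega> \<alpha> \<gamma>. (\<integral>\<^sup>+ s \<in> {0<..<1}. action m \<Omega> (M s) (N s) \<partial>lborel) \<le>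
     ennreal (1 / \<tau>) * (\<integral>\<^sup>+ s \<in> {0<..<1}. action m \<Omega> (\<mu>1 s) (\<nu>1 s) \<partial>lborel) +
     ennreal (1 / (1 - \<tau>)) * (\<integral>\<^sup>+ s \<in> {0<..<1}. action m \<Omega> (\<mu>2 s) (\<nu>2 s) \<partial>lborel)"
proof -
  define \<tau>' where "\<tau>' = 1 - \<tau>"
  have \<tau>': "0 < \<tau>'" "\<tau> + \<tau>' = 1" using \<tau> by (auto simp: \<tau>'_def)
  let ?a = "\<lambda>s. (s - 0) / \<tau>" and ?b = "\<lambda>s. (s - \<tau>) / \<tau>'"
  define M where "M s = (if s \<le> \<tau> then \<mu>1 (?a s) else \<mu>2 (?b s))" for s
  \<comment> \<open>At the junction the flux is 0, which lies in \<open>Mvec \<Omega>\<close>; a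
    single instant does not affect the time integrals.\<close>
  define N where "N s = (if s < \<tau> then (\<lambda>B. (1 / \<tau>) *\<^sub>R \<nu>1 (?a s) B) else if s = \<tau> then (\<lambda>B. 0) else (\<lambda>B. (1 / \<tau>') *\<^sub>R \<nu>2 (?b s) B))" for s
  have r1: "?a s \<in> {0<..<1} \<longleftrightarrow> s \<in> {0<..<\<tau>}" for s using \<tau> by (auto simp: field_simps)
  have r2: "?b s \<in> {0<..<1} \<longleftrightarrow> s \<in> {\<tau><..<1}" for s using \<tau> \<tau>' by (auto simp: field_simps)
  have r3: "?a s \<in> {0..1} \<longleftrightarrow> s \<in> {0..\<tau>}" for s using \<tau> by (auto simp: field_simps)
  have r4: "?b s \<in> {0..1} \<longleftrightarrow> s \<in> {\<tau>..1}" for s using \<tau> \<tau>' by (auto simp: field_simps)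
  have MM: "M s \<in> Mplus \<Omega>" if "s \<in> {0..1}" for s
  proof (cases "s \<le> \<tau>")
    case True then show ?thesis using CED(1)[OF CE1, of "?a s"] r3[of s] that by (simp add: M_def)
  next
    case False then show ?thesis using CED(1)[OF CE2, of "?b s"] r4[of s] that by (simp add: M_def)
  qed
  have NN: "N s \<in> Mvec \<Omega>" if "s \<in> {0<..<1}" for s
  proof -
    consider "s < \<tau>" | "s = \<tau>" | "s > \<tau>" by linarith
    then show ?thesis
    proof cases
      case 1 then show ?thesis using Mvec_scaleR[OF CED(2)[OF CE1, of "?a s"]] r1[of s] that by (simp add: N_def)
    next
      case 3 then show ?thesis using Mvec_scaleR[OF CED(2)[OF CE2, of "?b s"]] r2[of s] that by (simp add: N_def)
    qed (simp add: N_def)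
  qed
  have cont: "continuous_map (top_of_set {0..1}) (weak_star (Mplus \<Omega>)) M"
    unfolding weak_star_continuous_map
  proof (intro conjI ballI allI impI)
    fix f :: "'a \<Rightarrow> real" assume f: "continuous_on UNIV f \<and> bounded {x. f x \<noteq> 0}"
    have c1: "continuous_on {0..1} (\<lambda>s. LINT x|\<mu>1 s. f x)" using CED(3)[OF CE1] f by (auto simp: weak_star_continuous_map)
    have c2: "continuous_on {0..1} (\<lambda>s. LINT x|\<mu>2 s. f x)" using CED(3)[OF CE2] f by (auto simp: weak_star_continuous_map)
    have "continuous_on {0..1} (\<lambda>s. if s \<le> \<tau> then (LINT x|\<mu>1 (?a s). f x) else (LINT x|\<mu>2 (?b s). f x))"
    proof (rule continuous_on_cases_le)
      show "continuous_on {s \<in> {0..1}. s \<le> \<tau>} (\<lambda>s. LINT x|\<mu>1 (?a s). f x)"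
        by (rule continuous_on_compose2[OF c1]) (use \<tau> in \<open>auto intro!: continuous_intros simp: field_simps\<close>)
      show "continuous_on {s \<in> {0..1}. \<tau> \<le> s} (\<lambda>s. LINT x|\<mu>2 (?b s). f x)"
        by (rule continuous_on_compose2[OF c2]) (use \<tau> \<tau>' in \<open>auto intro!: continuous_intros simp: field_simps\<close>)
      show "(LINT x|\<mu>1 (?a s). f x) = (LINT x|\<mu>2 (?b s). f x)" if "s \<in> {0..1}" "s = \<tau>" for s
        using that \<tau> CED(5)[OF CE1] CED(4)[OF CE2] by simp
    qed auto
    then show "continuous_map (top_of_set {0..1}) euclideanreal (\<lambda>s. LINT x|M s. f x)"
      by (simp add: M_def if_distrib[of "\<lambda>\<mu>. LINT x|\<mu>. f x"] cong: if_cong)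
  qed (use MM in auto)
  have meas: "(\<lambda>s. N s B) \<in> borel_measurable (restrict_space borel {0<..<1})" if B: "B \<in> sets borel" for B
  proof -
    have "(\<lambda>s. indicator {0<..<1} s *\<^sub>R N s B) = (\<lambda>s. (1 / \<tau>) *\<^sub>R (indicator {0<..<1} (?a s) *\<^sub>R \<nu>1 (?a s) B)
       + (1 / \<tau>') *\<^sub>R (indicator {0<..<1} (?b s) *\<^sub>R \<nu>2 (?b s) B))"
      using \<tau> unfolding indicator_def r1 r2 by (auto simp: fun_eq_iff N_def)
    also have "\<dots> \<in> borel_measurable borel"
    proof -
      have [measurable]: "(\<lambda>s. indicator {0<..<1} (?a s) *\<^sub>R \<nu>1 (?a s) B) \<in> borel_measurable borel"
        by (rule measurable_compose[OF _ borel_measurable_CE_flux[OF CE1 B]]) measurable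
      have [measurable]: "(\<lambda>s. indicator {0<..<1} (?b s) *\<^sub>R \<nu>2 (?b s) B) \<in> borel_measurable borel"
        by (rule measurable_compose[OF _ borel_measurable_CE_flux[OF CE2 B]]) measurable
      show ?thesis by (rule borel_measurable_add; rule borel_measurable_scaleR; measurable)
    qed
    finally show ?thesis by (subst borel_measurable_restrict_space_iff) auto
  qed
  have AE\<tau>: "AE s in lborel. s \<noteq> \<tau>" by (rule AE_lborel_singleton)
  \<comment> \<open>One estimate for the total variation, which scales linearly in the flux, and for
    the action, which scales quadratically.\<close>
  have lower: "(\<integral>\<^sup>+ s. f s * indicator {0<..<1} s \<partial>lborel) \<le>
      ennreal (K1 * \<tau>) * (\<integral>\<^sup>+ s. g1 s * indicator {0<..<1} s \<partial>lborel) + ennreal (K2 * \<tau>') * (\<integral>\<^sup>+ s. g2 s * indicator {0<..<1} s \<partial>lborel)"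
    if K: "0 < K1" "0 < K2" and f1: "\<And>s. s \<in> {0<..<\<tau>} \<Longrightarrow> f s \<le> ennreal K1 * g1 (?a s)"
      and f2: "\<And>s. s \<in> {\<tau><..<1} \<Longrightarrow> f s \<le> ennreal K2 * g2 (?b s)" for f g1 g2 :: "real \<Rightarrow> ennreal" and K1 K2
  proof -
    have "(\<integral>\<^sup>+ s. f s * indicator {0<..<1} s \<partial>lborel) \<le>
      (\<integral>\<^sup>+ s. ennreal K1 * (g1 (?a s) * indicator {0<..<1} (?a s)) \<partial>lborel) +
      (\<integral>\<^sup>+ s. ennreal K2 * (g2 (?b s) * indicator {0<..<1} (?b s)) \<partial>lborel)"
    proof (rule nn_integral_split_lower[where A = "{..<\<tau>}"])
      show "AE s in lborel. f s * indicator {0<..<1} s \<le> ennreal K1 * (g1 (?a s) * indicator {0<..<1} (?a s)) +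
         ennreal K2 * (g2 (?b s) * indicator {0<..<1} (?b s))"
        using AE\<tau>
      proof eventually_elim
        case (elim s)
        then consider "s \<in> {0<..<\<tau>}" | "s \<in> {\<tau><..<1}" | "s \<notin> {0<..<1}" by fastforce
        then show ?case
        proof cases
          case 1
          then show ?thesis using f1[OF 1] \<tau> unfolding indicator_def r1 r2 by auto
        next
          case 2
          then show ?thesis using f2[OF 2] \<tau> unfolding indicator_def r1 r2 by auto
        qed (auto simp: indicator_def)
      qed
    qed (unfold indicator_def r1 r2, auto)
    also have "\<dots> \<le> ennreal (K1 * \<bar>\<tau>\<bar>) * (\<integral>\<^sup>+ s. g1 s * indicator {0<..<1} s \<partial>lborel) + ennreal (K2 * \<bar>\<tau>'\<bar>) * (\<integral>\<^sup>+ s. g2 s * indicator {0<..<1} s \<partial>lborel)"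
      using \<tau> \<tau>' K by (intro add_mono nn_integral_affine_scaled[of _ _ "\<lambda>s. g1 s * indicator {0<..<1} s"] nn_integral_affine_scaled[of _ _ "\<lambda>s. g2 s * indicator {0<..<1} s"]) auto
    finally show ?thesis using \<tau> \<tau>' by simp
  qed
  have tv: "(\<integral>\<^sup>+ s \<in> {0<..<1}. total_var (N s) (closure \<Omega>) \<partial>lborel) < \<infinity>"
  proof -
    have "(\<integral>\<^sup>+ s \<in> {0<..<1}. total_var (N s) (closure \<Omega>) \<partial>lborel) \<le>
      ennreal (1 / \<tau> * \<tau>) * (\<integral>\<^sup>+ s. total_var (\<nu>1 s) (closure \<Omega>) * indicator {0<..<1} s \<partial>lborel) + ennreal (1 / \<tau>' * \<tau>') * (\<integral>\<^sup>+ s. total_var (\<nu>2 s) (closure \<Omega>) * indicator {0<..<1} s \<partial>lborel)"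
      using \<tau> \<tau>' by (intro lower) (auto simp: N_def total_var_scaleR)
    also have "\<dots> < \<infinity>" using CED(7)[OF CE1] CED(7)[OF CE2] by (simp add: ennreal_mult_less_top)
    finally show ?thesis .
  qed
  have energy: "(\<integral>\<^sup>+ s \<in> {0<..<1}. action m \<Omega> (M s) (N s) \<partial>lborel) \<le>
      ennreal ((1 / \<tau>)\<^sup>2 * \<tau>) * (\<integral>\<^sup>+ s \<in> {0<..<1}. action m \<Omega> (\<mu>1 s) (\<nu>1 s) \<partial>lborel) +
      ennreal ((1 / \<tau>')\<^sup>2 * \<tau>') * (\<integral>\<^sup>+ s \<in> {0<..<1}. action m \<Omega> (\<mu>2 s) (\<nu>2 s) \<partial>lborel)"
  proof (rule lower)
    fix s assume s: "s \<in> {0<..<\<tau>}"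
    have r: "?a s \<in> {0<..<1}" using s r1 by blast
    then have "?a s \<in> {0..1}" by auto
    then have "action m \<Omega> (\<mu>1 (?a s)) (\<lambda>B. (1 / \<tau>) *\<^sub>R \<nu>1 (?a s) B) = ennreal ((1 / \<tau>)\<^sup>2) * action m \<Omega> (\<mu>1 (?a s)) (\<nu>1 (?a s))"
      using \<Omega> \<tau> by (intro action_scaleR[OF _ m CED(1)[OF CE1] CED(2)[OF CE1 r]]) auto
    then show "action m \<Omega> (M s) (N s) \<le> ennreal ((1 / \<tau>)\<^sup>2) * action m \<Omega> (\<mu>1 (?a s)) (\<nu>1 (?a s))"
      using s by (simp add: M_def N_def)
  next
    fix s assume s: "s \<in> {\<tau><..<1}"
    have r: "?b s \<in> {0<..<1}" using s r2 by blast
    then have "?b s \<in> {0..1}" by auto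
    then have "action m \<Omega> (\<mu>2 (?b s)) (\<lambda>B. (1 / \<tau>') *\<^sub>R \<nu>2 (?b s) B) = ennreal ((1 / \<tau>')\<^sup>2) * action m \<Omega> (\<mu>2 (?b s)) (\<nu>2 (?b s))"
      using \<Omega> \<tau>' by (intro action_scaleR[OF _ m CED(1)[OF CE2] CED(2)[OF CE2 r]]) auto
    then show "action m \<Omega> (M s) (N s) \<le> ennreal ((1 / \<tau>')\<^sup>2) * action m \<Omega> (\<mu>2 (?b s)) (\<nu>2 (?b s))"
      using s by (simp add: M_def N_def)
  qed (use \<tau> \<tau>' in auto)
  have eq: "(LINT s:{0<..<1}|lborel. (LINT x|M s. time_deriv \<zeta> s x) + vec_integral (N s) (space_grad \<zeta> s)) = 0"
    if \<zeta>: "\<zeta> \<in> test_functions" for \<zeta>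
  proof -
    note t = test_functions_smooth_compact[OF \<zeta>]
    define h1 where "h1 s = indicator {0<..<1} (?a s) * CE_integrand (\<lambda>s. \<mu>1 (?a s)) (\<lambda>s B. (1 / \<tau>) *\<^sub>R \<nu>1 (?a s) B) \<zeta> s" for s
    define h2 where "h2 s = indicator {0<..<1} (?b s) * CE_integrand (\<lambda>s. \<mu>2 (?b s)) (\<lambda>s B. (1 / \<tau>') *\<^sub>R \<nu>2 (?b s) B) \<zeta> s" for s
    have \<tau>0: "\<tau> \<noteq> 0" "\<tau>' \<noteq> 0" using \<tau> \<tau>' by auto
    note i1 = CE_affine[OF CE1 \<Omega>(1) \<tau>0(1) t(1), of 0, folded h1_def] and i2 = CE_affine[OF CE2 \<Omega>(1) \<tau>0(2) t(1), of \<tau>, folded h2_def]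
    \<comment> \<open>The junction stays as an explicit case, from which measurability of the
      integrand is read off.\<close>
    have eqf: "indicator {0<..<1} s *\<^sub>R CE_integrand M N \<zeta> s = (if s = \<tau> then CE_integrand M N \<zeta> \<tau> else h1 s + h2 s)" for s
    proof -
      consider "s = \<tau>" | "s \<in> {0<..<\<tau>}" | "s \<in> {\<tau><..<1}" | "s \<notin> {0<..<1}" by fastforce
      then show ?thesis
      proof cases
        case 1 then show ?thesis using \<tau> by simp
      next
        case 2
        then have "h2 s = 0" "h1 s = CE_integrand M N \<zeta> s"
          unfolding h1_def h2_def indicator_def r1 r2 by (auto simp: CE_integrand_def M_def N_def)
        then show ?thesis using 2 \<tau> by (auto simp: indicator_def)
      next
        case 3
        then have "h1 s = 0" "h2 s = CE_integrand M N \<zeta> s"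
          unfolding h1_def h2_def indicator_def r1 r2 by (auto simp: CE_integrand_def M_def N_def)
        then show ?thesis using 3 \<tau> by (auto simp: indicator_def)
      next
        case 4
        then have "h1 s = 0" "h2 s = 0" using \<tau> unfolding h1_def h2_def indicator_def r1 r2 by auto
        then show ?thesis using 4 \<tau> by (auto simp: indicator_def)
      qed
    qed
    have hh: "AE s in lborel. h1 s + h2 s = indicator {0<..<1} s *\<^sub>R CE_integrand M N \<zeta> s"
      using AE\<tau> by eventually_elim (simp only: eqf if_False)
    have "(LINT s:{0<..<1}|lborel. CE_integrand M N \<zeta> s) = (LINT s|lborel. h1 s + h2 s)"
      unfolding set_lebesgue_integral_def
    proof (rule integral_cong_AE[symmetric])
      show m1: "(\<lambda>s. h1 s + h2 s) \<in> borel_measurable lborel" using i1(1) i2(1) by (intro borel_measurable_add) auto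
      show "(\<lambda>s. indicator {0<..<1} s *\<^sub>R CE_integrand M N \<zeta> s) \<in> borel_measurable lborel"
        unfolding eqf using m1 by (intro measurable_If) auto
      show "AE s in lborel. h1 s + h2 s = indicator {0<..<1} s *\<^sub>R CE_integrand M N \<zeta> s" by (rule hh)
    qed
    also have "\<dots> = (LINT s|lborel. h1 s) + (LINT s|lborel. h2 s)" using i1(1) i2(1) by simp
    \<comment> \<open>The two boundary terms at \<tau> cancel, and those at 0 and 1 vanish by the
      support of \<zeta>.\<close>
    also have "\<dots> = 0" unfolding i1(2) i2(2) using \<tau> \<tau>' by (simp add: t(2))
    finally show ?thesis unfolding CE_integrand_def .
  qed
  have "M 0 = \<alpha>" "M 1 = \<gamma>" using \<tau> \<tau>' CED(4)[OF CE1] CED(5)[OF CE2] by (auto simp: M_def \<tau>'_def)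
  then have "(M, N) \<in> CE \<Omega> \<alpha> \<gamma>" unfolding CE_def using MM NN cont meas tv eq by simp
  moreover have "(1 / \<tau>)\<^sup>2 * \<tau> = 1 / \<tau>" "(1 / \<tau>')\<^sup>2 * \<tau>' = 1 / (1 - \<tau>)" using \<tau> \<tau>' by (auto simp: power2_eq_square \<tau>'_def)
  ultimately show ?thesis using energy by (intro bexI[of _ "(M, N)"]) auto
qed

section \<open>Solutions described by trajectories\<close>

lemma integrable_pair_bounded:
  fixes f :: "'s \<Rightarrow> 'w \<Rightarrow> 'b::{banach, second_countable_topology}"
  assumes R: "finite_measure R" and P: "sigma_finite_measure P"
    and f[measurable]: "(\<lambda>(s, w). f s w) \<in> borel_measurable (R \<Otimes>\<^sub>M P)"
    and K: "\<And>s. s \<in> space R \<Longrightarrow> (\<integral>\<^sup>+w. ennreal (norm (f s w)) \<partial>P) \<le> ennreal K"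
  shows "integrable (R \<Otimes>\<^sub>M P) (\<lambda>(s, w). f s w)"
proof (rule integrableI_bounded)
  interpret R: finite_measure R by fact
  interpret P: sigma_finite_measure P by fact
  have "(\<integral>\<^sup>+x. ennreal (norm (case x of (s, w) \<Rightarrow> f s w)) \<partial>(R \<Otimes>\<^sub>M P)) = (\<integral>\<^sup>+s. \<integral>\<^sup>+w. ennreal (norm (f s w)) \<partial>P \<partial>R)"
    by (subst P.nn_integral_fst[symmetric]) simp_all
  also have "\<dots> \<le> (\<integral>\<^sup>+s. ennreal K \<partial>R)" by (intro nn_integral_mono K)
  also have "\<dots> < \<infinity>" by (simp add: R.emeasure_eq_measure ennreal_mult_less_top)
  finally show "(\<integral>\<^sup>+x. ennreal (norm (case x of (s, w) \<Rightarrow> f s w)) \<partial>(R \<Otimes>\<^sub>M P)) < \<infinity>" .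
qed (rule f)

text \<open>After the integrals are exchanged, the time integral of \<open>G'\<close> is a
  difference of values of \<open>G\<close> outside \<open>[a, b]\<close>, where \<open>G\<close> is
  0. If \<open>P\<close> is a law of trajectories and \<open>G\<close> a test function along them,
  this is the continuity equation in Lagrangian form.\<close>

lemma fubini_time_derivative:
  fixes G G' :: "real \<Rightarrow> 'w \<Rightarrow> real"
  assumes P: "finite_measure P"
    and D: "\<And>s w. s \<in> {0<..<1} \<Longrightarrow> w \<in> space P \<Longrightarrow> ((\<lambda>s. G s w) has_real_derivative G' s w) (at s)"
    and C: "\<And>w. w \<in> space P \<Longrightarrow> continuous_on {0<..<1} (\<lambda>s. G' s w)"
    and ab: "0 < a" "a < b" "b < 1"
    and zero: "\<And>s w. s \<notin> {a..b} \<Longrightarrow> w \<in> space P \<Longrightarrow> G s w = 0 \<and> G' s w = 0"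
    and M: "(\<lambda>(s, w). G' s w) \<in> borel_measurable (borel \<Otimes>\<^sub>M P)"
    and K: "\<And>s. s \<in> {0<..<1} \<Longrightarrow> AE w in P. \<bar>G' s w\<bar> \<le> K"
  shows "(LINT s:{0<..<1}|lborel. LINT w|P. G' s w) = 0"
proof -
  interpret P: finite_measure P by fact
  define R where "R = restrict_space lborel {0<..<1::real}"
  interpret R: finite_measure R
    unfolding R_def by (intro finite_measureI) (simp add: emeasure_restrict_space space_restrict_space)
  interpret RP: pair_sigma_finite R P ..
  have sR: "sets R = sets (restrict_space borel {0<..<1})" unfolding R_def by (simp add: sets_restrict_space)
  have int: "integrable (R \<Otimes>\<^sub>M P) (\<lambda>(s, w). G' s w)"
  proof (rule integrable_pair_bounded[OF R.finite_measure_axioms P.sigma_finite_measure_axioms])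
    have "(\<lambda>x. x) \<in> R \<Otimes>\<^sub>M P \<rightarrow>\<^sub>M borel \<Otimes>\<^sub>M P"
    proof -
      have "fst \<in> R \<Otimes>\<^sub>M P \<rightarrow>\<^sub>M borel"
        using measurable_compose[OF measurable_fst, of "\<lambda>x. x" R borel P] sR by (simp add: measurable_restrict_space1 cong: measurable_cong_sets)
      then have "(\<lambda>x. (fst x, snd x)) \<in> R \<Otimes>\<^sub>M P \<rightarrow>\<^sub>M borel \<Otimes>\<^sub>M P" by (intro measurable_Pair) auto
      then show ?thesis by simp
    qed
    from measurable_compose[OF this M] show [measurable]: "(\<lambda>(s, w). G' s w) \<in> borel_measurable (R \<Otimes>\<^sub>M P)" by simp
    show "(\<integral>\<^sup>+w. ennreal (norm (G' s w)) \<partial>P) \<le> ennreal (K * measure P (space P))" if "s \<in> space R" for s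
    proof -
      have "s \<in> {0<..<1}" using that by (simp add: R_def space_restrict_space)
      from K[OF this] have "AE w in P. ennreal (norm (G' s w)) \<le> ennreal K"
        by eventually_elim (simp add: ennreal_leI)
      then have "(\<integral>\<^sup>+w. ennreal (norm (G' s w)) \<partial>P) \<le> (\<integral>\<^sup>+w. ennreal K \<partial>P)"
        by (rule nn_integral_mono_AE)
      then show ?thesis by (simp add: P.emeasure_eq_measure ennreal_mult'')
    qed
  qed
  have inner: "(LINT s|R. G' s w) = 0" if w: "w \<in> space P" for w
  proof -
    \<comment> \<open>End points strictly outside \<open>[a, b]\<close>, where \<open>G\<close>
      vanishes, yet inside the open time interval, where it is differentiable.\<close>
    define a' b' where "a' = a / 2" and "b' = (b + 1) / 2"
    have ab': "0 < a'" "a' < a" "b < b'" "b' < 1" using ab by (auto simp: a'_def b'_def)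
    have "has_bochner_integral lborel (\<lambda>s. G' s w * indicator {a'..b'} s) (G b' w - G a' w)"
    proof (rule has_bochner_integral_FTC_Icc_real)
      show "a' \<le> b'" using ab ab' by simp
      fix s assume "a' \<le> s" "s \<le> b'"
      then have s: "s \<in> {0<..<1}" using ab' by auto
      show "((\<lambda>s. G s w) has_real_derivative G' s w) (at s)" by (rule D[OF s w])
      show "isCont (\<lambda>s. G' s w) s" using C[OF w] s by (auto simp: continuous_on_eq_continuous_at)
    qed
    then have "(LINT s|lborel. G' s w * indicator {a'..b'} s) = 0"
      using zero[of b' w] zero[of a' w] w ab' by (simp add: has_bochner_integral_iff)
    moreover have "(LINT s|R. G' s w) = (LINT s|lborel. G' s w * indicator {a'..b'} s)"
      unfolding R_def by (subst integral_restrict_space)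
        (use zero[of _ w] w ab' in \<open>auto simp: indicator_def intro!: Bochner_Integration.integral_cong\<close>)
    ultimately show ?thesis by simp
  qed
  have "(LINT s:{0<..<1}|lborel. LINT w|P. G' s w) = (LINT s|R. (LINT w|P. G' s w))"
    unfolding R_def set_lebesgue_integral_def by (subst integral_restrict_space) auto
  also have "\<dots> = (LINT w|P. (LINT s|R. G' s w))"
    using RP.Fubini_integral[OF int] by simp
  also have "\<dots> = (LINT w|P. 0)" by (intro Bochner_Integration.integral_cong refl inner)
  finally show ?thesis by simp
qed

lemma frechet_derivative_time_space:
  fixes \<zeta> :: "real \<times> 'a::euclidean_space \<Rightarrow> real"
  assumes \<zeta>: "smooth_compact \<zeta>"
  shows "frechet_derivative \<zeta> (at (s, x)) (h, v) = h * time_deriv \<zeta> s x + space_grad \<zeta> s x \<bullet> v"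
proof -
  let ?D = "frechet_derivative \<zeta> (at (s, x))"
  have lin: "linear ?D" using has_derivative_linear[OF smooth_compactD(4)[OF \<zeta>]] .
  have "(h, v) = h *\<^sub>R (1, 0) + (\<Sum>b\<in>Basis. (v \<bullet> b) *\<^sub>R (0::real, b))"
    by (simp add: prod_eq_iff fst_sum snd_sum euclidean_representation)
  then have "?D (h, v) = h * ?D (1, 0) + (\<Sum>b\<in>Basis. (v \<bullet> b) * ?D (0, b))"
    by (simp only: linear_add[OF lin] linear_sum[OF lin] linear_cmul[OF lin] real_scaleR_def)
  also have "(\<Sum>b\<in>Basis. (v \<bullet> b) * ?D (0, b)) = space_grad \<zeta> s x \<bullet> v"
    unfolding space_grad_def inner_sum_left inner_scaleR_left by (simp add: inner_commute mult.commute)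
  finally show ?thesis by (simp add: time_deriv_def)
qed

lemma smooth_compact_chain:
  fixes \<zeta> :: "real \<times> 'a::euclidean_space \<Rightarrow> real"
  assumes \<zeta>: "smooth_compact \<zeta>" and X: "(X has_vector_derivative v) (at s)"
  shows "((\<lambda>s. \<zeta> (s, X s)) has_real_derivative time_deriv \<zeta> s (X s) + space_grad \<zeta> s (X s) \<bullet> v) (at s)"
    "((\<lambda>s. \<zeta> (t, X s)) has_real_derivative space_grad \<zeta> t (X s) \<bullet> v) (at s)"
proof -
  have "((\<lambda>s. (s, X s)) has_derivative (\<lambda>h. (h, h *\<^sub>R v))) (at s)"
    using X unfolding has_vector_derivative_def by (intro has_derivative_Pair has_derivative_ident)
  from has_derivative_compose[OF this smooth_compactD(4)[OF \<zeta>]]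
  show "((\<lambda>s. \<zeta> (s, X s)) has_real_derivative time_deriv \<zeta> s (X s) + space_grad \<zeta> s (X s) \<bullet> v) (at s)"
    unfolding has_field_derivative_def frechet_derivative_time_space[OF \<zeta>]
    by (rule has_derivative_eq_rhs) (simp add: fun_eq_iff algebra_simps)
  have "((\<lambda>s. (t, X s)) has_derivative (\<lambda>h. (0, h *\<^sub>R v))) (at s)"
    using X unfolding has_vector_derivative_def by (intro has_derivative_Pair has_derivative_const)
  from has_derivative_compose[OF this smooth_compactD(4)[OF \<zeta>]]
  show "((\<lambda>s. \<zeta> (t, X s)) has_real_derivative space_grad \<zeta> t (X s) \<bullet> v) (at s)"
    unfolding has_field_derivative_def frechet_derivative_time_space[OF \<zeta>]
    by (rule has_derivative_eq_rhs) (simp add: fun_eq_iff algebra_simps)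
qed

lemma derivs_outside_support:
  assumes "(s, x) \<notin> closure {z. \<zeta> z \<noteq> 0}"
  shows "\<zeta> (s, x) = 0" "time_deriv \<zeta> s x = 0" "space_grad \<zeta> s x = 0"
  using assms closure_subset[of "{z. \<zeta> z \<noteq> 0}"] by (auto simp: time_deriv_def space_grad_def frechet_derivative_eq_0)

lemma CE_constant:
  fixes \<Omega> :: "'a::euclidean_space set"
  assumes \<mu>: "\<mu> \<in> Mplus \<Omega>"
  shows "(\<lambda>_. \<mu>, \<lambda>_ _. 0) \<in> CE \<Omega> \<mu> \<mu>"
proof -
  have "(LINT s:{0<..<1}|lborel. (LINT x|\<mu>. time_deriv \<zeta> s x)) = 0" if \<zeta>: "\<zeta> \<in> test_functions" for \<zeta> :: "real \<times> 'a \<Rightarrow> real"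
  proof -
    note t = test_functions_smooth_compact[OF \<zeta>]
    obtain a b where ab: "0 < a" "a < b" "b < 1" "\<And>s x. s \<notin> {a..b} \<Longrightarrow> (s, x) \<notin> closure {z. \<zeta> z \<noteq> 0}"
      using t(3) by blast
    obtain K where K: "\<And>s x. \<bar>time_deriv \<zeta> s x\<bar> \<le> K" using bounded_time_deriv[OF t(1)] by blast
    have c: "continuous_on UNIV (\<lambda>z. time_deriv \<zeta> (fst z) (snd z))" by (rule continuous_time_deriv[OF t(1)])
    show ?thesis
    proof (rule fubini_time_derivative[OF MplusD(2)[OF \<mu>] _ _ ab(1-3), where G = "\<lambda>s x. \<zeta> (s, x)" and K = K])
      show "((\<lambda>s. \<zeta> (s, w)) has_real_derivative time_deriv \<zeta> s w) (at s)" for s w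
        using smooth_compact_chain(1)[OF t(1), of "\<lambda>_. w" 0 s] by simp
      show "continuous_on {0<..<1} (\<lambda>s. time_deriv \<zeta> s w)" for w
        using continuous_on_compose2[OF c, of "{0<..<1}" "\<lambda>s. (s, w)"] by (simp add: continuous_intros)
      have "(\<lambda>z. time_deriv \<zeta> (fst z) (snd z)) \<in> borel_measurable (borel \<Otimes>\<^sub>M borel)"
        using borel_measurable_continuous_onI[OF c] by (simp add: borel_prod)
      then show "(\<lambda>(s, w). time_deriv \<zeta> s w) \<in> borel_measurable (borel \<Otimes>\<^sub>M \<mu>)"
        unfolding measurable_cong_sets[OF sets_pair_measure_cong[OF refl MplusD(1)[OF \<mu>]] refl] by (simp add: split_beta')
      show "\<zeta> (s, w) = 0 \<and> time_deriv \<zeta> s w = 0" if "s \<notin> {a..b}" for s w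
        using derivs_outside_support(1,2)[OF ab(4)[OF that]] by simp
    qed (use K in auto)
  qed
  moreover have "continuous_map (top_of_set {0..1}) (weak_star (Mplus \<Omega>)) (\<lambda>_. \<mu>)"
    unfolding weak_star_continuous_map using \<mu> by simp
  ultimately show ?thesis using \<mu> by (simp add: CE_def total_var_eq_0)
qed

section \<open>The distance\<close>

lemma Wdist_le:
  assumes "(\<mu>, \<nu>) \<in> CE \<Omega> \<alpha> \<beta>" "(\<integral>\<^sup>+ s \<in> {0<..<1}. action m \<Omega> (\<mu> s) (\<nu> s) \<partial>lborel) \<le> ennreal (r\<^sup>2)" "0 \<le> r"
  shows "Wdist m \<Omega> \<alpha> \<beta> \<le> ennreal r"
proof -
  have "Wdist_sq m \<Omega> \<alpha> \<beta> \<le> ennreal (r\<^sup>2)"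
    unfolding Wdist_sq_def by (rule order_trans[OF INF_lower[OF assms(1)]]) (use assms(2) in simp)
  then obtain q where q: "Wdist_sq m \<Omega> \<alpha> \<beta> = ennreal q" "0 \<le> q" "q \<le> r\<^sup>2"
    by (cases "Wdist_sq m \<Omega> \<alpha> \<beta>") (auto simp: top_unique)
  have "sqrt q \<le> r" using q assms(3) by (intro real_le_lsqrt) auto
  then show ?thesis using q by (simp add: Wdist_def ennreal_leI)
qed

lemma Wdist_lessD:
  assumes "Wdist m \<Omega> \<alpha> \<beta> < ennreal r"
  shows "\<exists>\<mu> \<nu>. (\<mu>, \<nu>) \<in> CE \<Omega> \<alpha> \<beta> \<and> (\<integral>\<^sup>+ s \<in> {0<..<1}. action m \<Omega> (\<mu> s) (\<nu> s) \<partial>lborel) < ennreal (r\<^sup>2)"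
proof -
  have ne: "Wdist_sq m \<Omega> \<alpha> \<beta> \<noteq> \<infinity>" using assms by (auto simp: Wdist_def split: if_splits)
  then obtain q where q: "Wdist_sq m \<Omega> \<alpha> \<beta> = ennreal q" "0 \<le> q" by (cases "Wdist_sq m \<Omega> \<alpha> \<beta>") auto
  then have "sqrt q < r" using assms ne by (simp add: Wdist_def ennreal_less_iff)
  then have "q < r\<^sup>2" using q(2) by (metis real_sqrt_ge_zero real_sqrt_less_iff real_sqrt_pow2 real_sqrt_power power_strict_mono zero_less_numeral)
  then have "Wdist_sq m \<Omega> \<alpha> \<beta> < ennreal (r\<^sup>2)" using q by (simp add: ennreal_less_iff)
  then show ?thesis unfolding Wdist_sq_def INF_less_iff by auto
qed

lemma Wdist_self:
  assumes m: "mobility m" and \<mu>: "\<mu> \<in> Mplus \<Omega>" shows "Wdist m \<Omega> \<mu> \<mu> = 0"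
  using Wdist_le[OF CE_constant[OF \<mu>], of m 0] action_zero[OF m \<mu>] by simp

lemma Wdist_commute:
  fixes \<Omega> :: "'a::euclidean_space set"
  assumes m: "mobility m" and \<Omega>: "bounded \<Omega>" "open \<Omega>"
  shows "Wdist m \<Omega> \<alpha> \<beta> = Wdist m \<Omega> \<beta> \<alpha>"
proof -
  have "Wdist_sq m \<Omega> \<alpha> \<beta> \<le> Wdist_sq m \<Omega> \<beta> \<alpha>" for \<alpha> \<beta> :: "'a measure"
    unfolding Wdist_sq_def
  proof (rule INF_greatest, clarify)
    fix \<mu> \<nu> assume CE: "(\<mu>, \<nu>) \<in> CE \<Omega> \<beta> \<alpha>"
    have a: "action m \<Omega> (\<mu> (1 - s)) (\<lambda>B. - \<nu> (1 - s) B) = action m \<Omega> (\<mu> (1 - s)) (\<nu> (1 - s))" if "s \<in> {0<..<1}" for s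
      using action_scaleR[OF _ m CED(1)[OF CE, of "1 - s"] CED(2)[OF CE, of "1 - s"], of "-1"] that \<Omega> by simp
    have "(INF (\<mu>, \<nu>) \<in> CE \<Omega> \<alpha> \<beta>. \<integral>\<^sup>+ s \<in> {0<..<1}. action m \<Omega> (\<mu> s) (\<nu> s) \<partial>lborel) \<le>
      (\<integral>\<^sup>+ s \<in> {0<..<1}. action m \<Omega> (\<mu> (1 - s)) (\<lambda>B. - \<nu> (1 - s) B) \<partial>lborel)"
      by (rule order_trans[OF INF_lower[OF CE_reverse[OF CE \<Omega>(1)]]]) simp
    also have "\<dots> = (\<integral>\<^sup>+ s. action m \<Omega> (\<mu> ((s - 1) / -1)) (\<nu> ((s - 1) / -1)) * indicator {0<..<1} ((s - 1) / -1) \<partial>lborel)"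
      by (intro nn_integral_cong) (auto simp: indicator_def a)
    also have "\<dots> \<le> ennreal \<bar>- 1\<bar> * (\<integral>\<^sup>+ s \<in> {0<..<1}. action m \<Omega> (\<mu> s) (\<nu> s) \<partial>lborel)"
      by (rule nn_integral_affine_lower[of "-1" "\<lambda>s. action m \<Omega> (\<mu> s) (\<nu> s) * indicator {0<..<1} s"]) simp
    finally show "(INF (\<mu>, \<nu>) \<in> CE \<Omega> \<alpha> \<beta>. \<integral>\<^sup>+ s \<in> {0<..<1}. action m \<Omega> (\<mu> s) (\<nu> s) \<partial>lborel) \<le>
      (\<integral>\<^sup>+ s \<in> {0<..<1}. action m \<Omega> (\<mu> s) (\<nu> s) \<partial>lborel)" by simp
  qed
  then have "Wdist_sq m \<Omega> \<alpha> \<beta> = Wdist_sq m \<Omega> \<beta> \<alpha>" by (intro antisym) auto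
  then show ?thesis by (simp add: Wdist_def)
qed

text \<open>Travelling the two pieces in times \<open>\<tau> = p / (p + q)\<close> and \<open>1 - \<tau>\<close> costs
  \<open>p\<^sup>2 / \<tau> + q\<^sup>2 / (1 - \<tau>) = (p + q)\<^sup>2\<close>.\<close>

lemma Wdist_triangle_strict:
  assumes m: "mobility m" and \<Omega>: "bounded \<Omega>" "open \<Omega>"
    and p: "Wdist m \<Omega> \<alpha> \<beta> < ennreal p" and q: "Wdist m \<Omega> \<beta> \<gamma> < ennreal q"
  shows "Wdist m \<Omega> \<alpha> \<gamma> \<le> ennreal (p + q)"
proof -
  have pq: "0 < p" "0 < q" using le_less_trans[OF zero_le p] le_less_trans[OF zero_le q] by simp_all
  define \<tau> where "\<tau> = p / (p + q)"
  have \<tau>: "0 < \<tau>" "\<tau> < 1" using pq by (auto simp: \<tau>_def)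
  obtain \<mu>1 \<nu>1 where 1: "(\<mu>1, \<nu>1) \<in> CE \<Omega> \<alpha> \<beta>" "(\<integral>\<^sup>+ s \<in> {0<..<1}. action m \<Omega> (\<mu>1 s) (\<nu>1 s) \<partial>lborel) < ennreal (p\<^sup>2)"
    using Wdist_lessD[OF p] by blast
  obtain \<mu>2 \<nu>2 where 2: "(\<mu>2, \<nu>2) \<in> CE \<Omega> \<beta> \<gamma>" "(\<integral>\<^sup>+ s \<in> {0<..<1}. action m \<Omega> (\<mu>2 s) (\<nu>2 s) \<partial>lborel) < ennreal (q\<^sup>2)"
    using Wdist_lessD[OF q] by blast
  obtain M N where MN: "(M, N) \<in> CE \<Omega> \<alpha> \<gamma>" and le: "(\<integral>\<^sup>+ s \<in> {0<..<1}. action m \<Omega> (M s) (N s) \<partial>lborel) \<le>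
     ennreal (1 / \<tau>) * (\<integral>\<^sup>+ s \<in> {0<..<1}. action m \<Omega> (\<mu>1 s) (\<nu>1 s) \<partial>lborel) +
     ennreal (1 / (1 - \<tau>)) * (\<integral>\<^sup>+ s \<in> {0<..<1}. action m \<Omega> (\<mu>2 s) (\<nu>2 s) \<partial>lborel)"
    using CE_glue[OF m \<Omega> 1(1) 2(1) \<tau>] by blast
  note le
  also have "ennreal (1 / \<tau>) * (\<integral>\<^sup>+ s \<in> {0<..<1}. action m \<Omega> (\<mu>1 s) (\<nu>1 s) \<partial>lborel) +
     ennreal (1 / (1 - \<tau>)) * (\<integral>\<^sup>+ s \<in> {0<..<1}. action m \<Omega> (\<mu>2 s) (\<nu>2 s) \<partial>lborel) \<le> ennreal (1 / \<tau>) * ennreal (p\<^sup>2) + ennreal (1 / (1 - \<tau>)) * ennreal (q\<^sup>2)"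
    using 1(2) 2(2) by (intro add_mono mult_left_mono) auto
  also have "\<dots> = ennreal (1 / \<tau> * p\<^sup>2 + 1 / (1 - \<tau>) * q\<^sup>2)"
    using \<tau> by (simp add: ennreal_mult[symmetric] ennreal_plus[symmetric] del: ennreal_plus)
  also have "1 / \<tau> * p\<^sup>2 + 1 / (1 - \<tau>) * q\<^sup>2 = (p + q)\<^sup>2"
  proof -
    have e: "1 - \<tau> = q / (p + q)" using pq by (simp add: \<tau>_def field_simps)
    have "1 / \<tau> * p\<^sup>2 = (p + q) * p" using pq by (simp add: \<tau>_def power2_eq_square)
    moreover have "1 / (1 - \<tau>) * q\<^sup>2 = (p + q) * q" unfolding e using pq by (simp add: power2_eq_square)
    ultimately show ?thesis by (simp add: power2_eq_square algebra_simps)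
  qed
  finally show ?thesis using pq by (intro Wdist_le[OF MN]) simp_all
qed

text \<open>Enlarging both distances by e / 2 makes nearly optimal paths available and keeps both
  travel times positive when a distance is 0.\<close>

lemma Wdist_triangle:
  assumes m: "mobility m" and \<Omega>: "bounded \<Omega>" "open \<Omega>"
  shows "Wdist m \<Omega> \<alpha> \<gamma> \<le> Wdist m \<Omega> \<alpha> \<beta> + Wdist m \<Omega> \<beta> \<gamma>"
proof (cases "Wdist m \<Omega> \<alpha> \<beta> = \<infinity> \<or> Wdist m \<Omega> \<beta> \<gamma> = \<infinity>")
  case False
  then obtain p q where p: "Wdist m \<Omega> \<alpha> \<beta> = ennreal p" "0 \<le> p" and q: "Wdist m \<Omega> \<beta> \<gamma> = ennreal q" "0 \<le> q"
    by (cases "Wdist m \<Omega> \<alpha> \<beta>"; cases "Wdist m \<Omega> \<beta> \<gamma>") auto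
  have "Wdist m \<Omega> \<alpha> \<gamma> \<le> ennreal (p + q)"
  proof (rule ennreal_le_epsilon)
    fix e :: real assume "0 < e"
    then have "Wdist m \<Omega> \<alpha> \<gamma> \<le> ennreal ((p + e / 2) + (q + e / 2))"
      using p q by (intro Wdist_triangle_strict[OF m \<Omega>, where \<beta> = \<beta>]) (simp_all add: ennreal_less_iff del: ennreal_plus)
    then show "Wdist m \<Omega> \<alpha> \<gamma> \<le> ennreal (p + q) + ennreal e"
      using p q \<open>0 < e\<close> by (simp add: ennreal_plus[symmetric] algebra_simps del: ennreal_plus)
  qed
  then show ?thesis using p q by simp
qed auto

section \<open>The distance controls integrals of continuous functions\<close>

text \<open>For testing with functions that lack compact support: where the measures live, the
  cutoff and its derivative leave no trace.\<close>

lemma time_space_cutoff: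
  fixes \<Omega> :: "'a::euclidean_space set"
  assumes \<Omega>: "bounded \<Omega>"
  obtains \<psi> :: "real \<times> 'a \<Rightarrow> real" where "smooth_compact \<psi>"
    "\<And>s x. s \<in> {0..1} \<Longrightarrow> x \<in> closure \<Omega> \<Longrightarrow> \<psi> (s, x) = 1"
    "\<And>s x. s \<in> {0..1} \<Longrightarrow> x \<in> closure \<Omega> \<Longrightarrow> (\<psi> has_derivative (\<lambda>v. 0)) (at (s, x))"
proof -
  have "bounded ({0..1::real} \<times> closure \<Omega>)" using \<Omega> by (intro bounded_Times) (auto simp: bounded_closure)
  from smooth_cutoff[OF this] obtain \<psi> :: "real \<times> 'a \<Rightarrow> real" and U where \<psi>: "smooth_compact \<psi>" "open U" "{0..1} \<times> closure \<Omega> \<subseteq> U" "\<And>z. z \<in> U \<Longrightarrow> \<psi> z = 1"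
    by blast
  show thesis
  proof (rule that[OF \<psi>(1)])
    fix s :: real and x assume sx: "s \<in> {0..1}" "x \<in> closure \<Omega>"
    then have U: "(s, x) \<in> U" using \<psi>(3) by auto
    then show "\<psi> (s, x) = 1" by (rule \<psi>(4))
    show "(\<psi> has_derivative (\<lambda>v. 0)) (at (s, x))"
      by (rule has_derivative_transform_within_open[of "\<lambda>_. 1", OF _ \<psi>(2) U]) (auto simp: \<psi>(4))
  qed
qed

text \<open>The constant 1 is tested, cut off far from the domain: on the closure it has neither a
  time derivative nor a gradient.\<close>

lemma CE_mass:
  fixes \<Omega> :: "'a::euclidean_space set"
  assumes CE: "(\<mu>, \<nu>) \<in> CE \<Omega> \<mu>0 \<mu>1" and \<Omega>: "bounded \<Omega>" and t: "t \<in> {0..1}"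
  shows "emeasure (\<mu> t) UNIV = emeasure \<mu>0 UNIV"
proof (cases "t = 0")
  case True then show ?thesis using CED(4)[OF CE] by simp
next
  case False
  obtain \<psi> :: "real \<times> 'a \<Rightarrow> real" where \<psi>: "smooth_compact \<psi>" "\<And>s x. s \<in> {0..1} \<Longrightarrow> x \<in> closure \<Omega> \<Longrightarrow> \<psi> (s, x) = 1"
    "\<And>s x. s \<in> {0..1} \<Longrightarrow> x \<in> closure \<Omega> \<Longrightarrow> (\<psi> has_derivative (\<lambda>v. 0)) (at (s, x))"
    by (rule time_space_cutoff[OF \<Omega>]) blast
  have fd: "frechet_derivative \<psi> (at (s, x)) = (\<lambda>v. 0)" if "s \<in> {0..1}" "x \<in> closure \<Omega>" for s x
    using frechet_derivative_at[OF \<psi>(3)[OF that]] by simp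
  have z: "CE_integrand \<mu> \<nu> \<psi> s = 0" if s: "s \<in> {0<..<1}" for s
  proof -
    have s': "s \<in> {0..1}" using s by auto
    have "(LINT x|\<mu> s. time_deriv \<psi> s x) = (LINT x|\<mu> s. 0)"
      by (rule Mplus_integral_cong[OF CED(1)[OF CE s']])
        (auto simp: time_deriv_def fd[OF s'] intro!: borel_measurable_continuous_onI smooth_compact_slices(2)[OF \<psi>(1), unfolded time_deriv_def])
    moreover have "\<bar>vec_integral (\<nu> s) (space_grad \<psi> s)\<bar> \<le> 0"
      using vec_integral_Mvec_bound[OF CED(2)[OF CE s] smooth_compact_slices(4)[OF \<psi>(1)], of s 0]
      by (simp add: space_grad_def fd[OF s'] ennreal_le_iff2)
    ultimately show ?thesis by (simp add: CE_integrand_def)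
  qed
  have "(LINT s:{0<..<t}|lborel. CE_integrand \<mu> \<nu> \<psi> s) = 0"
    unfolding set_lebesgue_integral_def using z t
    by (subst Bochner_Integration.integral_cong[where g = "\<lambda>_. 0"]) (auto simp: indicator_def)
  then have "(LINT x|\<mu> t. \<psi> (t, x)) = (LINT x|\<mu> 0. \<psi> (0, x))"
    using CE_boundary[OF CE \<Omega> \<psi>(1), of 0 t] t False by auto
  moreover have m1: "(LINT x|\<mu> s. \<psi> (s, x)) = measure (\<mu> s) UNIV" if s: "s \<in> {0..1}" for s
  proof -
    have "(LINT x|\<mu> s. \<psi> (s, x)) = (LINT x|\<mu> s. 1)"
      by (rule Mplus_integral_cong[OF CED(1)[OF CE s]])
        (auto simp: \<psi>(2)[OF s] intro!: borel_measurable_continuous_onI smooth_compact_slices(1)[OF \<psi>(1)])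
    then show ?thesis using MplusD(4)[OF CED(1)[OF CE s]] by simp
  qed
  ultimately have "measure (\<mu> t) UNIV = measure \<mu>0 UNIV" using m1[OF t] m1[of 0] CED(4)[OF CE] by simp
  then show ?thesis
    using finite_measure.emeasure_eq_measure[OF MplusD(2)[OF CED(1)[OF CE t]], of UNIV]
      finite_measure.emeasure_eq_measure[OF MplusD(2)[OF CED(1)[OF CE, of 0]], of UNIV] CED(4)[OF CE] by simp
qed

text \<open>The increment is the time integral of the flux against the gradient of \<open>p\<close>.
  By \<open>action_controls_flux\<close> with l = 1 / r, twice the flux is at most the action over r
  plus \<open>Bd * r\<close>. With total action below r^2 this integrates to at most (1 + Bd)
  r.\<close>

lemma Wdist_controls_polynomial:
  fixes \<Omega> :: "'a::euclidean_space set"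
  assumes m: "mobility m" and \<Omega>: "bounded \<Omega>" "open \<Omega>" "convex \<Omega>" and c: "0 \<le> c" and p: "real_polynomial_function p"
  shows "\<exists>L\<ge>0. \<forall>\<mu>0 \<mu>1 r. \<mu>0 \<in> Mplus_mass \<Omega> c \<longrightarrow> 0 < r \<longrightarrow> Wdist m \<Omega> \<mu>0 \<mu>1 < ennreal r \<longrightarrow>
    \<bar>(LINT x|\<mu>1. p x) - (LINT x|\<mu>0. p x)\<bar> \<le> L * r"
proof -
  obtain \<psi> :: "real \<times> 'a \<Rightarrow> real" where \<psi>: "smooth_compact \<psi>" "\<And>s x. s \<in> {0..1} \<Longrightarrow> x \<in> closure \<Omega> \<Longrightarrow> \<psi> (s, x) = 1"
    "\<And>s x. s \<in> {0..1} \<Longrightarrow> x \<in> closure \<Omega> \<Longrightarrow> (\<psi> has_derivative (\<lambda>v. 0)) (at (s, x))"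
    by (rule time_space_cutoff[OF \<Omega>(1)]) blast
  define \<zeta> where "\<zeta> z = p (snd z) * \<psi> z" for z
  have pc: "continuous_on UNIV p" using Ck_real_polynomial_function[OF p, of 0] by simp
  have \<zeta>: "smooth_compact \<zeta>"
    unfolding \<zeta>_def[abs_def] by (rule smooth_compact_mult[OF Ck_comp_linear[OF bounded_linear_snd Ck_real_polynomial_function[OF p]] \<psi>(1)])
  have td: "time_deriv \<zeta> s x = 0" if "s \<in> {0..1}" "x \<in> closure \<Omega>" for s x
  proof -
    have "(p has_derivative frechet_derivative p (at x)) (at x)"
      by (rule Ck_Suc_has_derivative[OF Ck_real_polynomial_function[OF p]])
    then have "((\<lambda>z. p (snd z)) has_derivative (\<lambda>v. frechet_derivative p (at x) (snd v))) (at (s, x))"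
      using has_derivative_compose[OF bounded_linear_imp_has_derivative[OF bounded_linear_snd], of p _ "(s, x)" UNIV] by simp
    from has_derivative_mult[OF this \<psi>(3)[OF that]]
    have "frechet_derivative \<zeta> (at (s, x)) = (\<lambda>v. frechet_derivative p (at x) (snd v) * \<psi> (s, x))"
      unfolding \<zeta>_def[abs_def] using frechet_derivative_at by fastforce
    then show ?thesis
      using linear_0[OF has_derivative_linear[OF \<open>(p has_derivative frechet_derivative p (at x)) (at x)\<close>]] by (simp add: time_deriv_def)
  qed
  obtain L0 where L0: "0 \<le> L0" "\<And>s x. norm (space_grad \<zeta> s x) \<le> L0" using bounded_space_grad[OF \<zeta>] by blast
  \<comment> \<open>The added 1 keeps \<open>d\<close> positive even if the gradient vanishes; only
    positive factors are pulled out of the lower integral.\<close>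
  define G where "G = L0 + 1"
  have G: "0 < G" "\<And>s x. norm (space_grad \<zeta> s x) \<le> G" using L0 by (auto simp: G_def intro: order_trans[OF L0(2)])
  define Bd where "Bd = m 1 * (measure lborel \<Omega> + c)"
  have Bd: "0 \<le> Bd" using mobility_nonneg[OF m, of 1] c by (simp add: Bd_def)
  define d where "d = real DIM('a) * G"
  have d: "0 < d" using G by (simp add: d_def)
  have "\<bar>(LINT x|\<mu>1. p x) - (LINT x|\<mu>0. p x)\<bar> \<le> d * (1 + Bd) * r"
    if \<mu>0: "\<mu>0 \<in> Mplus_mass \<Omega> c" and r: "0 < r" and W: "Wdist m \<Omega> \<mu>0 \<mu>1 < ennreal r" for \<mu>0 \<mu>1 r
  proof -
    obtain \<mu> \<nu> where CE: "(\<mu>, \<nu>) \<in> CE \<Omega> \<mu>0 \<mu>1" and E: "(\<integral>\<^sup>+ s \<in> {0<..<1}. action m \<Omega> (\<mu> s) (\<nu> s) \<partial>lborel) < ennreal (r\<^sup>2)"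
      using Wdist_lessD[OF W] by blast
    define g where "g s = vec_integral (\<nu> s) (space_grad \<zeta> s)" for s
    have gi: "set_integrable lborel {0<..<1} g" unfolding g_def by (rule integrable_CE_integrand(2)[OF CE \<Omega>(1) \<zeta>])
    have mass: "\<mu> s \<in> Mplus_mass \<Omega> c" if "s \<in> {0..1}" for s
      using CED(1)[OF CE that] CE_mass[OF CE \<Omega>(1) that] \<mu>0 by (simp add: Mplus_mass_def)
    have bound: "ennreal \<bar>g s\<bar> \<le> ennreal (d / r) * action m \<Omega> (\<mu> s) (\<nu> s) + ennreal (d * Bd * r)" if s: "s \<in> {0<..<1}" for s
    proof (cases "action m \<Omega> (\<mu> s) (\<nu> s)")
      case (real A)
      have s': "s \<in> {0..1}" using s by auto
      define k where "k = (1 / r * A + Bd * r) / 2"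
      have k: "norm (\<nu> s B) \<le> k" if "B \<in> sets borel" for B
      proof -
        have "ennreal (2 * norm (\<nu> s B)) \<le> ennreal (1 / r) * action m \<Omega> (\<mu> s) (\<nu> s) + ennreal (m 1 * (measure lborel \<Omega> + c) / (1 / r))"
          using r by (intro action_controls_flux[OF m \<Omega> mass[OF s'] c CED(2)[OF CE s] _ that]) simp
        also have "\<dots> = ennreal (1 / r * A + Bd * r)"
          using real r Bd by (simp add: Bd_def ennreal_mult[symmetric] ennreal_plus[symmetric] del: ennreal_plus)
        finally show ?thesis using real r Bd by (simp add: k_def ennreal_le_iff del: ennreal_plus)
      qed
      have "\<bar>g s\<bar> \<le> real DIM('a) * (2 * k * G)"
        unfolding g_def using G k by (intro vec_integral_bound[OF MvecD(1)[OF CED(2)[OF CE s]] _ _ MvecD(5)[OF CED(2)[OF CE s]] smooth_compact_slices(4)[OF \<zeta>]]) auto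
      also have "\<dots> = d / r * A + d * Bd * r" by (simp add: k_def d_def field_simps)
      finally show ?thesis using real r Bd d by (simp add: ennreal_mult[symmetric] ennreal_plus[symmetric] ennreal_leI del: ennreal_plus)
    qed (use d r in \<open>simp add: ennreal_mult_top\<close>)
    let ?k = "d * Bd * r"
    have k0: "0 \<le> ?k" using d Bd r by simp
    have gm[measurable]: "(\<lambda>s. indicator {0<..<1} s * g s) \<in> borel_measurable borel"
      using gi unfolding set_integrable_def by auto
    \<comment> \<open>What exceeds the constant \<open>?k\<close> is a measurable minorant of a
      multiple of the action, hence is bounded by its lower integral.\<close>
    have 1: "(\<integral>\<^sup>+ s. ennreal (\<bar>indicator {0<..<1} s * g s\<bar> - ?k) \<partial>lborel) \<le> ennreal (d / r) * ennreal (r\<^sup>2)"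
    proof -
      have "(\<integral>\<^sup>+ s. ennreal (\<bar>indicator {0<..<1} s * g s\<bar> - ?k) \<partial>lborel) \<le>
        (\<integral>\<^sup>+ s. ennreal (d / r) * (action m \<Omega> (\<mu> s) (\<nu> s) * indicator {0<..<1} s) \<partial>lborel)"
      proof (rule nn_integral_mono)
        fix s :: real
        show "ennreal (\<bar>indicator {0<..<1} s * g s\<bar> - ?k) \<le> ennreal (d / r) * (action m \<Omega> (\<mu> s) (\<nu> s) * indicator {0<..<1} s)"
        proof (cases "s \<in> {0<..<1}")
          case True
          have "ennreal (\<bar>g s\<bar> - ?k) = ennreal \<bar>g s\<bar> - ennreal ?k" using k0 by (simp add: ennreal_minus)
          also have "\<dots> \<le> ennreal (d / r) * action m \<Omega> (\<mu> s) (\<nu> s)"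
            using bound[OF True] by (simp add: ennreal_minus_le_iff add.commute)
          finally show ?thesis using True by simp
        next
          case False
          then have "ennreal (\<bar>indicator {0<..<1} s * g s\<bar> - ?k) = 0" using k0 by (simp add: ennreal_neg)
          then show ?thesis by (metis zero_le)
        qed
      qed
      also have "\<dots> \<le> ennreal (d / r) * (\<integral>\<^sup>+ s. action m \<Omega> (\<mu> s) (\<nu> s) * indicator {0<..<1} s \<partial>lborel)"
        using d r by (intro nn_integral_cmult_lower) simp
      also have "\<dots> \<le> ennreal (d / r) * ennreal (r\<^sup>2)" using E by (intro mult_left_mono) auto
      finally show ?thesis .
    qed
    have "(\<integral>\<^sup>+ s. ennreal (norm (indicator {0<..<1} s *\<^sub>R g s)) \<partial>lborel) \<le>
      (\<integral>\<^sup>+ s. ennreal (\<bar>indicator {0<..<1} s * g s\<bar> - ?k) + ennreal ?k * indicator {0<..<1} s \<partial>lborel)"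
    proof (rule nn_integral_mono)
      fix s :: real
      have "ennreal \<bar>g s\<bar> \<le> ennreal (max 0 (\<bar>g s\<bar> - ?k) + ?k)" by (intro ennreal_leI) auto
      also have "\<dots> = ennreal (\<bar>g s\<bar> - ?k) + ennreal ?k" using k0 by (subst ennreal_plus) auto
      finally show "ennreal (norm (indicator {0<..<1} s *\<^sub>R g s)) \<le> ennreal (\<bar>indicator {0<..<1} s * g s\<bar> - ?k) + ennreal ?k * indicator {0<..<1} s"
        by (auto simp: indicator_def)
    qed
    also have "\<dots> = (\<integral>\<^sup>+ s. ennreal (\<bar>indicator {0<..<1} s * g s\<bar> - ?k) \<partial>lborel) + (\<integral>\<^sup>+ (s::real). ennreal ?k * indicator {0<..<1} s \<partial>lborel)"
      by (rule nn_integral_add) auto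
    also have "\<dots> \<le> ennreal (d / r) * ennreal (r\<^sup>2) + ennreal ?k"
      using 1 by (intro add_mono) (auto simp: nn_integral_cmult_indicator)
    also have "\<dots> = ennreal (d * (1 + Bd) * r)"
      using d r Bd by (simp add: ennreal_mult[symmetric] ennreal_plus[symmetric] power2_eq_square algebra_simps del: ennreal_plus)
    finally have "ennreal (norm (LINT s:{0<..<1}|lborel. g s)) \<le> ennreal (d * (1 + Bd) * r)"
      using integral_norm_bound_ennreal[OF gi[unfolded set_integrable_def]] unfolding set_lebesgue_integral_def by (rule order_trans[rotated])
    then have gb: "\<bar>LINT s:{0<..<1}|lborel. g s\<bar> \<le> d * (1 + Bd) * r"
      using d r Bd by (simp add: ennreal_le_iff)
    have "(LINT s:{0<..<1}|lborel. CE_integrand \<mu> \<nu> \<zeta> s) = (LINT s:{0<..<1}|lborel. g s)"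
    proof (rule set_lebesgue_integral_cong)
      show "\<forall>s. s \<in> {0<..<1} \<longrightarrow> CE_integrand \<mu> \<nu> \<zeta> s = g s"
      proof (intro allI impI)
        fix s :: real assume s: "s \<in> {0<..<1}"
        then have s': "s \<in> {0..1}" by auto
        have "(LINT x|\<mu> s. time_deriv \<zeta> s x) = (LINT x|\<mu> s. 0)"
          by (rule Mplus_integral_cong[OF CED(1)[OF CE s']])
            (auto simp: td[OF s'] intro!: borel_measurable_continuous_onI smooth_compact_slices(2)[OF \<zeta>])
        then show "CE_integrand \<mu> \<nu> \<zeta> s = g s" by (simp add: CE_integrand_def g_def)
      qed
    qed simp
    moreover have \<zeta>p: "(LINT x|\<mu> s. \<zeta> (s, x)) = (LINT x|\<mu> s. p x)" if s: "s \<in> {0..1}" for s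
    proof (rule Mplus_integral_cong[OF CED(1)[OF CE s]])
      show "\<zeta> (s, x) = p x" if "x \<in> closure \<Omega>" for x by (simp add: \<zeta>_def \<psi>(2)[OF s that])
    qed (intro borel_measurable_continuous_onI smooth_compact_slices(1)[OF \<zeta>] pc)+
    ultimately show ?thesis
      using CE_boundary[OF CE \<Omega>(1) \<zeta>, of 0 1] gb CED(4,5)[OF CE] \<zeta>p[of 0] \<zeta>p[of 1] by simp
  qed
  then show ?thesis using d Bd by (intro exI[of _ "d * (1 + Bd)"]) auto
qed

lemma Mplus_massD:
  assumes "\<mu> \<in> Mplus_mass \<Omega> c" "0 \<le> c"
  shows "\<mu> \<in> Mplus \<Omega>" "measure \<mu> UNIV = c"
  using assms by (auto simp: Mplus_mass_def measure_def)

text \<open>A polynomial within \<open>h\<close> of \<open>f\<close> on the compact closure changes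
  each integral by at most h c. Together with the polynomial estimate, three errors of e / 4 remain
  below e.\<close>

lemma Wdist_controls_continuous:
  fixes \<Omega> :: "'a::euclidean_space set" and f :: "'a \<Rightarrow> real"
  assumes m: "mobility m" and \<Omega>: "bounded \<Omega>" "open \<Omega>" "convex \<Omega>" and c: "0 \<le> c" and f: "continuous_on UNIV f" and e: "0 < e"
  shows "\<exists>r>0. \<forall>\<mu>0\<in>Mplus_mass \<Omega> c. \<forall>\<mu>1\<in>Mplus_mass \<Omega> c. Wdist m \<Omega> \<mu>0 \<mu>1 < ennreal r \<longrightarrow>
    \<bar>(LINT x|\<mu>1. f x) - (LINT x|\<mu>0. f x)\<bar> < e"
proof -
  define h where "h = e / (4 * (c + 1))"
  have h: "0 < h" "h * c \<le> e / 4" using e c by (auto simp: h_def field_simps)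
  have "compact (closure \<Omega>)" using \<Omega> by (simp add: compact_closure)
  then obtain p where p: "real_polynomial_function p" "\<And>x. x \<in> closure \<Omega> \<Longrightarrow> \<bar>f x - p x\<bar> < h"
    using Stone_Weierstrass_real_polynomial_function[of "closure \<Omega>" f h] continuous_on_subset[OF f] h by auto
  have pc: "continuous_on UNIV p" using Ck_real_polynomial_function[OF p(1), of 0] by simp
  obtain L where L: "0 \<le> L" "\<And>\<mu>0 \<mu>1 r. \<mu>0 \<in> Mplus_mass \<Omega> c \<Longrightarrow> 0 < r \<Longrightarrow> Wdist m \<Omega> \<mu>0 \<mu>1 < ennreal r \<Longrightarrow>
    \<bar>(LINT x|\<mu>1. p x) - (LINT x|\<mu>0. p x)\<bar> \<le> L * r"
    using Wdist_controls_polynomial[OF m \<Omega> c p(1)] by blast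
  have fp: "\<bar>(LINT x|\<mu>. f x) - (LINT x|\<mu>. p x)\<bar> \<le> e / 4" if \<mu>: "\<mu> \<in> Mplus_mass \<Omega> c" for \<mu>
  proof -
    note M = Mplus_massD[OF \<mu> c]
    have "\<bar>\<integral>x. f x - p x \<partial>\<mu>\<bar> \<le> h * measure \<mu> UNIV"
      by (rule Mplus_integral_bound[OF \<Omega>(1) M(1)]) (auto intro!: continuous_intros f pc less_imp_le p(2))
    then show ?thesis
      using h M(2) Mplus_integrable[OF \<Omega>(1) M(1) f] Mplus_integrable[OF \<Omega>(1) M(1) pc] by simp
  qed
  define r where "r = e / (4 * (L + 1))"
  have r: "0 < r" "L * r \<le> e / 4" using e L(1) by (auto simp: r_def field_simps)
  show ?thesis
  proof (intro exI[of _ r] conjI ballI impI)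
    fix \<mu>0 \<mu>1 assume \<mu>: "\<mu>0 \<in> Mplus_mass \<Omega> c" "\<mu>1 \<in> Mplus_mass \<Omega> c" and W: "Wdist m \<Omega> \<mu>0 \<mu>1 < ennreal r"
    show "\<bar>(LINT x|\<mu>1. f x) - (LINT x|\<mu>0. f x)\<bar> < e"
      using L(2)[OF \<mu>(1) r(1) W] fp[OF \<mu>(1)] fp[OF \<mu>(2)] r(2) e by linarith
  qed (rule r)
qed

text \<open>The indicator of a closed set is a bounded limit of continuous functions of the distance
  to it, and the closed sets are an intersection-stable generator of the Borel sets.\<close>

lemma Mplus_eqI:
  fixes \<mu> \<mu>' :: "'a::euclidean_space measure"
  assumes \<Omega>: "bounded \<Omega>" and \<mu>: "\<mu> \<in> Mplus \<Omega>" "\<mu>' \<in> Mplus \<Omega>"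
    and eq: "\<And>f :: 'a \<Rightarrow> real. continuous_on UNIV f \<Longrightarrow> bounded {x. f x \<noteq> 0} \<Longrightarrow> (LINT x|\<mu>. f x) = (LINT x|\<mu>'. f x)"
  shows "\<mu> = \<mu>'"
proof -
  obtain \<psi> where \<psi>: "smooth_compact \<psi>" "\<And>x. x \<in> closure \<Omega> \<Longrightarrow> \<psi> x = 1"
    using smooth_cutoff[of "closure \<Omega>"] \<Omega> by (auto simp: bounded_closure)
  have eq': "(LINT x|\<mu>. f x) = (LINT x|\<mu>'. f x)" if f: "continuous_on UNIV f" for f :: "'a \<Rightarrow> real"
  proof -
    have c: "continuous_on UNIV (\<lambda>x. \<psi> x * f x)"
      by (intro continuous_intros f smooth_compactD(3)[OF \<psi>(1)])
    have b: "bounded {x. \<psi> x * f x \<noteq> 0}"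
      by (rule bounded_subset[OF smooth_compactD(2)[OF \<psi>(1)]]) auto
    have "(LINT x|\<mu>''. f x) = (LINT x|\<mu>''. \<psi> x * f x)" if "\<mu>'' \<in> Mplus \<Omega>" for \<mu>''
      by (rule Mplus_integral_cong[OF that]) (auto simp: \<psi>(2) intro!: borel_measurable_continuous_onI f c)
    then show ?thesis using \<mu> eq[OF c b] by simp
  qed
  have closed: "emeasure \<mu> A = emeasure \<mu>' A" if A: "closed A" for A
  proof (cases "A = {}")
    case False
    define f where "f n x = max 0 (1 - real n * infdist x A)" for n x
    have fc: "continuous_on UNIV (f n)" for n
      unfolding f_def by (intro continuous_intros continuous_on_infdist)
    have lim: "(\<lambda>n. f n x) \<longlonglongrightarrow> indicator A x" for x
    proof (cases "x \<in> A")
      case True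
      then show ?thesis by (simp add: f_def)
    next
      case no: False
      then have "0 < infdist x A" using A False by (simp add: infdist_pos_not_in_closed)
      then obtain N where N: "1 < real N * infdist x A" using reals_Archimedean3 by blast
      have "\<forall>\<^sub>F n in sequentially. indicator A x = f n x"
        using eventually_ge_at_top[of N]
      proof eventually_elim
        case (elim n)
        then have "real N * infdist x A \<le> real n * infdist x A" by (intro mult_right_mono) (auto simp: infdist_nonneg)
        then show ?case using N no by (simp add: f_def)
      qed
      then show ?thesis by (rule Lim_transform_eventually[OF tendsto_const])
    qed
    have "(\<lambda>n. LINT x|\<mu>''. f n x) \<longlonglongrightarrow> (LINT x|\<mu>''. indicator A x)" if \<mu>'': "\<mu>'' \<in> Mplus \<Omega>" for \<mu>''
    proof -
      interpret finite_measure \<mu>'' using MplusD(2)[OF \<mu>''] .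
      note [measurable_cong] = MplusD(1)[OF \<mu>'']
      have [measurable]: "f n \<in> borel_measurable borel" for n by (rule borel_measurable_continuous_onI[OF fc])
      have [measurable]: "A \<in> sets borel" using A by simp
      show ?thesis
        by (rule integral_dominated_convergence[where w = "\<lambda>_. 1"]) (auto simp: lim, auto simp: f_def infdist_nonneg)
    qed
    from LIMSEQ_unique[OF this[OF \<mu>(1)]] this[OF \<mu>(2)] eq'[OF fc]
    have "(LINT x|\<mu>. indicator A x) = (\<integral>x. indicator A x \<partial>\<mu>' :: real)" by simp
    then have "measure \<mu> A = measure \<mu>' A" using A MplusD(1,4)[OF \<mu>(1)] MplusD(1,4)[OF \<mu>(2)] by simp
    then show ?thesis
      using finite_measure.emeasure_eq_measure[OF MplusD(2)[OF \<mu>(1)]] finite_measure.emeasure_eq_measure[OF MplusD(2)[OF \<mu>(2)]] by simp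
  qed simp
  show ?thesis
  proof (rule measure_eqI_generator_eq[where \<Omega> = UNIV and E = "{A. closed A}" and A = "\<lambda>_. UNIV"])
    show "Int_stable {A::'a set. closed A}" by (auto simp: Int_stable_def)
    show "sets \<mu> = sigma_sets UNIV {A. closed A}" "sets \<mu>' = sigma_sets UNIV {A. closed A}"
      using MplusD(1)[OF \<mu>(1)] MplusD(1)[OF \<mu>(2)] by (simp_all add: borel_eq_closed)
    show "emeasure \<mu> UNIV \<noteq> \<infinity>" using finite_measure.emeasure_finite[OF MplusD(2)[OF \<mu>(1)]] by simp
  qed (auto simp: closed)
qed

lemma Wdist_eq_0D:
  fixes \<Omega> :: "'a::euclidean_space set"
  assumes m: "mobility m" and \<Omega>: "bounded \<Omega>" "open \<Omega>" "convex \<Omega>" and c: "0 \<le> c"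
    and \<mu>: "\<mu>0 \<in> Mplus_mass \<Omega> c" "\<mu>1 \<in> Mplus_mass \<Omega> c" and W: "Wdist m \<Omega> \<mu>0 \<mu>1 = 0"
  shows "\<mu>0 = \<mu>1"
proof (rule Mplus_eqI[OF \<Omega>(1) Mplus_massD(1)[OF \<mu>(1) c] Mplus_massD(1)[OF \<mu>(2) c]])
  fix f :: "'a \<Rightarrow> real" assume f: "continuous_on UNIV f"
  have "\<bar>(LINT x|\<mu>1. f x) - (LINT x|\<mu>0. f x)\<bar> \<le> e" if e: "0 < e" for e
    using Wdist_controls_continuous[OF m \<Omega> c f e] \<mu> W by (auto intro: less_imp_le simp: ennreal_less_iff)
  then have "\<bar>(LINT x|\<mu>1. f x) - (LINT x|\<mu>0. f x)\<bar> \<le> 0" by (metis add_0 field_le_epsilon)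
  then show "(LINT x|\<mu>0. f x) = (LINT x|\<mu>1. f x)" by simp
qed

section \<open>Spreading a measure over the domain\<close>

abbreviation lerp :: "real \<Rightarrow> 'a::real_vector \<Rightarrow> 'a \<Rightarrow> 'a" where
  "lerp e x y \<equiv> (1 - e) *\<^sub>R x + e *\<^sub>R y"

definition spread_pair :: "'a::euclidean_space set \<Rightarrow> 'a measure \<Rightarrow> ('a \<times> 'a) measure" where
  "spread_pair \<Omega> \<mu> = \<mu> \<Otimes>\<^sub>M uniform_measure lborel \<Omega>"

definition spread :: "'a::euclidean_space set \<Rightarrow> 'a measure \<Rightarrow> real \<Rightarrow> 'a measure" where
  "spread \<Omega> \<mu> e = distr (spread_pair \<Omega> \<mu>) borel (\<lambda>(x, y). lerp e x y)"

text \<open>The density at \<open>z\<close> of (1 - e) x + e y for uniform y: the indicator tests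
  the y that leads from \<open>x\<close> to \<open>z\<close>, and e^d is the Jacobian.\<close>

definition spread_kernel :: "'a::euclidean_space set \<Rightarrow> real \<Rightarrow> 'a \<Rightarrow> 'a \<Rightarrow> real" where
  "spread_kernel \<Omega> e x z = indicator \<Omega> (x + (1 / e) *\<^sub>R (z - x)) / (e ^ DIM('a) * measure lborel \<Omega>)"

definition spread_density :: "'a::euclidean_space set \<Rightarrow> 'a measure \<Rightarrow> real \<Rightarrow> 'a \<Rightarrow> real" where
  "spread_density \<Omega> \<mu> e z = (LINT x|\<mu>. spread_kernel \<Omega> e x z)"

text \<open>Density times mean velocity: (z - x) / e is the velocity y - x of the particle that
  started at \<open>x\<close> and is now at \<open>z\<close>.\<close>

definition spread_flux :: "'a::euclidean_space set \<Rightarrow> 'a measure \<Rightarrow> real \<Rightarrow> 'a \<Rightarrow> 'a" where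
  "spread_flux \<Omega> \<mu> e z = (LINT x|\<mu>. spread_kernel \<Omega> e x z *\<^sub>R ((1 / e) *\<^sub>R (z - x)))"

locale convex_domain =
  fixes \<Omega> :: "'a::euclidean_space set" and c :: real
  assumes bounded_domain: "bounded \<Omega>" and open_domain: "open \<Omega>" and convex_domain: "convex \<Omega>"
    and domain_nonempty: "\<Omega> \<noteq> {}" and mass_pos: "0 < c"
begin

lemma domain_borel [measurable]: "\<Omega> \<in> sets borel" "closure \<Omega> \<in> sets borel"
  using open_domain by auto

definition vol :: real where "vol = measure lborel \<Omega>"

lemma emeasure_domain: "emeasure lborel \<Omega> = ennreal vol"
  using emeasure_bounded_finite[OF bounded_domain] by (simp add: vol_def emeasure_eq_ennreal_measure less_top)

lemma vol_pos: "0 < vol"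
proof -
  have "emeasure lborel \<Omega> \<noteq> 0"
    using open_domain domain_nonempty open_not_negligible
    by (metis completion.null_sets_outer emeasure_lborel_cbox_finite negligible_iff_null_sets null_sets_completionI null_setsI open_domain borel_open sets_lborel)
  then show ?thesis using emeasure_domain by (auto simp: vol_def zero_less_measure_iff)
qed

abbreviation kern where "kern \<equiv> spread_kernel \<Omega>"

abbreviation unif where "unif \<equiv> uniform_measure lborel \<Omega>"

lemma unif_prob: "prob_space unif"
  using emeasure_domain vol_pos by (intro prob_space_uniform_measure) auto

definition D where "D = diameter (closure \<Omega>)"

lemma D_nonneg: "0 \<le> D"
  unfolding D_def using bounded_domain by (intro diameter_ge_0) (simp add: bounded_closure)

lemma norm_diff_le_D: "x \<in> closure \<Omega> \<Longrightarrow> y \<in> closure \<Omega> \<Longrightarrow> norm (y - x) \<le> D"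
  unfolding D_def using diameter_bounded_bound[of "closure \<Omega>" y x] bounded_domain by (simp add: bounded_closure dist_norm)

text \<open>A segment from a closure point to an interior point of a convex set is interior except
  at its start. Spread densities therefore live on the open domain.\<close>

lemma interpolate_in_domain:
  assumes "x \<in> closure \<Omega>" "y \<in> \<Omega>" "0 < e" "e \<le> 1"
  shows "lerp e x y \<in> \<Omega>"
proof -
  have "x - e *\<^sub>R (x - y) \<in> interior \<Omega>"
    using assms convex_domain open_domain by (intro mem_interior_closure_convex_shrink) (auto simp: interior_open)
  moreover have "x - e *\<^sub>R (x - y) = lerp e x y" by (simp add: algebra_simps)
  ultimately show ?thesis using open_domain by (simp add: interior_open)
qed

lemma interpolate_in_closure:
  assumes "x \<in> closure \<Omega>" "y \<in> closure \<Omega>" "0 \<le> e" "e \<le> 1"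
  shows "lerp e x y \<in> closure \<Omega>"
  using convexD_alt[OF convex_closure[OF convex_domain] assms(1,2,3,4)] .

lemma spread_kernel_nonneg: "0 \<le> e \<Longrightarrow> 0 \<le> kern e x z"
  by (simp add: spread_kernel_def)

lemma spread_kernel_le: "0 < e \<Longrightarrow> kern e x z \<le> 1 / (e ^ DIM('a) * vol)"
  using vol_pos by (simp add: spread_kernel_def vol_def divide_right_mono indicator_def)

lemma spread_kernel_eq_0: "x \<in> closure \<Omega> \<Longrightarrow> z \<notin> \<Omega> \<Longrightarrow> 0 < e \<Longrightarrow> e \<le> 1 \<Longrightarrow> kern e x z = 0"
  using interpolate_in_domain[of x "x + (1 / e) *\<^sub>R (z - x)" e]
  by (auto simp: spread_kernel_def indicator_def algebra_simps)

text \<open>Where the kernel is nonzero, (z - x) / e joins two points of the closure and is no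
  longer than the diameter.\<close>

lemma spread_kernel_flux_le:
  assumes "x \<in> closure \<Omega>" "0 < e"
  shows "norm (kern e x z *\<^sub>R ((1 / e) *\<^sub>R (z - x))) \<le> D * kern e x z"
proof (cases "x + (1 / e) *\<^sub>R (z - x) \<in> \<Omega>")
  case True
  then have "norm ((1 / e) *\<^sub>R (z - x)) \<le> D"
    using norm_diff_le_D[OF assms(1), of "x + (1 / e) *\<^sub>R (z - x)"] closure_subset by auto
  then have "kern e x z * norm ((1 / e) *\<^sub>R (z - x)) \<le> kern e x z * D"
    using spread_kernel_nonneg[of e x z] assms(2) by (intro mult_left_mono) auto
  then show ?thesis using spread_kernel_nonneg[of e x z] assms(2)
    by (simp only: norm_scaleR abs_of_nonneg less_imp_le mult.commute)
qed (simp add: spread_kernel_def)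

lemma measurable_spread_kernel [measurable]:
  assumes [measurable]: "e \<in> borel_measurable M" "x \<in> borel_measurable M" "z \<in> borel_measurable M"
  shows "(\<lambda>w. kern (e w) (x w) (z w)) \<in> borel_measurable M"
  unfolding spread_kernel_def by measurable

end

section \<open>Densities and fluxes of the spread of one measure\<close>

locale spread_measure = convex_domain +
  fixes \<mu> :: "'a measure"
  assumes mass: "\<mu> \<in> Mplus_mass \<Omega> c"
begin

abbreviation dens where "dens \<equiv> spread_density \<Omega> \<mu>"
abbreviation flux where "flux \<equiv> spread_flux \<Omega> \<mu>"

lemma mu_Mplus: "\<mu> \<in> Mplus \<Omega>" using mass by (simp add: Mplus_mass_def)

lemma sets_mu [measurable_cong, simp]: "sets \<mu> = sets borel" and space_mu [simp]: "space \<mu> = UNIV"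
  using MplusD[OF mu_Mplus] by auto

lemma emeasure_mu: "emeasure \<mu> UNIV = ennreal c" using mass by (simp add: Mplus_mass_def)

lemma measure_mu: "measure \<mu> UNIV = c" using emeasure_mu mass_pos by (simp add: measure_def)

sublocale mu: finite_measure \<mu> using MplusD(2)[OF mu_Mplus] .
sublocale un: prob_space unif by (rule unif_prob)
sublocale pr: pair_sigma_finite \<mu> unif ..
sublocale pl: pair_sigma_finite \<mu> lborel ..
sublocale lm: pair_sigma_finite lborel \<mu> ..

lemma AE_mu: "AE x in \<mu>. x \<in> closure \<Omega>"
  using MplusD[OF mu_Mplus] by (intro AE_I[of _ _ "- closure \<Omega>"]) auto

lemma sets_pair [measurable_cong, simp]: "sets (spread_pair \<Omega> \<mu>) = sets (borel \<Otimes>\<^sub>M borel)"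
  unfolding spread_pair_def by (intro sets_pair_measure_cong) auto

lemma space_pair [simp]: "space (spread_pair \<Omega> \<mu>) = UNIV"
  unfolding spread_pair_def by (simp add: space_pair_measure)

lemma finite_pair: "finite_measure (spread_pair \<Omega> \<mu>)"
  unfolding spread_pair_def by (rule finite_measure_pair_measure[OF un.finite_measure_axioms mu.finite_measure_axioms])

sublocale sp: finite_measure "spread_pair \<Omega> \<mu>" by (rule finite_pair)

lemma emeasure_pair: "emeasure (spread_pair \<Omega> \<mu>) UNIV = ennreal c"
proof -
  have "emeasure (\<mu> \<Otimes>\<^sub>M unif) (UNIV \<times> UNIV) = emeasure \<mu> UNIV * emeasure unif UNIV"
    by (rule un.emeasure_pair_measure_Times) auto
  then show ?thesis using emeasure_mu un.emeasure_space_1 by (simp add: spread_pair_def)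
qed

lemma AE_pair: "AE (x, y) in spread_pair \<Omega> \<mu>. x \<in> closure \<Omega> \<and> y \<in> \<Omega>"
proof (rule AE_I)
  let ?N = "((- closure \<Omega>) \<times> UNIV) \<union> (UNIV \<times> (- \<Omega>))"
  show "{w \<in> space (spread_pair \<Omega> \<mu>). \<not> (case w of (x, y) \<Rightarrow> x \<in> closure \<Omega> \<and> y \<in> \<Omega>)} \<subseteq> ?N" by auto
  show "?N \<in> sets (spread_pair \<Omega> \<mu>)" unfolding sets_pair by measurable
  have "emeasure (\<mu> \<Otimes>\<^sub>M unif) ((- closure \<Omega>) \<times> UNIV) = emeasure \<mu> (- closure \<Omega>) * emeasure unif UNIV"
    by (rule un.emeasure_pair_measure_Times) auto
  moreover have "emeasure (\<mu> \<Otimes>\<^sub>M unif) (UNIV \<times> (- \<Omega>)) = emeasure \<mu> UNIV * emeasure unif (- \<Omega>)"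
    by (rule un.emeasure_pair_measure_Times) auto
  moreover have "emeasure unif (- \<Omega>) = 0" by (subst emeasure_uniform_measure) auto
  ultimately show "emeasure (spread_pair \<Omega> \<mu>) ?N = 0"
    using MplusD(3)[OF mu_Mplus] emeasure_subadditive[of "(- closure \<Omega>) \<times> UNIV" "\<mu> \<Otimes>\<^sub>M unif" "UNIV \<times> (- \<Omega>)"]
    by (simp add: spread_pair_def)
qed

lemma nn_integral_unif_affine:
  assumes [measurable]: "f \<in> borel_measurable borel" and e: "0 < e"
  shows "(\<integral>\<^sup>+y. f (lerp e x y) \<partial>unif) = (\<integral>\<^sup>+z. ennreal (kern e x z) * f z \<partial>lborel)"
proof -
  have "(\<integral>\<^sup>+z. ennreal (kern e x z) * f z \<partial>lborel) =
    (\<integral>\<^sup>+z. ennreal (kern e x z) * f z \<partial>density (distr lborel borel (\<lambda>y. lerp e x y)) (\<lambda>_. ennreal (\<bar>e\<bar> ^ DIM('a))))"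
    using lborel_affine[of e "(1 - e) *\<^sub>R x"] e by simp
  also have "\<dots> = (\<integral>\<^sup>+y. ennreal (e ^ DIM('a)) * (ennreal (kern e x (lerp e x y)) * f (lerp e x y)) \<partial>lborel)"
    using e by (simp add: nn_integral_density nn_integral_distr)
  also have "\<dots> = (\<integral>\<^sup>+y. indicator \<Omega> y / ennreal vol * f (lerp e x y) \<partial>lborel)"
  proof (intro nn_integral_cong)
    fix y
    have y: "x + (1 / e) *\<^sub>R ((lerp e x y) - x) = y"
      using e by (simp add: algebra_simps scaleR_add_left[symmetric] del: scaleR_add_left)
    have "ennreal (e ^ DIM('a)) * ennreal (kern e x (lerp e x y)) = indicator \<Omega> y / ennreal vol"
    proof (cases "y \<in> \<Omega>")
      case True
      have "ennreal (e ^ DIM('a)) * ennreal (1 / (e ^ DIM('a) * vol)) = ennreal 1 / ennreal vol"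
        using e vol_pos by (simp add: ennreal_mult[symmetric] divide_ennreal del: ennreal_1)
      then show ?thesis unfolding spread_kernel_def y using True by (simp add: vol_def)
    qed (unfold spread_kernel_def y, simp)
    then show "ennreal (e ^ DIM('a)) * (ennreal (kern e x (lerp e x y)) * f (lerp e x y))
      = indicator \<Omega> y / ennreal vol * f (lerp e x y)" by (simp add: mult.assoc[symmetric])
  qed
  also have "\<dots> = (\<integral>\<^sup>+y. f (lerp e x y) \<partial>unif)"
    unfolding uniform_measure_def emeasure_domain by (subst nn_integral_density) auto
  finally show ?thesis ..
qed

text \<open>The substitution y -> z for fixed \<open>x\<close>. The starting point is kept beside
  the position because velocities depend on both.\<close>

lemma distr_spread_pair:
  assumes e: "0 < e"
  shows "distr (spread_pair \<Omega> \<mu>) (borel \<Otimes>\<^sub>M borel) (\<lambda>(x, y). (x, lerp e x y)) =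
    density (\<mu> \<Otimes>\<^sub>M lborel) (\<lambda>(x, z). ennreal (kern e x z))"
proof (rule measure_eqI)
  have s: "sets (\<mu> \<Otimes>\<^sub>M lborel) = sets (borel \<Otimes>\<^sub>M borel)" by (intro sets_pair_measure_cong) auto
  show "sets (distr (spread_pair \<Omega> \<mu>) (borel \<Otimes>\<^sub>M borel) (\<lambda>(x, y). (x, lerp e x y))) = sets (density (\<mu> \<Otimes>\<^sub>M lborel) (\<lambda>(x, z). ennreal (kern e x z)))"
    by (simp add: s)
  fix A assume "A \<in> sets (distr (spread_pair \<Omega> \<mu>) (borel \<Otimes>\<^sub>M borel) (\<lambda>(x, y). (x, lerp e x y)))"
  then have A[measurable]: "A \<in> sets (borel \<Otimes>\<^sub>M borel)" by simp
  have "emeasure (distr (spread_pair \<Omega> \<mu>) (borel \<Otimes>\<^sub>M borel) (\<lambda>(x, y). (x, lerp e x y))) A =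
    (\<integral>\<^sup>+w. indicator A (case w of (x, y) \<Rightarrow> (x, lerp e x y)) \<partial>spread_pair \<Omega> \<mu>)"
    by (subst nn_integral_distr[symmetric, where M' = "borel \<Otimes>\<^sub>M borel"]) auto
  also have "\<dots> = (\<integral>\<^sup>+x. \<integral>\<^sup>+y. indicator A (x, lerp e x y) \<partial>unif \<partial>\<mu>)"
    unfolding spread_pair_def by (subst un.nn_integral_fst[symmetric]) auto
  also have "\<dots> = (\<integral>\<^sup>+x. \<integral>\<^sup>+z. ennreal (kern e x z) * indicator A (x, z) \<partial>lborel \<partial>\<mu>)"
    by (intro nn_integral_cong nn_integral_unif_affine e) measurable
  also have "\<dots> = (\<integral>\<^sup>+w. (case w of (x, z) \<Rightarrow> ennreal (kern e x z)) * indicator A w \<partial>(\<mu> \<Otimes>\<^sub>M lborel))"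
    by (subst lborel.nn_integral_fst[symmetric]) auto
  also have "\<dots> = emeasure (density (\<mu> \<Otimes>\<^sub>M lborel) (\<lambda>(x, z). ennreal (kern e x z))) A"
    by (subst emeasure_density) (auto simp: s)
  finally show "emeasure (distr (spread_pair \<Omega> \<mu>) (borel \<Otimes>\<^sub>M borel) (\<lambda>(x, y). (x, lerp e x y))) A = \<dots>" .
qed

lemma spread_change_of_variables:
  fixes g :: "'a \<Rightarrow> 'a \<Rightarrow> real"
  assumes g[measurable]: "(\<lambda>(x, z). g x z) \<in> borel_measurable (borel \<Otimes>\<^sub>M borel)" and e: "0 < e"
    and int: "integrable (spread_pair \<Omega> \<mu>) (\<lambda>(x, y). g x (lerp e x y))"
  shows "(\<integral>(x, y). g x (lerp e x y) \<partial>spread_pair \<Omega> \<mu>) = (LINT z|lborel. (LINT x|\<mu>. kern e x z * g x z))"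
    "integrable lborel (\<lambda>z. LINT x|\<mu>. kern e x z * g x z)"
proof -
  have k0: "0 \<le> kern e x z" for x z using e by (simp add: spread_kernel_nonneg)
  have [measurable]: "(\<lambda>w. kern e (fst w) (snd w)) \<in> borel_measurable (\<mu> \<Otimes>\<^sub>M lborel)" by measurable
  have [measurable]: "(\<lambda>w. g (fst w) (snd w)) \<in> borel_measurable (\<mu> \<Otimes>\<^sub>M lborel)"
    using g by (simp add: split_beta')
  have [measurable]: "(\<lambda>w. g (fst w) (snd w)) \<in> borel_measurable (borel \<Otimes>\<^sub>M borel)"
    using g by (simp add: split_beta')
  have dd: "(\<lambda>(x, z). ennreal (kern e x z)) = (\<lambda>w. ennreal (kern e (fst w) (snd w)))"
    by (simp add: split_beta')
  let ?T = "\<lambda>(x, y). (x, lerp e x y)"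
  have T[measurable]: "?T \<in> spread_pair \<Omega> \<mu> \<rightarrow>\<^sub>M borel \<Otimes>\<^sub>M borel" by measurable
  have i: "integrable (density (\<mu> \<Otimes>\<^sub>M lborel) (\<lambda>(x, z). ennreal (kern e x z))) (\<lambda>w. g (fst w) (snd w))"
    unfolding distr_spread_pair[OF e, symmetric] using int by (subst integrable_distr_eq) (auto simp: split_beta')
  have i2: "integrable (\<mu> \<Otimes>\<^sub>M lborel) (\<lambda>w. kern e (fst w) (snd w) * g (fst w) (snd w))"
    using i k0 unfolding dd by (subst (asm) integrable_density) auto
  have "(\<integral>(x, y). g x (lerp e x y) \<partial>spread_pair \<Omega> \<mu>) = (\<integral>w. g (fst w) (snd w) \<partial>distr (spread_pair \<Omega> \<mu>) (borel \<Otimes>\<^sub>M borel) ?T)"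
    by (subst integral_distr) (auto simp: split_beta')
  also have "\<dots> = (\<integral>w. kern e (fst w) (snd w) * g (fst w) (snd w) \<partial>(\<mu> \<Otimes>\<^sub>M lborel))"
    unfolding distr_spread_pair[OF e] dd using k0 by (subst integral_density) auto
  also have "\<dots> = (LINT z|lborel. (LINT x|\<mu>. kern e x z * g x z))"
    using pl.integral_snd[of "\<lambda>x z. kern e x z * g x z"] i2 by (simp add: split_beta')
  finally show "(\<integral>(x, y). g x (lerp e x y) \<partial>spread_pair \<Omega> \<mu>) = (LINT z|lborel. (LINT x|\<mu>. kern e x z * g x z))" .
  show "integrable lborel (\<lambda>z. LINT x|\<mu>. kern e x z * g x z)"
    using pl.integrable_snd[of "\<lambda>x z. kern e x z * g x z"] i2 by (simp add: split_beta')
qed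

lemma integrable_spread_kernel:
  assumes e: "0 < e" shows "integrable \<mu> (\<lambda>x. kern e x z)"
proof (rule mu.integrable_const_bound)
  show "AE x in \<mu>. norm (kern e x z) \<le> 1 / (e ^ DIM('a) * vol)"
    using spread_kernel_le[OF e] spread_kernel_nonneg[of e] e by (intro AE_I2) simp
qed measurable

lemma spread_density_nonneg: "0 \<le> e \<Longrightarrow> 0 \<le> dens e z"
  unfolding spread_density_def by (intro Bochner_Integration.integral_nonneg spread_kernel_nonneg)

lemma spread_density_le:
  assumes e: "0 < e" shows "dens e z \<le> c / (e ^ DIM('a) * vol)"
proof -
  have "dens e z \<le> (LINT x|\<mu>. 1 / (e ^ DIM('a) * vol))"
    unfolding spread_density_def using spread_kernel_le[OF e] by (intro integral_mono integrable_spread_kernel e) auto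
  then show ?thesis by (simp add: measure_mu)
qed

lemma spread_density_eq_0:
  assumes "0 < e" "e \<le> 1" "z \<notin> \<Omega>" shows "dens e z = 0"
proof -
  have "AE x in \<mu>. kern e x z = 0"
    using AE_mu by eventually_elim (use assms in \<open>auto intro: spread_kernel_eq_0\<close>)
  then show ?thesis unfolding spread_density_def by (intro integral_eq_zero_AE)
qed

lemma norm_spread_flux_le:
  assumes e: "0 < e" shows "norm (flux e z) \<le> D * dens e z"
proof -
  have i: "integrable \<mu> (\<lambda>x. D * kern e x z)" by (intro integrable_mult_right integrable_spread_kernel e)
  have le: "AE x in \<mu>. norm (kern e x z *\<^sub>R ((1 / e) *\<^sub>R (z - x))) \<le> D * kern e x z"
    using AE_mu by eventually_elim (rule spread_kernel_flux_le[OF _ e])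
  have "integrable \<mu> (\<lambda>x. kern e x z *\<^sub>R ((1 / e) *\<^sub>R (z - x)))"
    by (rule Bochner_Integration.integrable_bound[OF i]) (use le in \<open>auto elim!: eventually_mono\<close>)
  then have "norm (flux e z) \<le> (LINT x|\<mu>. D * kern e x z)"
    unfolding spread_flux_def by (intro order_trans[OF integral_norm_bound integral_mono_AE] integrable_norm i le)
  then show ?thesis by (simp add: spread_density_def)
qed

lemma measurable_spread_density [measurable]:
  "(\<lambda>w. dens (fst w) (snd w)) \<in> borel_measurable (borel \<Otimes>\<^sub>M borel)"
  "dens e \<in> borel_measurable borel"
  unfolding spread_density_def by measurable

lemma measurable_spread_flux [measurable]:
  "(\<lambda>w. flux (fst w) (snd w)) \<in> borel_measurable (borel \<Otimes>\<^sub>M borel)"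
  "flux e \<in> borel_measurable borel"
  unfolding spread_flux_def by measurable

end

context spread_measure
begin

lemma measurable_spread_map [measurable]: "(\<lambda>(x, y). lerp e x y) \<in> spread_pair \<Omega> \<mu> \<rightarrow>\<^sub>M borel"
  by measurable

lemma sets_spread [simp, measurable_cong]: "sets (spread \<Omega> \<mu> e) = sets borel"
  by (simp add: spread_def)

lemma emeasure_spread:
  "A \<in> sets borel \<Longrightarrow> emeasure (spread \<Omega> \<mu> e) A = emeasure (spread_pair \<Omega> \<mu>) ((\<lambda>(x, y). lerp e x y) -` A)"
  unfolding spread_def by (subst emeasure_distr) auto

lemma spread_mass:
  assumes e: "0 \<le> e" "e \<le> 1" shows "spread \<Omega> \<mu> e \<in> Mplus_mass \<Omega> c"
proof -
  have "emeasure (spread \<Omega> \<mu> e) UNIV = ennreal c" by (simp add: emeasure_spread emeasure_pair)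
  moreover have "emeasure (spread \<Omega> \<mu> e) (- closure \<Omega>) = 0"
  proof -
    have "AE w in spread_pair \<Omega> \<mu>. w \<notin> (\<lambda>(x, y). lerp e x y) -` (- closure \<Omega>)"
      using AE_pair by eventually_elim (use interpolate_in_closure[OF _ _ e] closure_subset[of \<Omega>] in auto)
    then have "emeasure (spread_pair \<Omega> \<mu>) ((\<lambda>(x, y). lerp e x y) -` (- closure \<Omega>)) = 0"
      using measurable_sets[OF measurable_spread_map, of "- closure \<Omega>" e]
      by (subst AE_iff_measurable[symmetric, where P = "\<lambda>w. w \<notin> (\<lambda>(x, y). lerp e x y) -` (- closure \<Omega>)"]) auto
    then show ?thesis by (simp add: emeasure_spread)
  qed
  moreover have "finite_measure (spread \<Omega> \<mu> e)"
    using \<open>emeasure (spread \<Omega> \<mu> e) UNIV = ennreal c\<close> by (intro finite_measureI) (simp add: spread_def)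
  ultimately show ?thesis by (simp add: Mplus_mass_def Mplus_def)
qed

lemma spread_0: "spread \<Omega> \<mu> 0 = \<mu>"
proof (rule measure_eqI)
  fix A assume "A \<in> sets (spread \<Omega> \<mu> 0)"
  then have A: "A \<in> sets borel" by simp
  have "(\<lambda>(x, y). (1 - 0) *\<^sub>R x + 0 *\<^sub>R y) -` A = A \<times> (UNIV :: 'a set)" by auto
  moreover have "emeasure (\<mu> \<Otimes>\<^sub>M unif) (A \<times> UNIV) = emeasure \<mu> A * emeasure unif UNIV"
    using A by (intro un.emeasure_pair_measure_Times) auto
  ultimately show "emeasure (spread \<Omega> \<mu> 0) A = emeasure \<mu> A"
    using A un.emeasure_space_1 by (simp add: emeasure_spread spread_pair_def)
qed simp

lemma integral_spread:
  fixes f :: "'a \<Rightarrow> real"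
  assumes [measurable]: "f \<in> borel_measurable borel"
  shows "(LINT z|spread \<Omega> \<mu> e. f z) = (\<integral>(x, y). f (lerp e x y) \<partial>spread_pair \<Omega> \<mu>)"
  unfolding spread_def by (subst integral_distr) (auto simp: split_beta')

lemma spread_eq_density:
  assumes e: "0 < e" shows "spread \<Omega> \<mu> e = density lborel (\<lambda>z. ennreal (dens e z))"
proof (rule measure_eqI)
  fix A assume "A \<in> sets (spread \<Omega> \<mu> e)"
  then have A[measurable]: "A \<in> sets borel" by simp
  have "emeasure (spread \<Omega> \<mu> e) A = (\<integral>\<^sup>+w. indicator A (case w of (x, y) \<Rightarrow> lerp e x y) \<partial>spread_pair \<Omega> \<mu>)"
    unfolding spread_def by (subst nn_integral_distr[symmetric, where M' = borel]) auto
  also have "\<dots> = (\<integral>\<^sup>+x. \<integral>\<^sup>+y. indicator A (lerp e x y) \<partial>unif \<partial>\<mu>)"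
    unfolding spread_pair_def by (subst un.nn_integral_fst[symmetric]) auto
  also have "\<dots> = (\<integral>\<^sup>+x. \<integral>\<^sup>+z. ennreal (kern e x z) * indicator A z \<partial>lborel \<partial>\<mu>)"
    by (intro nn_integral_cong nn_integral_unif_affine e) measurable
  also have "\<dots> = (\<integral>\<^sup>+z. \<integral>\<^sup>+x. ennreal (kern e x z) * indicator A z \<partial>\<mu> \<partial>lborel)"
    by (rule pl.Fubini'[symmetric]) measurable
  also have "\<dots> = (\<integral>\<^sup>+z. ennreal (dens e z) * indicator A z \<partial>lborel)"
  proof (intro nn_integral_cong)
    fix z
    have "(\<integral>\<^sup>+x. ennreal (kern e x z) * indicator A z \<partial>\<mu>) = (\<integral>\<^sup>+x. ennreal (kern e x z) \<partial>\<mu>) * indicator A z"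
      by (rule nn_integral_multc) measurable
    also have "(\<integral>\<^sup>+x. ennreal (kern e x z) \<partial>\<mu>) = ennreal (dens e z)"
      unfolding spread_density_def using spread_kernel_nonneg[of e] e by (intro nn_integral_eq_integral integrable_spread_kernel) auto
    finally show "(\<integral>\<^sup>+x. ennreal (kern e x z) * indicator A z \<partial>\<mu>) = ennreal (dens e z) * indicator A z" .
  qed
  also have "\<dots> = emeasure (density lborel (\<lambda>z. ennreal (dens e z))) A"
    by (subst emeasure_density) auto
  finally show "emeasure (spread \<Omega> \<mu> e) A = emeasure (density lborel (\<lambda>z. ennreal (dens e z))) A" .
qed simp

lemma nn_integral_spread_density:
  assumes e: "0 < e" shows "(\<integral>\<^sup>+z. ennreal (dens e z) \<partial>lborel) = ennreal c"
proof -
  have "emeasure (spread \<Omega> \<mu> e) UNIV = ennreal c" by (simp add: emeasure_spread emeasure_pair)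
  then show ?thesis unfolding spread_eq_density[OF e] by (subst (asm) emeasure_density) auto
qed

lemma spread_flux_eq_0: "0 < e \<Longrightarrow> e \<le> 1 \<Longrightarrow> z \<notin> \<Omega> \<Longrightarrow> flux e z = 0"
  using norm_spread_flux_le[of e z] spread_density_eq_0[of e z] by simp

text \<open>The flux of the motion \<open>e \<mapsto> (1 - e) x + e y\<close>, whose velocity is \<open>y - x\<close>.\<close>

lemma integral_spread_flux:
  fixes \<xi> :: "'a \<Rightarrow> 'a"
  assumes [measurable]: "\<xi> \<in> borel_measurable borel" and K: "\<And>z. norm (\<xi> z) \<le> K" and e: "0 < e"
  shows "(LINT z|lborel. \<xi> z \<bullet> flux e z) = (\<integral>(x, y). \<xi> (lerp e x y) \<bullet> (y - x) \<partial>spread_pair \<Omega> \<mu>)"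
proof -
  have K0: "0 \<le> K" using K[of 0] norm_ge_zero order_trans by blast
  have r: "(1 / e) *\<^sub>R ((lerp e x y) - x) = y - x" for x y :: 'a
    using e by (simp add: algebra_simps)
  have "AE w in spread_pair \<Omega> \<mu>. norm (case w of (x, y) \<Rightarrow> \<xi> (lerp e x y) \<bullet> ((1 / e) *\<^sub>R ((lerp e x y) - x))) \<le> K * D"
    using AE_pair
  proof eventually_elim
    case (elim w)
    obtain x y where w: "w = (x, y)" by force
    have "norm (y - x) \<le> D" using elim w closure_subset by (intro norm_diff_le_D) auto
    then have "norm (\<xi> (lerp e x y)) * norm (y - x) \<le> K * D" using K K0 by (intro mult_mono) auto
    then show ?case unfolding w prod.case r using Cauchy_Schwarz_ineq2 order_trans by (metis real_norm_def)
  qed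
  then have i: "integrable (spread_pair \<Omega> \<mu>) (\<lambda>(x, y). \<xi> (lerp e x y) \<bullet> ((1 / e) *\<^sub>R ((lerp e x y) - x)))"
    by (rule sp.integrable_const_bound) measurable
  have "(\<integral>(x, y). \<xi> (lerp e x y) \<bullet> (y - x) \<partial>spread_pair \<Omega> \<mu>) =
    (LINT z|lborel. (LINT x|\<mu>. kern e x z * (\<xi> z \<bullet> ((1 / e) *\<^sub>R (z - x)))))"
    using spread_change_of_variables(1)[OF _ e i] unfolding r by simp
  also have "\<dots> = (LINT z|lborel. \<xi> z \<bullet> flux e z)"
  proof (intro Bochner_Integration.integral_cong refl)
    fix z
    have le: "AE x in \<mu>. norm (kern e x z *\<^sub>R ((1 / e) *\<^sub>R (z - x))) \<le> D * kern e x z"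
      using AE_mu by eventually_elim (rule spread_kernel_flux_le[OF _ e])
    have "integrable \<mu> (\<lambda>x. kern e x z *\<^sub>R ((1 / e) *\<^sub>R (z - x)))"
      by (rule Bochner_Integration.integrable_bound[OF integrable_mult_right[OF integrable_spread_kernel[OF e, of z], of D]])
        (use le in \<open>auto elim!: eventually_mono\<close>)
    then have "\<xi> z \<bullet> flux e z = (LINT x|\<mu>. \<xi> z \<bullet> (kern e x z *\<^sub>R ((1 / e) *\<^sub>R (z - x))))"
      unfolding spread_flux_def by (subst integral_inner_right) auto
    also have "\<dots> = (LINT x|\<mu>. kern e x z * (\<xi> z \<bullet> ((1 / e) *\<^sub>R (z - x))))" by (simp only: inner_scaleR_right)
    finally show "(LINT x|\<mu>. kern e x z * (\<xi> z \<bullet> ((1 / e) *\<^sub>R (z - x)))) = \<xi> z \<bullet> flux e z" by simp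
  qed
  finally show ?thesis ..
qed

end

section \<open>Upper bounds for the distance from absolutely continuous paths\<close>

text \<open>When the flux has a density, \<open>vec_integral\<close> is a Lebesgue integral and the
  action is that of the densities. Membership in \<open>CE\<close> then reduces to one scalar
  identity, and the distance to a bound on the action at each time.\<close>

lemma Wdist_density_path:
  fixes \<Omega> :: "'a::euclidean_space set" and \<rho> :: "real \<Rightarrow> 'a \<Rightarrow> real" and w :: "real \<Rightarrow> 'a \<Rightarrow> 'a"
  assumes m: "mobility m" and \<Omega>: "bounded \<Omega>" "open \<Omega>"
    and \<mu>: "\<And>s. s \<in> {0..1} \<Longrightarrow> \<mu> s \<in> Mplus \<Omega>"
    and cont: "\<And>f :: 'a \<Rightarrow> real. continuous_on UNIV f \<Longrightarrow> bounded {x. f x \<noteq> 0} \<Longrightarrow> continuous_on {0..1} (\<lambda>s. LINT x|\<mu> s. f x)"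
    and \<rho>: "\<And>s. s \<in> {0<..<1} \<Longrightarrow> \<rho> s \<in> borel_measurable borel" "\<And>s z. s \<in> {0<..<1} \<Longrightarrow> 0 \<le> \<rho> s z"
    and dens: "\<And>s. s \<in> {0<..<1} \<Longrightarrow> \<mu> s = density lborel (\<lambda>z. ennreal (\<rho> s z))"
    and w: "(\<lambda>z. w (fst z) (snd z)) \<in> borel_measurable (borel \<Otimes>\<^sub>M borel)" "\<And>s z. s \<in> {0<..<1} \<Longrightarrow> z \<notin> \<Omega> \<Longrightarrow> w s z = 0"
    and wint: "\<And>s. s \<in> {0<..<1} \<Longrightarrow> (\<integral>\<^sup>+z. ennreal (norm (w s z)) \<partial>lborel) \<le> ennreal W"
    and eq: "\<And>\<zeta>. \<zeta> \<in> test_functions \<Longrightarrow> (LINT s:{0<..<1}|lborel. (LINT x|\<mu> s. time_deriv \<zeta> s x) + (LINT z|lborel. space_grad \<zeta> s z \<bullet> w s z)) = 0"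
    and E: "\<And>s. s \<in> {0<..<1} \<Longrightarrow> (\<integral>\<^sup>+z\<in>\<Omega>. act_density m (\<rho> s z) (w s z) \<partial>lborel) \<le> ennreal (r\<^sup>2)" and r: "0 \<le> r"
  shows "Wdist m \<Omega> (\<mu> 0) (\<mu> 1) \<le> ennreal r"
proof -
  define \<nu> where "\<nu> s B = (LINT z:B|lborel. w s z)" for s B
  have [measurable]: "\<Omega> \<in> sets borel" using \<Omega>(2) by simp
  have ws[measurable]: "w s \<in> borel_measurable borel" for s
    using measurable_compose[OF _ w(1), of "\<lambda>z. (s, z)" borel] by simp
  have wi: "integrable lborel (w s)" if "s \<in> {0<..<1}" for s
    using wint[OF that] by (intro integrableI_bounded) (auto intro: le_less_trans)
  have bound: "ennreal (norm (\<nu> s B)) \<le> emeasure (density lborel (\<lambda>z. ennreal (norm (w s z)))) B"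
    if s: "s \<in> {0<..<1}" and B: "B \<in> sets borel" for s B
  proof -
    have "ennreal (norm (\<nu> s B)) \<le> (\<integral>\<^sup>+z. ennreal (norm (indicator B z *\<^sub>R w s z)) \<partial>lborel)"
      unfolding \<nu>_def set_lebesgue_integral_def using B by (intro integral_norm_bound_ennreal integrable_mult_indicator wi s) auto
    also have "\<dots> = (\<integral>\<^sup>+z. ennreal (norm (w s z)) * indicator B z \<partial>lborel)"
      by (intro nn_integral_cong) (auto simp: indicator_def)
    also have "\<dots> = emeasure (density lborel (\<lambda>z. ennreal (norm (w s z)))) B"
      using B by (subst emeasure_density) auto
    finally show ?thesis .
  qed
  have tv: "total_var (\<nu> s) C \<le> ennreal W" if s: "s \<in> {0<..<1}" and C: "C \<in> sets borel" for s C
  proof -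
    have "total_var (\<nu> s) C \<le> emeasure (density lborel (\<lambda>z. ennreal (norm (w s z)))) C"
      by (rule total_var_le_measure[OF _ bound[OF s] C]) simp
    also have "\<dots> \<le> emeasure (density lborel (\<lambda>z. ennreal (norm (w s z)))) UNIV" by (intro emeasure_mono) auto
    also have "\<dots> \<le> ennreal W" using wint[OF s] by (subst emeasure_density) auto
    finally show ?thesis .
  qed
  have M: "\<nu> s \<in> Mvec \<Omega>" if s: "s \<in> {0<..<1}" for s
  proof -
    have "\<nu> s B = 0" if "B \<subseteq> - closure \<Omega>" for B
    proof -
      have "(\<lambda>z. indicator B z *\<^sub>R w s z) = (\<lambda>z. 0)"
        using that w(2)[OF s] closure_subset[of \<Omega>] by (auto simp: indicator_def fun_eq_iff)
      then show ?thesis unfolding \<nu>_def set_lebesgue_integral_def by simp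
    qed
    then have "total_var (\<nu> s) (- closure \<Omega>) = 0" by (intro total_var_eq_0) blast
    moreover have "total_var (\<nu> s) UNIV < \<infinity>" using tv[OF s, of UNIV] by (auto intro: le_less_trans)
    moreover have "vec_measure (\<nu> s)" unfolding \<nu>_def by (rule vec_measure_set_integral[OF _ wi[OF s]]) simp
    ultimately show ?thesis by (simp add: Mvec_def)
  qed
  have "(\<lambda>s. \<nu> s B) \<in> borel_measurable (restrict_space borel {0<..<1})" if [measurable]: "B \<in> sets borel" for B
  proof -
    have [measurable]: "(\<lambda>z. w (fst z) (snd z)) \<in> borel_measurable (borel \<Otimes>\<^sub>M lborel)"
      using w(1) by (simp cong: measurable_cong_sets)
    have "(\<lambda>s. \<nu> s B) \<in> borel_measurable borel"
      unfolding \<nu>_def set_lebesgue_integral_def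
      by (rule lborel.borel_measurable_lebesgue_integral) (simp add: split_beta')
    then show ?thesis by (rule measurable_restrict_space1)
  qed
  moreover have "(\<integral>\<^sup>+ s \<in> {0<..<1}. total_var (\<nu> s) (closure \<Omega>) \<partial>lborel) < \<infinity>"
  proof -
    have "(\<integral>\<^sup>+ s \<in> {0<..<1}. total_var (\<nu> s) (closure \<Omega>) \<partial>lborel) \<le> (\<integral>\<^sup>+ (s::real). ennreal W * indicator {0<..<1} s \<partial>lborel)"
      by (intro nn_integral_mono) (auto simp: indicator_def intro: tv)
    then show ?thesis by (simp add: nn_integral_cmult_indicator le_less_trans)
  qed
  moreover have "(LINT s:{0<..<1}|lborel. (LINT x|\<mu> s. time_deriv \<zeta> s x) + vec_integral (\<nu> s) (space_grad \<zeta> s)) = 0"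
    if \<zeta>: "\<zeta> \<in> test_functions" for \<zeta>
  proof -
    note t = test_functions_smooth_compact(1)[OF \<zeta>]
    obtain K where K: "\<And>s x. norm (space_grad \<zeta> s x) \<le> K" using bounded_space_grad[OF t] by blast
    have "vec_integral (\<nu> s) (space_grad \<zeta> s) = (LINT z|lborel. space_grad \<zeta> s z \<bullet> w s z)" if "s \<in> {0<..<1}" for s
      by (rule vec_integral_set_integral[OF _ wi[OF that] _ smooth_compact_slices(4)[OF t] K]) (auto simp: \<nu>_def)
    then have "(LINT s:{0<..<1}|lborel. (LINT x|\<mu> s. time_deriv \<zeta> s x) + vec_integral (\<nu> s) (space_grad \<zeta> s)) =
      (LINT s:{0<..<1}|lborel. (LINT x|\<mu> s. time_deriv \<zeta> s x) + (LINT z|lborel. space_grad \<zeta> s z \<bullet> w s z))"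
      by (intro set_lebesgue_integral_cong) auto
    then show ?thesis using eq[OF \<zeta>] by simp
  qed
  moreover have "continuous_map (top_of_set {0..1}) (weak_star (Mplus \<Omega>)) \<mu>"
    unfolding weak_star_continuous_map using \<mu> cont by auto
  ultimately have CE: "(\<mu>, \<nu>) \<in> CE \<Omega> (\<mu> 0) (\<mu> 1)" using \<mu> M by (simp add: CE_def)
  have a: "action m \<Omega> (\<mu> s) (\<nu> s) \<le> ennreal (r\<^sup>2)" if s: "s \<in> {0<..<1}" for s
  proof -
    have "s \<in> {0..1}" using s by auto
    then have "action m \<Omega> (\<mu> s) (\<nu> s) = (\<integral>\<^sup>+z\<in>\<Omega>. act_density m (\<rho> s z) (w s z) \<partial>lborel)"
      unfolding dens[OF s] using \<mu>[of s] dens[OF s]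
      by (intro action_density[OF m _ _ M[OF s] \<rho>(1)[OF s] \<rho>(2)[OF s] wi[OF s]]) (auto simp: \<nu>_def)
    then show ?thesis using E[OF s] by simp
  qed
  have "(\<integral>\<^sup>+ s \<in> {0<..<1}. action m \<Omega> (\<mu> s) (\<nu> s) \<partial>lborel) \<le> (\<integral>\<^sup>+ (s::real). ennreal (r\<^sup>2) * indicator {0<..<1} s \<partial>lborel)"
    using a by (intro nn_integral_mono) (auto simp: indicator_def)
  also have "\<dots> = ennreal (r\<^sup>2)" by (subst nn_integral_cmult_indicator) auto
  finally show ?thesis by (rule Wdist_le[OF CE _ r])
qed

context spread_measure
begin

text \<open>With \<open>e = \<epsilon> s\<^sup>2\<close> the speed \<open>2 \<epsilon> s\<close> compensates the blow-up rate \<open>1 / e\<close> of \<open>R / m(R)\<close>, where \<open>R\<close> is the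
  maximal density at parameter \<open>e\<close>.\<close>

lemma Wdist_spread:
  assumes m: "mobility m" and C: "0 \<le> C" "\<And>e. 0 < e \<Longrightarrow> e \<le> 1 \<Longrightarrow> (c / (e ^ DIM('a) * vol)) / m (c / (e ^ DIM('a) * vol)) \<le> C / e"
    and \<epsilon>: "0 < \<epsilon>" "\<epsilon> \<le> 1"
  shows "Wdist m \<Omega> \<mu> (spread \<Omega> \<mu> \<epsilon>) \<le> ennreal (sqrt (4 * \<epsilon> * D\<^sup>2 * c * C))"
proof -
  define e where "e s = \<epsilon> * s\<^sup>2" for s :: real
  have e: "0 < e s" "e s \<le> 1" if "s \<in> {0<..<1}" for s
    using that \<epsilon> by (auto simp: e_def intro!: mult_le_one power_le_one)
  have e01: "0 \<le> e s" "e s \<le> 1" if "s \<in> {0..1}" for s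
    using that \<epsilon> by (auto simp: e_def intro!: mult_le_one power_le_one)
  have eD: "(e has_real_derivative 2 * \<epsilon> * s) (at s)" for s
    unfolding e_def by (auto intro!: derivative_eq_intros)
  let ?v = "\<lambda>s p. (2 * \<epsilon> * s) *\<^sub>R (snd p - fst p :: 'a)"
  define w where "w s z = (2 * \<epsilon> * s) *\<^sub>R flux (e s) z" for s z
  have "Wdist m \<Omega> (spread \<Omega> \<mu> (e 0)) (spread \<Omega> \<mu> (e 1)) \<le> ennreal (sqrt (4 * \<epsilon> * D\<^sup>2 * c * C))"
  proof (rule Wdist_density_path[OF m bounded_domain open_domain, where \<mu> = "\<lambda>s. spread \<Omega> \<mu> (e s)" and w = w and
        \<rho> = "\<lambda>s. dens \<bar>e s\<bar>" and W = "2 * \<epsilon> * D * c"])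
    show "spread \<Omega> \<mu> (e s) \<in> Mplus \<Omega>" if "s \<in> {0..1}" for s
      using spread_mass[OF e01[OF that]] by (simp add: Mplus_mass_def)
    show "continuous_on {0..1} (\<lambda>s. LINT x|spread \<Omega> \<mu> (e s). f x)" if f: "continuous_on UNIV f" "bounded {x. f x \<noteq> 0}" for f :: "'a \<Rightarrow> real"
    proof -
      obtain K where K: "\<And>x. \<bar>f x\<bar> \<le> K" using bounded_support_bounded[OF f] by blast
      have [measurable]: "f \<in> borel_measurable borel" using f by (intro borel_measurable_continuous_onI)
      show ?thesis
        unfolding continuous_on_sequentially comp_def
      proof (intro allI ballI impI)
        fix sn s assume sn: "s \<in> {0..1::real}" "(\<forall>n. sn n \<in> {0..1}) \<and> sn \<longlonglongrightarrow> s"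
        then have es: "(\<lambda>n. e (sn n)) \<longlonglongrightarrow> e s" unfolding e_def by (intro tendsto_intros) auto
        show "(\<lambda>n. LINT x|spread \<Omega> \<mu> (e (sn n)). f x) \<longlonglongrightarrow> (LINT x|spread \<Omega> \<mu> (e s). f x)"
          unfolding integral_spread[OF \<open>f \<in> borel_measurable borel\<close>]
        proof (rule integral_dominated_convergence[where w = "\<lambda>_. K"])
          show "AE w in spread_pair \<Omega> \<mu>. (\<lambda>n. case w of (x, y) \<Rightarrow> f (lerp (e (sn n)) x y)) \<longlonglongrightarrow> (case w of (x, y) \<Rightarrow> f (lerp (e s) x y))"
          proof (intro AE_I2)
            fix w :: "'a \<times> 'a"
            obtain x y where w: "w = (x, y)" by force
            show "(\<lambda>n. case w of (x, y) \<Rightarrow> f (lerp (e (sn n)) x y)) \<longlonglongrightarrow> (case w of (x, y) \<Rightarrow> f (lerp (e s) x y))"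
              unfolding w prod.case by (rule continuous_on_tendsto_compose[OF f(1)]) (auto intro!: tendsto_intros es)
          qed
        qed (auto simp: K split_beta')
      qed
    qed
    show "dens \<bar>e s\<bar> \<in> borel_measurable borel" for s by measurable
    show "0 \<le> dens \<bar>e s\<bar> z" for s z by (rule spread_density_nonneg) simp
    show "spread \<Omega> \<mu> (e s) = density lborel (\<lambda>z. ennreal (dens \<bar>e s\<bar> z))" if "s \<in> {0<..<1}" for s
      using spread_eq_density[OF e(1)[OF that]] e(1)[OF that] by simp
    have "(\<lambda>z. flux (e (fst z)) (snd z)) \<in> borel_measurable (borel \<Otimes>\<^sub>M borel)"
    proof -
      have "(\<lambda>z. (e (fst z), snd z)) \<in> borel \<Otimes>\<^sub>M borel \<rightarrow>\<^sub>M borel \<Otimes>\<^sub>M (borel :: 'a measure)" unfolding e_def by measurable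
      from measurable_compose[OF this measurable_spread_flux(1)] show ?thesis by simp
    qed
    then show "(\<lambda>z. w (fst z) (snd z)) \<in> borel_measurable (borel \<Otimes>\<^sub>M borel)" unfolding w_def by measurable
    show "w s z = 0" if "s \<in> {0<..<1}" "z \<notin> \<Omega>" for s z using spread_flux_eq_0[OF e[OF that(1)] that(2)] by (simp add: w_def)
    have wn: "norm (w s z) \<le> 2 * \<epsilon> * s * (D * dens (e s) z)" if "s \<in> {0<..<1}" for s z
      unfolding w_def norm_scaleR using that \<epsilon> norm_spread_flux_le[OF e(1)[OF that], of z] by (simp add: mult_left_mono)
    show "(\<integral>\<^sup>+z. ennreal (norm (w s z)) \<partial>lborel) \<le> ennreal (2 * \<epsilon> * D * c)" if s: "s \<in> {0<..<1}" for s
    proof -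
      have "norm (w s z) \<le> 2 * \<epsilon> * D * dens (e s) z" for z
      proof -
        have "2 * \<epsilon> * s * (D * dens (e s) z) \<le> 2 * \<epsilon> * 1 * (D * dens (e s) z)"
          using s \<epsilon> D_nonneg spread_density_nonneg[of "e s" z] e(1)[OF s] by (intro mult_right_mono mult_left_mono) auto
        then show ?thesis using wn[OF s, of z] by (simp add: mult.assoc)
      qed
      then have "(\<integral>\<^sup>+z. ennreal (norm (w s z)) \<partial>lborel) \<le> (\<integral>\<^sup>+z. ennreal (2 * \<epsilon> * D) * ennreal (dens (e s) z) \<partial>lborel)"
        using \<epsilon> D_nonneg spread_density_nonneg[of "e s"] e(1)[OF s] by (intro nn_integral_mono) (auto simp: ennreal_mult[symmetric] intro!: ennreal_leI)
      also have "\<dots> = ennreal (2 * \<epsilon> * D) * ennreal c"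
        using nn_integral_spread_density[OF e(1)[OF s]] by (subst nn_integral_cmult) auto
      finally show ?thesis using \<epsilon> D_nonneg mass_pos by (simp add: ennreal_mult[symmetric])
    qed
    show "(LINT s:{0<..<1}|lborel. (LINT x|spread \<Omega> \<mu> (e s). time_deriv \<zeta> s x) + (LINT z|lborel. space_grad \<zeta> s z \<bullet> w s z)) = 0"
      if \<zeta>: "\<zeta> \<in> test_functions" for \<zeta>
    proof -
      note t = test_functions_smooth_compact[OF \<zeta>]
      obtain a b where ab: "0 < a" "a < b" "b < 1" "\<And>s x. s \<notin> {a..b} \<Longrightarrow> (s, x) \<notin> closure {z. \<zeta> z \<noteq> 0}"
        using t(3) by blast
      obtain K1 where K1: "0 \<le> K1" "\<And>s x. \<bar>time_deriv \<zeta> s x\<bar> \<le> K1" using bounded_time_deriv[OF t(1)] by blast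
      obtain K2 where K2: "0 \<le> K2" "\<And>s x. norm (space_grad \<zeta> s x) \<le> K2" using bounded_space_grad[OF t(1)] by blast
      \<comment> \<open>\<open>X s p\<close> is the position at time \<open>s\<close> of the
        particle labelled p = (x, y), and \<open>G'\<close> is the derivative of the test function
        along its trajectory.\<close>
      define X where "X s p = lerp (e s) (fst p) (snd p)" for s and p :: "'a \<times> 'a"
      define G' where "G' s p = time_deriv \<zeta> s (X s p) + space_grad \<zeta> s (X s p) \<bullet> (?v s p)" for s p
      have XD: "((\<lambda>s. X s p) has_vector_derivative ?v s p) (at s)" for s p
        unfolding X_def using eD[of s]
        by (auto intro!: derivative_eq_intros simp: algebra_simps has_real_derivative_iff_has_vector_derivative)
      have Xc: "continuous_on UNIV (\<lambda>q. X (fst q) (snd q))"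
        unfolding X_def e_def by (intro continuous_intros)
      have tdc: "continuous_on UNIV (\<lambda>q. time_deriv \<zeta> (fst q) (X (fst q) (snd q)))"
        by (rule continuous_on_compose2[OF continuous_time_deriv[OF t(1)], of _ "\<lambda>q. (fst q, X (fst q) (snd q))", simplified])
          (intro continuous_intros Xc)
      have sgc: "continuous_on UNIV (\<lambda>q. space_grad \<zeta> (fst q) (X (fst q) (snd q)))"
        by (rule continuous_on_compose2[OF continuous_space_grad[OF t(1)], of _ "\<lambda>q. (fst q, X (fst q) (snd q))", simplified])
          (intro continuous_intros Xc)
      have G'c: "continuous_on UNIV (\<lambda>q. G' (fst q) (snd q))"
        unfolding G'_def by (intro continuous_intros tdc sgc)
      have zero: "(LINT s:{0<..<1}|lborel. LINT p|spread_pair \<Omega> \<mu>. G' s p) = 0"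
      proof (rule fubini_time_derivative[OF finite_pair _ _ ab(1-3), where G = "\<lambda>s p. \<zeta> (s, X s p)" and K = "K1 + K2 * (2 * \<epsilon> * D)"])
        show "((\<lambda>s. \<zeta> (s, X s p)) has_real_derivative G' s p) (at s)" for s p
          unfolding G'_def by (rule smooth_compact_chain(1)[OF t(1) XD])
        show "continuous_on {0<..<1} (\<lambda>s. G' s p)" for p
          using continuous_on_compose2[OF G'c, of "{0<..<1}" "\<lambda>s. (s, p)"] by (simp add: continuous_intros)
        show "\<zeta> (s, X s p) = 0 \<and> G' s p = 0" if "s \<notin> {a..b}" for s p
          unfolding G'_def using derivs_outside_support[OF ab(4)[OF that]] by simp
        have "(\<lambda>q. G' (fst q) (snd q)) \<in> borel_measurable (borel \<Otimes>\<^sub>M (borel \<Otimes>\<^sub>M borel))"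
          using borel_measurable_continuous_onI[OF G'c] by (simp add: borel_prod)
        then show "(\<lambda>(s, p). G' s p) \<in> borel_measurable (borel \<Otimes>\<^sub>M spread_pair \<Omega> \<mu>)"
          unfolding measurable_cong_sets[OF sets_pair_measure_cong[OF refl sets_pair] refl] by (simp add: split_beta')
        show "AE p in spread_pair \<Omega> \<mu>. \<bar>G' s p\<bar> \<le> K1 + K2 * (2 * \<epsilon> * D)" if s: "s \<in> {0<..<1}" for s
          using AE_pair
        proof eventually_elim
          case (elim p)
          then have "norm (snd p - fst p) \<le> D" using closure_subset by (intro norm_diff_le_D) (auto simp: split_beta')
          then have "2 * \<epsilon> * s * norm (snd p - fst p) \<le> 2 * \<epsilon> * 1 * D"
            using s \<epsilon> by (intro mult_mono) auto
          then have "norm (?v s p) \<le> 2 * \<epsilon> * D" using s \<epsilon> by simp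
          then have "norm (space_grad \<zeta> s (X s p)) * norm (?v s p) \<le> K2 * (2 * \<epsilon> * D)"
            using K2 by (intro mult_mono) auto
          then have "\<bar>space_grad \<zeta> s (X s p) \<bullet> (?v s p)\<bar> \<le> K2 * (2 * \<epsilon> * D)"
            using Cauchy_Schwarz_ineq2 order_trans by blast
          then show ?case unfolding G'_def using K1(2)[of s "X s p"] by linarith
        qed
      qed
      have "(LINT x|spread \<Omega> \<mu> (e s). time_deriv \<zeta> s x) + (LINT z|lborel. space_grad \<zeta> s z \<bullet> w s z) = (LINT p|spread_pair \<Omega> \<mu>. G' s p)"
        if s: "s \<in> {0<..<1}" for s
      proof -
        have [measurable]: "time_deriv \<zeta> s \<in> borel_measurable borel" "space_grad \<zeta> s \<in> borel_measurable borel"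
          using smooth_compact_slices(2,4)[OF t(1), of s] by (auto intro: borel_measurable_continuous_onI)
        have 1: "(LINT x|spread \<Omega> \<mu> (e s). time_deriv \<zeta> s x) = (LINT p|spread_pair \<Omega> \<mu>. time_deriv \<zeta> s (X s p))"
          by (subst integral_spread) (auto simp: X_def split_beta')
        have "(LINT z|lborel. space_grad \<zeta> s z \<bullet> w s z) = (2 * \<epsilon> * s) * (LINT z|lborel. space_grad \<zeta> s z \<bullet> flux (e s) z)"
          by (simp add: w_def)
        also have "\<dots> = (LINT p|spread_pair \<Omega> \<mu>. space_grad \<zeta> s (X s p) \<bullet> (?v s p))"
          by (subst integral_spread_flux[OF _ K2(2) e(1)[OF s]]) (auto simp: X_def split_beta')
        finally have 2: "(LINT z|lborel. space_grad \<zeta> s z \<bullet> w s z) = \<dots>" .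
        have [measurable]: "X s \<in> spread_pair \<Omega> \<mu> \<rightarrow>\<^sub>M borel" unfolding X_def by measurable
        have i1: "integrable (spread_pair \<Omega> \<mu>) (\<lambda>p. time_deriv \<zeta> s (X s p))"
          by (rule sp.integrable_const_bound[where B = K1]) (auto simp: K1)
        have i2: "integrable (spread_pair \<Omega> \<mu>) (\<lambda>p. space_grad \<zeta> s (X s p) \<bullet> (?v s p))"
        proof (rule sp.integrable_const_bound[where B = "K2 * (\<bar>2 * \<epsilon> * s\<bar> * D)"])
          show "AE p in spread_pair \<Omega> \<mu>. norm (space_grad \<zeta> s (X s p) \<bullet> (?v s p)) \<le> K2 * (\<bar>2 * \<epsilon> * s\<bar> * D)"
            using AE_pair
          proof eventually_elim
            case (elim p)
            then have "norm (snd p - fst p) \<le> D" using closure_subset by (intro norm_diff_le_D) (auto simp: split_beta')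
            then have "norm (space_grad \<zeta> s (X s p)) * norm (?v s p) \<le> K2 * (\<bar>2 * \<epsilon> * s\<bar> * D)"
              using K2 unfolding norm_scaleR by (intro mult_mono mult_left_mono) auto
            then show ?case using Cauchy_Schwarz_ineq2 order_trans by (metis real_norm_def)
          qed
        qed measurable
        show ?thesis unfolding 1 2 G'_def using Bochner_Integration.integral_add[OF i1 i2] by simp
      qed
      then have "(LINT s:{0<..<1}|lborel. (LINT x|spread \<Omega> \<mu> (e s). time_deriv \<zeta> s x) + (LINT z|lborel. space_grad \<zeta> s z \<bullet> w s z)) =
        (LINT s:{0<..<1}|lborel. LINT p|spread_pair \<Omega> \<mu>. G' s p)"
        by (intro set_lebesgue_integral_cong) auto
      then show ?thesis using zero by simp
    qed
    show "(\<integral>\<^sup>+z\<in>\<Omega>. act_density m (dens \<bar>e s\<bar> z) (w s z) \<partial>lborel) \<le> ennreal ((sqrt (4 * \<epsilon> * D\<^sup>2 * c * C))\<^sup>2)" if s: "s \<in> {0<..<1}" for s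
    proof -
      define R where "R = c / (e s ^ DIM('a) * vol)"
      have abs: "\<bar>e s\<bar> = e s" using e(1)[OF s] by simp
      have R: "0 < R" using e(1)[OF s] mass_pos vol_pos by (simp add: R_def)
      \<comment> \<open>One factor \<open>q\<close> is kept and integrates to \<open>c\<close>. The
        other goes into the ratio \<open>q / m q\<close>, which is largest at \<open>R\<close>; its
        bound C / e(s) cancels the s^2 of the squared speed.\<close>
      have pt: "act_density m (dens (e s) z) (w s z) \<le> ennreal (4 * \<epsilon> * D\<^sup>2 * C) * ennreal (dens (e s) z)" for z
      proof -
        define q where "q = dens (e s) z"
        have q: "0 \<le> q" "q \<le> R" unfolding q_def R_def using spread_density_nonneg[of "e s" z] spread_density_le[OF e(1)[OF s], of z] e(1)[OF s] by auto
        have wq: "norm (w s z) \<le> 2 * \<epsilon> * s * (D * q)" unfolding q_def by (rule wn[OF s])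
        show ?thesis
        proof (cases "q = 0")
          case True
          then show ?thesis using wq unfolding q_def[symmetric] by simp
        next
          case False
          then have q0: "0 < q" using q by simp
          have "(norm (w s z))\<^sup>2 / m q \<le> (2 * \<epsilon> * s * (D * q))\<^sup>2 / m q"
            using wq mobility_pos[OF m q0] by (intro divide_right_mono power_mono) auto
          also have "\<dots> = 4 * \<epsilon>\<^sup>2 * s\<^sup>2 * D\<^sup>2 * q * (q / m q)" by (simp add: power2_eq_square)
          also have "\<dots> \<le> 4 * \<epsilon>\<^sup>2 * s\<^sup>2 * D\<^sup>2 * q * (C / e s)"
            using order_trans[OF mobility_ratio_mono[OF m q0 q(2)] C(2)[OF e[OF s], folded R_def]] q by (intro mult_left_mono) auto
          also have "\<dots> = 4 * \<epsilon> * D\<^sup>2 * C * q" using s \<epsilon> by (simp add: e_def power2_eq_square)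
          finally show ?thesis unfolding q_def[symmetric] using mobility_pos[OF m q0] q \<epsilon> C(1)
            by (simp add: act_density_eq ennreal_mult[symmetric] ennreal_leI)
        qed
      qed
      have "(\<integral>\<^sup>+z\<in>\<Omega>. act_density m (dens \<bar>e s\<bar> z) (w s z) \<partial>lborel) \<le> (\<integral>\<^sup>+z. ennreal (4 * \<epsilon> * D\<^sup>2 * C) * ennreal (dens (e s) z) \<partial>lborel)"
        unfolding abs using pt by (intro nn_integral_mono) (auto simp: indicator_def)
      also have "\<dots> = ennreal (4 * \<epsilon> * D\<^sup>2 * C) * ennreal c"
        using nn_integral_spread_density[OF e(1)[OF s]] by (subst nn_integral_cmult) auto
      finally show ?thesis using \<epsilon> C(1) mass_pos by (simp add: ennreal_mult[symmetric] ac_simps)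
    qed
    show "0 \<le> sqrt (4 * \<epsilon> * D\<^sup>2 * c * C)" using \<epsilon> C(1) mass_pos by simp
  qed
  then show ?thesis by (simp add: e_def spread_0)
qed

end

section \<open>Comparing two spread measures\<close>

text \<open>The flux accumulated between the parameters \<open>e\<close> and 1. Its divergence is
  the density at \<open>e\<close> minus the uniform density at 1, so it records the whole spreading
  as a single vector field.\<close>

definition spread_potential :: "'a::euclidean_space set \<Rightarrow> 'a measure \<Rightarrow> real \<Rightarrow> 'a \<Rightarrow> 'a" where
  "spread_potential \<Omega> \<mu> e z = (LINT t|restrict_space lborel {e..1}. spread_flux \<Omega> \<mu> t z)"

text \<open>The contribution of a unit mass at \<open>x\<close> to the potential at
  \<open>z\<close>.\<close>

definition potential_kernel :: "'a::euclidean_space set \<Rightarrow> real \<Rightarrow> 'a \<Rightarrow> 'a \<Rightarrow> 'a" where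
  "potential_kernel \<Omega> e x z = (LINT t|restrict_space lborel {e..1}. spread_kernel \<Omega> t x z *\<^sub>R ((1 / t) *\<^sub>R (z - x)))"

lemma finite_restrict_Icc: "finite_measure (restrict_space lborel {e..1::real})"
  using emeasure_bounded_finite[of "{e..1::real}"]
  by (intro finite_measureI) (simp add: emeasure_restrict_space space_restrict_space less_top)

lemma measurable_pair_restrict:
  assumes "f \<in> borel_measurable (borel \<Otimes>\<^sub>M M)"
  shows "f \<in> borel_measurable (restrict_space lborel {e..1::real} \<Otimes>\<^sub>M M)"
proof -
  let ?R = "restrict_space lborel {e..1::real}"
  have "fst \<in> ?R \<Otimes>\<^sub>M M \<rightarrow>\<^sub>M borel"
    using measurable_compose[OF measurable_fst, of "\<lambda>x. x" ?R borel M] by (simp add: measurable_restrict_space1)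
  then have "(\<lambda>x. (fst x, snd x)) \<in> ?R \<Otimes>\<^sub>M M \<rightarrow>\<^sub>M borel \<Otimes>\<^sub>M M" by (intro measurable_Pair) auto
  from measurable_compose[OF this assms] show ?thesis by simp
qed

context convex_domain
begin

lemma norm_kernel_flux_le:
  assumes "x \<in> closure \<Omega>" "0 < e" "e \<le> t"
  shows "norm (kern t x z *\<^sub>R ((1 / t) *\<^sub>R (z - x))) \<le> D / (e ^ DIM('a) * vol)"
proof -
  have "norm (kern t x z *\<^sub>R ((1 / t) *\<^sub>R (z - x))) \<le> D * kern t x z"
    using assms by (intro spread_kernel_flux_le) auto
  also have "\<dots> \<le> D * (1 / (t ^ DIM('a) * vol))" using spread_kernel_le[of t x z] D_nonneg assms by (intro mult_left_mono) auto
  also have "\<dots> \<le> D * (1 / (e ^ DIM('a) * vol))"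
    using D_nonneg vol_pos assms by (intro mult_left_mono divide_left_mono mult_right_mono power_mono mult_pos_pos) auto
  finally show ?thesis by simp
qed

lemma measurable_potential_kernel: "(\<lambda>x. potential_kernel \<Omega> e x z) \<in> borel_measurable borel"
proof -
  interpret R: finite_measure "restrict_space lborel {e..1::real}" by (rule finite_restrict_Icc)
  have "(\<lambda>w. kern (fst w) (snd w) z *\<^sub>R ((1 / fst w) *\<^sub>R (z - snd w))) \<in> borel_measurable (restrict_space lborel {e..1} \<Otimes>\<^sub>M borel)"
    by (rule measurable_pair_restrict) measurable
  then have "(\<lambda>w. kern (snd w) (fst w) z *\<^sub>R ((1 / snd w) *\<^sub>R (z - fst w))) \<in> borel_measurable (borel \<Otimes>\<^sub>M restrict_space lborel {e..1})"
    by (subst measurable_pair_swap_iff) (simp add: split_beta')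
  then show ?thesis
    unfolding potential_kernel_def by (intro R.borel_measurable_lebesgue_integral) (simp add: split_beta')
qed

text \<open>For \<open>z \<in> \<Omega>\<close> the ray \<open>t \<mapsto> x + (z - x) / t\<close> meets the frontier of the convex domain at most once.\<close>

lemma frontier_crossing:
  assumes z: "z \<in> \<Omega>" and e: "0 < e"
  shows "finite {t \<in> {e..1}. x + (1 / t) *\<^sub>R (z - x) \<in> frontier \<Omega>}"
proof -
  let ?y = "\<lambda>t. x + (1 / t) *\<^sub>R (z - x)"
  have no: False if t: "t1 \<in> {e..1}" "t2 \<in> {e..1}" "t1 < t2" and f: "?y t1 \<in> frontier \<Omega>" "?y t2 \<in> frontier \<Omega>" for t1 t2
  proof -
    have t0: "0 < t1" "0 < t2" "t2 \<le> 1" "t1 < 1" using t e by auto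
    \<comment> \<open>The ray is affine in 1 / t and equals \<open>z\<close> at t = 1; this \<theta>
      makes \<open>?y t2\<close> the combination of \<open>?y t1\<close> and \<open>z\<close> with
      weights \<theta> and 1 - \<theta>. A combination of a closure point with \<open>z\<close> is
      interior unless \<theta> = 1.\<close>
    define \<theta> where "\<theta> = (1 / t2 - 1) / (1 / t1 - 1)"
    have d: "0 < 1 / t1 - 1" using t0 by (simp add: field_simps)
    have lt: "1 / t2 < 1 / t1" using t0 t(3) by (simp add: field_simps)
    have "1 \<le> 1 / t2" using t0 by (simp add: field_simps)
    then have "0 \<le> \<theta>" unfolding \<theta>_def using d by (intro divide_nonneg_pos) auto
    moreover have "\<theta> < 1" unfolding \<theta>_def divide_less_eq_1_pos[OF d] using lt by simp
    ultimately have \<theta>: "0 \<le> \<theta>" "\<theta> < 1" .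
    have "(1 - (1 - \<theta>)) *\<^sub>R ?y t1 + (1 - \<theta>) *\<^sub>R z = ?y t2"
    proof -
      have \<theta>': "\<theta> * (1 / t1 - 1) = 1 / t2 - 1"
      proof -
        have "p / q * q = p" if "0 < q" for p q :: real using that by simp
        from this[OF d] show ?thesis unfolding \<theta>_def .
      qed
      have "(1 - (1 - \<theta>)) *\<^sub>R ?y t1 + (1 - \<theta>) *\<^sub>R z = x + (1 + \<theta> * (1 / t1 - 1)) *\<^sub>R (z - x)"
        by (simp add: algebra_simps)
      then show ?thesis unfolding \<theta>' by simp
    qed
    moreover have "(1 - (1 - \<theta>)) *\<^sub>R ?y t1 + (1 - \<theta>) *\<^sub>R z \<in> \<Omega>"
      using f(1) z \<theta> by (intro interpolate_in_domain) (auto simp: frontier_def)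
    ultimately have "?y t2 \<in> \<Omega>" by simp
    then show False using f(2) open_domain by (simp add: frontier_def interior_open)
  qed
  have "\<exists>t0. {t \<in> {e..1}. ?y t \<in> frontier \<Omega>} \<subseteq> {t0}"
  proof (cases "{t \<in> {e..1}. ?y t \<in> frontier \<Omega>} = {}")
    case False
    then obtain t0 where t0: "t0 \<in> {e..1}" "?y t0 \<in> frontier \<Omega>" by blast
    have "t = t0" if "t \<in> {e..1}" "?y t \<in> frontier \<Omega>" for t
      using no[of t t0] no[of t0 t] that t0 by (meson linorder_neqE_linordered_idom)
    then show ?thesis by blast
  qed auto
  then show ?thesis using finite_subset by blast
qed

text \<open>For fixed \<open>t\<close> the kernel jumps when
  \<open>x + (1 / t) *\<^sub>R (z - x)\<close> meets the frontier. Only finitely many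
  \<open>t\<close> are affected, and the average over \<open>t\<close> is continuous by dominated
  convergence.\<close>

lemma continuous_potential_kernel:
  assumes z: "z \<in> \<Omega>" and e: "0 < e"
  shows "continuous_on (closure \<Omega>) (\<lambda>x. potential_kernel \<Omega> e x z)"
  unfolding continuous_on_sequentially comp_def
proof (intro allI ballI impI)
  fix xn x assume x: "x \<in> closure \<Omega>" and xn: "(\<forall>n. xn n \<in> closure \<Omega>) \<and> xn \<longlonglongrightarrow> x"
  interpret R: finite_measure "restrict_space lborel {e..1::real}" by (rule finite_restrict_Icc)
  show "(\<lambda>n. potential_kernel \<Omega> e (xn n) z) \<longlonglongrightarrow> potential_kernel \<Omega> e x z"
    unfolding potential_kernel_def
  proof (rule integral_dominated_convergence[where w = "\<lambda>_. D / (e ^ DIM('a) * vol)"])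
    have m: "(\<lambda>t. kern t x' z *\<^sub>R ((1 / t) *\<^sub>R (z - x'))) \<in> borel_measurable (restrict_space lborel {e..1})" for x'
      by (rule measurable_restrict_space1) measurable
    show "(\<lambda>t. kern t x z *\<^sub>R ((1 / t) *\<^sub>R (z - x))) \<in> borel_measurable (restrict_space lborel {e..1})"
      "(\<lambda>t. kern t (xn n) z *\<^sub>R ((1 / t) *\<^sub>R (z - xn n))) \<in> borel_measurable (restrict_space lborel {e..1})" for n
      by (rule m)+
    show "AE t in restrict_space lborel {e..1}. norm (kern t (xn n) z *\<^sub>R ((1 / t) *\<^sub>R (z - xn n))) \<le> D / (e ^ DIM('a) * vol)" for n
      using xn e by (intro AE_I2 norm_kernel_flux_le) (auto simp: space_restrict_space)
    let ?T = "{t \<in> {e..1}. x + (1 / t) *\<^sub>R (z - x) \<in> frontier \<Omega>}"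
    have "?T \<in> null_sets lborel" using frontier_crossing[OF z e] finite_imp_null_set_lborel by blast
    then have "AE t in lborel. t \<notin> ?T" by (rule AE_not_in)
    then have "AE t in lborel. t \<in> {e..1} \<longrightarrow> (\<lambda>n. kern t (xn n) z *\<^sub>R ((1 / t) *\<^sub>R (z - xn n))) \<longlonglongrightarrow> kern t x z *\<^sub>R ((1 / t) *\<^sub>R (z - x))"
    proof eventually_elim
      case (elim t)
      show ?case
      proof
        assume t: "t \<in> {e..1}"
        let ?y = "\<lambda>x. x + (1 / t) *\<^sub>R (z - x)"
        have nf: "?y x \<notin> frontier \<Omega>" using elim t by auto
        have lim: "(\<lambda>n. ?y (xn n)) \<longlonglongrightarrow> ?y x" using xn by (intro tendsto_intros) auto
        have "\<forall>\<^sub>F n in sequentially. kern t x z = kern t (xn n) z"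
        proof (cases "?y x \<in> \<Omega>")
          case True
          have "\<forall>\<^sub>F n in sequentially. ?y (xn n) \<in> \<Omega>" by (rule topological_tendstoD[OF lim open_domain True])
          then show ?thesis by eventually_elim (use True in \<open>simp add: spread_kernel_def\<close>)
        next
          case False
          then have "?y x \<in> - closure \<Omega>" using nf open_domain by (simp add: frontier_def interior_open)
          moreover have "open (- closure \<Omega>)" by auto
          ultimately have "\<forall>\<^sub>F n in sequentially. ?y (xn n) \<in> - closure \<Omega>" using topological_tendstoD[OF lim] by blast
          then show ?thesis
          proof eventually_elim
            case (elim n)
            then have "?y (xn n) \<notin> \<Omega>" using closure_subset by auto
            then show ?case using False by (simp add: spread_kernel_def)
          qed
        qed
        then have "(\<lambda>n. kern t (xn n) z) \<longlonglongrightarrow> kern t x z" by (rule Lim_transform_eventually[OF tendsto_const])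
        then show "(\<lambda>n. kern t (xn n) z *\<^sub>R ((1 / t) *\<^sub>R (z - xn n))) \<longlonglongrightarrow> kern t x z *\<^sub>R ((1 / t) *\<^sub>R (z - x))"
          using xn by (intro tendsto_intros) auto
      qed
    qed
    then show "AE t in restrict_space lborel {e..1}. (\<lambda>n. kern t (xn n) z *\<^sub>R ((1 / t) *\<^sub>R (z - xn n))) \<longlonglongrightarrow> kern t x z *\<^sub>R ((1 / t) *\<^sub>R (z - x))"
      by (subst AE_restrict_space_iff) auto
  qed simp
qed

end

context spread_measure
begin

lemma norm_spread_flux_le': "0 < e \<Longrightarrow> e \<le> t \<Longrightarrow> norm (flux t z) \<le> D * c / (e ^ DIM('a) * vol)"
proof -
  assume e: "0 < e" "e \<le> t"
  have "norm (flux t z) \<le> D * dens t z" using e by (intro norm_spread_flux_le) simp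
  also have "\<dots> \<le> D * (c / (t ^ DIM('a) * vol))" using e D_nonneg by (intro mult_left_mono spread_density_le) auto
  also have "\<dots> \<le> D * (c / (e ^ DIM('a) * vol))"
    using e D_nonneg vol_pos mass_pos by (intro mult_left_mono divide_left_mono mult_right_mono power_mono mult_pos_pos) auto
  finally show ?thesis by simp
qed

lemma measurable_flux_pair: "(\<lambda>(t, z). flux t z) \<in> borel_measurable (restrict_space lborel {e..1} \<Otimes>\<^sub>M lborel)"
  using measurable_spread_flux(1) by (intro measurable_pair_restrict) (simp add: split_beta' cong: measurable_cong_sets)

lemma measurable_spread_potential [measurable]: "spread_potential \<Omega> \<mu> e \<in> borel_measurable borel"
proof -
  interpret R: finite_measure "restrict_space lborel {e..1::real}" by (rule finite_restrict_Icc)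
  have "(\<lambda>(z, t). flux t z) \<in> borel_measurable (lborel \<Otimes>\<^sub>M restrict_space lborel {e..1})"
    using measurable_flux_pair[of e] by (subst measurable_pair_swap_iff) (simp add: split_beta')
  then have "(\<lambda>z. spread_potential \<Omega> \<mu> e z) \<in> borel_measurable lborel"
    unfolding spread_potential_def by (rule R.borel_measurable_lebesgue_integral)
  then show ?thesis by simp
qed

lemma spread_potential_eq_0: "0 < e \<Longrightarrow> z \<notin> \<Omega> \<Longrightarrow> spread_potential \<Omega> \<mu> e z = 0"
  unfolding spread_potential_def by (rule integral_eq_zero_AE) (auto simp: space_restrict_space spread_flux_eq_0 intro!: AE_I2)

text \<open>The bound does not depend on \<mu>, so it dominates the potentials along a sequence of
  measures.\<close>

lemma norm_spread_potential_le:
  assumes e: "0 < e" "e \<le> 1" shows "norm (spread_potential \<Omega> \<mu> e z) \<le> D * c / (e ^ DIM('a) * vol)"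
proof -
  interpret R: finite_measure "restrict_space lborel {e..1::real}" by (rule finite_restrict_Icc)
  let ?B = "D * c / (e ^ DIM('a) * vol)"
  have B: "0 \<le> ?B" using D_nonneg mass_pos vol_pos e by simp
  have m: "(\<lambda>t. flux t z) \<in> borel_measurable (restrict_space lborel {e..1})"
    using measurable_compose[OF _ measurable_spread_flux(1), of "\<lambda>t. (t, z)" borel] by (intro measurable_restrict_space1) simp
  have bd: "AE t in restrict_space lborel {e..1}. norm (flux t z) \<le> ?B"
    using e by (intro AE_I2 norm_spread_flux_le') (auto simp: space_restrict_space)
  have "norm (spread_potential \<Omega> \<mu> e z) \<le> (LINT t|restrict_space lborel {e..1}. ?B)"
    unfolding spread_potential_def
    by (intro order_trans[OF integral_norm_bound integral_mono_AE] integrable_norm R.integrable_const_bound[OF bd m] bd) auto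
  also have "\<dots> = (1 - e) * ?B" using e by (simp add: measure_restrict_space space_restrict_space)
  also have "\<dots> \<le> 1 * ?B" using e B by (intro mult_right_mono) auto
  finally show ?thesis by simp
qed

text \<open>By Fubini the potential at \<open>z\<close> is the integral of a fixed function of
  \<open>x\<close> against \<mu>, the form in which weak convergence can act.\<close>

lemma spread_potential_kernel:
  assumes e: "0 < e" shows "spread_potential \<Omega> \<mu> e z = (LINT x|\<mu>. potential_kernel \<Omega> e x z)"
proof -
  let ?R = "restrict_space lborel {e..1::real}"
  interpret R: finite_measure ?R by (rule finite_restrict_Icc)
  interpret RM: pair_sigma_finite ?R \<mu> ..
  have "integrable (?R \<Otimes>\<^sub>M \<mu>) (\<lambda>(t, x). kern t x z *\<^sub>R ((1 / t) *\<^sub>R (z - x)))"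
  proof (rule integrable_pair_bounded[OF R.finite_measure_axioms mu.sigma_finite_measure_axioms])
    show "(\<lambda>(t, x). kern t x z *\<^sub>R ((1 / t) *\<^sub>R (z - x))) \<in> borel_measurable (?R \<Otimes>\<^sub>M \<mu>)"
      by (rule measurable_pair_restrict) measurable
    fix t assume "t \<in> space ?R"
    then have t: "e \<le> t" by (simp add: space_restrict_space)
    have "AE x in \<mu>. ennreal (norm (kern t x z *\<^sub>R ((1 / t) *\<^sub>R (z - x)))) \<le> ennreal (D / (e ^ DIM('a) * vol))"
      using AE_mu by eventually_elim (intro ennreal_leI norm_kernel_flux_le e t)
    then have "(\<integral>\<^sup>+x. ennreal (norm (kern t x z *\<^sub>R ((1 / t) *\<^sub>R (z - x)))) \<partial>\<mu>) \<le> (\<integral>\<^sup>+x. ennreal (D / (e ^ DIM('a) * vol)) \<partial>\<mu>)"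
      by (rule nn_integral_mono_AE)
    then show "(\<integral>\<^sup>+x. ennreal (norm (kern t x z *\<^sub>R ((1 / t) *\<^sub>R (z - x)))) \<partial>\<mu>) \<le> ennreal (D / (e ^ DIM('a) * vol) * c)"
    proof -
      have "ennreal (D / (e ^ DIM('a) * vol)) * ennreal c = ennreal (D / (e ^ DIM('a) * vol) * c)"
        using mass_pos D_nonneg vol_pos e by (intro ennreal_mult[symmetric]) auto
      then show ?thesis using \<open>_ \<le> (\<integral>\<^sup>+x. ennreal (D / (e ^ DIM('a) * vol)) \<partial>\<mu>)\<close> by (simp only: nn_integral_const space_mu emeasure_mu)
    qed
  qed
  from RM.Fubini_integral[OF this] show ?thesis
    unfolding spread_potential_def spread_flux_def potential_kernel_def by simp
qed

text \<open>With \<open>s\<close> frozen, the integrand for a label (x, y) is the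
  \<open>t\<close>-derivative of the test function along the segment from x to y. Exchanging the
  integrals leaves the end values.\<close>

lemma spread_potential_transport:
  fixes \<zeta> :: "real \<times> 'a \<Rightarrow> real"
  assumes \<zeta>: "smooth_compact \<zeta>" and e: "0 < e" "e \<le> 1"
  shows "(LINT z|lborel. space_grad \<zeta> s z \<bullet> spread_potential \<Omega> \<mu> e z) = (LINT z|spread \<Omega> \<mu> 1. \<zeta> (s, z)) - (LINT z|spread \<Omega> \<mu> e. \<zeta> (s, z))"
proof -
  let ?R = "restrict_space lborel {e..1::real}"
  interpret R: finite_measure ?R by (rule finite_restrict_Icc)
  interpret RL: pair_sigma_finite ?R lborel ..
  interpret RP: pair_sigma_finite ?R "spread_pair \<Omega> \<mu>" ..
  obtain K where K: "0 \<le> K" "\<And>s x. norm (space_grad \<zeta> s x) \<le> K" using bounded_space_grad[OF \<zeta>] by blast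
  obtain K1 where K1: "\<And>z. \<bar>\<zeta> z\<bar> \<le> K1" using smooth_compact_bounded[OF \<zeta>] by blast
  have [measurable]: "space_grad \<zeta> s \<in> borel_measurable borel" by (rule smooth_compact_slices(4)[OF \<zeta>])
  have \<zeta>m[measurable]: "(\<lambda>x. \<zeta> (s, x)) \<in> borel_measurable borel"
    using smooth_compact_slices(1)[OF \<zeta>] by (rule borel_measurable_continuous_onI)
  define X where "X t p = (1 - t) *\<^sub>R fst p + t *\<^sub>R snd p" for t and p :: "'a \<times> 'a"
  have Xc: "continuous_on UNIV (\<lambda>q. X (fst q) (snd q))" unfolding X_def by (intro continuous_intros)
  define g where "g t p = space_grad \<zeta> s (X t p) \<bullet> (snd p - fst p)" for t p
  have sgc: "continuous_on UNIV (space_grad \<zeta> s)" by (rule smooth_compact_slices(3)[OF \<zeta>])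
  have gc: "continuous_on UNIV (\<lambda>q. g (fst q) (snd q))"
    unfolding g_def by (intro continuous_intros continuous_on_compose2[OF sgc Xc]) auto
  have int1: "integrable (?R \<Otimes>\<^sub>M lborel) (\<lambda>(t, z). space_grad \<zeta> s z \<bullet> flux t z)"
  proof (rule integrable_pair_bounded[OF R.finite_measure_axioms sigma_finite_lborel])
    have [measurable]: "(\<lambda>w. flux (fst w) (snd w)) \<in> borel_measurable (?R \<Otimes>\<^sub>M lborel)"
      using measurable_flux_pair by (simp add: split_beta')
    show "(\<lambda>(t, z). space_grad \<zeta> s z \<bullet> flux t z) \<in> borel_measurable (?R \<Otimes>\<^sub>M lborel)"
      unfolding split_beta' by measurable
    fix t assume "t \<in> space ?R"
    then have t: "0 < t" using e by (simp add: space_restrict_space)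
    have "norm (space_grad \<zeta> s z \<bullet> flux t z) \<le> (K * D) * dens t z" for z
    proof -
      have "norm (space_grad \<zeta> s z \<bullet> flux t z) \<le> norm (space_grad \<zeta> s z) * norm (flux t z)"
        using Cauchy_Schwarz_ineq2 by simp
      also have "\<dots> \<le> K * (D * dens t z)"
        using K norm_spread_flux_le[OF t] by (intro mult_mono) auto
      finally show ?thesis by simp
    qed
    then have "(\<integral>\<^sup>+z. ennreal (norm (space_grad \<zeta> s z \<bullet> flux t z)) \<partial>lborel) \<le> (\<integral>\<^sup>+z. ennreal (K * D) * ennreal (dens t z) \<partial>lborel)"
      using K(1) D_nonneg spread_density_nonneg[of t] t by (intro nn_integral_mono) (auto simp: ennreal_mult[symmetric] intro!: ennreal_leI)
    also have "\<dots> = ennreal (K * D) * ennreal c" using nn_integral_spread_density[OF t] by (subst nn_integral_cmult) auto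
    finally show "(\<integral>\<^sup>+z. ennreal (norm (space_grad \<zeta> s z \<bullet> flux t z)) \<partial>lborel) \<le> ennreal (K * D * c)"
      using K(1) D_nonneg mass_pos by (simp add: ennreal_mult)
  qed
  have int2: "integrable (?R \<Otimes>\<^sub>M spread_pair \<Omega> \<mu>) (\<lambda>(t, p). g t p)"
  proof (rule integrable_pair_bounded[OF R.finite_measure_axioms sp.sigma_finite_measure_axioms])
    have "(\<lambda>q. g (fst q) (snd q)) \<in> borel_measurable (borel \<Otimes>\<^sub>M (borel \<Otimes>\<^sub>M borel))"
      using borel_measurable_continuous_onI[OF gc] by (simp add: borel_prod)
    then have "(\<lambda>(t, p). g t p) \<in> borel_measurable (borel \<Otimes>\<^sub>M spread_pair \<Omega> \<mu>)"
      unfolding measurable_cong_sets[OF sets_pair_measure_cong[OF refl sets_pair] refl] by (simp add: split_beta')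
    then show "(\<lambda>(t, p). g t p) \<in> borel_measurable (?R \<Otimes>\<^sub>M spread_pair \<Omega> \<mu>)" by (rule measurable_pair_restrict)
    fix t assume "t \<in> space ?R"
    have "AE p in spread_pair \<Omega> \<mu>. ennreal (norm (g t p)) \<le> ennreal (K * D)"
      using AE_pair
    proof eventually_elim
      case (elim p)
      then have "norm (snd p - fst p) \<le> D" using closure_subset by (intro norm_diff_le_D) (auto simp: split_beta')
      then have "norm (space_grad \<zeta> s (X t p)) * norm (snd p - fst p) \<le> K * D" using K by (intro mult_mono) auto
      then have "\<bar>g t p\<bar> \<le> K * D" unfolding g_def by (rule order_trans[OF Cauchy_Schwarz_ineq2])
      then show ?case by (simp add: ennreal_leI)
    qed
    then have "(\<integral>\<^sup>+p. ennreal (norm (g t p)) \<partial>spread_pair \<Omega> \<mu>) \<le> (\<integral>\<^sup>+p. ennreal (K * D) \<partial>spread_pair \<Omega> \<mu>)" by (rule nn_integral_mono_AE)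
    then show "(\<integral>\<^sup>+p. ennreal (norm (g t p)) \<partial>spread_pair \<Omega> \<mu>) \<le> ennreal (K * D * c)"
      using mass_pos by (simp add: emeasure_pair ennreal_mult'')
  qed
  have "(LINT z|lborel. space_grad \<zeta> s z \<bullet> spread_potential \<Omega> \<mu> e z) = (LINT z|lborel. (LINT t|?R. space_grad \<zeta> s z \<bullet> flux t z))"
  proof (intro Bochner_Integration.integral_cong refl)
    fix z
    have m: "(\<lambda>t. flux t z) \<in> borel_measurable ?R"
      using measurable_compose[OF _ measurable_spread_flux(1), of "\<lambda>t. (t, z)" borel] by (intro measurable_restrict_space1) simp
    have "integrable ?R (\<lambda>t. flux t z)"
      by (rule R.integrable_const_bound[OF _ m, where B = "D * c / (e ^ DIM('a) * vol)"]) (use e in \<open>auto simp: space_restrict_space intro!: AE_I2 norm_spread_flux_le'\<close>)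
    then show "space_grad \<zeta> s z \<bullet> spread_potential \<Omega> \<mu> e z = (LINT t|?R. space_grad \<zeta> s z \<bullet> flux t z)"
      unfolding spread_potential_def by simp
  qed
  also have "\<dots> = (LINT t|?R. (LINT z|lborel. space_grad \<zeta> s z \<bullet> flux t z))"
    using RL.Fubini_integral[OF int1] by simp
  also have "\<dots> = (LINT t|?R. (LINT p|spread_pair \<Omega> \<mu>. g t p))"
  proof (intro Bochner_Integration.integral_cong refl)
    fix t assume "t \<in> space ?R"
    then have t: "0 < t" using e by (simp add: space_restrict_space)
    show "(LINT z|lborel. space_grad \<zeta> s z \<bullet> flux t z) = (LINT p|spread_pair \<Omega> \<mu>. g t p)"
      by (subst integral_spread_flux[OF _ K(2) t]) (auto simp: g_def[abs_def] X_def split_beta')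
  qed
  also have "\<dots> = (LINT p|spread_pair \<Omega> \<mu>. (LINT t|?R. g t p))"
    using RP.Fubini_integral[OF int2] by simp
  also have "\<dots> = (LINT p|spread_pair \<Omega> \<mu>. \<zeta> (s, X 1 p) - \<zeta> (s, X e p))"
  proof (intro Bochner_Integration.integral_cong refl)
    fix p
    have "has_bochner_integral lborel (\<lambda>t. g t p * indicator {e..1} t) (\<zeta> (s, X 1 p) - \<zeta> (s, X e p))"
    proof (rule has_bochner_integral_FTC_Icc_real[OF e(2)])
      fix t
      have "((\<lambda>t. X t p) has_vector_derivative (snd p - fst p)) (at t)"
        unfolding X_def by (auto intro!: derivative_eq_intros simp: algebra_simps)
      then show "((\<lambda>t. \<zeta> (s, X t p)) has_real_derivative g t p) (at t)"
        unfolding g_def by (rule smooth_compact_chain(2)[OF \<zeta>])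
      show "isCont (\<lambda>t. g t p) t"
        using continuous_on_compose2[OF gc, of UNIV "\<lambda>t. (t, p)"] by (simp add: continuous_intros continuous_on_eq_continuous_at)
    qed
    then show "(LINT t|?R. g t p) = \<zeta> (s, X 1 p) - \<zeta> (s, X e p)"
      by (subst integral_restrict_space) (auto simp: has_bochner_integral_iff mult.commute)
  qed
  also have "\<dots> = (LINT p|spread_pair \<Omega> \<mu>. \<zeta> (s, X 1 p)) - (LINT p|spread_pair \<Omega> \<mu>. \<zeta> (s, X e p))"
  proof -
    have "integrable (spread_pair \<Omega> \<mu>) (\<lambda>p. \<zeta> (s, X t p))" for t
    proof (rule sp.integrable_const_bound[where B = K1])
      have "X t \<in> spread_pair \<Omega> \<mu> \<rightarrow>\<^sub>M borel" unfolding X_def by measurable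
      then show "(\<lambda>p. \<zeta> (s, X t p)) \<in> borel_measurable (spread_pair \<Omega> \<mu>)" by (rule measurable_compose[OF _ \<zeta>m])
    qed (simp add: K1)
    then show ?thesis by simp
  qed
  also have "\<dots> = (LINT z|spread \<Omega> \<mu> 1. \<zeta> (s, z)) - (LINT z|spread \<Omega> \<mu> e. \<zeta> (s, z))"
    by (subst (1 2) integral_spread) (auto simp: X_def split_beta')
  finally show ?thesis .
qed

lemma spread_density_1: "dens 1 z = c / vol * indicator \<Omega> z"
  unfolding spread_density_def spread_kernel_def by (simp add: vol_def measure_mu)

lemma integral_spread_real:
  fixes f :: "'a \<Rightarrow> real"
  assumes [measurable]: "f \<in> borel_measurable borel" and e: "0 < e"
  shows "(LINT z|spread \<Omega> \<mu> e. f z) = (LINT z|lborel. dens e z * f z)"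
  unfolding spread_eq_density[OF e] using spread_density_nonneg[of e] e by (subst integral_density) auto

end

context convex_domain
begin

text \<open>Near the end points the weight \<open>\<theta> = \<delta> s\<^sup>2 (1 - s)\<^sup>2\<close> of the uniform density bounds the mobility from below
  by \<open>\<theta> m(c / vol)\<close>, while the flux is \<open>O(s (1 - s))\<close>.\<close>

lemma Wdist_spread_spread:
  assumes m: "mobility m" and \<mu>0: "\<mu>0 \<in> Mplus_mass \<Omega> c" and \<mu>1: "\<mu>1 \<in> Mplus_mass \<Omega> c"
    and e: "0 < e" "e \<le> 1" and \<delta>: "0 < \<delta>" "\<delta> \<le> 1" and J: "0 \<le> J"
    "(\<integral>\<^sup>+z\<in>\<Omega>. ennreal ((norm (spread_potential \<Omega> \<mu>1 e z - spread_potential \<Omega> \<mu>0 e z))\<^sup>2) \<partial>lborel) \<le> ennreal J"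
  defines "B \<equiv> D * c / (e ^ DIM('a) * vol)"
  shows "Wdist m \<Omega> (spread \<Omega> \<mu>0 e) (spread \<Omega> \<mu>1 e) \<le> ennreal (sqrt ((8 * \<delta> * B\<^sup>2 * vol + 72 / \<delta> * J) / m (c / vol)))"
proof -
  interpret S0: spread_measure \<Omega> c \<mu>0 by unfold_locales (rule \<mu>0)
  interpret S1: spread_measure \<Omega> c \<mu>1 by unfold_locales (rule \<mu>1)
  define u where "u = c / vol"
  have u: "0 < u" using mass_pos vol_pos by (simp add: u_def)
  have mu: "0 < m u" by (rule mobility_pos[OF m u])
  have B0: "0 \<le> B" using D_nonneg mass_pos vol_pos e by (simp add: B_def)
  define \<rho>0 where "\<rho>0 = spread_density \<Omega> \<mu>0 e"
  define \<rho>1 where "\<rho>1 = spread_density \<Omega> \<mu>1 e"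
  define \<rho>u where "\<rho>u z = u * indicator \<Omega> z" for z :: 'a
  define V0 where "V0 = spread_potential \<Omega> \<mu>0 e"
  define V1 where "V1 = spread_potential \<Omega> \<mu>1 e"
  have V0B: "norm (V0 z) \<le> B" and V1B: "norm (V1 z) \<le> B" for z
    unfolding V0_def V1_def B_def by (rule S0.norm_spread_potential_le[OF e], rule S1.norm_spread_potential_le[OF e])
  have V0z: "V0 z = 0" and V1z: "V1 z = 0" if "z \<notin> \<Omega>" for z
    using that S0.spread_potential_eq_0[OF e(1)] S1.spread_potential_eq_0[OF e(1)] by (auto simp: V0_def V1_def)
  have \<rho>00: "0 \<le> \<rho>0 z" and \<rho>10: "0 \<le> \<rho>1 z" and \<rho>u0: "0 \<le> \<rho>u z" for z
    using S0.spread_density_nonneg[of e z] S1.spread_density_nonneg[of e z] e u by (auto simp: \<rho>0_def \<rho>1_def \<rho>u_def)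
  define Q where "Q = c / (e ^ DIM('a) * vol) + u"
  have Q0: "0 \<le> Q" using u mass_pos vol_pos e by (simp add: Q_def)
  have \<rho>0Q: "\<rho>0 z \<le> Q" and \<rho>1Q: "\<rho>1 z \<le> Q" and \<rho>uQ: "\<rho>u z \<le> Q" for z
    using S0.spread_density_le[OF e(1), of z] S1.spread_density_le[OF e(1), of z] u mass_pos vol_pos e
    by (auto simp: \<rho>0_def \<rho>1_def \<rho>u_def Q_def indicator_def intro: add_increasing add_increasing2)
  have \<rho>0z: "\<rho>0 z = 0" and \<rho>1z: "\<rho>1 z = 0" and \<rho>uz: "\<rho>u z = 0" if "z \<notin> \<Omega>" for z
    using that S0.spread_density_eq_0[OF e] S1.spread_density_eq_0[OF e] by (auto simp: \<rho>0_def \<rho>1_def \<rho>u_def)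
  have [measurable]: "\<rho>0 \<in> borel_measurable borel" "\<rho>1 \<in> borel_measurable borel" "\<rho>u \<in> borel_measurable borel"
    "V0 \<in> borel_measurable borel" "V1 \<in> borel_measurable borel"
    unfolding \<rho>0_def \<rho>1_def \<rho>u_def V0_def V1_def by measurable
  have ni: "(\<integral>\<^sup>+z. ennreal (\<rho>0 z) \<partial>lborel) = ennreal c" "(\<integral>\<^sup>+z. ennreal (\<rho>1 z) \<partial>lborel) = ennreal c" "(\<integral>\<^sup>+z. ennreal (\<rho>u z) \<partial>lborel) = ennreal c"
  proof -
    show "(\<integral>\<^sup>+z. ennreal (\<rho>0 z) \<partial>lborel) = ennreal c" "(\<integral>\<^sup>+z. ennreal (\<rho>1 z) \<partial>lborel) = ennreal c"
      unfolding \<rho>0_def \<rho>1_def using S0.nn_integral_spread_density[OF e(1)] S1.nn_integral_spread_density[OF e(1)] by auto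
    show "(\<integral>\<^sup>+z. ennreal (\<rho>u z) \<partial>lborel) = ennreal c"
      using S0.nn_integral_spread_density[of 1] by (simp add: S0.spread_density_1 \<rho>u_def u_def)
  qed
  have i: "integrable lborel \<rho>0" "integrable lborel \<rho>1" "integrable lborel \<rho>u"
    using ni \<rho>00 \<rho>10 \<rho>u0 by (auto intro!: integrableI_nonneg)
  define \<theta> where "\<theta> s = \<delta> * s\<^sup>2 * (1 - s)\<^sup>2" for s
  define \<theta>' where "\<theta>' s = 2 * \<delta> * s * (1 - s) * (1 - 2 * s)" for s
  \<comment> \<open>The cubic step from 0 to 1: its derivative vanishes at both ends like the square
    root of \<theta>, so \<open>(\<beta>' s)\<^sup>2 / \<theta> s\<close> stays at 36 /
    \<delta>.\<close>
  define \<beta> where "\<beta> s = 3 * s\<^sup>2 - 2 * s ^ 3" for s :: real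
  define \<beta>' where "\<beta>' s = 6 * s * (1 - s)" for s :: real
  \<comment> \<open>Weights of \<open>\<rho>0\<close> and \<open>\<rho>1\<close>; together with the
    weight \<theta> of the uniform density they sum to 1.\<close>
  define a where "a s = (1 - \<theta> s) * (1 - \<beta> s)" for s
  define b where "b s = (1 - \<theta> s) * \<beta> s" for s
  define a' where "a' s = - \<theta>' s * (1 - \<beta> s) - (1 - \<theta> s) * \<beta>' s" for s
  define b' where "b' s = - \<theta>' s * \<beta> s + (1 - \<theta> s) * \<beta>' s" for s
  let ?I = "\<lambda>f r. \<integral>z. f z * r z \<partial>(lborel :: 'a measure) :: real"
  have \<theta>D: "(\<theta> has_real_derivative \<theta>' s) (at s)" for s
    unfolding \<theta>_def \<theta>'_def by (auto intro!: derivative_eq_intros simp: power2_eq_square algebra_simps)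
  have \<beta>D: "(\<beta> has_real_derivative \<beta>' s) (at s)" for s
    unfolding \<beta>_def \<beta>'_def by (auto intro!: derivative_eq_intros simp: power2_eq_square algebra_simps)
  have aD: "(a has_real_derivative a' s) (at s)" for s
    unfolding a_def a'_def by (auto intro!: derivative_eq_intros \<theta>D \<beta>D simp: algebra_simps)
  have bD: "(b has_real_derivative b' s) (at s)" for s
    unfolding b_def b'_def by (auto intro!: derivative_eq_intros \<theta>D \<beta>D simp: algebra_simps)
  have sum1: "a s + b s + \<theta> s = 1" for s by (simp add: a_def b_def algebra_simps)
  have sum0: "a' s + b' s + \<theta>' s = 0" for s by (simp add: a'_def b'_def algebra_simps)
  have \<theta>01: "0 \<le> \<theta> s" "\<theta> s \<le> 1" if "s \<in> {0..1}" for s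
    using that \<delta> by (auto simp: \<theta>_def intro!: mult_le_one power_le_one)
  have \<beta>01: "0 \<le> \<beta> s" "\<beta> s \<le> 1" if "s \<in> {0..1}" for s
  proof -
    have "\<beta> s = s\<^sup>2 * (3 - 2 * s)" by (simp add: \<beta>_def power2_eq_square power3_eq_cube algebra_simps)
    then show "0 \<le> \<beta> s" using that by simp
    have "1 - \<beta> s = (1 - s)\<^sup>2 * (1 + 2 * s)" by (simp add: \<beta>_def power2_eq_square power3_eq_cube algebra_simps)
    moreover have "0 \<le> (1 - s)\<^sup>2 * (1 + 2 * s)" using that by simp
    ultimately show "\<beta> s \<le> 1" by linarith
  qed
  have ab01: "0 \<le> a s" "0 \<le> b s" if "s \<in> {0..1}" for s
    using \<theta>01[OF that] \<beta>01[OF that] by (auto simp: a_def b_def)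
  have ab1: "a s \<le> 1" "b s \<le> 1" if "s \<in> {0..1}" for s
    using sum1[of s] ab01[OF that] \<theta>01[OF that] by linarith+
  have \<theta>'2: "\<bar>\<theta>' s\<bar> \<le> 2" if s: "s \<in> {0..1}" for s
  proof -
    have "\<bar>\<delta> * s * (1 - s) * (1 - 2 * s)\<bar> \<le> 1"
      using s \<delta> unfolding abs_mult by (intro mult_le_one) auto
    then show ?thesis by (simp add: \<theta>'_def mult.assoc)
  qed
  have \<beta>'6: "\<bar>\<beta>' s\<bar> \<le> 6" if s: "s \<in> {0..1}" for s
  proof -
    have "\<bar>s * (1 - s)\<bar> \<le> 1" using s unfolding abs_mult by (intro mult_le_one) auto
    then show ?thesis by (simp add: \<beta>'_def mult.assoc)
  qed
  have ab'8: "\<bar>a' s\<bar> \<le> 8" "\<bar>b' s\<bar> \<le> 8" if s: "s \<in> {0..1}" for s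
  proof -
    have 1: "\<bar>\<theta>' s * (1 - \<beta> s)\<bar> \<le> 2 * 1" "\<bar>\<theta>' s * \<beta> s\<bar> \<le> 2 * 1"
      unfolding abs_mult using \<theta>'2[OF s] \<beta>01[OF s] by (intro mult_mono; simp)+
    have 2: "\<bar>(1 - \<theta> s) * \<beta>' s\<bar> \<le> 1 * 6"
      unfolding abs_mult using \<beta>'6[OF s] \<theta>01[OF s] by (intro mult_mono) auto
    show "\<bar>a' s\<bar> \<le> 8" "\<bar>b' s\<bar> \<le> 8" unfolding a'_def b'_def using 1 2 by linarith+
  qed
  define \<rho> where "\<rho> s z = a s * \<rho>0 z + b s * \<rho>1 z + \<theta> s * \<rho>u z" for s z
  \<comment> \<open>Both potentials lead to the same uniform density, and the derivatives of the
    three weights sum to 0; so this flux produces the time derivative of \<rho>.\<close>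
  define w where "w s z = - (a' s *\<^sub>R V0 z + b' s *\<^sub>R V1 z)" for s z
  define \<mu> where "\<mu> s = density lborel (\<lambda>z. ennreal (\<rho> s z))" for s
  have \<rho>nn: "0 \<le> \<rho> s z" if "s \<in> {0..1}" for s z
    unfolding \<rho>_def using ab01[OF that] \<theta>01[OF that] \<rho>00 \<rho>10 \<rho>u0 by simp
  have [measurable]: "\<rho> s \<in> borel_measurable borel" for s unfolding \<rho>_def by measurable
  have \<rho>i: "integrable lborel (\<rho> s)" for s unfolding \<rho>_def using i by simp
  have int: "integrable lborel (\<lambda>z. f z * \<rho>' z)" if "f \<in> borel_measurable borel" "\<And>x. \<bar>f x\<bar> \<le> K" "integrable lborel \<rho>'" for f \<rho>' :: "'a \<Rightarrow> real" and K
  proof (rule Bochner_Integration.integrable_bound[of _ "\<lambda>z. K * \<rho>' z"])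
    have "\<bar>f z\<bar> * \<bar>\<rho>' z\<bar> \<le> \<bar>K\<bar> * \<bar>\<rho>' z\<bar>" for z using that(2)[of z] by (intro mult_right_mono) auto
    then show "AE z in lborel. norm (f z * \<rho>' z) \<le> norm (K * \<rho>' z)" by (simp add: abs_mult)
    show "(\<lambda>z. f z * \<rho>' z) \<in> borel_measurable lborel" using that(1) borel_measurable_integrable[OF that(3)] by simp
  qed (use that in simp)
  have int_\<mu>: "(LINT z|\<mu> s. f z) = (LINT z|lborel. f z * \<rho> s z)" if "s \<in> {0..1}" "f \<in> borel_measurable borel" for s and f :: "'a \<Rightarrow> real"
    unfolding \<mu>_def using that \<rho>nn[OF that(1)] by (subst integral_density) (auto simp: mult.commute)
  have int_\<mu>': "(LINT z|\<mu> s. f z) = a s * ?I f \<rho>0 + b s * ?I f \<rho>1 + \<theta> s * ?I f \<rho>u"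
    if "s \<in> {0..1}" "f \<in> borel_measurable borel" "\<And>x. \<bar>f x\<bar> \<le> K" for s K and f :: "'a \<Rightarrow> real"
  proof -
    have "(LINT z|lborel. f z * \<rho> s z) = (LINT z|lborel. a s * (f z * \<rho>0 z) + b s * (f z * \<rho>1 z) + \<theta> s * (f z * \<rho>u z))"
      by (intro Bochner_Integration.integral_cong) (auto simp: \<rho>_def algebra_simps)
    then show ?thesis using int_\<mu>[OF that(1,2)] int[OF that(2,3) i(1)] int[OF that(2,3) i(2)] int[OF that(2,3) i(3)] by simp
  qed
  have "Wdist m \<Omega> (\<mu> 0) (\<mu> 1) \<le> ennreal (sqrt ((8 * \<delta> * B\<^sup>2 * vol + 72 / \<delta> * J) / m u))"
  proof (rule Wdist_density_path[OF m bounded_domain open_domain, where \<mu> = \<mu> and \<rho> = \<rho> and w = w and W = "16 * B * vol"])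
    show "\<mu> s \<in> Mplus \<Omega>" if s: "s \<in> {0..1}" for s
    proof -
      have "emeasure (\<mu> s) UNIV = (\<integral>\<^sup>+z. ennreal (\<rho> s z) \<partial>lborel)" unfolding \<mu>_def by (subst emeasure_density) auto
      also have "\<dots> < \<infinity>" using integrableD(2)[OF \<rho>i[of s]] \<rho>nn[OF s] by (simp add: less_top)
      finally have "finite_measure (\<mu> s)" by (intro finite_measureI) (simp add: \<mu>_def)
      moreover have "emeasure (\<mu> s) (- closure \<Omega>) = 0"
      proof -
        have "ennreal (\<rho> s z) * indicator (- closure \<Omega>) z = 0" for z
        proof (cases "z \<in> \<Omega>")
          case True
          then have "z \<in> closure \<Omega>" using closure_subset by blast
          then show ?thesis by simp
        qed (simp add: \<rho>_def \<rho>0z \<rho>1z \<rho>uz)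
        then have "(\<lambda>z. ennreal (\<rho> s z) * indicator (- closure \<Omega>) z) = (\<lambda>z. 0)" by (rule ext)
        then have "(\<integral>\<^sup>+z\<in>- closure \<Omega>. ennreal (\<rho> s z) \<partial>lborel) = 0" by (simp only: nn_integral_const mult_zero_left)
        then show ?thesis unfolding \<mu>_def by (subst emeasure_density) auto
      qed
      ultimately show ?thesis by (simp add: Mplus_def \<mu>_def)
    qed
    show "continuous_on {0..1} (\<lambda>s. LINT x|\<mu> s. f x)" if f: "continuous_on UNIV f" "bounded {x. f x \<noteq> 0}" for f :: "'a \<Rightarrow> real"
    proof -
      obtain K where K: "\<And>x. \<bar>f x\<bar> \<le> K" using bounded_support_bounded[OF f] by blast
      have fm: "f \<in> borel_measurable borel" using f by (intro borel_measurable_continuous_onI)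
      have "continuous_on {0..1} (\<lambda>s. a s * ?I f \<rho>0 + b s * ?I f \<rho>1 + \<theta> s * ?I f \<rho>u)"
        unfolding a_def b_def \<theta>_def \<beta>_def by (intro continuous_intros)
      then show ?thesis by (rule continuous_on_eq) (simp add: int_\<mu>'[OF _ fm K])
    qed
    show "\<rho> s \<in> borel_measurable borel" for s by measurable
    show "0 \<le> \<rho> s z" if "s \<in> {0<..<1}" for s z using that by (intro \<rho>nn) auto
    show "\<mu> s = density lborel (\<lambda>z. ennreal (\<rho> s z))" for s by (rule \<mu>_def)
    show "(\<lambda>z. w (fst z) (snd z)) \<in> borel_measurable (borel \<Otimes>\<^sub>M borel)"
      unfolding w_def a'_def b'_def \<theta>_def \<beta>_def \<theta>'_def \<beta>'_def by measurable
    show "w s z = 0" if "z \<notin> \<Omega>" for s z using that by (simp add: w_def V0z V1z)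
    show "(\<integral>\<^sup>+z. ennreal (norm (w s z)) \<partial>lborel) \<le> ennreal (16 * B * vol)" if "s \<in> {0<..<1}" for s
    proof -
      have s: "s \<in> {0..1}" using that by auto
      have "norm (w s z) \<le> 16 * B * indicator \<Omega> z" for z
      proof (cases "z \<in> \<Omega>")
        case True
        have "norm (a' s *\<^sub>R V0 z) \<le> 8 * B" "norm (b' s *\<^sub>R V1 z) \<le> 8 * B"
          unfolding norm_scaleR using ab'8[OF s] V0B V1B by (auto intro!: mult_mono)
        then show ?thesis using True norm_triangle_ineq[of "a' s *\<^sub>R V0 z" "b' s *\<^sub>R V1 z"] unfolding w_def norm_minus_cancel by simp
      qed (simp add: w_def V0z V1z)
      then have "(\<integral>\<^sup>+z. ennreal (norm (w s z)) \<partial>lborel) \<le> (\<integral>\<^sup>+z. ennreal (16 * B) * indicator \<Omega> z \<partial>lborel)"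
      proof (intro nn_integral_mono)
        fix z
        have "ennreal (norm (w s z)) \<le> ennreal (16 * B * indicator \<Omega> z)" by (rule ennreal_leI) fact
        then show "ennreal (norm (w s z)) \<le> ennreal (16 * B) * indicator \<Omega> z" by (cases "z \<in> \<Omega>") simp_all
      qed
      also have "\<dots> = ennreal (16 * B) * ennreal vol" by (subst nn_integral_cmult_indicator) (auto simp: emeasure_domain)
      finally show ?thesis using B0 vol_pos by (simp add: ennreal_mult[symmetric])
    qed
    show "(LINT s:{0<..<1}|lborel. (LINT x|\<mu> s. time_deriv \<zeta> s x) + (LINT z|lborel. space_grad \<zeta> s z \<bullet> w s z)) = 0"
      if \<zeta>: "\<zeta> \<in> test_functions" for \<zeta>
    proof -
      note t = test_functions_smooth_compact[OF \<zeta>]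
      let ?Z = "\<lambda>s r. LINT z|lborel. \<zeta> (s, z) * r z" and ?G = "\<lambda>s V. LINT z|lborel. space_grad \<zeta> s z \<bullet> V z"
      obtain p q where pq: "0 < p" "p < q" "q < 1" "\<And>s x. s \<notin> {p..q} \<Longrightarrow> (s, x) \<notin> closure {z. \<zeta> z \<noteq> 0}"
        using t(3) by blast
      obtain K1 where K1: "0 \<le> K1" "\<And>s x. \<bar>time_deriv \<zeta> s x\<bar> \<le> K1" using bounded_time_deriv[OF t(1)] by blast
      obtain K2 where K2: "0 \<le> K2" "\<And>s x. norm (space_grad \<zeta> s x) \<le> K2" using bounded_space_grad[OF t(1)] by blast
      obtain K where K: "0 \<le> K" "\<And>z. \<bar>\<zeta> z\<bar> \<le> K" using smooth_compact_bounded[OF t(1)] by blast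
      define \<rho>' where "\<rho>' s z = a' s * \<rho>0 z + b' s * \<rho>1 z + \<theta>' s * \<rho>u z" for s z
      define G' where "G' s z = time_deriv \<zeta> s z * \<rho> s z + \<zeta> (s, z) * \<rho>' s z" for s z
      \<comment> \<open>Lebesgue measure on the bounded domain is finite, as
        \<open>fubini_time_derivative\<close> demands, and all densities vanish outside.\<close>
      define P where "P = restrict_space lborel \<Omega>"
      have finP: "finite_measure P"
        unfolding P_def by (intro finite_measureI) (simp add: emeasure_restrict_space space_restrict_space emeasure_domain)
      have idm: "(\<lambda>x. x) \<in> (borel :: real measure) \<Otimes>\<^sub>M P \<rightarrow>\<^sub>M borel \<Otimes>\<^sub>M (borel :: 'a measure)"
      proof -
        have "snd \<in> (borel :: real measure) \<Otimes>\<^sub>M P \<rightarrow>\<^sub>M borel"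
          using measurable_compose[OF measurable_snd, of "\<lambda>x. x" P borel borel] unfolding P_def by (simp add: measurable_restrict_space1)
        then have "(\<lambda>x. (fst x, snd x)) \<in> (borel :: real measure) \<Otimes>\<^sub>M P \<rightarrow>\<^sub>M borel \<Otimes>\<^sub>M borel" by (intro measurable_Pair) auto
        then show ?thesis by simp
      qed
      have c1: "continuous_on UNIV (\<lambda>z. time_deriv \<zeta> (fst z) (snd z))" by (rule continuous_time_deriv[OF t(1)])
      have zero: "(LINT s:{0<..<1}|lborel. LINT z|P. G' s z) = 0"
      proof (rule fubini_time_derivative[OF finP _ _ pq(1-3), where G = "\<lambda>s z. \<zeta> (s, z) * \<rho> s z" and K = "K1 * (Q + Q + Q) + K * (24 * Q)"])
        fix s :: real and z :: 'a
        have \<zeta>D: "((\<lambda>s. \<zeta> (s, z)) has_real_derivative time_deriv \<zeta> s z) (at s)"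
          using smooth_compact_chain(1)[OF t(1), of "\<lambda>_. z" 0 s] by simp
        have "((\<lambda>s. \<rho> s z) has_real_derivative \<rho>' s z) (at s)"
          unfolding \<rho>_def \<rho>'_def by (auto intro!: derivative_eq_intros aD bD \<theta>D)
        from DERIV_mult[OF \<zeta>D this]
        show "((\<lambda>s. \<zeta> (s, z) * \<rho> s z) has_real_derivative G' s z) (at s)" unfolding G'_def by (simp add: mult.commute add.commute)
        show "\<zeta> (s, z) * \<rho> s z = 0 \<and> G' s z = 0" if "s \<notin> {p..q}"
          unfolding G'_def using derivs_outside_support(1,2)[OF pq(4)[OF that]] by simp
      next
        fix z :: 'a
        have "continuous_on {0<..<1} (\<lambda>s. time_deriv \<zeta> s z)"
          using continuous_on_compose2[OF c1, of "{0<..<1}" "\<lambda>s. (s, z)"] by (simp add: continuous_intros)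
        moreover have "continuous_on {0<..<1} (\<lambda>s. \<zeta> (s, z))"
          using continuous_on_compose2[OF smooth_compactD(3)[OF t(1)], of "{0<..<1}" "\<lambda>s. (s, z)"] by (simp add: continuous_intros)
        ultimately show "continuous_on {0<..<1} (\<lambda>s. G' s z)"
          unfolding G'_def \<rho>_def \<rho>'_def a_def b_def a'_def b'_def \<theta>_def \<beta>_def \<theta>'_def \<beta>'_def by (intro continuous_intros)
      next
        have [measurable]: "(\<lambda>z. time_deriv \<zeta> (fst z) (snd z)) \<in> borel_measurable (borel \<Otimes>\<^sub>M borel)"
          using borel_measurable_continuous_onI[OF c1] by (simp add: borel_prod)
        have [measurable]: "\<zeta> \<in> borel_measurable (borel \<Otimes>\<^sub>M borel)"
          using borel_measurable_continuous_onI[OF smooth_compactD(3)[OF t(1)]] by (simp add: borel_prod)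
        have "(\<lambda>z. G' (fst z) (snd z)) \<in> borel_measurable (borel \<Otimes>\<^sub>M borel)"
          unfolding G'_def \<rho>_def \<rho>'_def a_def b_def a'_def b'_def \<theta>_def \<beta>_def \<theta>'_def \<beta>'_def by measurable
        from measurable_compose[OF idm this] show "(\<lambda>(s, z). G' s z) \<in> borel_measurable (borel \<Otimes>\<^sub>M P)" by (simp add: split_beta')
      next
        fix s :: real assume "s \<in> {0<..<1}"
        then have s: "s \<in> {0..1}" by auto
        show "AE z in P. \<bar>G' s z\<bar> \<le> K1 * (Q + Q + Q) + K * (24 * Q)"
        proof (rule AE_I2)
          fix z
          have "a s * \<rho>0 z \<le> 1 * Q" "b s * \<rho>1 z \<le> 1 * Q" "\<theta> s * \<rho>u z \<le> 1 * Q"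
            using ab01[OF s] ab1[OF s] \<theta>01[OF s] \<rho>00 \<rho>10 \<rho>u0 \<rho>0Q \<rho>1Q \<rho>uQ Q0 by (intro mult_mono; simp)+
          then have 1: "\<bar>\<rho> s z\<bar> \<le> Q + Q + Q" using \<rho>nn[OF s, of z] by (simp add: \<rho>_def)
          have "\<bar>a' s * \<rho>0 z\<bar> \<le> 8 * Q" "\<bar>b' s * \<rho>1 z\<bar> \<le> 8 * Q" "\<bar>\<theta>' s * \<rho>u z\<bar> \<le> 8 * Q"
            unfolding abs_mult using ab'8[OF s] \<theta>'2[OF s] \<rho>00 \<rho>10 \<rho>u0 \<rho>0Q \<rho>1Q \<rho>uQ Q0 by (auto intro!: mult_mono)
          then have 2: "\<bar>\<rho>' s z\<bar> \<le> 24 * Q" unfolding \<rho>'_def by linarith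
          have "\<bar>time_deriv \<zeta> s z * \<rho> s z\<bar> \<le> K1 * (Q + Q + Q)" "\<bar>\<zeta> (s, z) * \<rho>' s z\<bar> \<le> K * (24 * Q)"
            unfolding abs_mult using 1 2 K K1 by (auto intro!: mult_mono)
          then show "\<bar>G' s z\<bar> \<le> K1 * (Q + Q + Q) + K * (24 * Q)" unfolding G'_def by linarith
        qed
      qed
      have "(LINT x|\<mu> s. time_deriv \<zeta> s x) + ?G s (w s) = (LINT z|P. G' s z)" if s': "s \<in> {0<..<1}" for s
      proof -
        have s: "s \<in> {0..1}" using s' by auto
        have tm: "time_deriv \<zeta> s \<in> borel_measurable borel" and \<zeta>m: "(\<lambda>x. \<zeta> (s, x)) \<in> borel_measurable borel"
          and [measurable]: "space_grad \<zeta> s \<in> borel_measurable borel"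
          using smooth_compact_slices[OF t(1), of s] by (auto intro: borel_measurable_continuous_onI)
        have Vi: "integrable lborel V" if "V \<in> borel_measurable borel" "\<And>z. norm (V z) \<le> B" "\<And>z. z \<notin> \<Omega> \<Longrightarrow> V z = 0" for V :: "'a \<Rightarrow> 'a"
        proof (rule Bochner_Integration.integrable_bound[of _ "\<lambda>z. B * indicator \<Omega> z"])
          show "integrable lborel (\<lambda>z. B * indicator \<Omega> z :: real)" by (intro integrable_mult_right integrable_real_indicator) (auto simp: emeasure_domain)
          have "norm (V z) \<le> norm (B * indicator \<Omega> z)" for z using that(2)[of z] that(3)[of z] B0 by (cases "z \<in> \<Omega>") auto
          then show "AE z in lborel. norm (V z) \<le> norm (B * indicator \<Omega> z)" by simp
        qed (use that in simp)
        have gi: "integrable lborel (\<lambda>z. space_grad \<zeta> s z \<bullet> V z)" if V: "V \<in> borel_measurable borel" "integrable lborel V" for V :: "'a \<Rightarrow> 'a"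
        proof (rule Bochner_Integration.integrable_bound[of _ "\<lambda>z. K2 * norm (V z)"])
          show "integrable lborel (\<lambda>z. K2 * norm (V z))" using V by simp
          have "\<bar>space_grad \<zeta> s z \<bullet> V z\<bar> \<le> K2 * norm (V z)" for z
            by (rule order_trans[OF Cauchy_Schwarz_ineq2]) (use K2 in \<open>simp add: mult_right_mono\<close>)
          then show "AE z in lborel. norm (space_grad \<zeta> s z \<bullet> V z) \<le> norm (K2 * norm (V z))"
            by (intro AE_I2) (metis abs_ge_self order_trans real_norm_def)
          show "(\<lambda>z. space_grad \<zeta> s z \<bullet> V z) \<in> borel_measurable lborel" using V by simp
        qed
        have i0: "integrable lborel (\<lambda>z. space_grad \<zeta> s z \<bullet> V0 z)" by (rule gi[OF _ Vi]) (auto simp: V0B V0z)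
        have i1: "integrable lborel (\<lambda>z. space_grad \<zeta> s z \<bullet> V1 z)" by (rule gi[OF _ Vi]) (auto simp: V1B V1z)
        have tr0: "?G s V0 = ?Z s \<rho>u - ?Z s \<rho>0"
          unfolding V0_def S0.spread_potential_transport[OF t(1) e] S0.integral_spread_real[OF \<zeta>m zero_less_one] S0.integral_spread_real[OF \<zeta>m e(1)]
          by (simp add: S0.spread_density_1 \<rho>u_def u_def \<rho>0_def mult.commute)
        have tr1: "?G s V1 = ?Z s \<rho>u - ?Z s \<rho>1"
          unfolding V1_def S1.spread_potential_transport[OF t(1) e] S1.integral_spread_real[OF \<zeta>m zero_less_one] S1.integral_spread_real[OF \<zeta>m e(1)]
          by (simp add: S1.spread_density_1 \<rho>u_def u_def \<rho>1_def mult.commute)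
        have "?G s (w s) = (LINT z|lborel. - a' s * (space_grad \<zeta> s z \<bullet> V0 z) + - b' s * (space_grad \<zeta> s z \<bullet> V1 z))"
          by (intro Bochner_Integration.integral_cong) (auto simp: w_def inner_add_right inner_diff_right)
        also have "\<dots> = - a' s * ?G s V0 + - b' s * ?G s V1"
          using i0 i1 by simp
        also have "\<dots> = a' s * ?Z s \<rho>0 + b' s * ?Z s \<rho>1 + (- a' s - b' s) * ?Z s \<rho>u"
          unfolding tr0 tr1 by (simp add: algebra_simps)
        also have "- a' s - b' s = \<theta>' s" using sum0[of s] by linarith
        also have "a' s * ?Z s \<rho>0 + b' s * ?Z s \<rho>1 + \<theta>' s * ?Z s \<rho>u = ?Z s (\<rho>' s)"
        proof -
          have "?Z s (\<rho>' s) = (LINT z|lborel. a' s * (\<zeta> (s, z) * \<rho>0 z) + b' s * (\<zeta> (s, z) * \<rho>1 z) + \<theta>' s * (\<zeta> (s, z) * \<rho>u z))"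
            by (intro Bochner_Integration.integral_cong) (auto simp: \<rho>'_def algebra_simps)
          then show ?thesis using int[OF \<zeta>m K(2) i(1)] int[OF \<zeta>m K(2) i(2)] int[OF \<zeta>m K(2) i(3)] by simp
        qed
        finally have 2: "?G s (w s) = ?Z s (\<rho>' s)" .
        have \<rho>'i: "integrable lborel (\<rho>' s)" unfolding \<rho>'_def using i by simp
        have "(LINT z|lborel. time_deriv \<zeta> s z * \<rho> s z) + ?Z s (\<rho>' s) = (LINT z|lborel. G' s z)"
          unfolding G'_def using int[OF tm K1(2) \<rho>i] int[OF \<zeta>m K(2) \<rho>'i] by simp
        also have "\<dots> = (LINT z|P. G' s z)"
          unfolding P_def by (subst integral_restrict_space)
            (auto intro!: Bochner_Integration.integral_cong simp: indicator_def G'_def \<rho>_def \<rho>'_def \<rho>0z \<rho>1z \<rho>uz)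
        finally show ?thesis unfolding 2 int_\<mu>[OF s tm] .
      qed
      then have "(LINT s:{0<..<1}|lborel. (LINT x|\<mu> s. time_deriv \<zeta> s x) + ?G s (w s)) = (LINT s:{0<..<1}|lborel. LINT z|P. G' s z)"
        by (intro set_lebesgue_integral_cong) auto
      then show ?thesis using zero by simp
    qed
    show "(\<integral>\<^sup>+z\<in>\<Omega>. act_density m (\<rho> s z) (w s z) \<partial>lborel) \<le> ennreal ((sqrt ((8 * \<delta> * B\<^sup>2 * vol + 72 / \<delta> * J) / m u))\<^sup>2)" if s': "s \<in> {0<..<1}" for s
    proof -
      have s: "s \<in> {0..1}" using s' by auto
      have \<theta>p: "0 < \<theta> s" using s' \<delta> by (simp add: \<theta>_def)
      have pt: "act_density m (\<rho> s z) (w s z) \<le> ennreal (8 * \<delta> * B\<^sup>2 / m u) + ennreal (72 / \<delta> / m u) * ennreal ((norm (V1 z - V0 z))\<^sup>2)" if z: "z \<in> \<Omega>" for z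
      proof -
        define n where "n = norm (V1 z - V0 z)"
        let ?V = "(1 - \<beta> s) *\<^sub>R V0 z + \<beta> s *\<^sub>R V1 z"
        have "\<theta> s * u \<le> \<rho> s z" using z ab01[OF s] \<rho>00 \<rho>10 by (simp add: \<rho>_def \<rho>u_def)
        then have "m (\<theta> s * u) \<le> m (\<rho> s z)" using \<theta>p u by (intro mobility_mono[OF m]) auto
        moreover have "\<theta> s * m u \<le> m (\<theta> s * u)" using u \<theta>01[OF s] by (intro mobility_scale[OF m]) auto
        ultimately have mr: "\<theta> s * m u \<le> m (\<rho> s z)" by simp
        have mp: "0 < m (\<rho> s z)" using mr \<theta>p mu by (meson less_le_trans mult_pos_pos)
        \<comment> \<open>The flux is \<open>\<theta>' s\<close> times a convex combination of the
          potentials, bounded by \<open>B\<close>, minus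
          \<open>(1 - \<theta> s) * \<beta>' s\<close> times their difference. Only the latter
          compares the two measures.\<close>
        have wn: "norm (w s z) \<le> \<bar>\<theta>' s\<bar> * B + \<bar>\<beta>' s\<bar> * n"
        proof -
          have "w s z = \<theta>' s *\<^sub>R (?V) - ((1 - \<theta> s) * \<beta>' s) *\<^sub>R (V1 z - V0 z)"
            by (simp add: w_def a'_def b'_def algebra_simps)
          then have "norm (w s z) \<le> norm (\<theta>' s *\<^sub>R (?V)) + norm (((1 - \<theta> s) * \<beta>' s) *\<^sub>R (V1 z - V0 z))"
            by (simp only: norm_triangle_ineq4)
          also have "norm (\<theta>' s *\<^sub>R (?V)) \<le> \<bar>\<theta>' s\<bar> * B"
          proof -
            have "norm (?V) \<le> (1 - \<beta> s) * B + \<beta> s * B"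
              using \<beta>01[OF s] V0B[of z] V1B[of z] by (intro order_trans[OF norm_triangle_ineq] add_mono) (auto intro: mult_left_mono)
            then have "norm (?V) \<le> B" by (simp add: algebra_simps)
            then show ?thesis unfolding norm_scaleR by (rule mult_left_mono) simp
          qed
          also have "norm (((1 - \<theta> s) * \<beta>' s) *\<^sub>R (V1 z - V0 z)) \<le> 1 * \<bar>\<beta>' s\<bar> * n"
            unfolding norm_scaleR abs_mult n_def using \<theta>01[OF s] by (intro mult_right_mono) auto
          finally show ?thesis by simp
        qed
        have sq: "(x + y)\<^sup>2 \<le> 2 * x\<^sup>2 + 2 * y\<^sup>2" for x y :: real
          using zero_le_power2[of "x - y"] by (simp add: power2_sum power2_diff)
        have "(norm (w s z))\<^sup>2 \<le> (\<bar>\<theta>' s\<bar> * B + \<bar>\<beta>' s\<bar> * n)\<^sup>2" using wn by (intro power_mono) auto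
        also have "\<dots> \<le> 2 * (\<theta>' s)\<^sup>2 * B\<^sup>2 + 2 * (\<beta>' s)\<^sup>2 * n\<^sup>2" using sq[of "\<bar>\<theta>' s\<bar> * B" "\<bar>\<beta>' s\<bar> * n"] by (simp add: power_mult_distrib)
        \<comment> \<open>\<open>(\<theta>' s)\<^sup>2\<close> is at most
          \<open>4 * \<delta> * \<theta> s\<close> and \<open>(\<beta>' s)\<^sup>2\<close> is
          \<open>36 / \<delta> * \<theta> s\<close>; doubled, they give 8 and 72. The common factor
          \<open>\<theta> s\<close> cancels against the lower bound of the mobility.\<close>
        also have "\<dots> \<le> \<theta> s * (8 * \<delta> * B\<^sup>2 + 72 / \<delta> * n\<^sup>2)"
        proof -
          have "(1 - 2 * s)\<^sup>2 \<le> 1" using s abs_square_le_1[of "1 - 2 * s"] by (simp add: abs_le_iff)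
          then have "4 * \<delta> * \<theta> s * (1 - 2 * s)\<^sup>2 \<le> 4 * \<delta> * \<theta> s * 1" using \<delta> \<theta>p by (intro mult_left_mono) auto
          moreover have "(\<theta>' s)\<^sup>2 = 4 * \<delta> * \<theta> s * (1 - 2 * s)\<^sup>2" by (simp add: \<theta>'_def \<theta>_def power2_eq_square)
          ultimately have "(\<theta>' s)\<^sup>2 * B\<^sup>2 \<le> 4 * \<delta> * \<theta> s * B\<^sup>2" by (intro mult_right_mono) auto
          moreover have "(\<beta>' s)\<^sup>2 = 36 / \<delta> * \<theta> s" using \<delta> by (simp add: \<beta>'_def \<theta>_def power2_eq_square)
          ultimately show ?thesis by (simp add: algebra_simps)
        qed
        finally have "(norm (w s z))\<^sup>2 / m (\<rho> s z) \<le> (\<theta> s * (8 * \<delta> * B\<^sup>2 + 72 / \<delta> * n\<^sup>2)) / (\<theta> s * m u)"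
          using mr mp \<theta>p mu \<delta> by (intro frac_le) auto
        also have "\<dots> = 8 * \<delta> * B\<^sup>2 / m u + 72 / \<delta> / m u * n\<^sup>2" using \<theta>p mu by (simp add: add_divide_distrib)
        finally have "ennreal ((norm (w s z))\<^sup>2 / m (\<rho> s z)) \<le> ennreal (8 * \<delta> * B\<^sup>2 / m u + 72 / \<delta> / m u * n\<^sup>2)" by (rule ennreal_leI)
        also have "\<dots> = ennreal (8 * \<delta> * B\<^sup>2 / m u) + ennreal (72 / \<delta> / m u) * ennreal (n\<^sup>2)"
          using \<delta> mu by (simp add: ennreal_mult[symmetric] ennreal_plus[symmetric] del: ennreal_plus)
        finally show ?thesis unfolding act_density_eq[of "\<rho> s z" m, OF \<rho>nn[OF s] mp] n_def .
      qed
      have "(\<integral>\<^sup>+z\<in>\<Omega>. act_density m (\<rho> s z) (w s z) \<partial>lborel) \<le>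
        (\<integral>\<^sup>+z. ennreal (8 * \<delta> * B\<^sup>2 / m u) * indicator \<Omega> z + ennreal (72 / \<delta> / m u) * (ennreal ((norm (V1 z - V0 z))\<^sup>2) * indicator \<Omega> z) \<partial>lborel)"
        using pt by (intro nn_integral_mono) (auto simp: indicator_def)
      also have "\<dots> = (\<integral>\<^sup>+(z::'a). ennreal (8 * \<delta> * B\<^sup>2 / m u) * indicator \<Omega> z \<partial>lborel) + (\<integral>\<^sup>+z. ennreal (72 / \<delta> / m u) * (ennreal ((norm (V1 z - V0 z))\<^sup>2) * indicator \<Omega> z) \<partial>lborel)"
        by (rule nn_integral_add) measurable
      also have "(\<integral>\<^sup>+(z::'a). ennreal (8 * \<delta> * B\<^sup>2 / m u) * indicator \<Omega> z \<partial>lborel) = ennreal (8 * \<delta> * B\<^sup>2 / m u) * ennreal vol"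
        by (subst nn_integral_cmult_indicator) (auto simp: emeasure_domain)
      also have "(\<integral>\<^sup>+z. ennreal (72 / \<delta> / m u) * (ennreal ((norm (V1 z - V0 z))\<^sup>2) * indicator \<Omega> z) \<partial>lborel) = ennreal (72 / \<delta> / m u) * (\<integral>\<^sup>+z\<in>\<Omega>. ennreal ((norm (V1 z - V0 z))\<^sup>2) \<partial>lborel)"
        by (rule nn_integral_cmult) measurable
      also have "ennreal (8 * \<delta> * B\<^sup>2 / m u) * ennreal vol + ennreal (72 / \<delta> / m u) * (\<integral>\<^sup>+z\<in>\<Omega>. ennreal ((norm (V1 z - V0 z))\<^sup>2) \<partial>lborel) \<le> ennreal (8 * \<delta> * B\<^sup>2 / m u) * ennreal vol + ennreal (72 / \<delta> / m u) * ennreal J"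
        using J(2) unfolding V0_def V1_def by (intro add_left_mono mult_left_mono) auto
      also have "\<dots> = ennreal ((8 * \<delta> * B\<^sup>2 * vol + 72 / \<delta> * J) / m u)"
        using \<delta> mu vol_pos J(1) by (simp add: ennreal_mult[symmetric] ennreal_plus[symmetric] add_divide_distrib del: ennreal_plus)
      finally show ?thesis using \<delta> mu vol_pos J(1) by simp
    qed
    show "0 \<le> sqrt ((8 * \<delta> * B\<^sup>2 * vol + 72 / \<delta> * J) / m u)" using \<delta> mu vol_pos J(1) by simp
  qed
  moreover have "\<mu> 0 = spread \<Omega> \<mu>0 e" "\<mu> 1 = spread \<Omega> \<mu>1 e"
    unfolding \<mu>_def S0.spread_eq_density[OF e(1)] S1.spread_eq_density[OF e(1)]
    by (simp_all add: \<rho>_def a_def b_def \<theta>_def \<beta>_def \<rho>0_def \<rho>1_def)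
  ultimately show ?thesis by (simp add: u_def)
qed

end

section \<open>Weak convergence implies convergence in the distance\<close>

text \<open>The integrand of K decreases, so z / 2 times its value at z is at most its integral over
  [z / 2, z], hence at most the whole integral from 1; z >= 2 keeps the interval in the range.
  Squaring solves for z / m(z).\<close>

lemma mobility_ratio_growth:
  assumes m: "mobility m" and d: "0 < d" and K: "K_mob m d 1 < \<infinity>"
  shows "\<exists>A\<ge>0. \<forall>z\<ge>2. z / m z \<le> A * z powr (1 / real d)"
proof -
  define q where "q z = z powr (1 + 1 / real d) * m z" for z
  define J where "J = (\<integral>\<^sup>+z\<in>{1..}. ennreal (q z powr (- 1 / 2)) \<partial>lborel)"
  have "J < \<infinity>" using K d unfolding K_mob_def J_def q_def by (auto simp: ennreal_mult_less_top)
  then obtain j where j: "J = ennreal j" "0 \<le> j" by (cases J) auto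
  have "z / m z \<le> 4 * j\<^sup>2 * z powr (1 / real d)" if z: "2 \<le> z" for z
  proof -
    have q0: "0 < q x" if "1 \<le> x" for x using that mobility_pos[OF m, of x] by (simp add: q_def)
    have qz: "0 < q z" and mz: "0 < m z" using q0[of z] z mobility_pos[OF m, of z] by auto
    have "(\<integral>\<^sup>+x. ennreal (q z powr (- 1 / 2)) * indicator {z / 2..z} x \<partial>lborel) \<le> J"
      unfolding J_def
    proof (rule nn_integral_mono)
      fix x
      show "ennreal (q z powr (- 1 / 2)) * indicator {z / 2..z} x \<le> ennreal (q x powr (- 1 / 2)) * indicator {1..} x"
      proof (cases "x \<in> {z / 2..z}")
        case True
        then have x: "1 \<le> x" "x \<le> z" using z by auto
        have "q x \<le> q z" unfolding q_def
          using x mobility_mono[OF m, of x z] mobility_pos[OF m, of x] by (intro mult_mono powr_mono2) auto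
        then have "q z powr (- 1 / 2) \<le> q x powr (- 1 / 2)" using q0[OF x(1)] by (intro powr_mono2') auto
        then show ?thesis using True x by (simp add: ennreal_leI)
      qed simp
    qed
    also have "(\<integral>\<^sup>+x. ennreal (q z powr (- 1 / 2)) * indicator {z / 2..z} x \<partial>lborel) = ennreal (q z powr (- 1 / 2) * (z / 2))"
      using z by (subst nn_integral_cmult_indicator) (auto simp: ennreal_mult[symmetric])
    finally have "q z powr (- 1 / 2) * (z / 2) \<le> j" using j by simp
    then have "(q z powr (- 1 / 2) * (z / 2))\<^sup>2 \<le> j\<^sup>2" using z by (intro power_mono) auto
    moreover have "(q z powr (- 1 / 2))\<^sup>2 = inverse (q z)"
      using qz by (simp add: powr_minus powr_half_sqrt power_inverse)
    ultimately have "inverse (q z) * z\<^sup>2 \<le> 4 * j\<^sup>2" by (simp add: power_mult_distrib power_divide)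
    then have "z\<^sup>2 \<le> 4 * j\<^sup>2 * q z" using qz by (simp add: field_simps)
    also have "q z = z * z powr (1 / real d) * m z" using z by (simp add: q_def powr_add)
    finally have "z * z \<le> z * (4 * j\<^sup>2 * z powr (1 / real d) * m z)" by (simp add: power2_eq_square algebra_simps)
    then have "z \<le> 4 * j\<^sup>2 * z powr (1 / real d) * m z" using z by simp
    then show ?thesis using mz by (simp add: divide_le_eq)
  qed
  then show ?thesis by (intro exI[of _ "4 * j\<^sup>2"]) auto
qed

lemma small_factor: "0 \<le> x \<Longrightarrow> 0 < y \<Longrightarrow> \<exists>e. 0 < e \<and> e \<le> 1 \<and> e * x \<le> y" for x y :: real
proof (intro exI conjI)
  assume x: "0 \<le> x" and y: "0 < y"
  show "0 < min 1 (y / (x + 1))" "min 1 (y / (x + 1)) \<le> 1" using x y by auto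
  have "min 1 (y / (x + 1)) * x \<le> y / (x + 1) * x" using x by (intro mult_right_mono) auto
  also have "\<dots> \<le> y" using x y by (simp add: field_simps)
  finally show "min 1 (y / (x + 1)) * x \<le> y" .
qed

definition weakly_converges :: "(nat \<Rightarrow> 'a::euclidean_space measure) \<Rightarrow> 'a measure \<Rightarrow> bool" where
  "weakly_converges \<mu>n \<mu> \<longleftrightarrow> (\<forall>f :: 'a \<Rightarrow> real. continuous_on UNIV f \<longrightarrow> (\<lambda>n. LINT x|\<mu>n n. f x) \<longlonglongrightarrow> (LINT x|\<mu>. f x))"

context convex_domain
begin

text \<open>The d-th root of c / (e^d vol) is (c / vol)^(1 / d) / e, which gives the first term of
  \<open>C\<close>. The second term covers densities below 2, to which the growth estimate does not
  extend.\<close>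

lemma spread_ratio_bound:
  assumes m: "mobility m" and K: "K_mob m DIM('a) 1 < \<infinity>"
  shows "\<exists>C\<ge>0. \<forall>e. 0 < e \<longrightarrow> e \<le> 1 \<longrightarrow> (c / (e ^ DIM('a) * vol)) / m (c / (e ^ DIM('a) * vol)) \<le> C / e"
proof -
  let ?d = "DIM('a)"
  obtain A where A: "0 \<le> A" "\<And>z. 2 \<le> z \<Longrightarrow> z / m z \<le> A * z powr (1 / real ?d)"
    using mobility_ratio_growth[OF m DIM_positive K] by blast
  have m2: "0 < m 2" by (rule mobility_pos[OF m]) simp
  define C where "C = A * (c / vol) powr (1 / real ?d) + 2 / m 2"
  have C1: "0 \<le> A * (c / vol) powr (1 / real ?d)" using A by simp
  have "(c / (e ^ ?d * vol)) / m (c / (e ^ ?d * vol)) \<le> C / e" if e: "0 < e" "e \<le> 1" for e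
  proof -
    define R where "R = c / (e ^ ?d * vol)"
    have R0: "0 < R" using e mass_pos vol_pos by (simp add: R_def)
    have "R / m R \<le> C / e"
    proof (cases "2 \<le> R")
      case True
      have "e ^ ?d = e powr real ?d" using e by (simp add: powr_realpow)
      then have "(e ^ ?d) powr (1 / real ?d) = e" using e by (simp add: powr_powr)
      then have "R powr (1 / real ?d) = (c / vol) powr (1 / real ?d) / e"
        using e mass_pos vol_pos by (simp add: R_def powr_divide powr_mult)
      then have "R / m R \<le> A * (c / vol) powr (1 / real ?d) / e" using A(2)[OF True] by simp
      also have "\<dots> \<le> C / e" using e m2 by (intro divide_right_mono) (auto simp: C_def)
      finally show ?thesis .
    next
      case False
      then have "R / m R \<le> 2 / m 2" using R0 by (intro mobility_ratio_mono[OF m]) auto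
      also have "\<dots> \<le> C" using C1 by (simp add: C_def)
      also have "C \<le> C / e" using e C1 m2 by (simp add: C_def le_divide_eq mult_left_le)
      finally show ?thesis .
    qed
    then show ?thesis by (simp add: R_def)
  qed
  then show ?thesis using C1 m2 by (intro exI[of _ C]) (auto simp: C_def)
qed

text \<open>At e = 1 the starting point drops out of (1 - e) x + e y.\<close>

lemma spread_1_cong:
  assumes "\<mu>0 \<in> Mplus_mass \<Omega> c" "\<mu>1 \<in> Mplus_mass \<Omega> c" shows "spread \<Omega> \<mu>0 1 = spread \<Omega> \<mu>1 1"
proof -
  interpret S0: spread_measure \<Omega> c \<mu>0 by unfold_locales (rule assms)
  interpret S1: spread_measure \<Omega> c \<mu>1 by unfold_locales (rule assms)
  show ?thesis
    unfolding S0.spread_eq_density[OF zero_less_one] S1.spread_eq_density[OF zero_less_one] S0.spread_density_1 S1.spread_density_1 ..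
qed

lemma Wdist_finite:
  assumes m: "mobility m" and K: "K_mob m DIM('a) 1 < \<infinity>" and \<mu>: "\<mu>0 \<in> Mplus_mass \<Omega> c" "\<mu>1 \<in> Mplus_mass \<Omega> c"
  shows "Wdist m \<Omega> \<mu>0 \<mu>1 < \<infinity>"
proof -
  interpret S0: spread_measure \<Omega> c \<mu>0 by unfold_locales (rule \<mu>)
  interpret S1: spread_measure \<Omega> c \<mu>1 by unfold_locales (rule \<mu>)
  obtain C where C: "0 \<le> C" "\<And>e. 0 < e \<Longrightarrow> e \<le> 1 \<Longrightarrow> (c / (e ^ DIM('a) * vol)) / m (c / (e ^ DIM('a) * vol)) \<le> C / e"
    using spread_ratio_bound[OF m K] by blast
  have "Wdist m \<Omega> \<mu>0 \<mu>1 \<le> Wdist m \<Omega> \<mu>0 (spread \<Omega> \<mu>0 1) + Wdist m \<Omega> (spread \<Omega> \<mu>0 1) \<mu>1"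
    by (rule Wdist_triangle[OF m bounded_domain open_domain])
  also have "Wdist m \<Omega> (spread \<Omega> \<mu>0 1) \<mu>1 = Wdist m \<Omega> \<mu>1 (spread \<Omega> \<mu>1 1)"
    unfolding spread_1_cong[OF \<mu>] by (rule Wdist_commute[OF m bounded_domain open_domain])
  also have "Wdist m \<Omega> \<mu>0 (spread \<Omega> \<mu>0 1) + Wdist m \<Omega> \<mu>1 (spread \<Omega> \<mu>1 1) < \<infinity>"
    using le_less_trans[OF S0.Wdist_spread[OF m C zero_less_one order_refl] ennreal_less_top]
      le_less_trans[OF S1.Wdist_spread[OF m C zero_less_one order_refl] ennreal_less_top] by simp
  finally show ?thesis .
qed

text \<open>The potential kernel is continuous in \<open>x\<close> on the closure of the domain. A
  Tietze extension turns it into a test function on the whole space with the same integrals.\<close>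

lemma spread_potential_tendsto:
  assumes \<mu>n: "\<And>n. \<mu>n n \<in> Mplus_mass \<Omega> c" and \<mu>: "\<mu> \<in> Mplus_mass \<Omega> c" and conv: "weakly_converges \<mu>n \<mu>"
    and z: "z \<in> \<Omega>" and e: "0 < e"
  shows "(\<lambda>n. spread_potential \<Omega> (\<mu>n n) e z) \<longlonglongrightarrow> spread_potential \<Omega> \<mu> e z"
proof -
  obtain g where g: "continuous_on UNIV g" "\<And>x. x \<in> closure \<Omega> \<Longrightarrow> g x = potential_kernel \<Omega> e x z"
    using Tietze_unbounded[OF continuous_potential_kernel[OF z e], of UNIV] by auto
  have eq: "spread_potential \<Omega> \<alpha> e z \<bullet> b = (LINT x|\<alpha>. g x \<bullet> b)" if \<alpha>: "\<alpha> \<in> Mplus_mass \<Omega> c" for \<alpha> b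
  proof -
    interpret A: spread_measure \<Omega> c \<alpha> by unfold_locales (rule \<alpha>)
    have gm: "g \<in> borel_measurable \<alpha>" using borel_measurable_continuous_onI[OF g(1)] by simp
    have "integrable \<alpha> (\<lambda>x. norm (g x))"
      by (rule Mplus_integrable[OF bounded_domain A.mu_Mplus]) (intro continuous_intros g)
    then have gi: "integrable \<alpha> g" using gm by (simp add: integrable_norm_iff)
    have "AE x in \<alpha>. potential_kernel \<Omega> e x z = g x" using A.AE_mu by eventually_elim (simp add: g)
    then have "(LINT x|\<alpha>. potential_kernel \<Omega> e x z) = (LINT x|\<alpha>. g x)"
      using measurable_potential_kernel[of e z] gm by (intro integral_cong_AE) auto
    then show ?thesis unfolding A.spread_potential_kernel[OF e] using gi by simp
  qed
  have "(\<lambda>n. LINT x|\<mu>n n. g x \<bullet> b) \<longlonglongrightarrow> (LINT x|\<mu>. g x \<bullet> b)" for b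
    using conv g(1) unfolding weakly_converges_def by (auto intro!: continuous_intros)
  then show ?thesis by (subst tendsto_componentwise_iff) (simp add: eq[OF \<mu>] eq[OF \<mu>n])
qed

text \<open>Three legs of length \<eta> / 3 lead through the two spread measures. The order of
  choices matters: \<open>e\<close> determines \<open>B\<close>, then \<delta> is taken small
  against \<open>B\<close>, and then \<open>n\<close> large enough for the potentials to be close
  relative to \<delta>.\<close>

lemma Wdist_tendsto_0:
  assumes m: "mobility m" and K: "K_mob m DIM('a) 1 < \<infinity>"
    and \<mu>n: "\<And>n. \<mu>n n \<in> Mplus_mass \<Omega> c" and \<mu>: "\<mu> \<in> Mplus_mass \<Omega> c" and conv: "weakly_converges \<mu>n \<mu>" and \<eta>: "0 < \<eta>"
  shows "eventually (\<lambda>n. Wdist m \<Omega> (\<mu>n n) \<mu> \<le> ennreal \<eta>) sequentially"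
proof -
  interpret S: spread_measure \<Omega> c \<mu> by unfold_locales (rule \<mu>)
  have Sn: "spread_measure \<Omega> c (\<mu>n n)" for n by unfold_locales (rule \<mu>n)
  obtain C where C: "0 \<le> C" "\<And>e. 0 < e \<Longrightarrow> e \<le> 1 \<Longrightarrow> (c / (e ^ DIM('a) * vol)) / m (c / (e ^ DIM('a) * vol)) \<le> C / e"
    using spread_ratio_bound[OF m K] by blast
  define t where "t = \<eta> / 3"
  have t: "0 < t" using \<eta> by (simp add: t_def)
  obtain e where e: "0 < e" "e \<le> 1" "e * (4 * D\<^sup>2 * c * C) \<le> t\<^sup>2"
    using small_factor[of "4 * D\<^sup>2 * c * C" "t\<^sup>2"] C(1) mass_pos t by auto
  have "sqrt (4 * e * D\<^sup>2 * c * C) \<le> t" using e(3) t by (intro real_le_lsqrt) (simp_all add: algebra_simps)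
  then have near: "Wdist m \<Omega> \<alpha> (spread \<Omega> \<alpha> e) \<le> ennreal t" if "\<alpha> \<in> Mplus_mass \<Omega> c" for \<alpha>
  proof -
    interpret A: spread_measure \<Omega> c \<alpha> by unfold_locales (rule that)
    show ?thesis using A.Wdist_spread[OF m C e(1,2)] ennreal_leI[OF \<open>sqrt (4 * e * D\<^sup>2 * c * C) \<le> t\<close>] by (rule order_trans)
  qed
  define B where "B = D * c / (e ^ DIM('a) * vol)"
  define mu where "mu = m (c / vol)"
  have mu: "0 < mu" unfolding mu_def using mass_pos vol_pos by (intro mobility_pos[OF m]) simp
  obtain \<delta> where \<delta>: "0 < \<delta>" "\<delta> \<le> 1" "\<delta> * (8 * B\<^sup>2 * vol) \<le> t\<^sup>2 * mu / 2"
    using small_factor[of "8 * B\<^sup>2 * vol" "t\<^sup>2 * mu / 2"] vol_pos t mu by auto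
  \<comment> \<open>Chosen so that \<open>72 / \<delta> * J\<close> is the half of
    \<open>t\<^sup>2 * mu\<close> that \<delta> has left over.\<close>
  define J where "J = \<delta> * t\<^sup>2 * mu / 144"
  have J: "0 < J" using \<delta> t mu by (simp add: J_def)
  have "72 / \<delta> * J = t\<^sup>2 * mu / 2" using \<delta>(1) by (simp add: J_def)
  then have "8 * \<delta> * B\<^sup>2 * vol + 72 / \<delta> * J \<le> t\<^sup>2 * mu" using \<delta>(3) by (simp add: algebra_simps)
  then have small: "sqrt ((8 * \<delta> * B\<^sup>2 * vol + 72 / \<delta> * J) / mu) \<le> t"
    using t mu by (intro real_le_lsqrt) (simp_all add: divide_le_eq)
  let ?n = "\<lambda>n z. norm (spread_potential \<Omega> (\<mu>n n) e z - spread_potential \<Omega> \<mu> e z)"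
  let ?u = "\<lambda>n z. ennreal ((?n n z)\<^sup>2) * indicator \<Omega> z"
  have "(\<lambda>n. \<integral>\<^sup>+z. ?u n z \<partial>lborel) \<longlonglongrightarrow> (\<integral>\<^sup>+(z::'a). 0 \<partial>lborel)"
  proof (rule nn_integral_dominated_convergence[where w = "\<lambda>z. ennreal ((B + B)\<^sup>2) * indicator \<Omega> z"])
    show "?u n \<in> borel_measurable lborel" for n
      using spread_measure.measurable_spread_potential[OF Sn, of n e] S.measurable_spread_potential[of e] by measurable
    show "(\<integral>\<^sup>+z. ennreal ((B + B)\<^sup>2) * indicator \<Omega> z \<partial>lborel) < \<infinity>"
      by (subst nn_integral_cmult_indicator) (auto simp: emeasure_domain ennreal_mult_less_top)
    show "AE z in lborel. ?u n z \<le> ennreal ((B + B)\<^sup>2) * indicator \<Omega> z" for n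
    proof (rule AE_I2)
      fix z
      have "?n n z \<le> B + B"
        unfolding B_def
        by (rule order_trans[OF norm_triangle_ineq4]) (intro add_mono spread_measure.norm_spread_potential_le[OF Sn e(1,2)] S.norm_spread_potential_le[OF e(1,2)])
      then have "(?n n z)\<^sup>2 \<le> (B + B)\<^sup>2" by (rule power_mono) simp
      then show "?u n z \<le> ennreal ((B + B)\<^sup>2) * indicator \<Omega> z" by (intro mult_right_mono ennreal_leI) auto
    qed
    show "AE z in lborel. (\<lambda>n. ?u n z) \<longlonglongrightarrow> 0"
    proof (rule AE_I2)
      fix z
      show "(\<lambda>n. ?u n z) \<longlonglongrightarrow> 0"
      proof (cases "z \<in> \<Omega>")
        case True
        have "(\<lambda>n. (?n n z)\<^sup>2) \<longlonglongrightarrow> (norm (spread_potential \<Omega> \<mu> e z - spread_potential \<Omega> \<mu> e z))\<^sup>2"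
          by (intro tendsto_intros spread_potential_tendsto[OF \<mu>n \<mu> conv True e(1)])
        then have "(\<lambda>n. ennreal ((?n n z)\<^sup>2)) \<longlonglongrightarrow> ennreal 0"
          by (intro tendsto_ennrealI) simp
        then show ?thesis using True by simp
      qed simp
    qed
  qed simp_all
  then have "(\<lambda>n. \<integral>\<^sup>+z. ?u n z \<partial>lborel) \<longlonglongrightarrow> 0" by simp
  then have "eventually (\<lambda>n. (\<integral>\<^sup>+z. ?u n z \<partial>lborel) < ennreal J) sequentially" using J by (intro order_tendstoD(2)) auto
  then show ?thesis
  proof eventually_elim
    case (elim n)
    have "(\<integral>\<^sup>+z. ennreal ((norm (spread_potential \<Omega> \<mu> e z - spread_potential \<Omega> (\<mu>n n) e z))\<^sup>2) * indicator \<Omega> z \<partial>lborel) \<le> ennreal J"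
      using elim by (simp add: norm_minus_commute)
    then have "Wdist m \<Omega> (spread \<Omega> (\<mu>n n) e) (spread \<Omega> \<mu> e) \<le> ennreal (sqrt ((8 * \<delta> * B\<^sup>2 * vol + 72 / \<delta> * J) / mu))"
      unfolding B_def mu_def using J by (intro Wdist_spread_spread[OF m \<mu>n \<mu> e(1,2) \<delta>(1,2)]) auto
    also have "\<dots> \<le> ennreal t" using small by (rule ennreal_leI)
    finally have mid: "Wdist m \<Omega> (spread \<Omega> (\<mu>n n) e) (spread \<Omega> \<mu> e) \<le> ennreal t" .
    have "Wdist m \<Omega> (\<mu>n n) \<mu> \<le> Wdist m \<Omega> (\<mu>n n) (spread \<Omega> (\<mu>n n) e) + Wdist m \<Omega> (spread \<Omega> (\<mu>n n) e) \<mu>"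
      by (rule Wdist_triangle[OF m bounded_domain open_domain])
    also have "Wdist m \<Omega> (spread \<Omega> (\<mu>n n) e) \<mu> \<le> Wdist m \<Omega> (spread \<Omega> (\<mu>n n) e) (spread \<Omega> \<mu> e) + Wdist m \<Omega> (spread \<Omega> \<mu> e) \<mu>"
      by (rule Wdist_triangle[OF m bounded_domain open_domain])
    also have "Wdist m \<Omega> (spread \<Omega> \<mu> e) \<mu> = Wdist m \<Omega> \<mu> (spread \<Omega> \<mu> e)" by (rule Wdist_commute[OF m bounded_domain open_domain])
    finally have "Wdist m \<Omega> (\<mu>n n) \<mu> \<le> Wdist m \<Omega> (\<mu>n n) (spread \<Omega> (\<mu>n n) e) + (Wdist m \<Omega> (spread \<Omega> (\<mu>n n) e) (spread \<Omega> \<mu> e) + Wdist m \<Omega> \<mu> (spread \<Omega> \<mu> e))"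
      by (simp add: add_left_mono)
    also have "\<dots> \<le> ennreal t + (ennreal t + ennreal t)" by (intro add_mono near mid \<mu> \<mu>n)
    also have "\<dots> = ennreal \<eta>" using t by (simp add: t_def ennreal_plus[symmetric] del: ennreal_plus)
    finally show ?case .
  qed
qed

end

section \<open>Weak sequential compactness\<close>

text \<open>Helly's theorem on the line carries over to \<open>\<real>\<^sup>d\<close> along Schoenberg's space-filling curve, whose
  restriction to the Cantor set has a Borel right inverse given by binary digits.\<close>

definition zigzag :: "real \<Rightarrow> real" where
  "zigzag t = max 0 (min 1 (1 / 2 - cos (pi * t)))"

definition binary_digit :: "nat \<Rightarrow> real \<Rightarrow> nat" where
  "binary_digit n y = nat (\<lfloor>2 ^ Suc n * y\<rfloor> - 2 * \<lfloor>2 ^ n * y\<rfloor>)"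

text \<open>The point of the Cantor set with the ternary digits \<open>2 * b k\<close>.\<close>

definition ternary :: "(nat \<Rightarrow> nat) \<Rightarrow> real" where
  "ternary b = (\<Sum>k. 2 * real (b k) * (1 / 3) ^ Suc k)"

lemma zigzag_bounds: "0 \<le> zigzag t" "zigzag t \<le> 1"
  by (auto simp: zigzag_def)

lemma continuous_zigzag: "continuous_on UNIV zigzag"
  unfolding zigzag_def by (intro continuous_intros)

lemma zigzag_periodic: "zigzag (2 * real n + t) = zigzag t"
proof -
  have "cos (pi * (2 * real n + t)) = cos (2 * real n * pi + pi * t)" by (simp add: algebra_simps)
  also have "\<dots> = cos (pi * t)" unfolding cos_add cos_2npi sin_2npi by simp
  finally show ?thesis by (simp add: zigzag_def)
qed

lemma zigzag_digit:
  assumes r: "0 \<le> r" "r \<le> 1 / 3" and b: "b \<le> 1" shows "zigzag (2 * real b / 3 + r) = real b"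
proof (cases "b = 0")
  case True
  have "cos (pi / 3) \<le> cos (pi * r)" using r by (intro cos_monotone_0_pi_le) (auto simp: field_simps)
  then show ?thesis using True by (simp add: zigzag_def cos_60)
next
  case False
  then have b1: "b = 1" using b by simp
  have "0 \<le> pi * (1 / 3 - r)" "pi * (1 / 3 - r) \<le> pi / 3" using r by (auto simp: field_simps)
  then have "cos (pi / 3) \<le> cos (pi * (1 / 3 - r))" by (intro cos_monotone_0_pi_le) (auto intro: order_trans)
  also have "pi * (1 / 3 - r) = pi - pi * (2 / 3 + r)" by (simp add: algebra_simps)
  also have "cos (pi - pi * (2 / 3 + r)) = - cos (pi * (2 / 3 + r))" by simp
  finally show ?thesis using b1 by (simp add: zigzag_def cos_60)
qed

lemma ternary_summable:
  assumes "\<And>k. b k \<le> 1" shows "summable (\<lambda>k. 2 * real (b k) * (1 / 3) ^ Suc k)"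
proof (rule summable_comparison_test')
  show "summable (\<lambda>k. 2 * (1 / 3 :: real) ^ Suc k)" by (intro summable_mult summable_Suc_iff[THEN iffD2] summable_geometric) simp
  show "norm (2 * real (b k) * (1 / 3) ^ Suc k) \<le> 2 * (1 / 3) ^ Suc k" for k using assms[of k] by simp
qed

lemma ternary_bounds:
  assumes b: "\<And>k. b k \<le> 1" shows "0 \<le> ternary b" "ternary b \<le> 1"
proof -
  show "0 \<le> ternary b" unfolding ternary_def by (intro suminf_nonneg ternary_summable b) simp
  have s: "(\<lambda>k. 2 * (1 / 3 :: real) ^ Suc k) sums 1"
    using sums_mult[OF geometric_sums[of "1 / 3 :: real"], of "2 / 3"] by (simp add: field_simps)
  have "ternary b \<le> (\<Sum>k. 2 * (1 / 3 :: real) ^ Suc k)"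
    unfolding ternary_def using b by (intro suminf_le ternary_summable sums_summable[OF s]) (auto intro: mult_right_mono)
  then show "ternary b \<le> 1" using sums_unique[OF s] by simp
qed

lemma ternary_shift:
  assumes b: "\<And>k. b k \<le> 1" shows "3 * ternary b = 2 * real (b 0) + ternary (\<lambda>k. b (Suc k))"
proof -
  have "(\<Sum>k. 2 * real (b (Suc k)) * (1 / 3) ^ Suc (Suc k)) = ternary b - 2 * real (b 0) * (1 / 3) ^ Suc 0"
    unfolding ternary_def by (rule suminf_split_head[OF ternary_summable[OF b]])
  moreover have "(\<Sum>k. 2 * real (b (Suc k)) * (1 / 3) ^ Suc (Suc k)) = (\<Sum>k. (1 / 3) * (2 * real (b (Suc k)) * (1 / 3) ^ Suc k))"
    by (simp add: mult_ac)
  moreover have "\<dots> = (1 / 3) * ternary (\<lambda>k. b (Suc k))"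
    unfolding ternary_def by (rule suminf_mult[OF ternary_summable]) (rule b)
  ultimately show ?thesis by simp
qed

text \<open>Each multiplication by 3 shifts the digits and splits off an integer. That integer is
  even, as the digits are 0 or 2, and the period 2 of \<open>zigzag\<close> absorbs it.\<close>

lemma zigzag_ternary:
  assumes "\<And>k. b k \<le> 1" shows "zigzag (3 ^ k * ternary b) = real (b k)"
  using assms
proof (induction k arbitrary: b)
  case 0
  have "ternary b = 2 * real (b 0) / 3 + ternary (\<lambda>k. b (Suc k)) / 3" using ternary_shift[of b] 0 by simp
  then show ?case using zigzag_digit[of "ternary (\<lambda>k. b (Suc k)) / 3" "b 0"] ternary_bounds[of "\<lambda>k. b (Suc k)"] 0 by simp
next
  case (Suc k)
  have "3 ^ Suc k * ternary b = 3 ^ k * (3 * ternary b)" by simp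
  also have "\<dots> = 2 * real (3 ^ k * b 0) + 3 ^ k * ternary (\<lambda>k. b (Suc k))"
    unfolding ternary_shift[OF Suc.prems] by (simp add: algebra_simps)
  finally show ?case using Suc.IH[of "\<lambda>k. b (Suc k)"] Suc.prems by (simp only: zigzag_periodic)
qed

lemma binary_digit_le: "binary_digit n y \<le> 1"
proof -
  have "2 * (2 ^ n * y) < 2 * (real_of_int \<lfloor>2 ^ n * y\<rfloor> + 1)"
    by (intro mult_strict_left_mono real_of_int_floor_add_one_gt) simp
  then have "2 ^ Suc n * y < 2 * (real_of_int \<lfloor>2 ^ n * y\<rfloor> + 1)" by (simp only: power_Suc mult.assoc)
  then have "\<lfloor>2 ^ Suc n * y\<rfloor> < 2 * \<lfloor>2 ^ n * y\<rfloor> + 2" by (simp add: floor_less_iff)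
  then show ?thesis unfolding binary_digit_def by linarith
qed

lemma binary_digit_eq: "real (binary_digit n y) = real_of_int (\<lfloor>2 ^ Suc n * y\<rfloor> - 2 * \<lfloor>2 ^ n * y\<rfloor>)"
proof -
  have "real_of_int (2 * \<lfloor>2 ^ n * y\<rfloor>) \<le> 2 ^ Suc n * y" using floor_correct[of "2 ^ n * y"] by simp
  then have "2 * \<lfloor>2 ^ n * y\<rfloor> \<le> \<lfloor>2 ^ Suc n * y\<rfloor>" by (simp only: le_floor_iff)
  then show ?thesis unfolding binary_digit_def by simp
qed

text \<open>The digits are differences of consecutive floors, so the partial sums telescope to
  floor(2^N y) / 2^N.\<close>

lemma binary_digits_sums:
  assumes y: "0 \<le> y" "y < 1" shows "(\<lambda>n. real (binary_digit n y) * (1 / 2) ^ Suc n) sums y"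
proof -
  have partial: "(\<Sum>n<N. real (binary_digit n y) * (1 / 2) ^ Suc n) = real_of_int \<lfloor>2 ^ N * y\<rfloor> * (1 / 2) ^ N" for N
  proof (induction N)
    case 0
    have "\<lfloor>y\<rfloor> = 0" using y by (simp add: floor_eq_iff)
    then show ?case by simp
  next
    case (Suc N)
    then show ?case by (simp add: binary_digit_eq algebra_simps)
  qed
  have half: "(\<lambda>N. (1 / 2 :: real) ^ N) \<longlonglongrightarrow> 0" by (intro LIMSEQ_realpow_zero) auto
  have "(\<lambda>N. real_of_int \<lfloor>2 ^ N * y\<rfloor> * (1 / 2) ^ N) \<longlonglongrightarrow> y"
  proof (rule tendsto_sandwich[of "\<lambda>N. y - (1 / 2) ^ N" _ _ "\<lambda>N. y"])
    have 1: "real_of_int \<lfloor>2 ^ N * y\<rfloor> \<le> 2 ^ N * y" "2 ^ N * y - 1 \<le> real_of_int \<lfloor>2 ^ N * y\<rfloor>" for N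
      using floor_correct[of "2 ^ N * y"] by auto
    have 2: "2 ^ N * (1 / 2 :: real) ^ N = 1" for N by (simp add: power_mult_distrib[symmetric])
    have "real_of_int \<lfloor>2 ^ N * y\<rfloor> * (1 / 2) ^ N \<le> (2 ^ N * y) * (1 / 2) ^ N" for N using 1 by (intro mult_right_mono) auto
    also have "(2 ^ N * y) * (1 / 2) ^ N = y" for N using 2[of N] by (simp add: mult_ac)
    finally show "eventually (\<lambda>N. real_of_int \<lfloor>2 ^ N * y\<rfloor> * (1 / 2) ^ N \<le> y) sequentially" by simp
    have "(2 ^ N * y - 1) * (1 / 2) ^ N \<le> real_of_int \<lfloor>2 ^ N * y\<rfloor> * (1 / 2) ^ N" for N using 1 by (intro mult_right_mono) auto
    moreover have "(2 ^ N * y - 1) * (1 / 2) ^ N = y * (2 ^ N * (1 / 2) ^ N) - (1 / 2) ^ N" for N by (simp add: algebra_simps)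
    ultimately show "eventually (\<lambda>N. y - (1 / 2) ^ N \<le> real_of_int \<lfloor>2 ^ N * y\<rfloor> * (1 / 2) ^ N) sequentially" by (simp add: 2)
    show "(\<lambda>N. y - (1 / 2) ^ N) \<longlonglongrightarrow> y" using tendsto_diff[OF tendsto_const half] by simp
  qed simp
  then show ?thesis unfolding sums_def partial .
qed

text \<open>Digits are interleaved: ternary place n d + i of the parameter holds binary digit n of
  coordinate i. The curve is a uniform limit of continuous functions, and the inverse is Borel
  because each digit is.\<close>

lemma space_filling_curve:
  fixes K :: "'a::euclidean_space set"
  assumes K: "bounded K"
  shows "\<exists>\<gamma> \<sigma>. continuous_on UNIV \<gamma> \<and> bounded (range \<gamma>) \<and> \<sigma> \<in> borel_measurable borel \<and> (\<forall>x. \<sigma> x \<in> {0..1::real}) \<and> (\<forall>x\<in>K. \<gamma> (\<sigma> x) = x)"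
proof -
  define d where "d = DIM('a)"
  have d: "0 < d" by (simp add: d_def)
  obtain h where h: "bij_betw h {0..<d} (Basis :: 'a set)" using ex_bij_betw_nat_finite[of "Basis :: 'a set"] by (auto simp: d_def)
  obtain R where R: "0 < R" "\<And>x. x \<in> K \<Longrightarrow> norm x < R"
    using K unfolding bounded_pos by (metis add.commute less_add_one add_pos_pos le_less_trans zero_less_one)
  \<comment> \<open>Rescales (-R, R) to (0, 1); the strict bound on the norm in \<open>K\<close>
    keeps \<open>y i x\<close> below 1, as the binary expansion demands.\<close>
  define y where "y i x = (x \<bullet> h i / R + 1) / 2" for i and x :: 'a
  define \<Gamma> where "\<Gamma> i t = (\<Sum>n. zigzag (3 ^ (n * d + i) * t) * (1 / 2) ^ Suc n)" for i t
  define \<gamma> where "\<gamma> t = (\<Sum>i<d. (R * (2 * \<Gamma> i t - 1)) *\<^sub>R h i)" for t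
  define dig where "dig x k = binary_digit (k div d) (y (k mod d) x)" for x k
  define \<sigma> where "\<sigma> x = ternary (dig x)" for x
  have dig1: "dig x k \<le> 1" for x k unfolding dig_def by (rule binary_digit_le)
  have half: "(\<lambda>n. (1 / 2 :: real) ^ Suc n) sums 1" by (rule power_half_series)
  have nb: "norm (zigzag s * (1 / 2) ^ Suc n) \<le> (1 / 2) ^ Suc n" for s n
    using zigzag_bounds[of s] by (simp add: mult_left_le_one_le)
  have sm: "summable (\<lambda>n. zigzag (3 ^ (n * d + i) * t) * (1 / 2) ^ Suc n)" for i t
    by (rule summable_comparison_test'[OF sums_summable[OF half] nb])
  have c\<Gamma>: "continuous_on UNIV (\<Gamma> i)" for i
    unfolding \<Gamma>_def
  proof (rule uniform_limit_theorem[OF _ Weierstrass_m_test])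
    show "eventually (\<lambda>n. continuous_on UNIV (\<lambda>t. \<Sum>n<n. zigzag (3 ^ (n * d + i) * t) * (1 / 2) ^ Suc n)) sequentially"
      by (intro always_eventually allI continuous_intros continuous_on_compose2[OF continuous_zigzag]) auto
  qed (rule nb sums_summable[OF half] sequentially_bot)+
  have \<Gamma>01: "0 \<le> \<Gamma> i t" "\<Gamma> i t \<le> 1" for i t
  proof -
    show "0 \<le> \<Gamma> i t" unfolding \<Gamma>_def using zigzag_bounds by (intro suminf_nonneg sm) auto
    have "\<Gamma> i t \<le> (\<Sum>n. (1 / 2) ^ Suc n)" unfolding \<Gamma>_def
      by (intro suminf_le sm sums_summable[OF half]) (simp add: zigzag_bounds)
    then show "\<Gamma> i t \<le> 1" using sums_unique[OF half] by simp
  qed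
  have "continuous_on UNIV \<gamma>" unfolding \<gamma>_def by (intro continuous_intros c\<Gamma>)
  moreover have "bounded (range \<gamma>)"
  proof (rule boundedI[of _ "real d * R"])
    fix v assume "v \<in> range \<gamma>"
    then obtain t where t: "v = \<gamma> t" by blast
    have "norm (\<gamma> t) \<le> (\<Sum>i<d. R)" unfolding \<gamma>_def
    proof (rule sum_norm_le)
      fix i assume "i \<in> {..<d}"
      then have "h i \<in> Basis" using h by (auto simp: bij_betw_def)
      moreover have "R * \<bar>2 * \<Gamma> i t - 1\<bar> \<le> R * 1" using R \<Gamma>01[of i t] by (intro mult_left_mono) auto
      ultimately show "norm ((R * (2 * \<Gamma> i t - 1)) *\<^sub>R h i) \<le> R" using R by (simp add: abs_mult)
    qed
    then show "norm v \<le> real d * R" using t by simp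
  qed
  moreover have "\<sigma> \<in> borel_measurable borel"
    unfolding \<sigma>_def ternary_def dig_def binary_digit_def y_def by measurable
  moreover have "\<sigma> x \<in> {0..1}" for x using ternary_bounds[OF dig1] by (simp add: \<sigma>_def)
  moreover have "\<gamma> (\<sigma> x) = x" if x: "x \<in> K" for x
  proof -
    have "R * (2 * \<Gamma> i (\<sigma> x) - 1) = x \<bullet> h i" if i: "i < d" for i
    proof -
      have hi: "h i \<in> Basis" using i h by (auto simp: bij_betw_def)
      have "\<bar>x \<bullet> h i\<bar> < R" using R(2)[OF x] Basis_le_norm[OF hi, of x] by simp
      then have y01: "0 \<le> y i x" "y i x < 1" using R(1) by (auto simp: y_def field_simps)
      have "zigzag (3 ^ (n * d + i) * \<sigma> x) = real (binary_digit n (y i x))" for n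
        unfolding \<sigma>_def zigzag_ternary[OF dig1] using i by (simp add: dig_def)
      then have "\<Gamma> i (\<sigma> x) = y i x" using sums_unique[OF binary_digits_sums[OF y01]] by (simp add: \<Gamma>_def)
      then show ?thesis using R(1) by (simp add: y_def field_simps)
    qed
    then have "\<gamma> (\<sigma> x) = (\<Sum>i<d. (x \<bullet> h i) *\<^sub>R h i)" by (simp add: \<gamma>_def)
    also have "\<dots> = (\<Sum>b\<in>Basis. (x \<bullet> b) *\<^sub>R b)"
      by (rule sum.reindex_bij_betw) (use h in \<open>simp add: lessThan_atLeast0\<close>)
    finally show ?thesis by (simp add: euclidean_representation)
  qed
  ultimately show ?thesis by blast
qed

text \<open>The inverse curve transports the normalised measures to laws on [0, 1], which are tight.
  Weak limits come back through the continuous \<gamma>: integrating \<open>f\<close> over the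
  domain is integrating the bounded continuous composite of \<open>f\<close> and \<gamma> against
  the transported law.\<close>

theorem Mplus_mass_weakly_sequentially_compact:
  fixes \<Omega> :: "'a::euclidean_space set"
  assumes \<Omega>: "bounded \<Omega>" "\<Omega> \<noteq> {}" and c: "0 < c" and \<mu>n: "\<And>n :: nat. \<mu>n n \<in> Mplus_mass \<Omega> c"
  shows "\<exists>r \<mu>. strict_mono r \<and> \<mu> \<in> Mplus_mass \<Omega> c \<and> weakly_converges (\<mu>n \<circ> r) \<mu>"
proof -
  obtain \<gamma> :: "real \<Rightarrow> 'a" and \<sigma> where \<gamma>: "continuous_on UNIV \<gamma>" "bounded (range \<gamma>)"
    and \<sigma>[measurable]: "\<sigma> \<in> borel_measurable borel" and \<sigma>01: "\<And>x. \<sigma> x \<in> {0..1}" and inv: "\<And>x. x \<in> closure \<Omega> \<Longrightarrow> \<gamma> (\<sigma> x) = x"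
    using space_filling_curve[of "closure \<Omega>"] \<Omega> by (auto simp: bounded_closure)
  have \<gamma>m[measurable]: "\<gamma> \<in> borel_measurable borel" using \<gamma>(1) by (rule borel_measurable_continuous_onI)
  have Mp: "\<mu>n n \<in> Mplus \<Omega>" and ms: "measure (\<mu>n n) UNIV = c" for n using Mplus_massD[OF \<mu>n] c by auto
  have [measurable_cong, simp]: "sets (\<mu>n n) = sets borel" for n using MplusD(1)[OF Mp] .
  have sp: "space (\<mu>n n) = UNIV" for n using sets_eq_imp_space_eq[of "\<mu>n n" borel] by simp
  define P where "P n = distr (density (\<mu>n n) (\<lambda>_. ennreal (1 / c))) borel \<sigma>" for n
  have P_emeasure: "emeasure (P n) A = 1" if A: "A \<in> sets borel" "{0..1} \<subseteq> A" for n A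
  proof -
    have "\<sigma> x \<in> A" for x using \<sigma>01[of x] A(2) by (rule set_mp[rotated])
    then have "\<sigma> -` A = UNIV" by auto
    then have "emeasure (P n) A = emeasure (density (\<mu>n n) (\<lambda>_. ennreal (1 / c))) UNIV"
      unfolding P_def using A by (subst emeasure_distr) (auto simp: sp)
    also have "\<dots> = ennreal (1 / c) * emeasure (\<mu>n n) UNIV" by (subst emeasure_density) (auto simp: nn_integral_cmult_indicator sp)
    also have "emeasure (\<mu>n n) UNIV = ennreal c" using \<mu>n[of n] by (simp add: Mplus_mass_def)
    also have "ennreal (1 / c) * ennreal c = 1" using c by (simp add: ennreal_mult[symmetric])
    finally show ?thesis .
  qed
  have rd: "real_distribution (P n)" for n
    using P_emeasure[of UNIV n] by (intro real_distribution.intro prob_spaceI real_distribution_axioms.intro) (auto simp: P_def)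
  have "tight P"
    unfolding tight_def
  proof (intro conjI allI impI)
    fix \<epsilon> :: real assume "0 < \<epsilon>"
    \<comment> \<open>The interval is open on the left and starts at -1 so as to contain 0.\<close>
    moreover have "measure (P n) {-1<..1} = 1" for n unfolding measure_def by (subst P_emeasure) auto
    ultimately show "\<exists>a b. a < b \<and> (\<forall>n. 1 - \<epsilon> < measure (P n) {a<..b})" by (intro exI[of _ "-1"] exI[of _ 1]) simp
  qed (rule rd)
  from tight_imp_convergent_subsubsequence[OF this strict_mono_id]
  obtain r M where r: "strict_mono r" and M: "real_distribution M" and conv: "weak_conv_m (P \<circ> r) M" by auto
  interpret M: real_distribution M by (rule M)
  define \<mu> where "\<mu> = density (distr M borel \<gamma>) (\<lambda>_. ennreal c)"
  have int\<mu>: "(LINT x|\<mu>. f x) = c * (LINT t|M. f (\<gamma> t))" if f: "continuous_on UNIV f" for f :: "'a \<Rightarrow> real"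
  proof -
    have [measurable]: "f \<in> borel_measurable borel" using f by (rule borel_measurable_continuous_onI)
    show ?thesis unfolding \<mu>_def using c by (subst integral_density) (auto simp: integral_distr)
  qed
  have intP: "(LINT t|P n. f (\<gamma> t)) = (1 / c) * (LINT x|\<mu>n n. f x)" if f: "continuous_on UNIV f" for f :: "'a \<Rightarrow> real" and n
  proof -
    have [measurable]: "f \<in> borel_measurable borel" using f by (rule borel_measurable_continuous_onI)
    have "(LINT t|P n. f (\<gamma> t)) = (1 / c) * (LINT x|\<mu>n n. f (\<gamma> (\<sigma> x)))"
      unfolding P_def using c by (subst integral_distr) (auto simp: integral_density)
    also have "(LINT x|\<mu>n n. f (\<gamma> (\<sigma> x))) = (LINT x|\<mu>n n. f x)"
      by (rule Mplus_integral_cong[OF Mp]) (auto simp: inv)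
    finally show ?thesis .
  qed
  have wc: "weakly_converges (\<mu>n \<circ> r) \<mu>"
    unfolding weakly_converges_def
  proof (intro allI impI)
    fix f :: "'a \<Rightarrow> real" assume f: "continuous_on UNIV f"
    have "compact (closure (range \<gamma>))" using \<gamma>(2) by (simp add: compact_closure)
    then have "bounded (f ` closure (range \<gamma>))" using f by (intro compact_imp_bounded compact_continuous_image) (auto intro: continuous_on_subset)
    then obtain B where B: "\<And>v. v \<in> closure (range \<gamma>) \<Longrightarrow> norm (f v) \<le> B" unfolding bounded_iff by blast
    have "norm (f (\<gamma> t)) \<le> B" for t using closure_subset[of "range \<gamma>"] by (intro B) auto
    moreover have "isCont (\<lambda>t. f (\<gamma> t)) t" for t
      using continuous_on_compose2[OF f \<gamma>(1)] by (simp add: continuous_on_eq_continuous_at)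
    ultimately have "(\<lambda>n. \<integral>t. f (\<gamma> t) \<partial>(P \<circ> r) n) \<longlonglongrightarrow> (LINT t|M. f (\<gamma> t))"
      using rd by (intro weak_conv_imp_integral_bdd_continuous_conv[OF _ M conv]) auto
    then have "(\<lambda>n. c * (LINT t|P (r n). f (\<gamma> t))) \<longlonglongrightarrow> c * (LINT t|M. f (\<gamma> t))" by (intro tendsto_mult_left) simp
    then show "(\<lambda>n. \<integral>x. f x \<partial>(\<mu>n \<circ> r) n) \<longlonglongrightarrow> (LINT x|\<mu>. f x)" using c by (simp add: intP[OF f] int\<mu>[OF f])
  qed
  have em: "emeasure \<mu> UNIV = ennreal c"
    unfolding \<mu>_def by (subst emeasure_density) (auto simp: emeasure_distr nn_integral_cmult_indicator M.emeasure_space_1[simplified])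
  have fin: "finite_measure \<mu>" by (intro finite_measureI) (simp add: em \<mu>_def[THEN arg_cong[where f = space]])
  have "emeasure \<mu> (- closure \<Omega>) = 0"
  proof -
    \<comment> \<open>The truncated distance to the closure has integral 0 along the sequence, hence
      also in the limit.\<close>
    define f where "f x = min 1 (infdist x (closure \<Omega>))" for x :: 'a
    have f: "continuous_on UNIV f" unfolding f_def by (intro continuous_intros continuous_on_infdist)
    have "(LINT x|\<mu>n n. f x) = (LINT x|\<mu>n n. 0)" for n
    proof (rule Mplus_integral_cong[OF Mp])
      show "f x = 0" if "x \<in> closure \<Omega>" for x using that by (simp add: f_def)
    qed (use borel_measurable_continuous_onI[OF f] in simp_all)
    then have "(\<lambda>n. 0) \<longlonglongrightarrow> (LINT x|\<mu>. f x)" using wc f by (auto simp: weakly_converges_def)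
    then have f0: "(LINT x|\<mu>. f x) = 0" using LIMSEQ_unique tendsto_const by blast
    have f01: "0 \<le> f x" "f x \<le> 1" for x by (auto simp: f_def infdist_nonneg)
    have [measurable_cong]: "sets \<mu> = sets borel" by (simp add: \<mu>_def)
    have [measurable]: "f \<in> borel_measurable borel" using f by (rule borel_measurable_continuous_onI)
    have "integrable \<mu> f"
      using f01 by (intro finite_measure.integrable_const_bound[OF fin, of _ 1]) auto
    then have "AE x in \<mu>. f x = 0" using f0 f01 by (subst integral_nonneg_eq_0_iff_AE[symmetric]) auto
    then have "AE x in \<mu>. x \<notin> - closure \<Omega>"
    proof eventually_elim
      case (elim x)
      then have "infdist x (closure \<Omega>) = 0" by (simp add: f_def min_def split: if_splits)
      then show ?case using \<Omega>(2) in_closed_iff_infdist_zero[of "closure \<Omega>" x] by simp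
    qed
    then show ?thesis by (intro AE_iff_measurable[THEN iffD1, rotated 2]) (auto simp: \<mu>_def)
  qed
  then have "\<mu> \<in> Mplus_mass \<Omega> c" using em fin by (simp add: Mplus_mass_def Mplus_def \<mu>_def)
  then show ?thesis using r wc by blast
qed

section \<open>The topology induced by the distance\<close>

text \<open>Total boundedness gives a finite net for each mesh 1 / (n + 1); their union is countable
  and dense.\<close>

lemma (in Metric_space) compact_imp_separable:
  assumes "compact_space mtopology" shows "separable_space mtopology"
proof -
  have "\<exists>K. finite K \<and> K \<subseteq> M \<and> M \<subseteq> (\<Union>x\<in>K. mball x (1 / real (Suc n)))" for n
    using assms by (simp add: compact_space_eq_mcomplete_mtotally_bounded mtotally_bounded_def del: of_nat_Suc)
  then obtain K where K: "\<And>n. finite (K n)" "\<And>n. K n \<subseteq> M" "\<And>n. M \<subseteq> (\<Union>x\<in>K n. mball x (1 / real (Suc n)))"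
    by metis
  have "mtopology closure_of (\<Union>n. K n) = M"
  proof -
    have "\<exists>y\<in>\<Union>n. K n. y \<in> mball x r" if x: "x \<in> M" and r: "0 < r" for x r
    proof -
      obtain n where n: "1 / real (Suc n) < r" using reals_Archimedean[OF r] by (auto simp: inverse_eq_divide)
      obtain y where "y \<in> K n" "x \<in> mball y (1 / real (Suc n))" using K(3)[of n] x by blast
      then show ?thesis using n commute[of x y] by (intro bexI[of _ y]) auto
    qed
    then show ?thesis unfolding metric_closure_of by auto
  qed
  moreover have "countable (\<Union>n. K n)" using K(1) by (intro countable_UN) (auto intro: countable_finite)
  ultimately show ?thesis unfolding separable_space_def using K(2) by (intro exI[of _ "\<Union>n. K n"]) auto
qed

lemma topspace_weak_star: "topspace (weak_star X) = (X :: 'a::euclidean_space measure set)"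
proof
  show "topspace (weak_star X) \<subseteq> X" unfolding weak_star_def topology_generated_by_topspace by auto
  have "X \<in> {{\<mu> \<in> X. (LINT x|\<mu>. f x) \<in> U} | (f :: 'a \<Rightarrow> real) U. continuous_on UNIV f \<and> compact (closure {x. f x \<noteq> 0}) \<and> open U}"
    by (intro CollectI exI[of _ "\<lambda>_. 0"] exI[of _ UNIV]) simp
  then show "X \<subseteq> topspace (weak_star X)" unfolding weak_star_def topology_generated_by_topspace by (rule Union_upper)
qed

lemma Hausdorff_weak_star:
  fixes \<Omega> :: "'a::euclidean_space set"
  assumes \<Omega>: "bounded \<Omega>" and X: "X \<subseteq> Mplus \<Omega>" shows "Hausdorff_space (weak_star X)"
  unfolding Hausdorff_space_def topspace_weak_star
proof (intro allI impI)
  fix \<mu> \<mu>' assume \<mu>: "\<mu> \<in> X \<and> \<mu>' \<in> X \<and> \<mu> \<noteq> \<mu>'"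
  then have "\<exists>f :: 'a \<Rightarrow> real. continuous_on UNIV f \<and> bounded {x. f x \<noteq> 0} \<and> (LINT x|\<mu>. f x) \<noteq> (LINT x|\<mu>'. f x)"
    using Mplus_eqI[OF \<Omega>, of \<mu> \<mu>'] X by blast
  then obtain f :: "'a \<Rightarrow> real" where f: "continuous_on UNIV f" "bounded {x. f x \<noteq> 0}" and ne: "(LINT x|\<mu>. f x) \<noteq> (LINT x|\<mu>'. f x)"
    by blast
  obtain U V where UV: "open U" "open V" "(LINT x|\<mu>. f x) \<in> U" "(LINT x|\<mu>'. f x) \<in> V" "U \<inter> V = {}"
    using hausdorff[OF ne] by blast
  have "continuous_map (weak_star X) euclideanreal (\<lambda>\<mu>. LINT x|\<mu>. f x)"
    using weak_star_continuous_map[of "weak_star X" X "\<lambda>\<mu>. \<mu>"] f by simp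
  then have "openin (weak_star X) {\<alpha> \<in> X. (LINT x|\<alpha>. f x) \<in> W}" if "open W" for W
    using openin_continuous_map_preimage[of "weak_star X" euclideanreal _ W] that by (simp add: topspace_weak_star)
  then show "\<exists>U V. openin (weak_star X) U \<and> openin (weak_star X) V \<and> \<mu> \<in> U \<and> \<mu>' \<in> V \<and> disjnt U V"
    using UV \<mu> by (intro exI[of _ "{\<alpha> \<in> X. (LINT x|\<alpha>. f x) \<in> U}"] exI[of _ "{\<alpha> \<in> X. (LINT x|\<alpha>. f x) \<in> V}"]) (auto simp: disjnt_def)
qed

text \<open>A closed set in the compact topology is compact, its continuous image is compact, and
  compact sets are closed in a Hausdorff space.\<close>

lemma compact_Hausdorff_topology_eq:
  assumes "compact_space S" "Hausdorff_space T" "topspace S = topspace T" and id: "continuous_map S T (\<lambda>x. x)"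
  shows "S = T"
proof -
  have cl: "closed_map S T (\<lambda>x. x)"
    using assms by (intro continuous_imp_closed_map_gen Hausdorff_imp_kc_space)
  have "openin S U \<longleftrightarrow> openin T U" for U
  proof
    assume U: "openin S U"
    then have "closedin T (topspace S - U)" using cl unfolding closed_map_def by fastforce
    then show "openin T U" using openin_subset[OF U] assms(3) by (simp add: openin_closedin_eq)
  next
    assume U: "openin T U"
    then have "{x \<in> topspace S. x \<in> U} = U" using openin_subset[OF U] assms(3) by auto
    then show "openin S U" using openin_continuous_map_preimage[OF id U] by simp
  qed
  then show ?thesis by (simp add: topology_eq)
qed

lemma Mplus_empty: "0 < c \<Longrightarrow> Mplus_mass {} c = {}"
  by (auto simp: Mplus_mass_def Mplus_def)

theorem theorem3p6:
  fixes \<Omega> :: "'a::euclidean_space set" and m :: "real \<Rightarrow> real" and c :: real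
  assumes "bounded \<Omega>" and "open \<Omega>" and "convex \<Omega>"
    and "mobility m"
    and "c > 0"
    and "\<forall>r>0. K_mob m DIM('a) r < \<infinity>"
  shows "(\<forall>\<mu>0\<in>Mplus_mass \<Omega> c. \<forall>\<mu>1\<in>Mplus_mass \<Omega> c. Wdist m \<Omega> \<mu>0 \<mu>1 < \<infinity>)
    \<and> Metric_space (Mplus_mass \<Omega> c) (Wdist_real m \<Omega>)
    \<and> Metric_space.mtopology (Mplus_mass \<Omega> c) (Wdist_real m \<Omega>) = weak_star (Mplus_mass \<Omega> c)
    \<and> compact_space (Metric_space.mtopology (Mplus_mass \<Omega> c) (Wdist_real m \<Omega>))
    \<and> separable_space (Metric_space.mtopology (Mplus_mass \<Omega> c) (Wdist_real m \<Omega>))"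
proof -
  note \<Omega> = assms(1-3) and m = assms(4)
  let ?X = "Mplus_mass \<Omega> c" and ?d = "Wdist_real m \<Omega>"
  have K: "K_mob m DIM('a) 1 < \<infinity>" using assms(6) by simp
  have c: "0 \<le> c" using assms(5) by simp
  have XM: "?X \<subseteq> Mplus \<Omega>" by (auto simp: Mplus_mass_def)
  \<comment> \<open>The locale asks for a nonempty domain, which the existence of a measure of
    positive mass supplies; for the empty domain the space of measures is empty.\<close>
  have domain: "convex_domain \<Omega> c" if "\<alpha> \<in> ?X" for \<alpha>
  proof
    show "\<Omega> \<noteq> {}" using that Mplus_empty[OF assms(5)] by auto
  qed (use assms in auto)
  have fin: "Wdist m \<Omega> \<alpha> \<beta> < \<infinity>" if "\<alpha> \<in> ?X" "\<beta> \<in> ?X" for \<alpha> \<beta>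
    by (rule convex_domain.Wdist_finite[OF domain[OF that(1)] m K that])
  then have real: "Wdist m \<Omega> \<alpha> \<beta> = ennreal (?d \<alpha> \<beta>)" if "\<alpha> \<in> ?X" "\<beta> \<in> ?X" for \<alpha> \<beta>
    using that by (simp add: Wdist_real_def less_top)
  have d0: "0 \<le> ?d \<alpha> \<beta>" for \<alpha> \<beta> by (simp add: Wdist_real_def)
  have metric: "Metric_space ?X ?d"
  proof
    fix \<alpha> \<beta> \<gamma>
    show "0 \<le> ?d \<alpha> \<beta>" by (rule d0)
    show "?d \<alpha> \<beta> = ?d \<beta> \<alpha>" unfolding Wdist_real_def using Wdist_commute[OF m \<Omega>(1,2), of \<alpha> \<beta>] by simp
    assume \<alpha>: "\<alpha> \<in> ?X" and \<beta>: "\<beta> \<in> ?X"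
    show "?d \<alpha> \<beta> = 0 \<longleftrightarrow> \<alpha> = \<beta>"
    proof
      assume "?d \<alpha> \<beta> = 0"
      then have "Wdist m \<Omega> \<alpha> \<beta> = 0" using real[OF \<alpha> \<beta>] by simp
      then show "\<alpha> = \<beta>" by (rule Wdist_eq_0D[OF m \<Omega> c \<alpha> \<beta>])
    next
      assume "\<alpha> = \<beta>"
      then show "?d \<alpha> \<beta> = 0" using Wdist_self[OF m, of \<alpha> \<Omega>] \<alpha> XM by (auto simp: Wdist_real_def)
    qed
    assume \<gamma>: "\<gamma> \<in> ?X"
    have "ennreal (?d \<alpha> \<gamma>) \<le> ennreal (?d \<alpha> \<beta>) + ennreal (?d \<beta> \<gamma>)"
      using Wdist_triangle[OF m \<Omega>(1,2), of \<alpha> \<gamma> \<beta>] by (simp add: real \<alpha> \<beta> \<gamma>)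
    then show "?d \<alpha> \<gamma> \<le> ?d \<alpha> \<beta> + ?d \<beta> \<gamma>" using d0 by (simp add: ennreal_plus[symmetric] del: ennreal_plus)
  qed
  interpret W: Metric_space ?X ?d by (rule metric)
  have "continuous_map W.mtopology euclideanreal (\<lambda>\<alpha>. LINT x|\<alpha>. f x)" if f: "continuous_on UNIV f" for f :: "'a \<Rightarrow> real"
    unfolding W.continuous_map_from_metric
  proof (intro conjI ballI allI impI)
    fix \<alpha> U assume \<alpha>: "\<alpha> \<in> ?X" and "openin euclideanreal U \<and> (LINT x|\<alpha>. f x) \<in> U"
    then obtain e where e: "0 < e" "\<And>y. dist y (LINT x|\<alpha>. f x) < e \<Longrightarrow> y \<in> U" by (auto simp: open_dist)
    obtain r where r: "0 < r" "\<And>\<mu>0 \<mu>1. \<mu>0 \<in> ?X \<Longrightarrow> \<mu>1 \<in> ?X \<Longrightarrow> Wdist m \<Omega> \<mu>0 \<mu>1 < ennreal r \<Longrightarrow> \<bar>(LINT x|\<mu>1. f x) - (LINT x|\<mu>0. f x)\<bar> < e"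
      using Wdist_controls_continuous[OF m \<Omega> c f e(1)] by blast
    have "(LINT x|\<beta>. f x) \<in> U" if "\<beta> \<in> ?X" "?d \<alpha> \<beta> < r" for \<beta>
      using r(2)[OF \<alpha> that(1)] that(2) d0 by (intro e(2)) (simp add: real \<alpha> that(1) dist_real_def ennreal_less_iff)
    then show "\<exists>r>0. \<forall>\<beta>. \<beta> \<in> ?X \<and> ?d \<alpha> \<beta> < r \<longrightarrow> (LINT x|\<beta>. f x) \<in> U" using r(1) by blast
  qed simp
  then have id: "continuous_map W.mtopology (weak_star ?X) (\<lambda>\<alpha>. \<alpha>)"
    unfolding weak_star_continuous_map by simp
  have compact: "compact_space W.mtopology"
    unfolding W.compact_space_sequentially
  proof (intro allI impI)
    fix \<mu>n :: "nat \<Rightarrow> 'a measure" assume "range \<mu>n \<subseteq> ?X"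
    then have \<mu>n: "\<mu>n n \<in> ?X" for n by auto
    interpret convex_domain \<Omega> c by (rule domain[OF \<mu>n])
    obtain r \<mu> where r: "strict_mono r" and \<mu>: "\<mu> \<in> ?X" and conv: "weakly_converges (\<mu>n \<circ> r) \<mu>"
      using Mplus_mass_weakly_sequentially_compact[OF bounded_domain domain_nonempty mass_pos, of \<mu>n] \<mu>n by blast
    have "eventually (\<lambda>n. (\<mu>n \<circ> r) n \<in> ?X \<and> ?d ((\<mu>n \<circ> r) n) \<mu> < e) sequentially" if e: "0 < e" for e
    proof -
      \<comment> \<open>Half of \<open>e\<close> turns the nonstrict bound into the strict one
        required by metric convergence.\<close>
      have "eventually (\<lambda>n. Wdist m \<Omega> ((\<mu>n \<circ> r) n) \<mu> \<le> ennreal (e / 2)) sequentially"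
        using e \<mu>n by (intro Wdist_tendsto_0[OF m K _ \<mu> conv]) auto
      then show ?thesis
      proof eventually_elim
        case (elim n)
        then have "?d ((\<mu>n \<circ> r) n) \<mu> \<le> e / 2" using e by (simp add: real \<mu>n \<mu>)
        then show ?case using e \<mu>n by simp
      qed
    qed
    then have "limitin W.mtopology (\<mu>n \<circ> r) \<mu> sequentially" unfolding W.limitin_metric using \<mu> by blast
    then show "\<exists>l r. l \<in> ?X \<and> strict_mono r \<and> limitin W.mtopology (\<mu>n \<circ> r) l sequentially" using r \<mu> by blast
  qed
  have "W.mtopology = weak_star ?X"
    by (rule compact_Hausdorff_topology_eq[OF compact Hausdorff_weak_star[OF \<Omega>(1) XM] _ id]) (simp add: topspace_weak_star)
  then show ?thesis using fin metric compact W.compact_imp_separable[OF compact] by blast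
qed

end
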